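(* Let $\mathcal M$ be a sufficiently saturated o-minimal structure. Let $\{S_t:t\in T\}$ be a definable family of gp-short, definably connected subsets of $M^n$, and assume there is $a_0\in M^n$ such that $a_0\in\mathrm{Cl}(S_t)$ (topological closure) for every $t\in T$. Then $S=\bigcup_{t\in T}S_t$ is a gp-short set.
   Context: Definable means definable with parameters. A generalized group-interval is an open interval $(b,c)\subseteq M$ ($b,c\in M\cup\{\pm\infty\}$) endowed with a definable partial continuous binary operation making it a positive group-interval, a negative group-interval, or a group-interval; e.g. a positive group-interval $(0,a)$ has a partial continuous $+$ which is commutative, associative and order-preserving when defined, such that for each $x$ the domain of $y\mapsto x+y$ is $(0,r(x))$, $\lim_{x'\to0}(x'+x)=x$ and $\lim_{x'\to r(x)}(x+x')=a$; negative group-intervals and group-intervals (the latter with inverses) are analogous. An interval $I\subseteq M$ is gp-short if it can be written as a finite disjoint union of points and open intervals each of which can be endowed with the structure of a generalized group-interval; otherwise it is gp-long. A definable set $S\subseteq M^n$ is gp-short if there are gp-short intervals $I_1,\ldots,I_k$ such that $S$ is in definable bijection with a subset of $I_1\times\cdots\times I_k$. *)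

theory Defs
  imports "HOL-Analysis.Analysis" "HOL-Library.Extended"
begin

section \<open>First-order structures expanding a linear order\<close>

datatype 'f trm = Var nat | Fn 'f "'f trm list"

datatype ('f, 'r) fm =
    Eq "'f trm" "'f trm"
  | Lt "'f trm" "'f trm"
  | Rel 'r "'f trm list"
  | Neg "('f, 'r) fm"
  | Conj "('f, 'r) fm" "('f, 'r) fm"
  | Ex nat "('f, 'r) fm"

text \<open>
  The universe of a structure is the type \<open>'a\<close>, and the symbol \<open>Lt\<close> is always
  interpreted by the order of that type. An arity \<open>None\<close> means that the symbol does not belong
  to the language, so languages without function or relation symbols are covered as well;
  constants are function symbols of arity 0. The interpretation of a symbol on lists of
  the wrong length is irrelevant, because only well-formed formulas are ever considered.
\<close>

record ('f, 'r, 'a) fo_structure =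
  fun_arity :: "'f \<Rightarrow> nat option"
  rel_arity :: "'r \<Rightarrow> nat option"
  fun_int :: "'f \<Rightarrow> 'a list \<Rightarrow> 'a"
  rel_int :: "'r \<Rightarrow> 'a list \<Rightarrow> bool"

fun wf_trm :: "('f, 'r, 'a) fo_structure \<Rightarrow> 'f trm \<Rightarrow> bool" where
  "wf_trm M (Var i) \<longleftrightarrow> True"
| "wf_trm M (Fn f ts) \<longleftrightarrow> fun_arity M f = Some (length ts) \<and> (\<forall>t\<in>set ts. wf_trm M t)"

fun wf_fm :: "('f, 'r, 'a) fo_structure \<Rightarrow> ('f, 'r) fm \<Rightarrow> bool" where
  "wf_fm M (Eq s t) \<longleftrightarrow> wf_trm M s \<and> wf_trm M t"
| "wf_fm M (Lt s t) \<longleftrightarrow> wf_trm M s \<and> wf_trm M t"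
| "wf_fm M (Rel r ts) \<longleftrightarrow> rel_arity M r = Some (length ts) \<and> (\<forall>t\<in>set ts. wf_trm M t)"
| "wf_fm M (Neg \<phi>) \<longleftrightarrow> wf_fm M \<phi>"
| "wf_fm M (Conj \<phi> \<psi>) \<longleftrightarrow> wf_fm M \<phi> \<and> wf_fm M \<psi>"
| "wf_fm M (Ex i \<phi>) \<longleftrightarrow> wf_fm M \<phi>"

fun fv_trm :: "'f trm \<Rightarrow> nat set" where
  "fv_trm (Var i) = {i}"
| "fv_trm (Fn f ts) = (\<Union>t\<in>set ts. fv_trm t)"

fun fv :: "('f, 'r) fm \<Rightarrow> nat set" where
  "fv (Eq s t) = fv_trm s \<union> fv_trm t"
| "fv (Lt s t) = fv_trm s \<union> fv_trm t"
| "fv (Rel r ts) = (\<Union>t\<in>set ts. fv_trm t)"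
| "fv (Neg \<phi>) = fv \<phi>"
| "fv (Conj \<phi> \<psi>) = fv \<phi> \<union> fv \<psi>"
| "fv (Ex i \<phi>) = fv \<phi> - {i}"

fun eval_trm :: "('f, 'r, 'a) fo_structure \<Rightarrow> (nat \<Rightarrow> 'a) \<Rightarrow> 'f trm \<Rightarrow> 'a" where
  "eval_trm M e (Var i) = e i"
| "eval_trm M e (Fn f ts) = fun_int M f (map (eval_trm M e) ts)"

fun sat :: "('f, 'r, 'a::linorder) fo_structure \<Rightarrow> (nat \<Rightarrow> 'a) \<Rightarrow> ('f, 'r) fm \<Rightarrow> bool" where
  "sat M e (Eq s t) \<longleftrightarrow> eval_trm M e s = eval_trm M e t"
| "sat M e (Lt s t) \<longleftrightarrow> eval_trm M e s < eval_trm M e t"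
| "sat M e (Rel r ts) \<longleftrightarrow> rel_int M r (map (eval_trm M e) ts)"
| "sat M e (Neg \<phi>) \<longleftrightarrow> \<not> sat M e \<phi>"
| "sat M e (Conj \<phi> \<psi>) \<longleftrightarrow> sat M e \<phi> \<and> sat M e \<psi>"
| "sat M e (Ex i \<phi>) \<longleftrightarrow> (\<exists>a. sat M (e(i := a)) \<phi>)"


section \<open>Definable sets and saturation\<close>

text \<open>
  Points of \<open>M\<^sup>n\<close> are extensional functions on \<open>{..<n}\<close>, and \<open>M\<^sup>m \<times> M\<^sup>n\<close> is identified with
  \<open>M\<^bsup>m+n\<^esup>\<close> through \<open>join m n\<close>.
\<close>

abbreviation Pow_n :: "nat \<Rightarrow> (nat \<Rightarrow> 'a) set" where
  "Pow_n n \<equiv> {..<n} \<rightarrow>\<^sub>E UNIV"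

definition join :: "nat \<Rightarrow> nat \<Rightarrow> (nat \<Rightarrow> 'a) \<Rightarrow> (nat \<Rightarrow> 'a) \<Rightarrow> nat \<Rightarrow> 'a" where
  "join m n x y = (\<lambda>i\<in>{..<m + n}. if i < m then x i else y (i - m))"

text \<open>
  In \<open>holds M n \<phi> e x\<close> the variables below \<open>n\<close> are the object variables, with values given
  by \<open>x\<close>, and all other variables are parameters, with values given by \<open>e\<close>.
\<close>

definition holds ::
  "('f, 'r, 'a::linorder) fo_structure \<Rightarrow> nat \<Rightarrow> ('f, 'r) fm \<Rightarrow> (nat \<Rightarrow> 'a) \<Rightarrow> (nat \<Rightarrow> 'a) \<Rightarrow> bool"
  where "holds M n \<phi> e x \<longleftrightarrow> sat M (override_on e x {..<n}) \<phi>"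

definition definable ::
  "('f, 'r, 'a::linorder) fo_structure \<Rightarrow> nat \<Rightarrow> (nat \<Rightarrow> 'a) set \<Rightarrow> bool" where
  "definable M n X \<longleftrightarrow> (\<exists>\<phi> e. wf_fm M \<phi> \<and> X = {x \<in> Pow_n n. holds M n \<phi> e x})"

definition definable_family ::
  "('f, 'r, 'a::linorder) fo_structure \<Rightarrow> nat \<Rightarrow> nat \<Rightarrow> (nat \<Rightarrow> 'a) set
    \<Rightarrow> ((nat \<Rightarrow> 'a) \<Rightarrow> (nat \<Rightarrow> 'a) set) \<Rightarrow> bool" where
  "definable_family M m n T S \<longleftrightarrow>
     definable M m T \<and> (\<forall>t\<in>T. S t \<subseteq> Pow_n n) \<and>
     definable M (m + n) {join m n t x | t x. t \<in> T \<and> x \<in> S t}"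

text \<open>
  ``Sufficiently saturated'' is read as \<open>\<kappa>\<close>-saturated for \<open>\<kappa>\<close> the successor of the number of
  formulas of the language, that is, of \<open>|L| + \<aleph>\<^sub>0\<close>: every finitely satisfiable set \<open>p\<close> of
  formulas in \<open>n\<close> variables, with parameters from a set \<open>A\<close> of at most that cardinality, is
  realized. An element of \<open>p\<close> is a formula together with the values of its parameters.
\<close>

definition sufficiently_saturated :: "('f, 'r, 'a::linorder) fo_structure \<Rightarrow> bool" where
  "sufficiently_saturated M \<longleftrightarrow>
     (\<forall>A n p. A \<lesssim> {\<phi>. wf_fm M \<phi>} \<longrightarrow>
        (\<forall>(\<phi>, e)\<in>p. wf_fm M \<phi> \<and> (\<forall>i\<in>fv \<phi>. n \<le> i \<longrightarrow> e i \<in> A)) \<longrightarrow>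
        (\<forall>q. q \<subseteq> p \<and> finite q \<longrightarrow> (\<exists>x\<in>Pow_n n. \<forall>(\<phi>, e)\<in>q. holds M n \<phi> e x)) \<longrightarrow>
        (\<exists>x\<in>Pow_n n. \<forall>(\<phi>, e)\<in>p. holds M n \<phi> e x))"


section \<open>Intervals and o-minimality\<close>

definition open_interval :: "'a::linorder extended \<Rightarrow> 'a extended \<Rightarrow> 'a set" where
  "open_interval b c = {x. b < Fin x \<and> Fin x < c}"

text \<open>Intervals need not be open, and \<open>{a}\<close> counts as the interval \<open>[a, a]\<close>.\<close>

definition is_interv :: "'a::linorder set \<Rightarrow> bool" where
  "is_interv I \<longleftrightarrow> I \<noteq> {} \<and>
     (\<exists>b c. open_interval b c \<subseteq> I \<and> I \<subseteq> {x. b \<le> Fin x \<and> Fin x \<le> c})"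

definition o_minimal :: "('f, 'r, 'a::linorder) fo_structure \<Rightarrow> bool" where
  "o_minimal M \<longleftrightarrow>
     (\<forall>X. definable M 1 X \<longrightarrow>
        (\<exists>\<J>. finite \<J> \<and> (\<lambda>x. x 0) ` X = \<Union>\<J> \<and>
           (\<forall>J\<in>\<J>. (\<exists>a. J = {a}) \<or> (\<exists>b c. J = open_interval b c))))"

definition power_top :: "nat \<Rightarrow> (nat \<Rightarrow> 'a::topological_space) topology" where
  "power_top n = product_topology (\<lambda>_. euclidean) {..<n}"

definition definably_connected ::
  "('f, 'r, 'a::linorder_topology) fo_structure \<Rightarrow> nat \<Rightarrow> (nat \<Rightarrow> 'a) set \<Rightarrow> bool" where
  "definably_connected M n X \<longleftrightarrow> definable M n X \<and>
     \<not> (\<exists>U V. definable M n U \<and> definable M n V \<and> U \<noteq> {} \<and> V \<noteq> {} \<and> U \<inter> V = {} \<and> U \<union> V = X \<and>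
          openin (subtopology (power_top n) X) U \<and> openin (subtopology (power_top n) X) V)"


section \<open>Generalized group-intervals\<close>

text \<open>
  One-sided neighbourhoods of a left endpoint (\<open>right_of\<close>) and of a right endpoint (\<open>left_of\<close>),
  and convergence to a point of \<open>M \<union> {\<plusminus>\<infinity>}\<close>. The value \<open>bot\<close> is a dummy for the cases that
  cannot be endpoints of nonempty intervals on the relevant side.
\<close>

fun right_of :: "'a::linorder_topology extended \<Rightarrow> 'a filter" where
  "right_of (Fin b) = at_right b"
| "right_of Minf = at_bot"
| "right_of Pinf = bot"

fun left_of :: "'a::linorder_topology extended \<Rightarrow> 'a filter" where
  "left_of (Fin c) = at_left c"
| "left_of Pinf = at_top"
| "left_of Minf = bot"

fun nhds_ext :: "'a::linorder_topology extended \<Rightarrow> 'a filter" where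
  "nhds_ext (Fin a) = nhds a"
| "nhds_ext Pinf = at_top"
| "nhds_ext Minf = at_bot"

text \<open>
  A partial binary operation is a function \<open>p\<close> together with its domain \<open>D\<close>. Commutativity
  includes symmetry of the domain; associativity and monotonicity are required whenever all the
  sums occurring in them are defined.
\<close>

definition partial_sum ::
  "('f, 'r, 'a::linorder_topology) fo_structure \<Rightarrow> 'a set \<Rightarrow> ('a \<times> 'a) set \<Rightarrow> ('a \<Rightarrow> 'a \<Rightarrow> 'a) \<Rightarrow> bool"
  where
  "partial_sum M I D p \<longleftrightarrow>
     D \<subseteq> I \<times> I \<and> (\<forall>(x, y)\<in>D. p x y \<in> I) \<and>
     definable M 3 {v \<in> Pow_n 3. (v 0, v 1) \<in> D \<and> v 2 = p (v 0) (v 1)} \<and>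
     continuous_on D (\<lambda>(x, y). p x y) \<and>
     (\<forall>x y. (x, y) \<in> D \<longrightarrow> (y, x) \<in> D \<and> p x y = p y x) \<and>
     (\<forall>x y z. (x, y) \<in> D \<and> (p x y, z) \<in> D \<and> (y, z) \<in> D \<and> (x, p y z) \<in> D
        \<longrightarrow> p (p x y) z = p x (p y z)) \<and>
     (\<forall>x y z. x < y \<and> (x, z) \<in> D \<and> (y, z) \<in> D \<longrightarrow> p x z < p y z)"

text \<open>The left endpoint \<open>b\<close> plays the role of \<open>0\<close>.\<close>

definition positive_group_interval ::
  "('f, 'r, 'a::linorder_topology) fo_structure \<Rightarrow> 'a extended \<Rightarrow> 'a extended
    \<Rightarrow> ('a \<times> 'a) set \<Rightarrow> ('a \<Rightarrow> 'a \<Rightarrow> 'a) \<Rightarrow> bool" where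
  "positive_group_interval M b c D p \<longleftrightarrow>
     b < c \<and> partial_sum M (open_interval b c) D p \<and>
     (\<forall>x\<in>open_interval b c. \<exists>r. b < r \<and> r \<le> c \<and>
        {y. (x, y) \<in> D} = open_interval b r \<and>
        ((\<lambda>x'. p x' x) \<longlongrightarrow> x) (right_of b) \<and>
        filterlim (\<lambda>x'. p x x') (nhds_ext c) (left_of r))"

text \<open>The right endpoint \<open>c\<close> plays the role of \<open>0\<close>.\<close>

definition negative_group_interval ::
  "('f, 'r, 'a::linorder_topology) fo_structure \<Rightarrow> 'a extended \<Rightarrow> 'a extended
    \<Rightarrow> ('a \<times> 'a) set \<Rightarrow> ('a \<Rightarrow> 'a \<Rightarrow> 'a) \<Rightarrow> bool" where
  "negative_group_interval M b c D p \<longleftrightarrow>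
     b < c \<and> partial_sum M (open_interval b c) D p \<and>
     (\<forall>x\<in>open_interval b c. \<exists>l. b \<le> l \<and> l < c \<and>
        {y. (x, y) \<in> D} = open_interval l c \<and>
        ((\<lambda>x'. p x' x) \<longlongrightarrow> x) (left_of c) \<and>
        filterlim (\<lambda>x'. p x x') (nhds_ext b) (right_of l))"

text \<open>
  Here \<open>0\<close> is an inner point \<open>z\<close>, as for addition restricted to \<open>(-a, a)\<close>: the translation
  by a positive (negative) element is cut off only at the right (left) end, where its values
  tend to the right (left) endpoint.
\<close>

definition group_interval ::
  "('f, 'r, 'a::linorder_topology) fo_structure \<Rightarrow> 'a extended \<Rightarrow> 'a extended
    \<Rightarrow> ('a \<times> 'a) set \<Rightarrow> ('a \<Rightarrow> 'a \<Rightarrow> 'a) \<Rightarrow> bool" where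
  "group_interval M b c D p \<longleftrightarrow>
     partial_sum M (open_interval b c) D p \<and>
     (\<exists>z\<in>open_interval b c.
        (\<forall>x\<in>open_interval b c. (z, x) \<in> D \<and> p z x = x \<and> ((\<lambda>x'. p x' x) \<longlongrightarrow> x) (at z)) \<and>
        (\<forall>x\<in>open_interval b c. \<exists>y. (x, y) \<in> D \<and> p x y = z) \<and>
        (\<forall>x\<in>open_interval b c. z < x \<longrightarrow> (\<exists>r. b < r \<and> r \<le> c \<and>
           {y. (x, y) \<in> D} = open_interval b r \<and>
           filterlim (\<lambda>x'. p x x') (nhds_ext c) (left_of r))) \<and>
        (\<forall>x\<in>open_interval b c. x < z \<longrightarrow> (\<exists>l. b \<le> l \<and> l < c \<and>
           {y. (x, y) \<in> D} = open_interval l c \<and>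
           filterlim (\<lambda>x'. p x x') (nhds_ext b) (right_of l))))"

definition generalized_group_interval ::
  "('f, 'r, 'a::linorder_topology) fo_structure \<Rightarrow> 'a set \<Rightarrow> bool" where
  "generalized_group_interval M I \<longleftrightarrow>
     (\<exists>b c D p. I = open_interval b c \<and>
        (positive_group_interval M b c D p \<or> negative_group_interval M b c D p \<or>
         group_interval M b c D p))"


section \<open>Short sets\<close>

definition gp_short_interval :: "('f, 'r, 'a::linorder_topology) fo_structure \<Rightarrow> 'a set \<Rightarrow> bool"
  where
  "gp_short_interval M I \<longleftrightarrow> is_interv I \<and>
     (\<exists>\<J>. finite \<J> \<and> partition_on I \<J> \<and>
        (\<forall>J\<in>\<J>. (\<exists>a. J = {a}) \<or> generalized_group_interval M J))"

definition gp_short ::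
  "('f, 'r, 'a::linorder_topology) fo_structure \<Rightarrow> nat \<Rightarrow> (nat \<Rightarrow> 'a) set \<Rightarrow> bool" where
  "gp_short M n S \<longleftrightarrow> definable M n S \<and>
     (\<exists>k I f. (\<forall>i<k. gp_short_interval M (I i)) \<and>
        inj_on f S \<and> f ` S \<subseteq> PiE {..<k} I \<and>
        definable M (n + k) {join n k x (f x) | x. x \<in> S})"

end

theory Submission
  imports Defs
begin

text \<open>
  Each coordinate projection of \<open>S t\<close> is convex, has \<open>a\<^sub>0 i\<close> in its closure and is short: it is the
  image of a subset of a product of group-intervals, and by induction on the number of factors such
  an image is cut by the boundary points of its fibres into finitely many pieces that lie in single
  fibres. So everything reduces to one claim about the line: if \<open>(a, r)\<close> is short for all \<open>r < b\<close>,
  then \<open>(a, b)\<close> is short.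

  By saturation there are \<open>x < b\<close> and a single definable family of additions with parameters \<open>t\<close>
  such that every \<open>(x, y)\<close> with \<open>y < b\<close> is a group-interval by one of them. If the sets of possible
  values of a bounded difference \<open>w - u\<close> did not stabilise as \<open>y\<close> tends to \<open>b\<close>, then a short set
  would be mapped onto a final segment of \<open>(a, b)\<close>, and we would be done. Otherwise we fix, one after
  the other, generic values of differences that still have infinitely many possible values; each
  of them lowers the rank of \<open>t\<close>, so finally all differences have only finitely many possible
  values. Along a definable ultrafilter of parameters every difference is then eventually constant,
  and these constants are the differences of a group-interval structure on all of \<open>(x, b)\<close>.
\<close>

section \<open>Definable predicates on environments\<close>

text \<open>Differences are tracked rather than sums because \<open>w - u\<close> is smaller than
  \<open>w\<close>: however far \<open>y\<close> moves, its values stay in the short set between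
  \<open>x\<close> and \<open>w\<close>, and definable images of short sets are short. Sums admit no
  such bound; in the limit they are recovered by subtraction. Definable choice may fail, so no
  definable map from \<open>y\<close> to a parameter \<open>t\<close> is available. Instead a whole
  set \<open>Z y\<close> of parameters is kept that shrinks as \<open>y\<close> grows; the
  ultrafilter enters only when every difference has finitely many values left, and it must be
  definable for the limit addition to be definable. Fixing differences stops because
  \<open>dcl\<close> satisfies exchange: a value computable from \<open>t\<close> but generic over
  the parameters fixed so far can replace one generating coordinate of \<open>t\<close>. Exchange
  rests on the monotonicity theorem. The end \<open>b\<close> need not be a point of
  \<open>M\<close>. So a convex set \<open>R\<close> without greatest element takes the place of
  \<open>(x, b)\<close>, and \<open>lt\<close> stands for either \<open>(<)\<close> or
  \<open>(>)\<close> to treat both ends alike.\<close>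

lemma finite_fv_trm: "finite (fv_trm t)"
  by (induction t) auto

lemma finite_fv: "finite (fv \<phi>)"
  by (induction \<phi>) (auto simp: finite_fv_trm)

lemma eval_trm_cong: "(\<And>i. i \<in> fv_trm t \<Longrightarrow> e i = e' i) \<Longrightarrow> eval_trm M e t = eval_trm M e' t"
proof (induction t)
  case (Fn f ts)
  then have "map (eval_trm M e) ts = map (eval_trm M e') ts"
    by auto
  then show ?case
    by (simp del: map_eq_conv)
qed auto

lemma sat_cong: "(\<And>i. i \<in> fv \<phi> \<Longrightarrow> e i = e' i) \<Longrightarrow> sat M e \<phi> = sat M e' \<phi>"
proof (induction \<phi> arbitrary: e e')
  case (Rel r ts)
  then have "map (eval_trm M e) ts = map (eval_trm M e') ts"
    by (auto intro!: eval_trm_cong)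
  then show ?case
    by (simp del: map_eq_conv)
next
  case (Ex i \<phi>)
  have "sat M (e(i := a)) \<phi> = sat M (e'(i := a)) \<phi>" for a
    by (rule Ex.IH) (use Ex.prems in auto)
  then show ?case
    by simp
next
  case (Eq s t)
  then have "eval_trm M e s = eval_trm M e' s" "eval_trm M e t = eval_trm M e' t"
    by (auto intro!: eval_trm_cong)
  then show ?case
    by simp
next
  case (Lt s t)
  then have "eval_trm M e s = eval_trm M e' s" "eval_trm M e t = eval_trm M e' t"
    by (auto intro!: eval_trm_cong)
  then show ?case
    by simp
next
  case (Neg \<phi>)
  then have "sat M e \<phi> = sat M e' \<phi>"
    by (metis fv.simps(4))
  then show ?case
    by simp
next
  case (Conj \<phi> \<psi>)
  have "sat M e \<phi> = sat M e' \<phi>" "sat M e \<psi> = sat M e' \<psi>"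
    by (rule Conj.IH; use Conj.prems in auto)+
  then show ?case
    by simp
qed

section \<open>Capture-avoiding renaming of variables\<close>

primrec rename_trm :: "(nat \<Rightarrow> nat) \<Rightarrow> 'f trm \<Rightarrow> 'f trm" where
  "rename_trm \<rho> (Var i) = Var (\<rho> i)"
| "rename_trm \<rho> (Fn f ts) = Fn f (map (rename_trm \<rho>) ts)"

text \<open>The renaming need not be injective, so a free variable could be captured. Each binder is
  therefore moved to a variable outside the image of the free variables of its body.\<close>

primrec rename :: "('f, 'r) fm \<Rightarrow> (nat \<Rightarrow> nat) \<Rightarrow> ('f, 'r) fm" where
  "rename (Eq s t) \<rho> = Eq (rename_trm \<rho> s) (rename_trm \<rho> t)"
| "rename (Lt s t) \<rho> = Lt (rename_trm \<rho> s) (rename_trm \<rho> t)"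
| "rename (Rel r ts) \<rho> = Rel r (map (rename_trm \<rho>) ts)"
| "rename (Neg \<phi>) \<rho> = Neg (rename \<phi> \<rho>)"
| "rename (Conj \<phi> \<psi>) \<rho> = Conj (rename \<phi> \<rho>) (rename \<psi> \<rho>)"
| "rename (Ex i \<phi>) \<rho> =
     (let j = (SOME j. j \<notin> \<rho> ` fv \<phi>) in Ex j (rename \<phi> (\<rho>(i := j))))"

lemma eval_rename_trm: "eval_trm M e (rename_trm \<rho> t) = eval_trm M (e \<circ> \<rho>) t"
proof (induction t)
  case (Fn f ts)
  then have "map (eval_trm M e \<circ> rename_trm \<rho>) ts = map (eval_trm M (e \<circ> \<rho>)) ts"
    by (auto simp: o_def)
  then show ?case
    by (simp add: o_def del: map_eq_conv)
qed auto

lemma wf_rename_trm: "wf_trm M (rename_trm \<rho> t) = wf_trm M t"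
  by (induction t) auto

lemma fv_rename_trm: "fv_trm (rename_trm \<rho> t) = \<rho> ` fv_trm t"
  by (induction t) auto

lemma wf_rename: "wf_fm M (rename \<phi> \<rho>) = wf_fm M \<phi>"
  by (induction \<phi> arbitrary: \<rho>) (auto simp: wf_rename_trm Let_def)

lemma fresh_rename: "(SOME j. j \<notin> \<rho> ` fv \<phi>) \<notin> \<rho> ` fv (\<phi> :: ('f, 'r) fm)" for \<rho> :: "nat \<Rightarrow> nat"
  by (rule someI_ex) (use finite_fv ex_new_if_finite[of "\<rho> ` fv \<phi>"] in auto)

lemma fv_rename: "fv (rename \<phi> \<rho>) \<subseteq> \<rho> ` fv \<phi>"
proof (induction \<phi> arbitrary: \<rho>)
  case (Ex i \<phi>)
  define j where "j = (SOME j. j \<notin> \<rho> ` fv \<phi>)"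
  have "fv (rename (Ex i \<phi>) \<rho>) = fv (rename \<phi> (\<rho>(i := j))) - {j}"
    by (simp add: j_def Let_def)
  also have "\<dots> \<subseteq> (\<rho>(i := j)) ` fv \<phi> - {j}"
    using Ex.IH by blast
  also have "\<dots> \<subseteq> \<rho> ` fv (Ex i \<phi>)"
    by (auto split: if_splits)
  finally show ?case .
next
  case (Conj \<phi> \<psi>)
  then show ?case
    by (simp add: image_Un) blast
qed (auto simp: fv_rename_trm)

lemma sat_rename: "sat M e (rename \<phi> \<rho>) = sat M (e \<circ> \<rho>) \<phi>"
proof (induction \<phi> arbitrary: e \<rho>)
  case (Rel r ts)
  have "map (eval_trm M e \<circ> rename_trm \<rho>) ts = map (eval_trm M (e \<circ> \<rho>)) ts"
    by (auto simp: eval_rename_trm)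
  then show ?case
    by (simp add: o_def del: map_eq_conv)
next
  case (Ex i \<phi>)
  define j where "j = (SOME j. j \<notin> \<rho> ` fv \<phi>)"
  have j: "j \<notin> \<rho> ` fv \<phi>"
    unfolding j_def by (rule fresh_rename)
  have "sat M (e(j := a) \<circ> \<rho>(i := j)) \<phi> = sat M ((e \<circ> \<rho>)(i := a)) \<phi>" for a
    by (rule sat_cong) (use j in auto)
  then show ?case
    by (simp only: rename.simps Let_def j_def[symmetric] sat.simps Ex.IH)
qed (auto simp: eval_rename_trm)

text \<open>Only variables and parameters are ever put in place of a variable; function symbols stay
  inside the formulas. So no substitution of terms is needed: a change of the environment has the
  same effect.\<close>

definition atomic_trm :: "'a set \<Rightarrow> ((nat \<Rightarrow> 'a) \<Rightarrow> 'a) \<Rightarrow> bool" where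
  "atomic_trm B f \<longleftrightarrow> (\<exists>i. f = (\<lambda>v. v i)) \<or> (\<exists>c\<in>B. f = (\<lambda>v. c))"

lemma atomic_trm_var [intro, simp]: "atomic_trm B (\<lambda>v. v i)"
  by (auto simp: atomic_trm_def)

lemma atomic_trm_const [intro]: "c \<in> B \<Longrightarrow> atomic_trm B (\<lambda>v. c)"
  by (auto simp: atomic_trm_def)

lemma atomic_trm_comp:
  "atomic_trm B f \<Longrightarrow> (\<And>i. atomic_trm B (h i)) \<Longrightarrow> atomic_trm B (\<lambda>v. f (\<lambda>i. h i v))"
  by (auto simp: atomic_trm_def)

lemma atomic_trm_mono: "atomic_trm B f \<Longrightarrow> B \<subseteq> B' \<Longrightarrow> atomic_trm B' f"
  by (auto simp: atomic_trm_def)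

lemma atomic_trm_if:
  "atomic_trm B f \<Longrightarrow> atomic_trm B g \<Longrightarrow> atomic_trm B (\<lambda>v. if b then f v else g v)"
  by (cases b) auto

lemma atomic_trm_case_nat:
  "atomic_trm B g \<Longrightarrow> (\<And>i. atomic_trm B (\<lambda>v. h v i)) \<Longrightarrow> atomic_trm B (\<lambda>v. case_nat (g v) (h v) i)"
  by (cases i) auto

locale fo_str =
  fixes M :: "('f, 'r, 'a::unbounded_dense_linorder) fo_structure"
begin

text \<open>
  Predicates on environments whose truth is given by a formula with parameters from \<open>B\<close>. A
  quantifier pushes the new value in front of the environment, in the manner of de Bruijn indices.
\<close>

definition dfn :: "'a set \<Rightarrow> ((nat \<Rightarrow> 'a) \<Rightarrow> bool) \<Rightarrow> bool" where
  "dfn B P \<longleftrightarrow> (\<exists>\<phi> g. wf_fm M \<phi> \<and> (\<forall>i\<in>fv \<phi>. atomic_trm B (g i)) \<and>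
     (\<forall>v. P v \<longleftrightarrow> sat M (\<lambda>i. g i v) \<phi>))"

lemma dfn_cong: "dfn B P \<Longrightarrow> (\<And>v. P v = Q v) \<Longrightarrow> dfn B Q"
  by (auto simp: dfn_def)

lemma dfn_mono: "dfn B P \<Longrightarrow> B \<subseteq> B' \<Longrightarrow> dfn B' P"
  unfolding dfn_def by (meson atomic_trm_mono)

lemma dfn_subst:
  assumes "dfn B P" and "\<And>i. atomic_trm B (\<lambda>v. h v i)"
  shows "dfn B (\<lambda>v. P (h v))"
proof -
  from assms(1) obtain \<phi> g where \<phi>: "wf_fm M \<phi>" "\<forall>i\<in>fv \<phi>. atomic_trm B (g i)"
    "\<forall>v. P v \<longleftrightarrow> sat M (\<lambda>i. g i v) \<phi>"
    by (auto simp: dfn_def)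
  have "\<forall>i\<in>fv \<phi>. atomic_trm B (\<lambda>v. g i (h v))"
    using \<phi>(2) assms(2) atomic_trm_comp[of B _ "\<lambda>i v. h v i"] by auto
  with \<phi> show ?thesis
    unfolding dfn_def by (intro exI[of _ \<phi>] exI[of _ "\<lambda>i v. g i (h v)"]) auto
qed

lemma dfn_less: "atomic_trm B f \<Longrightarrow> atomic_trm B g \<Longrightarrow> dfn B (\<lambda>v. f v < g v)"
  unfolding dfn_def
  by (rule exI[of _ "Lt (Var 0) (Var 1)"], rule exI[of _ "\<lambda>i. if i = 0 then f else g"]) auto

lemma dfn_eq: "atomic_trm B f \<Longrightarrow> atomic_trm B g \<Longrightarrow> dfn B (\<lambda>v. f v = g v)"
  unfolding dfn_def
  by (rule exI[of _ "Eq (Var 0) (Var 1)"], rule exI[of _ "\<lambda>i. if i = 0 then f else g"]) auto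

lemma dfn_not: "dfn B P \<Longrightarrow> dfn B (\<lambda>v. \<not> P v)"
  unfolding dfn_def by (metis sat.simps(4) wf_fm.simps(4) fv.simps(4))

lemma dfn_conj:
  assumes "dfn B P" "dfn B Q"
  shows "dfn B (\<lambda>v. P v \<and> Q v)"
proof -
  from assms obtain \<phi> g \<psi> h where
    \<phi>: "wf_fm M \<phi>" "\<forall>i\<in>fv \<phi>. atomic_trm B (g i)" "\<forall>v. P v \<longleftrightarrow> sat M (\<lambda>i. g i v) \<phi>" and
    \<psi>: "wf_fm M \<psi>" "\<forall>i\<in>fv \<psi>. atomic_trm B (h i)" "\<forall>v. Q v \<longleftrightarrow> sat M (\<lambda>i. h i v) \<psi>"
    by (auto simp: dfn_def)
  \<comment> \<open>The two formulas may read the same variable differently, through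
    \<open>g\<close> and through \<open>h\<close>. Sending their variables to even and odd numbers
    keeps the two readings apart.\<close>
  define \<theta> where "\<theta> = Conj (rename \<phi> (\<lambda>i. 2 * i)) (rename \<psi> (\<lambda>i. 2 * i + 1))"
  define k where "k = (\<lambda>i. if even i then g (i div 2) else h (i div 2))"
  have "fv \<theta> \<subseteq> (\<lambda>i. 2 * i) ` fv \<phi> \<union> (\<lambda>i. 2 * i + 1) ` fv \<psi>"
    using fv_rename[of \<phi> "\<lambda>i. 2 * i"] fv_rename[of \<psi> "\<lambda>i. 2 * i + 1"] by (auto simp: \<theta>_def)
  then have "\<forall>i\<in>fv \<theta>. atomic_trm B (k i)"
    using \<phi>(2) \<psi>(2) by (auto simp: k_def)
  moreover have "wf_fm M \<theta>"
    using \<phi> \<psi> by (simp add: \<theta>_def wf_rename)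
  moreover have "(P v \<and> Q v) = sat M (\<lambda>i. k i v) \<theta>" for v
    using \<phi> \<psi> by (simp add: \<theta>_def sat_rename o_def k_def)
  ultimately show ?thesis
    unfolding dfn_def by blast
qed

lemma dfn_const [intro, simp]: "dfn B (\<lambda>v. b)"
proof -
  have "dfn B (\<lambda>v. \<not> (v 0 = v 0))" "dfn B (\<lambda>v. v 0 = v 0)"
    by (intro dfn_not dfn_eq atomic_trm_var)+
  then show ?thesis
    by (cases b) auto
qed

lemma dfn_disj: "dfn B P \<Longrightarrow> dfn B Q \<Longrightarrow> dfn B (\<lambda>v. P v \<or> Q v)"
  by (rule dfn_cong[OF dfn_not[OF dfn_conj[OF dfn_not dfn_not]]]) auto

lemma dfn_imp: "dfn B P \<Longrightarrow> dfn B Q \<Longrightarrow> dfn B (\<lambda>v. P v \<longrightarrow> Q v)"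
  by (rule dfn_cong[OF dfn_disj[OF dfn_not]]) auto

lemma dfn_iff: "dfn B P \<Longrightarrow> dfn B Q \<Longrightarrow> dfn B (\<lambda>v. P v \<longleftrightarrow> Q v)"
  by (rule dfn_cong[OF dfn_conj[OF dfn_imp[of B P Q] dfn_imp[of B Q P]]]) auto

lemma dfn_le: "atomic_trm B f \<Longrightarrow> atomic_trm B g \<Longrightarrow> dfn B (\<lambda>v. f v \<le> g v)"
  by (rule dfn_cong[OF dfn_not[OF dfn_less[of B g f]]]) auto

lemma dfn_ex_push:
  assumes "dfn B P"
  shows "dfn B (\<lambda>v. \<exists>a. P (case_nat a v))"
proof -
  from assms obtain \<phi> g where \<phi>: "wf_fm M \<phi>" "\<forall>i\<in>fv \<phi>. atomic_trm B (g i)"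
    "\<forall>v. P v \<longleftrightarrow> sat M (\<lambda>i. g i v) \<phi>"
    by (auto simp: dfn_def)
  \<comment> \<open>All variables of \<open>\<phi>\<close> that read coordinate 0 are merged into
    the bound variable 0, the others move up by one. In \<open>h\<close> the value
    \<open>undefined\<close> is a dummy, as the variables that remain do not read coordinate
    0.\<close>
  define \<rho> where "\<rho> = (\<lambda>i. if g i = (\<lambda>v. v 0) then 0 else Suc i)"
  define h where "h = (\<lambda>i v. g (i - 1) (case_nat undefined v))"
  define \<psi> where "\<psi> = Ex 0 (rename \<phi> \<rho>)"
  have "fv \<psi> \<subseteq> Suc ` {i \<in> fv \<phi>. g i \<noteq> (\<lambda>v. v 0)}"
    using fv_rename[of \<phi> \<rho>] by (auto simp: \<psi>_def \<rho>_def split: if_splits)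
  moreover have nz: "(\<exists>j. g i = (\<lambda>v. v (Suc j))) \<or> (\<exists>c\<in>B. g i = (\<lambda>v. c))"
    if "i \<in> fv \<phi>" "g i \<noteq> (\<lambda>v. v 0)" for i
    using \<phi>(2) that by (auto simp: atomic_trm_def) (metis not0_implies_Suc)
  ultimately have at: "\<forall>i\<in>fv \<psi>. atomic_trm B (h i)"
  proof (intro ballI)
    fix i assume sub: "fv \<psi> \<subseteq> Suc ` {i \<in> fv \<phi>. g i \<noteq> (\<lambda>v. v 0)}" and "i \<in> fv \<psi>"
    then obtain i' where "i = Suc i'" "i' \<in> fv \<phi>" "g i' \<noteq> (\<lambda>v. v 0)"
      by blast
    with nz[of i'] show "atomic_trm B (h i)"
      by (auto simp: h_def)
  qed
  have "sat M (\<lambda>i. g i (case_nat a v)) \<phi> = sat M ((\<lambda>i. h i v)(0 := a) \<circ> \<rho>) \<phi>" for a v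
  proof (rule sat_cong)
    fix i assume "i \<in> fv \<phi>"
    then show "g i (case_nat a v) = ((\<lambda>i. h i v)(0 := a) \<circ> \<rho>) i"
      using nz[of i] by (auto simp: h_def \<rho>_def)
  qed
  then have "(\<exists>a. P (case_nat a v)) = sat M (\<lambda>i. h i v) \<psi>" for v
    by (simp add: \<phi>(3) \<psi>_def sat_rename)
  moreover have "wf_fm M \<psi>"
    using \<phi> by (simp add: \<psi>_def wf_rename)
  ultimately show ?thesis
    unfolding dfn_def using at by blast
qed

lemma dfn_ex: "dfn B (\<lambda>v. P (\<lambda>i. v (Suc i)) (v 0)) \<Longrightarrow> dfn B (\<lambda>v. \<exists>a. P v a)"
  by (drule dfn_ex_push) simp

lemma dfn_all: "dfn B (\<lambda>v. P (\<lambda>i. v (Suc i)) (v 0)) \<Longrightarrow> dfn B (\<lambda>v. \<forall>a. P v a)"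
  by (rule dfn_cong[OF dfn_not[OF dfn_ex[of B "\<lambda>v a. \<not> P v a"]]]) (auto intro: dfn_not)

text \<open>A formula has finitely many free variables, and each of them reads at most one
  coordinate of the environment.\<close>

lemma dfn_support:
  assumes "dfn B P"
  obtains N where "\<And>v v'. (\<And>i. i < N \<Longrightarrow> v i = v' i) \<Longrightarrow> P v = P v'"
proof -
  from assms obtain \<phi> g where \<phi>: "wf_fm M \<phi>" "\<forall>i\<in>fv \<phi>. atomic_trm B (g i)"
    "\<forall>v. P v \<longleftrightarrow> sat M (\<lambda>i. g i v) \<phi>"
    by (auto simp: dfn_def)
  have "\<forall>i\<in>fv \<phi>. \<exists>n. \<forall>v v'. (\<forall>j<n. v j = v' j) \<longrightarrow> g i v = g i v'"
  proof
    fix i assume "i \<in> fv \<phi>"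
    then consider j where "g i = (\<lambda>v. v j)" | c where "g i = (\<lambda>v. c)"
      using \<phi>(2) by (auto simp: atomic_trm_def)
    then show "\<exists>n. \<forall>v v'. (\<forall>j<n. v j = v' j) \<longrightarrow> g i v = g i v'"
    proof cases
      case (1 j)
      then show ?thesis
        by (intro exI[of _ "Suc j"]) auto
    qed auto
  qed
  then obtain n where n: "\<And>i v v'. i \<in> fv \<phi> \<Longrightarrow> (\<forall>j<n i. v j = v' j) \<Longrightarrow> g i v = g i v'"
    by metis
  define N where "N = Max (insert 0 (n ` fv \<phi>))"
  have N: "n i \<le> N" if "i \<in> fv \<phi>" for i
    using that by (auto simp: N_def finite_fv)
  show ?thesis
  proof
    fix v v' :: "nat \<Rightarrow> 'a" assume "\<And>i. i < N \<Longrightarrow> v i = v' i"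
    then have "g i v = g i v'" if "i \<in> fv \<phi>" for i
      using n[OF that] N[OF that] by auto
    then show "P v = P v'"
      using \<phi>(3) sat_cong[of \<phi> "\<lambda>i. g i v" "\<lambda>i. g i v'"] by auto
  qed
qed

lemma dfn_finite_params:
  assumes "dfn B P"
  obtains B' where "finite B'" "B' \<subseteq> B" "dfn B' P"
proof -
  from assms obtain \<phi> g where \<phi>: "wf_fm M \<phi>" "\<forall>i\<in>fv \<phi>. atomic_trm B (g i)"
    "\<forall>v. P v \<longleftrightarrow> sat M (\<lambda>i. g i v) \<phi>"
    by (auto simp: dfn_def)
  have "\<forall>i\<in>fv \<phi>. \<exists>C. finite C \<and> C \<subseteq> B \<and> atomic_trm C (g i)"
  proof
    fix i assume "i \<in> fv \<phi>"
    then consider j where "g i = (\<lambda>v. v j)" | c where "c \<in> B" "g i = (\<lambda>v. c)"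
      using \<phi>(2) by (auto simp: atomic_trm_def)
    then show "\<exists>C. finite C \<and> C \<subseteq> B \<and> atomic_trm C (g i)"
    proof cases
      case (2 c)
      then show ?thesis
        by (intro exI[of _ "{c}"]) auto
    qed auto
  qed
  then obtain C where C: "\<And>i. i \<in> fv \<phi> \<Longrightarrow> finite (C i) \<and> C i \<subseteq> B \<and> atomic_trm (C i) (g i)"
    by metis
  show ?thesis
  proof
    show "finite (\<Union>i\<in>fv \<phi>. C i)" "(\<Union>i\<in>fv \<phi>. C i) \<subseteq> B"
      using C finite_fv by auto
    have "\<forall>i\<in>fv \<phi>. atomic_trm (\<Union>i\<in>fv \<phi>. C i) (g i)"
      using C atomic_trm_mono[of "C _"] by (meson UN_upper)
    with \<phi> show "dfn (\<Union>i\<in>fv \<phi>. C i) P"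
      unfolding dfn_def by blast
  qed
qed

text \<open>A named parameter becomes one more variable: whatever was the constant \<open>c\<close>
  now reads the new first coordinate. Quantifying over this coordinate later removes
  parameters.\<close>

lemma dfn_abstract:
  assumes "dfn (insert c B) P"
  obtains P' where "dfn B P'" "\<And>v. P v = P' (case_nat c v)"
proof -
  from assms obtain \<phi> g where \<phi>: "wf_fm M \<phi>" "\<forall>i\<in>fv \<phi>. atomic_trm (insert c B) (g i)"
    "\<forall>v. P v \<longleftrightarrow> sat M (\<lambda>i. g i v) \<phi>"
    by (auto simp: dfn_def)
  define h where "h = (\<lambda>i w. if g i = (\<lambda>v. c) then w 0 else g i (\<lambda>i. w (Suc i)))"
  have "atomic_trm B (h i)" if "i \<in> fv \<phi>" for i
  proof (cases "g i = (\<lambda>v. c)")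
    case False
    then have "atomic_trm B (g i)"
      using \<phi>(2) that by (auto simp: atomic_trm_def)
    then show ?thesis
      using False atomic_trm_comp[of B "g i" "\<lambda>i w. w (Suc i)"] by (simp add: h_def)
  qed (simp add: h_def)
  then have "dfn B (\<lambda>w. sat M (\<lambda>i. h i w) \<phi>)"
    unfolding dfn_def using \<phi>(1) by blast
  moreover have "P v = sat M (\<lambda>i. h i (case_nat c v)) \<phi>" for v
    unfolding \<phi>(3)[rule_format] by (rule sat_cong) (auto simp: h_def)
  ultimately show ?thesis
    using that by blast
qed

text \<open>Separates a definable ternary relation into a formula without parameters and a tuple
  \<open>t\<close> of parameters, so that compactness can range over formulas alone.\<close>

lemma dfn_family:
  assumes "dfn B (\<lambda>v. P (v 0) (v 1) (v 2))"
  obtains Q t where "dfn {} Q"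
    "\<And>u v w. P u v w = Q (case_nat u (case_nat v (case_nat w t)))"
proof -
  from assms obtain \<phi> g where \<phi>: "wf_fm M \<phi>" "\<forall>i\<in>fv \<phi>. atomic_trm B (g i)"
    "\<forall>v. P (v 0) (v 1) (v 2) \<longleftrightarrow> sat M (\<lambda>i. g i v) \<phi>"
    by (auto simp: dfn_def)
  define pr where "pr = (\<lambda>i j. g i = (\<lambda>v. v j))"
  \<comment> \<open>Coordinates 0, 1, 2 are kept. A higher coordinate cannot influence
    \<open>P\<close> and is redirected to 0. The constant belonging to variable \<open>i\<close> of
    the formula is stored at position \<open>i + 3\<close>.\<close>
  define h where "h = (\<lambda>i w. w (if \<exists>j. pr i j then (let j = SOME j. pr i j in if j < 3 then j else 0)
    else i + 3) :: 'a)"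
  have "dfn {} (\<lambda>w. sat M (\<lambda>i. h i w) \<phi>)"
    unfolding dfn_def using \<phi>(1) by (intro exI[of _ \<phi>] exI[of _ h]) (auto simp: h_def)
  moreover have "P u v w = sat M (\<lambda>i. h i (case_nat u (case_nat v (case_nat w (\<lambda>i. g i undefined))))) \<phi>"
    for u v w
  proof -
    define e where "e = (\<lambda>i::nat. if i = 0 then u else if i = 1 then v else if i = 2 then w else u)"
    have "P u v w = sat M (\<lambda>i. g i e) \<phi>"
      using \<phi>(3)[rule_format, of e] by (simp add: e_def)
    also have "\<dots> = sat M (\<lambda>i. h i (case_nat u (case_nat v (case_nat w (\<lambda>i. g i undefined))))) \<phi>"
    proof (rule sat_cong)
      fix i assume i: "i \<in> fv \<phi>"
      show "g i e = h i (case_nat u (case_nat v (case_nat w (\<lambda>i. g i undefined))))"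
      proof (cases "\<exists>j. pr i j")
        case True
        define j where "j = (SOME j. pr i j)"
        have "pr i j"
          unfolding j_def using True by (rule someI_ex)
        then have "g i e = e j"
          by (simp add: pr_def)
        also have "\<dots> = case_nat u (case_nat v (case_nat w (\<lambda>i. g i undefined))) (if j < 3 then j else 0)"
          by (auto simp: e_def numeral_2_eq_2 numeral_3_eq_3 less_Suc_eq split: nat.splits)
        finally show ?thesis
          using True by (simp add: h_def j_def Let_def)
      next
        case False
        then obtain c where "g i = (\<lambda>v. c)"
          using \<phi>(2) i by (auto simp: atomic_trm_def pr_def)
        then show ?thesis
          unfolding h_def if_not_P[OF False] by (simp add: numeral_3_eq_3)
      qed
    qed
    finally show ?thesis .
  qed
  ultimately show ?thesis
    using that[of "\<lambda>w. sat M (\<lambda>i. h i w) \<phi>" "\<lambda>i. g i undefined"] by blast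
qed

text \<open>
  Quantification over a whole environment \<open>t\<close> makes sense because only finitely many of its values
  matter. The pair \<open>(v, t)\<close> is coded by interleaving.
\<close>

lemma dfn_ex_env:
  assumes "dfn B (\<lambda>v. P (\<lambda>i. v (2 * i)) (\<lambda>i. v (2 * i + 1)))"
  shows "dfn B (\<lambda>v. \<exists>t. P v t)"
proof -
  define Q where "Q = (\<lambda>v. P (\<lambda>i. v (2 * i)) (\<lambda>i. v (2 * i + 1)))"
  obtain N where N: "\<And>v v'. (\<And>i. i < N \<Longrightarrow> v i = v' i) \<Longrightarrow> Q v = Q v'"
    using dfn_support[OF assms] unfolding Q_def by blast
  \<comment> \<open>The odd coordinates below \<open>2 * n\<close> are quantified one at a time;
    \<open>N\<close> rounds are enough because \<open>Q\<close> reads no coordinate from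
    \<open>N\<close> on.\<close>
  define R where "R = (\<lambda>n v. \<exists>t. Q (\<lambda>i. if odd i \<and> i < 2 * n then t i else v i))"
  have R: "dfn B (R n)" for n
  proof (induction n)
    case 0
    then show ?case
      using assms by (simp add: R_def Q_def)
  next
    case (Suc n)
    have eq: "(\<exists>a. R n (v(2 * n + 1 := a))) = R (Suc n) v" for v
    proof
      assume "R (Suc n) v"
      then obtain t where t: "Q (\<lambda>i. if odd i \<and> i < 2 * Suc n then t i else v i)"
        by (auto simp: R_def)
      have "(\<lambda>i. if odd i \<and> i < 2 * Suc n then t i else v i) =
        (\<lambda>i. if odd i \<and> i < 2 * n then t i else (v(2 * n + 1 := t (2 * n + 1))) i)"
        by (auto simp: fun_eq_iff less_Suc_eq)
      with t have "Q (\<lambda>i. if odd i \<and> i < 2 * n then t i else (v(2 * n + 1 := t (2 * n + 1))) i)"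
        by (simp only:)
      then show "\<exists>a. R n (v(2 * n + 1 := a))"
        unfolding R_def by blast
    next
      assume "\<exists>a. R n (v(2 * n + 1 := a))"
      then obtain a t where t: "Q (\<lambda>i. if odd i \<and> i < 2 * n then t i else (v(2 * n + 1 := a)) i)"
        unfolding R_def by blast
      have "(\<lambda>i. if odd i \<and> i < 2 * Suc n then (t(2 * n + 1 := a)) i else v i) =
        (\<lambda>i. if odd i \<and> i < 2 * n then t i else (v(2 * n + 1 := a)) i)"
        by (auto simp: fun_eq_iff less_Suc_eq)
      with t have "Q (\<lambda>i. if odd i \<and> i < 2 * Suc n then (t(2 * n + 1 := a)) i else v i)"
        by (simp only:)
      then show "R (Suc n) v"
        unfolding R_def by blast
    qed
    have "dfn B (\<lambda>v. \<exists>a. R n (v(2 * n + 1 := a)))"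
      by (rule dfn_ex, rule dfn_subst[OF Suc.IH]) (simp add: atomic_trm_if)
    then show ?case
      by (rule dfn_cong) (rule eq)
  qed
  \<comment> \<open>Odd positions are either overwritten by the quantified \<open>t\<close> or too
    high for \<open>Q\<close> to read, so \<open>v 0\<close> is only a filler that is
    atomic.\<close>
  have dR: "dfn B (\<lambda>v. R N (\<lambda>i. if even i then v (i div 2) else v 0))"
    by (rule dfn_subst[OF R]) (simp add: atomic_trm_if)
  have "R N (\<lambda>i. if even i then v (i div 2) else v 0) = (\<exists>t. P v t)" for v
  proof
    assume "R N (\<lambda>i. if even i then v (i div 2) else v 0)"
    then obtain t where "Q (\<lambda>i. if odd i \<and> i < 2 * N then t i else if even i then v (i div 2) else v 0)"
      by (auto simp: R_def)
    then show "\<exists>t. P v t"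
      unfolding Q_def by auto
  next
    assume "\<exists>t. P v t"
    then obtain t where "P v t" ..
    then have "Q (\<lambda>i. if even i then v (i div 2) else t (i div 2))"
      by (simp add: Q_def)
    moreover have "Q (\<lambda>i. if even i then v (i div 2) else t (i div 2)) =
      Q (\<lambda>i. if odd i \<and> i < 2 * N then t (i div 2) else if even i then v (i div 2) else v 0)"
      by (rule N) auto
    ultimately show "R N (\<lambda>i. if even i then v (i div 2) else v 0)"
      unfolding R_def by (intro exI[of _ "\<lambda>i. t (i div 2)"]) auto
  qed
  then show ?thesis
    by (rule dfn_cong[OF dR])
qed

lemma dfn_1:
  "dfn B (\<lambda>v. P (v 0)) \<Longrightarrow> atomic_trm B f \<Longrightarrow> dfn B (\<lambda>v. P (f v))"
  by (drule dfn_subst[of _ _ "\<lambda>v i. f v"]) auto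

lemma dfn_2:
  assumes "dfn B (\<lambda>v. P (v 0) (v 1))" "atomic_trm B f" "atomic_trm B g"
  shows "dfn B (\<lambda>v. P (f v) (g v))"
proof -
  have "atomic_trm B (\<lambda>v. if i = 0 then f v else g v)" for i :: nat
    by (intro atomic_trm_if assms)
  from dfn_subst[OF assms(1), of "\<lambda>v i. if i = 0 then f v else g v", OF this] show ?thesis
    by simp
qed

lemma dfn_3:
  assumes "dfn B (\<lambda>v. P (v 0) (v 1) (v 2))" "atomic_trm B f" "atomic_trm B g" "atomic_trm B h"
  shows "dfn B (\<lambda>v. P (f v) (g v) (h v))"
proof -
  have "atomic_trm B (\<lambda>v. if i = 0 then f v else if i = 1 then g v else h v)" for i :: nat
    by (intro atomic_trm_if assms)
  from dfn_subst[OF assms(1), of "\<lambda>v i. if i = 0 then f v else if i = 1 then g v else h v", OF this]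
  show ?thesis
    by simp
qed

lemma dfn_env:
  assumes "dfn B Q" "\<And>i. atomic_trm B (\<lambda>v. h v i)"
  shows "dfn B (\<lambda>v. Q (h v))"
  using assms by (rule dfn_subst)

lemma dfn_1_env:
  assumes "dfn B (\<lambda>v. P (v 0) (\<lambda>i. v (Suc i)))" "atomic_trm B f" "\<And>i. atomic_trm B (\<lambda>v. h v i)"
  shows "dfn B (\<lambda>v. P (f v) (h v))"
  using dfn_subst[OF assms(1), of "\<lambda>v. case_nat (f v) (h v)"] assms(2,3)
  by (auto intro: atomic_trm_case_nat)

lemma dfn_set_finite: "finite F \<Longrightarrow> F \<subseteq> B \<Longrightarrow> atomic_trm B f \<Longrightarrow> dfn B (\<lambda>v. f v \<in> F)"
proof (induction F rule: finite_induct)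
  case (insert c F)
  then have "dfn B (\<lambda>v. f v = c \<or> f v \<in> F)"
    by (intro dfn_disj dfn_eq) auto
  then show ?case
    by simp
qed auto

lemma dfn_ball_finite: "finite F \<Longrightarrow> (\<And>c. c \<in> F \<Longrightarrow> dfn B (P c)) \<Longrightarrow> dfn B (\<lambda>v. \<forall>c\<in>F. P c v)"
proof (induction F rule: finite_induct)
  case (insert c F)
  then have "dfn B (\<lambda>v. P c v \<and> (\<forall>c\<in>F. P c v))"
    by (intro dfn_conj) auto
  then show ?case
    by simp
qed auto

lemmas dfn_intros = dfn_const dfn_ex dfn_all dfn_conj dfn_disj dfn_imp dfn_not dfn_iff
  dfn_le dfn_less dfn_eq atomic_trm_var atomic_trm_const

subsection \<open>Definable sets in the sense of tuples\<close>

lemma definable_iff_dfn: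
  "definable M n X \<longleftrightarrow> X \<subseteq> Pow_n n \<and> dfn UNIV (\<lambda>v. restrict v {..<n} \<in> X)"
proof
  assume "definable M n X"
  then obtain \<phi> e where \<phi>: "wf_fm M \<phi>" "X = {x \<in> Pow_n n. holds M n \<phi> e x}"
    by (auto simp: definable_def)
  have "dfn UNIV (\<lambda>v. restrict v {..<n} \<in> X)"
    unfolding dfn_def
  proof (intro exI conjI)
    show "wf_fm M \<phi>"
      by (fact \<phi>)
    show "\<forall>i\<in>fv \<phi>. atomic_trm UNIV (\<lambda>v. if i < n then v i else e i)"
      by (auto intro!: atomic_trm_if)
    show "\<forall>v. restrict v {..<n} \<in> X \<longleftrightarrow> sat M (\<lambda>i. if i < n then v i else e i) \<phi>"
      unfolding \<phi>(2) holds_def override_on_def by (auto cong: if_cong simp: PiE_def)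
  qed
  with \<phi> show "X \<subseteq> Pow_n n \<and> dfn UNIV (\<lambda>v. restrict v {..<n} \<in> X)"
    by auto
next
  assume X: "X \<subseteq> Pow_n n \<and> dfn UNIV (\<lambda>v. restrict v {..<n} \<in> X)"
  then obtain \<phi> g where \<phi>: "wf_fm M \<phi>" "\<forall>i\<in>fv \<phi>. atomic_trm UNIV (g i)"
    "\<forall>v. restrict v {..<n} \<in> X \<longleftrightarrow> sat M (\<lambda>i. g i v) \<phi>"
    by (auto simp: dfn_def)
  \<comment> \<open>Points of \<open>Pow_n n\<close> are \<open>undefined\<close> beyond
    \<open>n\<close>. A variable that reads such a coordinate is therefore treated as a parameter
    with this value, and the parameters are moved to the variables \<open>n + i\<close>.\<close>
  define pr where "pr = (\<lambda>i j. j < n \<and> g i = (\<lambda>v. v j))"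
  define \<rho> where "\<rho> = (\<lambda>i. if \<exists>j. pr i j then SOME j. pr i j else n + i)"
  define e where "e = (\<lambda>i. g (i - n) (\<lambda>j. undefined))"
  have "x \<in> X \<longleftrightarrow> holds M n (rename \<phi> \<rho>) e x" if x: "x \<in> Pow_n n" for x
  proof -
    have "restrict x {..<n} = x"
      using x by (metis PiE_restrict)
    then have "x \<in> X \<longleftrightarrow> sat M (\<lambda>i. g i x) \<phi>"
      using \<phi>(3) by metis
    also have "\<dots> \<longleftrightarrow> sat M (override_on e x {..<n} \<circ> \<rho>) \<phi>"
    proof (rule sat_cong)
      fix i assume i: "i \<in> fv \<phi>"
      show "g i x = (override_on e x {..<n} \<circ> \<rho>) i"
      proof (cases "\<exists>j. pr i j")
        case True
        then have "pr i (\<rho> i)"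
          unfolding \<rho>_def by (simp add: someI_ex)
        then show ?thesis
          by (auto simp: pr_def override_on_def)
      next
        case False
        have "g i x = g i (\<lambda>j. undefined)"
        proof (cases "\<exists>j. g i = (\<lambda>v. v j)")
          case True
          then obtain j where j: "g i = (\<lambda>v. v j)" ..
          with False have "\<not> j < n"
            by (auto simp: pr_def)
          with x j show ?thesis
            by (auto simp: PiE_def extensional_def)
        next
          case False
          with \<phi>(2) i show ?thesis
            by (auto simp: atomic_trm_def)
        qed
        then show ?thesis
          unfolding o_def \<rho>_def if_not_P[OF False] by (simp add: e_def override_on_def)
      qed
    qed
    finally show ?thesis
      by (simp add: holds_def sat_rename)
  qed
  then have "X = {x \<in> Pow_n n. holds M n (rename \<phi> \<rho>) e x}"
    using X by auto
  then show "definable M n X"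
    unfolding definable_def using \<phi>(1) wf_rename by metis
qed

end

section \<open>One-dimensional o-minimality and saturation\<close>

locale omin = fo_str M for M :: "('f, 'r, 'a::unbounded_dense_linorder) fo_structure" +
  assumes o_min: "o_minimal M" and saturated: "sufficiently_saturated M"
begin

text \<open>There may be arbitrarily many predicates in \<open>\<P>\<close>; only the set of
  parameters occurring in them has to be countable.\<close>

lemma saturation_1:
  assumes "countable B" and dfn: "\<And>p. p \<in> \<P> \<Longrightarrow> dfn B (\<lambda>v. p (v 0))"
    and fin: "\<And>\<Q>. finite \<Q> \<Longrightarrow> \<Q> \<subseteq> \<P> \<Longrightarrow> \<exists>x. \<forall>p\<in>\<Q>. p x"
  shows "\<exists>x. \<forall>p\<in>\<P>. p x"
proof -
  have "\<exists>\<phi> e. wf_fm M \<phi> \<and> (\<forall>i\<in>fv \<phi>. 1 \<le> i \<longrightarrow> e i \<in> B) \<and> (\<forall>x. holds M 1 \<phi> e x \<longleftrightarrow> p (x 0))"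
    if "p \<in> \<P>" for p
  proof -
    from dfn[OF that] obtain \<phi> g where \<phi>: "wf_fm M \<phi>" "\<forall>i\<in>fv \<phi>. atomic_trm B (g i)"
      "\<forall>v. p (v 0) \<longleftrightarrow> sat M (\<lambda>i. g i v) \<phi>"
      by (auto simp: dfn_def)
    define \<rho> where "\<rho> = (\<lambda>i. if \<exists>j. g i = (\<lambda>v. v j) then 0 else Suc i)"
    define e where "e = (\<lambda>i. g (i - 1) undefined)"
    have "e i \<in> B" if "i \<in> fv (rename \<phi> \<rho>)" "1 \<le> i" for i
    proof -
      from that fv_rename[of \<phi> \<rho>] obtain i' where "i' \<in> fv \<phi>" "i = Suc i'" "\<nexists>j. g i' = (\<lambda>v. v j)"
        by (auto simp: \<rho>_def split: if_splits)
      with \<phi>(2) show ?thesis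
        by (auto simp: e_def atomic_trm_def)
    qed
    moreover have "holds M 1 (rename \<phi> \<rho>) e x \<longleftrightarrow> p (x 0)" for x
    proof -
      have "sat M (override_on e x {..<1} \<circ> \<rho>) \<phi> = sat M (\<lambda>i. g i (\<lambda>_. x 0)) \<phi>"
        by (rule sat_cong) (use \<phi>(2) in \<open>auto simp: \<rho>_def e_def atomic_trm_def override_on_def\<close>)
      then show ?thesis
        using \<phi>(3)[rule_format, of "\<lambda>_. x 0"] by (simp add: holds_def sat_rename)
    qed
    ultimately show ?thesis
      using \<phi>(1) by (intro exI[of _ "rename \<phi> \<rho>"] exI[of _ e]) (auto simp: wf_rename)
  qed
  then obtain \<phi> e where \<phi>: "\<And>p. p \<in> \<P> \<Longrightarrow> wf_fm M (\<phi> p) \<and> (\<forall>i\<in>fv (\<phi> p). 1 \<le> i \<longrightarrow> e p i \<in> B) \<and>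
      (\<forall>x. holds M 1 (\<phi> p) (e p) x \<longleftrightarrow> p (x 0))"
    by metis
  define q where "q = (\<lambda>p. (\<phi> p, e p)) ` \<P>"
  from \<open>countable B\<close> obtain f :: "'a \<Rightarrow> nat" where f: "inj_on f B"
    by (auto simp: countable_def)
  \<comment> \<open>The formulas \<open>Eq (Var k) (Var k)\<close> exist in every language, so
    countable parameter sets are always small enough for the saturation that is assumed.\<close>
  have B: "B \<lesssim> {\<phi>. wf_fm M \<phi>}"
    unfolding lepoll_def
    by (rule exI[of _ "\<lambda>b. Eq (Var (f b)) (Var (f b))"]) (use f in \<open>auto simp: inj_on_def\<close>)
  have q: "\<forall>(\<phi>, e)\<in>q. wf_fm M \<phi> \<and> (\<forall>i\<in>fv \<phi>. 1 \<le> i \<longrightarrow> e i \<in> B)"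
    using \<phi> by (auto simp: q_def)
  have fin_q: "\<forall>q'. q' \<subseteq> q \<and> finite q' \<longrightarrow> (\<exists>x\<in>Pow_n 1. \<forall>(\<phi>, e)\<in>q'. holds M 1 \<phi> e x)"
  proof (intro allI impI, elim conjE)
    fix q' assume q': "q' \<subseteq> q" "finite q'"
    obtain \<Q> where \<Q>: "\<Q> \<subseteq> \<P>" "finite \<Q>" "q' = (\<lambda>p. (\<phi> p, e p)) ` \<Q>"
      using finite_subset_image[OF q'(2) q'(1)[unfolded q_def]] by blast
    with fin obtain x where "\<forall>p\<in>\<Q>. p x"
      by blast
    moreover have "holds M 1 (\<phi> p) (e p) y \<longleftrightarrow> p (y 0)" if "p \<in> \<Q>" for p y
      using \<phi> \<Q>(1) that by blast
    ultimately show "\<exists>x\<in>Pow_n 1. \<forall>(\<phi>, e)\<in>q'. holds M 1 \<phi> e x"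
      by (intro bexI[of _ "\<lambda>i\<in>{..<1}. x"]) (simp_all add: \<Q>(3))
  qed
  obtain x where "\<forall>(\<phi>, e)\<in>q. holds M 1 \<phi> e x"
    using saturated[unfolded sufficiently_saturated_def, THEN spec, THEN spec, THEN spec,
        THEN mp, THEN mp, THEN mp, OF B q fin_q] by blast
  then show ?thesis
    using \<phi> by (auto simp: q_def)
qed

section \<open>Definable subsets of the line, their cuts, and definable closure\<close>

definition dset :: "'a set \<Rightarrow> bool" where
  "dset X \<longleftrightarrow> dfn UNIV (\<lambda>v. v 0 \<in> X)"

lemma dsetI: "dfn B (\<lambda>v. v 0 \<in> X) \<Longrightarrow> dset X"
  unfolding dset_def by (erule dfn_mono) simp

lemma dset_atomic: "dset X \<Longrightarrow> atomic_trm UNIV f \<Longrightarrow> dfn UNIV (\<lambda>v. f v \<in> X)"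
  unfolding dset_def by (rule dfn_1)

lemma dset_Un: "dset X \<Longrightarrow> dset Y \<Longrightarrow> dset (X \<union> Y)"
  unfolding dset_def by (simp add: dfn_disj)

lemma dset_Int: "dset X \<Longrightarrow> dset Y \<Longrightarrow> dset (X \<inter> Y)"
  unfolding dset_def by (simp add: dfn_conj)

lemma dset_Compl: "dset X \<Longrightarrow> dset (- X)"
  unfolding dset_def by (simp add: dfn_not)

lemma dset_Diff: "dset X \<Longrightarrow> dset Y \<Longrightarrow> dset (X - Y)"
  by (simp add: Diff_eq dset_Int dset_Compl)

lemma dset_finite: "finite X \<Longrightarrow> dset X"
  unfolding dset_def by (rule dfn_set_finite) auto

definition conv :: "'a set \<Rightarrow> bool" where
  "conv J \<longleftrightarrow> (\<forall>x\<in>J. \<forall>z\<in>J. \<forall>y. x < y \<and> y < z \<longrightarrow> y \<in> J)"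

text \<open>The form in which o-minimality is used throughout. Testing all convex sets instead of
  intervals avoids endpoints, in particular infinite ones, and \<open>J\<close> may be any convex
  set, definable or not.\<close>

definition cuts :: "'a set \<Rightarrow> 'a set \<Rightarrow> bool" where
  "cuts C X \<longleftrightarrow> finite C \<and> (\<forall>J. conv J \<longrightarrow> J \<inter> C = {} \<longrightarrow> J \<subseteq> X \<or> J \<inter> X = {})"

lemma cuts_mono: "cuts C X \<Longrightarrow> C \<subseteq> C' \<Longrightarrow> finite C' \<Longrightarrow> cuts C' X"
  unfolding cuts_def by blast

lemma cutsD: "cuts C X \<Longrightarrow> conv J \<Longrightarrow> J \<inter> C = {} \<Longrightarrow> J \<subseteq> X \<or> J \<inter> X = {}"
  unfolding cuts_def by blast

lemma cuts_finite: "cuts C X \<Longrightarrow> finite C"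
  unfolding cuts_def by blast

text \<open>The singletons and the finite endpoints of the intervals given by o-minimality serve as
  cuts: a convex set that meets an interval and avoids its endpoints cannot leave it.\<close>

lemma ex_cuts:
  assumes "dset X"
  obtains C where "cuts C X"
proof -
  have d: "definable M 1 {v \<in> Pow_n 1. v 0 \<in> X}"
    unfolding definable_iff_dfn using assms by (auto simp: dset_def)
  obtain \<J> where \<J>: "finite \<J>" "(\<lambda>x. x 0) ` {v \<in> Pow_n 1. v 0 \<in> X} = \<Union>\<J>"
    "\<forall>J\<in>\<J>. (\<exists>a. J = {a}) \<or> (\<exists>b c. J = open_interval b c)"
    using o_min[unfolded o_minimal_def, THEN spec, THEN mp, OF d] by (elim exE conjE)
  have "x \<in> (\<lambda>x. x 0) ` {v \<in> Pow_n 1. v 0 \<in> X}" if "x \<in> X" for x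
    by (rule image_eqI[of _ _ "\<lambda>i\<in>{..<1}. x"]) (use that in auto)
  with \<J>(2) have X: "X = \<Union>\<J>"
    by (metis (no_types, lifting) image_subsetI mem_Collect_eq subsetI subset_antisym)
  have "\<exists>C. finite C \<and> (\<forall>L. conv L \<and> L \<inter> C = {} \<longrightarrow> L \<subseteq> J \<or> L \<inter> J = {})" if "J \<in> \<J>" for J
  proof -
    from \<J>(3) that consider a where "J = {a}" | b c where "J = open_interval b c"
      by blast
    then show ?thesis
    proof cases
      case (1 a)
      then show ?thesis
        by (intro exI[of _ "{a}"]) auto
    next
      case (2 b c)
      let ?C = "{x. Fin x = b \<or> Fin x = c}"
      have "?C \<subseteq> (case b of Fin x \<Rightarrow> {x} | _ \<Rightarrow> {}) \<union> (case c of Fin x \<Rightarrow> {x} | _ \<Rightarrow> {})"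
        by auto
      moreover have "finite ((case b of Fin x \<Rightarrow> {x} | _ \<Rightarrow> {}) \<union> (case c of Fin x \<Rightarrow> {x} | _ \<Rightarrow> {}))"
        by (cases b; cases c) auto
      ultimately have "finite ?C"
        by (rule finite_subset)
      moreover have "L \<subseteq> J" if L: "conv L" "L \<inter> ?C = {}" "z \<in> L" "z \<in> J" for L z
      proof
        fix y assume y: "y \<in> L"
        have "b < Fin z" "Fin z < c"
          using L 2 by (auto simp: open_interval_def)
        have "b < Fin y"
        proof (rule ccontr)
          assume "\<not> b < Fin y"
          with \<open>b < Fin z\<close> obtain b' where b': "b = Fin b'" "b' < z" "y \<le> b'"
            by (cases b) auto
          with L y have "b' \<in> L"
            unfolding conv_def by (metis order_le_less)
          with b' L show False
            by auto
        qed
        moreover have "Fin y < c"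
        proof (rule ccontr)
          assume "\<not> Fin y < c"
          with \<open>Fin z < c\<close> obtain c' where c': "c = Fin c'" "z < c'" "c' \<le> y"
            by (cases c) auto
          with L y have "c' \<in> L"
            unfolding conv_def by (metis order_le_less)
          with c' L show False
            by auto
        qed
        ultimately show "y \<in> J"
          using 2 by (auto simp: open_interval_def)
      qed
      ultimately show ?thesis
        by (intro exI[of _ ?C]) blast
    qed
  qed
  then obtain D where D: "\<And>J. J \<in> \<J> \<Longrightarrow> finite (D J) \<and> (\<forall>L. conv L \<and> L \<inter> D J = {} \<longrightarrow> L \<subseteq> J \<or> L \<inter> J = {})"
    by metis
  have "cuts (\<Union>(D ` \<J>)) X"
    unfolding cuts_def X using D \<J>(1) by (auto 0 3) blast
  then show ?thesis
    using that by blast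
qed

lemma ex_cuts_family:
  assumes "finite \<X>" "\<And>X. X \<in> \<X> \<Longrightarrow> dset X"
  obtains C where "finite C" "\<And>X. X \<in> \<X> \<Longrightarrow> cuts C X"
proof -
  have "\<forall>X\<in>\<X>. \<exists>D. cuts D X"
    using assms(2) ex_cuts by blast
  then obtain D where D: "\<And>X. X \<in> \<X> \<Longrightarrow> cuts (D X) X"
    by metis
  show ?thesis
  proof
    show "finite (\<Union>(D ` \<X>))"
      using assms(1) D cuts_finite by auto
    then show "cuts (\<Union>(D ` \<X>)) X" if "X \<in> \<X>" for X
      using D[OF that] that by (auto intro: cuts_mono)
  qed
qed

text \<open>These are the pieces of the complement of \<open>C\<close>, labelled by the part
  \<open>A\<close> of \<open>C\<close> to their left. A label that is not an initial segment of
  \<open>C\<close> gives the empty set, which does no harm.\<close>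

definition cell :: "'a set \<Rightarrow> 'a set \<Rightarrow> 'a set" where
  "cell C A = {z. z \<notin> C \<and> {c \<in> C. c < z} = A}"

lemma conv_cell: "conv (cell C A)"
  unfolding conv_def
proof (intro ballI allI impI, elim conjE)
  fix x z y assume xz: "x \<in> cell C A" "z \<in> cell C A" "x < y" "y < z"
  then have "{c \<in> C. c < x} \<subseteq> {c \<in> C. c < y}" "{c \<in> C. c < y} \<subseteq> {c \<in> C. c < z}"
    by auto
  moreover have "y \<notin> C"
  proof
    assume "y \<in> C"
    with xz have "y \<in> {c \<in> C. c < x}"
      unfolding cell_def by auto
    with xz show False
      by (auto dest: order_less_asym)
  qed
  ultimately show "y \<in> cell C A"
    using xz by (auto simp: cell_def)
qed

lemma cell_disjoint: "cell C A \<inter> C = {}"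
  by (auto simp: cell_def)

lemma Compl_eq_cells: "- C = (\<Union>A\<in>Pow C. cell C A)"
proof (intro equalityI subsetI)
  fix z assume "z \<in> - C"
  then have "z \<in> cell C {c \<in> C. c < z}" "{c \<in> C. c < z} \<in> Pow C"
    by (auto simp: cell_def)
  then show "z \<in> (\<Union>A\<in>Pow C. cell C A)"
    by blast
qed (auto simp: cell_def)

lemma dset_cell: "finite C \<Longrightarrow> dset (cell C A)"
proof -
  assume C: "finite C"
  have "dfn UNIV (\<lambda>v. v 0 \<notin> C \<and> A \<subseteq> C \<and> (\<forall>c\<in>C. c < v 0 \<longleftrightarrow> c \<in> A))"
    by (intro dfn_conj dfn_not dfn_set_finite[OF C] dfn_ball_finite[OF C] dfn_iff dfn_less
        dfn_const atomic_trm_var atomic_trm_const) auto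
  then show ?thesis
    unfolding dset_def by (rule dfn_cong) (auto simp: cell_def)
qed

text \<open>Since \<open>M\<close> is linearly ordered, this is also the algebraic closure.\<close>

definition dcl :: "'a set \<Rightarrow> 'a set" where
  "dcl B = {c. dfn B (\<lambda>v. v 0 = c)}"

lemma dcl_superset: "B \<subseteq> dcl B"
  unfolding dcl_def by (auto intro: dfn_eq)

lemma dcl_mono: "B \<subseteq> B' \<Longrightarrow> dcl B \<subseteq> dcl B'"
  unfolding dcl_def by (auto intro: dfn_mono)

text \<open>The parameter \<open>c\<close> can be quantified away, being the only element that
  satisfies its definition over \<open>B\<close>.\<close>

lemma dfn_insert_dcl:
  assumes "dfn (insert c B) P" "c \<in> dcl B"
  shows "dfn B P"
proof -
  obtain P' where P': "dfn B P'" "\<And>v. P v = P' (case_nat c v)"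
    using dfn_abstract[OF assms(1)] by blast
  have "dfn B (\<lambda>v. v 0 = c \<and> P' v)"
    using assms(2) P'(1) by (auto simp: dcl_def intro: dfn_conj)
  from dfn_ex_push[OF this] show ?thesis
    by (rule dfn_cong) (auto simp: P'(2))
qed

lemma dfn_dcl_finite: "finite C \<Longrightarrow> C \<subseteq> dcl B \<Longrightarrow> dfn (B \<union> C) P \<Longrightarrow> dfn B P"
proof (induction C rule: finite_induct)
  case (insert c C)
  then have "c \<in> dcl (B \<union> C)"
    using dcl_mono[of B "B \<union> C"] by auto
  with insert.prems have "dfn (B \<union> C) P"
    by (metis Un_insert_right dfn_insert_dcl)
  with insert show ?case
    by auto
qed auto

lemma dfn_dcl:
  assumes "dfn B' P" "B' \<subseteq> dcl B"
  shows "dfn B P"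
proof -
  obtain C where C: "finite C" "C \<subseteq> B'" "dfn C P"
    using dfn_finite_params[OF assms(1)] by blast
  then have "dfn (B \<union> C) P"
    by (auto intro: dfn_mono)
  then show ?thesis
    using C assms(2) dfn_dcl_finite[of C B P] by auto
qed

lemma dcl_trans: "B' \<subseteq> dcl B \<Longrightarrow> dcl B' \<subseteq> dcl B"
  using dfn_dcl unfolding dcl_def[of B'] by (metis (mono_tags) dcl_def mem_Collect_eq subsetI)

text \<open>The least element of a finite definable set is definable, and the set without it is
  again definable over the same parameters.\<close>

lemma finite_subset_dcl: "finite X \<Longrightarrow> dfn B (\<lambda>v. v 0 \<in> X) \<Longrightarrow> X \<subseteq> dcl B"
proof (induction X rule: finite_linorder_min_induct)
  case (insert m X)
  have X: "dfn B (\<lambda>v. f v \<in> insert m X)" if "atomic_trm B f" for f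
    using dfn_1[OF insert.prems that] .
  have "dfn B (\<lambda>v. v 0 \<in> insert m X \<and> (\<forall>z. z \<in> insert m X \<longrightarrow> v 0 \<le> z))"
    by (intro dfn_intros X)
  then have "dfn B (\<lambda>v. v 0 = m)"
    by (rule dfn_cong) (metis insert.hyps(2) insert_iff leD order_less_imp_le order_refl)
  then have "m \<in> dcl B"
    by (simp add: dcl_def)
  moreover have "dfn B (\<lambda>v. v 0 \<in> insert m X \<and> (\<exists>z. z \<in> insert m X \<and> z < v 0))"
    by (intro dfn_intros X)
  then have "dfn B (\<lambda>v. v 0 \<in> X)"
    by (rule dfn_cong) (use insert.hyps in auto)
  ultimately show ?case
    using insert.IH by auto
qed auto

text \<open>The conditions \<open>x \<noteq> c\<close> for \<open>c\<close> in \<open>dcl B\<close>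
  are definable over \<open>B\<close> itself, so saturation applies although \<open>dcl B\<close> is
  not the parameter set. Finitely many of them cannot exhaust the infinite set
  \<open>X\<close>.\<close>

lemma ex_generic:
  assumes "countable B" "dfn B (\<lambda>v. v 0 \<in> X)" "infinite X"
  obtains d where "d \<in> X" "d \<notin> dcl B"
proof -
  define \<P> where "\<P> = insert (\<lambda>x. x \<in> X) ((\<lambda>c x. x \<noteq> c) ` dcl B)"
  have "\<exists>d. \<forall>p\<in>\<P>. p d"
  proof (rule saturation_1[OF assms(1)])
    fix p assume "p \<in> \<P>"
    then show "dfn B (\<lambda>v. p (v 0))"
      using assms(2) by (auto simp: \<P>_def dcl_def intro: dfn_not)
  next
    fix \<Q> assume \<Q>: "finite \<Q>" "\<Q> \<subseteq> \<P>"
    have "finite (\<Q> - {\<lambda>x. x \<in> X})" "\<Q> - {\<lambda>x. x \<in> X} \<subseteq> (\<lambda>c x. x \<noteq> c) ` dcl B"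
      using \<Q> by (auto simp: \<P>_def)
    then obtain F where F: "finite F" "\<Q> - {\<lambda>x. x \<in> X} = (\<lambda>c x. x \<noteq> c) ` F"
      by (metis finite_subset_image)
    from assms(3) F(1) obtain d where "d \<in> X - F"
      by (metis Diff_infinite_finite ex_in_conv finite.emptyI)
    then have "p d" if "p \<in> \<Q>" for p
    proof (cases "p = (\<lambda>x. x \<in> X)")
      case False
      with that F(2) have "p \<in> (\<lambda>c x. x \<noteq> c) ` F"
        by blast
      with \<open>d \<in> X - F\<close> show ?thesis
        by auto
    qed (use \<open>d \<in> X - F\<close> in simp)
    then show "\<exists>d. \<forall>p\<in>\<Q>. p d"
      by blast
  qed
  then show ?thesis
    using that by (auto simp: \<P>_def)
qed

end

text \<open>Statements about \<open>\<sqsubset>\<close> hold for the order and for its reverse.\<close>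

locale omin_dir = omin M for M :: "('f, 'r, 'a::unbounded_dense_linorder) fo_structure" +
  fixes lt :: "'a \<Rightarrow> 'a \<Rightarrow> bool" (infix "\<sqsubset>" 50)
  assumes lt_dir: "lt = (<) \<or> lt = (>)"
begin

definition le :: "'a \<Rightarrow> 'a \<Rightarrow> bool" (infix "\<sqsubseteq>" 50) where
  "x \<sqsubseteq> y \<longleftrightarrow> x \<sqsubset> y \<or> x = y"

sublocale dir: unbounded_dense_linorder le lt
proof -
  from lt_dir consider "lt = (<)" | "lt = (>)"
    by blast
  then show "class.unbounded_dense_linorder le lt"
  proof cases
    case 1
    then have "le = (\<le>)"
      by (auto simp: le_def fun_eq_iff)
    with 1 show ?thesis
      using unbounded_dense_linorder_class.unbounded_dense_linorder_axioms by simp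
  next
    case 2
    then have "le = (\<ge>)"
      by (auto simp: le_def fun_eq_iff)
    with 2 show ?thesis
      by unfold_locales (auto simp: gt_ex lt_ex, use dense in blast)
  qed
qed

lemma omin_dir_rev: "omin_dir M (\<lambda>x y. y \<sqsubset> x)"
  by unfold_locales (use lt_dir in auto)

lemma dfn_lt: "atomic_trm B f \<Longrightarrow> atomic_trm B g \<Longrightarrow> dfn B (\<lambda>v. f v \<sqsubset> g v)"
  using lt_dir dfn_less[of B f g] dfn_less[of B g f] by auto

lemma dfn_lt_eq: "atomic_trm B f \<Longrightarrow> atomic_trm B g \<Longrightarrow> dfn B (\<lambda>v. f v \<sqsubseteq> g v)"
  unfolding le_def by (intro dfn_disj dfn_lt dfn_eq)

lemmas dfn_dir_intros = dfn_intros dfn_lt dfn_lt_eq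

lemma conv_iff: "conv J \<longleftrightarrow> (\<forall>x\<in>J. \<forall>z\<in>J. \<forall>y. x \<sqsubset> y \<and> y \<sqsubset> z \<longrightarrow> y \<in> J)"
  using lt_dir by (auto simp: conv_def)

lemma convD: "conv J \<Longrightarrow> x \<in> J \<Longrightarrow> z \<in> J \<Longrightarrow> x \<sqsubseteq> y \<Longrightarrow> y \<sqsubseteq> z \<Longrightarrow> y \<in> J"
  unfolding conv_iff le_def by blast

definition itv :: "'a \<Rightarrow> 'a \<Rightarrow> 'a set" where
  "itv u v = {z. u \<sqsubset> z \<and> z \<sqsubset> v}"

lemma mem_itv [simp]: "z \<in> itv u v \<longleftrightarrow> u \<sqsubset> z \<and> z \<sqsubset> v"
  by (simp add: itv_def)

lemma conv_itv: "conv (itv u v)"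
  unfolding conv_iff by (auto intro: dir.less_trans)

lemma dset_itv: "dset (itv u v)"
  unfolding dset_def mem_itv by (intro dfn_dir_intros) auto

lemma infinite_itv: "u \<sqsubset> v \<Longrightarrow> infinite (itv u v)"
proof
  assume "u \<sqsubset> v" and fin: "finite (itv u v)"
  moreover obtain z where "u \<sqsubset> z" "z \<sqsubset> v"
    using dir.dense[OF \<open>u \<sqsubset> v\<close>] by blast
  ultimately have "itv u v \<noteq> {}"
    by auto
  from dir.finite_has_minimal[OF fin this] obtain m where m: "m \<in> itv u v"
    "\<forall>b\<in>itv u v. b \<sqsubseteq> m \<longrightarrow> m = b"
    by blast
  then obtain w where "u \<sqsubset> w" "w \<sqsubset> m"
    using dir.dense by (metis mem_itv)
  with m show False
    by (metis dir.less_imp_le dir.less_irrefl dir.less_trans mem_itv)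
qed

lemma ex_gap: "finite C \<Longrightarrow> u \<sqsubset> v \<Longrightarrow> \<exists>w. u \<sqsubset> w \<and> w \<sqsubseteq> v \<and> itv u w \<inter> C = {}"
proof (induction C rule: finite_induct)
  case (insert c C)
  then obtain w where w: "u \<sqsubset> w" "w \<sqsubseteq> v" "itv u w \<inter> C = {}"
    by blast
  show ?case
  proof (cases "u \<sqsubset> c \<and> c \<sqsubset> w")
    case True
    with w have "itv u c \<inter> C = {}"
      unfolding disjoint_iff mem_itv by (meson dir.less_trans)
    then have "itv u c \<inter> insert c C = {}"
      by auto
    moreover have "c \<sqsubseteq> v"
      using True w(2) by (meson dir.less_imp_le dir.less_le_trans)
    ultimately
    show ?thesis
      using True by blast
  next
    case False
    with w show ?thesis
      by (intro exI[of _ w]) auto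
  qed
qed (auto intro: exI[of _ v])

lemma cuts_germ_right:
  assumes "dset X" "x \<sqsubset> z"
  obtains y where "x \<sqsubset> y" "y \<sqsubseteq> z" "itv x y \<subseteq> X \<or> itv x y \<inter> X = {}"
proof -
  obtain C where C: "cuts C X"
    using ex_cuts[OF assms(1)] .
  obtain y where y: "x \<sqsubset> y" "y \<sqsubseteq> z" "itv x y \<inter> C = {}"
    using ex_gap[OF cuts_finite[OF C] assms(2)] by blast
  with cutsD[OF C conv_itv y(3)] that show ?thesis
    by blast
qed

lemma ex_gap_at:
  assumes "finite C" "z \<notin> C"
  obtains u v where "u \<sqsubset> z" "z \<sqsubset> v" "itv u v \<inter> C = {}"
proof -
  interpret rev: omin_dir M "\<lambda>x y. y \<sqsubset> x"
    by (rule omin_dir_rev)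
  obtain v0 u0 where "z \<sqsubset> v0" "u0 \<sqsubset> z"
    using dir.gt_ex dir.lt_ex by blast
  then obtain v u where "z \<sqsubset> v" "itv z v \<inter> C = {}" "u \<sqsubset> z" "rev.itv z u \<inter> C = {}"
    using ex_gap[OF assms(1)] rev.ex_gap[OF assms(1)] by metis
  then show ?thesis
    using that[of u v] assms(2) by (auto simp: disjoint_iff) (metis dir.neqE)
qed

lemma infinite_contains_itv:
  assumes "dset X" "infinite X"
  obtains u v where "u \<sqsubset> v" "itv u v \<subseteq> X"
proof -
  obtain C where C: "cuts C X"
    using ex_cuts[OF assms(1)] .
  then obtain z where "z \<in> X" "z \<notin> C"
    using assms(2) cuts_finite[OF C] by (metis finite_subset subsetI)
  then obtain u v where uv: "u \<sqsubset> z" "z \<sqsubset> v" "itv u v \<inter> C = {}"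
    using ex_gap_at cuts_finite[OF C] by metis
  with cutsD[OF C conv_itv uv(3)] \<open>z \<in> X\<close> show ?thesis
    using that[of u v] by (auto intro: dir.less_trans)
qed

definition no_max :: "'a set \<Rightarrow> bool" where
  "no_max R \<longleftrightarrow> (\<forall>x\<in>R. \<exists>y\<in>R. x \<sqsubset> y)"

lemma no_max_above: "finite C \<Longrightarrow> no_max R \<Longrightarrow> R \<noteq> {} \<Longrightarrow> C \<subseteq> R \<Longrightarrow> \<exists>r\<in>R. \<forall>c\<in>C. c \<sqsubset> r"
proof (induction C rule: finite_induct)
  case (insert c C)
  then obtain r where r: "r \<in> R" "\<forall>c\<in>C. c \<sqsubset> r"
    by auto
  obtain m where m: "m \<in> R" "c \<sqsubseteq> m" "r \<sqsubseteq> m"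
    using r(1) insert.prems(3) by (metis dir.linear insert_subset dir.order_refl)
  then obtain y where "y \<in> R" "m \<sqsubset> y"
    using insert.prems unfolding no_max_def by blast
  with m r show ?case
    by (metis dir.le_less_trans dir.less_trans insert_iff)
qed auto

text \<open>A finite set of cuts cannot be cofinal in a set without greatest element. This replaces
  germs at a right endpoint; \<open>R\<close> may be unbounded, so there need not be such a
  point.\<close>

lemma cuts_tail:
  assumes "dset X" "conv R" "R \<noteq> {}" "no_max R"
  obtains r where "r \<in> R" "{z \<in> R. r \<sqsubset> z} \<subseteq> X \<or> {z \<in> R. r \<sqsubset> z} \<inter> X = {}"
proof -
  obtain C where C: "cuts C X"
    using ex_cuts[OF assms(1)] .
  obtain r where r: "r \<in> R" "\<forall>c\<in>C \<inter> R. c \<sqsubset> r"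
    using no_max_above[of "C \<inter> R" R] assms(3,4) cuts_finite[OF C] by auto
  have "conv {z \<in> R. r \<sqsubset> z}"
    using assms(2) unfolding conv_iff by (auto intro: dir.less_trans)
  moreover have "{z \<in> R. r \<sqsubset> z} \<inter> C = {}"
    using r by (auto dest: dir.less_asym)
  ultimately show ?thesis
    using that[OF r(1)] cutsD[OF C] by blast
qed

text \<open>The order itself need not be complete. If a definable \<open>X\<close> had upper bounds
  but no least one, then the points below \<open>X\<close> and the upper bounds would form a gap,
  and an interval around this gap that avoids all cuts would contain points of \<open>X\<close> as
  well as upper bounds outside \<open>X\<close>.\<close>

lemma ex_lub:
  assumes "dset X" "x0 \<in> X" "\<And>x. x \<in> X \<Longrightarrow> x \<sqsubseteq> u0"
  obtains s where "\<And>x. x \<in> X \<Longrightarrow> x \<sqsubseteq> s" "\<And>u. (\<And>x. x \<in> X \<Longrightarrow> x \<sqsubseteq> u) \<Longrightarrow> s \<sqsubseteq> u"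
proof (cases "no_max X")
  case False
  then obtain s where "s \<in> X" "\<And>x. x \<in> X \<Longrightarrow> \<not> s \<sqsubset> x"
    unfolding no_max_def by blast
  then show ?thesis
    using that[of s] by (auto simp: dir.not_less)
next
  case True
  define L where "L = {z. \<exists>x\<in>X. z \<sqsubset> x}"
  define U where "U = {u. \<forall>x\<in>X. x \<sqsubseteq> u}"
  have LU: "z \<in> L \<or> z \<in> U" "\<not> (z \<in> L \<and> z \<in> U)" for z
    by (auto simp: L_def U_def dir.not_less)
  show ?thesis
  proof (rule ccontr)
    assume no: "\<not> thesis"
    interpret rev: omin_dir M "\<lambda>x y. y \<sqsubset> x"
      by (rule omin_dir_rev)
    have U: "rev.no_max U"
      unfolding rev.no_max_def
    proof
      fix s assume "s \<in> U"
      with no that[of s] obtain u where "\<forall>x\<in>X. x \<sqsubseteq> u" "\<not> s \<sqsubseteq> u"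
        by (auto simp: U_def)
      then show "\<exists>u\<in>U. u \<sqsubset> s"
        by (auto simp: U_def dir.not_le)
    qed
    have L: "no_max L" "X \<subseteq> L"
      using True dir.dense unfolding no_max_def L_def by blast+
    obtain C where C: "cuts C X"
      using ex_cuts[OF assms(1)] .
    have "u0 \<in> U"
      using assms(3) by (auto simp: U_def)
    then obtain u where u: "u \<in> U" "\<forall>c\<in>C \<inter> U. u \<sqsubset> c"
      using rev.no_max_above[of "C \<inter> U" U] U cuts_finite[OF C] by auto
    have "x0 \<in> L"
      using L assms(2) by auto
    then obtain l where l: "l \<in> L" "\<forall>c\<in>C \<inter> L. c \<sqsubset> l"
      using no_max_above[of "C \<inter> L" L] L(1) cuts_finite[OF C] by auto
    have "itv l u \<inter> C = {}"
      using u(2) l(2) LU(1) unfolding disjoint_iff mem_itv by (meson IntI dir.less_asym)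
    then have "itv l u \<subseteq> X \<or> itv l u \<inter> X = {}"
      using cutsD[OF C conv_itv] by blast
    moreover obtain x where x: "x \<in> X" "l \<sqsubset> x"
      using l(1) by (auto simp: L_def)
    then have "x \<in> itv l u"
      using u(1) L(2) LU(2)[of u] by (auto simp: U_def le_def)
    moreover obtain u' where u': "u' \<in> U" "u' \<sqsubset> u"
      using U u(1) unfolding rev.no_max_def by blast
    then have "l \<sqsubset> u'"
      using x by (auto simp: U_def intro: dir.less_le_trans)
    then have "u' \<in> itv l u"
      using u' by simp
    moreover have "u' \<notin> X"
      using u'(1) LU(2) L(2) by blast
    ultimately show False
      using x(1) by blast
  qed
qed

text \<open>A definable \<open>Y\<close> is decided near the bottom of \<open>X\<close>: at the
  minimum of \<open>X\<close> if there is one, otherwise on a tail of the points above some element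
  of \<open>X\<close>, in the reversed order. Membership of \<open>e\<close> in \<open>X\<close> is
  what the recursion in \<open>sel\<close> needs.\<close>

lemma bottom_germ:
  assumes "dset X" "x0 \<in> X" "dset Y"
  obtains e where "e \<in> X" "(\<forall>s\<in>X. s \<sqsubseteq> e \<longrightarrow> s \<in> Y) \<or> (\<forall>s\<in>X. s \<sqsubseteq> e \<longrightarrow> s \<notin> Y)"
proof (cases "\<exists>m\<in>X. \<forall>x\<in>X. m \<sqsubseteq> x")
  case True
  then show ?thesis
    using that by (metis dir.order_antisym)
next
  case False
  interpret rev: omin_dir M "\<lambda>x y. y \<sqsubset> x"
    by (rule omin_dir_rev)
  define R where "R = {z. \<exists>x\<in>X. x \<sqsubseteq> z}"
  have "conv R"
    unfolding R_def conv_iff by (auto simp: le_def intro: dir.less_trans)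
  moreover have "rev.no_max R"
    unfolding rev.no_max_def R_def using False
    by (auto simp: dir.not_le) (metis dir.le_less_trans dir.order_refl dir.less_le_trans)
  moreover have "x0 \<in> R"
    unfolding R_def using assms(2) by (auto simp: le_def)
  ultimately obtain r where r: "r \<in> R" "{z \<in> R. z \<sqsubset> r} \<subseteq> Y \<or> {z \<in> R. z \<sqsubset> r} \<inter> Y = {}"
    using rev.cuts_tail[OF assms(3), of R] by auto
  obtain x where "x \<in> X" "x \<sqsubseteq> r"
    using r(1) by (auto simp: R_def)
  with False obtain e where "e \<in> X" "e \<sqsubset> r"
    by (metis dir.not_le dir.less_le_trans)
  moreover have "s \<in> R" "s \<sqsubset> r" if "s \<in> X" "s \<sqsubseteq> e" for s
    using that \<open>e \<sqsubset> r\<close> by (auto simp: R_def le_def intro: dir.less_trans)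
  ultimately show ?thesis
    using that[of e] r(2) by blast
qed

end

section \<open>The monotonicity theorem\<close>

context omin_dir
begin

lemma rev_itv: "omin_dir.itv (\<lambda>x y. y \<sqsubset> x) u v = itv v u"
  using omin_dir.itv_def[OF omin_dir_rev] by (auto simp: itv_def)

lemma rev_le: "omin_dir.le (\<lambda>x y. y \<sqsubset> x) x y \<longleftrightarrow> y \<sqsubseteq> x"
  using omin_dir.le_def[OF omin_dir_rev] by (auto simp: le_def)

lemma ex_glb:
  assumes "dset X" "x0 \<in> X" "\<And>x. x \<in> X \<Longrightarrow> u0 \<sqsubseteq> x"
  obtains s where "\<And>x. x \<in> X \<Longrightarrow> s \<sqsubseteq> x" "\<And>u. (\<And>x. x \<in> X \<Longrightarrow> u \<sqsubseteq> x) \<Longrightarrow> u \<sqsubseteq> s"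
  using omin_dir.ex_lub[OF omin_dir_rev, of X x0 u0] assms unfolding rev_le by blast

lemma cuts_germ_left:
  assumes "dset X" "z \<sqsubset> x"
  obtains y where "y \<sqsubset> x" "z \<sqsubseteq> y" "itv y x \<subseteq> X \<or> itv y x \<inter> X = {}"
  by (rule omin_dir.cuts_germ_right[OF omin_dir_rev assms, unfolded rev_le rev_itv]) (rule that)

lemma itv_no_max: "no_max (itv u v)"
  unfolding no_max_def
proof
  fix x assume x: "x \<in> itv u v"
  then obtain y where "x \<sqsubset> y" "y \<sqsubset> v"
    using dir.dense[of x v] by auto
  with x show "\<exists>y\<in>itv u v. x \<sqsubset> y"
    by (auto intro: dir.less_trans)
qed

lemma itv_eq_empty_iff: "itv u v = {} \<longleftrightarrow> \<not> u \<sqsubset> v"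
  using dir.dense[of u v] by (auto simp: itv_def intro: dir.less_trans)

lemma cuts_tail_itv:
  assumes "dset X" "u \<sqsubset> v"
  obtains r where "u \<sqsubset> r" "r \<sqsubset> v" "itv r v \<subseteq> X \<or> itv r v \<inter> X = {}"
proof -
  have "itv u v \<noteq> {}"
    using assms(2) by (simp add: itv_eq_empty_iff)
  from cuts_tail[OF assms(1) conv_itv this itv_no_max] obtain r where
    "r \<in> itv u v" "{z \<in> itv u v. r \<sqsubset> z} \<subseteq> X \<or> {z \<in> itv u v. r \<sqsubset> z} \<inter> X = {}"
    by blast
  moreover have "{z \<in> itv u v. r \<sqsubset> z} = itv r v" if "u \<sqsubset> r"
    using that by (auto intro: dir.less_trans)
  ultimately show ?thesis
    using that by auto
qed

text \<open>Induction along the order. Let \<open>s\<close> be the infimum of the points up to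
  \<open>y\<close> at which the relation to \<open>x\<close> fails. The left neighbourhood of
  \<open>s\<close> gives \<open>R x s\<close>, and the right one carries the relation beyond
  \<open>s\<close>, a contradiction. Definability of \<open>R\<close> is what makes \<open>s\<close>
  exist.\<close>

lemma local_to_global:
  assumes J: "conv J" and R: "dfn UNIV (\<lambda>v. R (v 0) (v 1))"
    and trans: "\<And>x y z. R x y \<Longrightarrow> R y z \<Longrightarrow> R x z"
    and right: "\<And>x. x \<in> J \<Longrightarrow> \<exists>y. x \<sqsubset> y \<and> (\<forall>z\<in>itv x y. R x z)"
    and left: "\<And>x. x \<in> J \<Longrightarrow> \<exists>y. y \<sqsubset> x \<and> (\<forall>z\<in>itv y x. R z x)"
    and xy: "x \<in> J" "y \<in> J" "x \<sqsubset> y"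
  shows "R x y"
proof (rule ccontr)
  assume bad: "\<not> R x y"
  define E where "E = {z. x \<sqsubset> z \<and> z \<sqsubseteq> y \<and> \<not> R x z}"
  have dE: "dset E"
    unfolding dset_def E_def mem_Collect_eq
    by (intro dfn_dir_intros dfn_2[OF R]) auto
  have "y \<in> E"
    using xy bad by (simp add: E_def)
  then obtain s where s: "\<And>z. z \<in> E \<Longrightarrow> s \<sqsubseteq> z" "\<And>u. (\<And>z. z \<in> E \<Longrightarrow> u \<sqsubseteq> z) \<Longrightarrow> u \<sqsubseteq> s"
    using ex_glb[OF dE, of y x] by (auto simp: E_def dir.less_imp_le)
  obtain y0 where y0: "x \<sqsubset> y0" "\<forall>z\<in>itv x y0. R x z"
    using right xy by blast
  have "y0 \<sqsubseteq> s"
    by (rule s(2)) (use y0 in \<open>auto simp: E_def dir.not_less[symmetric]\<close>)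
  with y0 have xs: "x \<sqsubset> s"
    by (meson dir.less_le_trans)
  have sy: "s \<sqsubseteq> y"
    using s(1) \<open>y \<in> E\<close> by blast
  have sJ: "s \<in> J"
    using convD[OF J xy(1,2)] xs sy by (simp add: dir.less_imp_le)
  have below: "R x z" if "x \<sqsubset> z" "z \<sqsubset> s" for z
  proof (rule ccontr)
    assume "\<not> R x z"
    with that sy have "z \<in> E"
      unfolding E_def by (auto intro: dir.less_imp_le dir.less_le_trans)
    with s(1) that show False
      by (meson dir.leD)
  qed
  obtain y1 where y1: "y1 \<sqsubset> s" "\<forall>z\<in>itv y1 s. R z s"
    using left[OF sJ] by blast
  obtain m where m: "y1 \<sqsubseteq> m" "x \<sqsubseteq> m" "m \<sqsubset> s"
    using y1(1) xs by (metis dir.linear dir.order_refl)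
  obtain z where "m \<sqsubset> z" "z \<sqsubset> s"
    using dir.dense[OF m(3)] by blast
  with m y1 below have Rxs: "R x s"
    by (meson dir.le_less_trans mem_itv trans)
  obtain y2 where y2: "s \<sqsubset> y2" "\<forall>z\<in>itv s y2. R s z"
    using right[OF sJ] by blast
  have "y2 \<sqsubseteq> s"
  proof (rule s(2), rule ccontr)
    fix z assume z: "z \<in> E" "\<not> y2 \<sqsubseteq> z"
    then have "s \<sqsubseteq> z" "z \<sqsubset> y2"
      using s(1) by (auto simp: dir.not_le)
    with y2(2) Rxs have "R x z"
      by (metis le_def mem_itv trans)
    with z show False
      by (simp add: E_def)
  qed
  with y2(1) show False
    by (meson dir.leD)
qed

text \<open>
  Think of \<open>R x y\<close> as \<open>f x < f y\<close> for an injective function \<open>f\<close>. If every point is a strict local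
  minimum, then somewhere \<open>f\<close> jumps down at every point; by symmetry it also jumps up.
\<close>

lemma local_minima_jump:
  assumes R: "dfn UNIV (\<lambda>v. R (v 0) (v 1))" and uv: "u \<sqsubset> v"
    and irrefl: "\<And>x. \<not> R x x"
    and trans: "\<And>x y z. R x y \<Longrightarrow> R y z \<Longrightarrow> R x z"
    and total: "\<And>x y. x \<in> itv u v \<Longrightarrow> y \<in> itv u v \<Longrightarrow> x \<noteq> y \<Longrightarrow> R x y \<or> R y x"
    and right: "\<And>x. x \<in> itv u v \<Longrightarrow> \<exists>y. x \<sqsubset> y \<and> (\<forall>z\<in>itv x y. R x z)"
    and left: "\<And>x. x \<in> itv u v \<Longrightarrow> \<exists>y. y \<sqsubset> x \<and> (\<forall>z\<in>itv y x. R x z)"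
  obtains r where "u \<sqsubset> r" "r \<sqsubset> v"
    "\<And>w. w \<in> itv r v \<Longrightarrow> \<exists>w1 w2. w1 \<sqsubset> w \<and> w \<sqsubset> w2 \<and> (\<forall>y1\<in>itv w1 w. \<forall>y2\<in>itv w w2. R y2 y1)"
proof -
  have asym: "R x y \<Longrightarrow> \<not> R y x" for x y
    using irrefl trans by blast
  \<comment> \<open>In terms of \<open>f\<close>: the points whose value is smaller than all later
    values.\<close>
  define B where "B = {x. \<forall>y\<in>itv u v. x \<sqsubset> y \<longrightarrow> R x y}"
  have dB: "dset B"
    unfolding dset_def B_def mem_Collect_eq Ball_def mem_itv
    by (intro dfn_dir_intros dfn_2[OF R]) auto
  obtain r where r: "u \<sqsubset> r" "r \<sqsubset> v" "itv r v \<subseteq> B \<or> itv r v \<inter> B = {}"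
    using cuts_tail_itv[OF dB uv] .
  \<comment> \<open>On a final segment contained in \<open>B\<close> the function would be
    increasing, which contradicts the minima as seen from the left.\<close>
  have "\<not> itv r v \<subseteq> B"
  proof
    assume sub: "itv r v \<subseteq> B"
    obtain x where x: "r \<sqsubset> x" "x \<sqsubset> v"
      using dir.dense[OF r(2)] by blast
    have xI: "x \<in> itv u v"
      using x r by (auto intro: dir.less_trans)
    then obtain y where y: "y \<sqsubset> x" "\<forall>z\<in>itv y x. R x z"
      using left by blast
    obtain m where m: "y \<sqsubseteq> m" "r \<sqsubseteq> m" "m \<sqsubset> x"
      using y(1) x by (metis dir.linear dir.order_refl)
    obtain z where z: "m \<sqsubset> z" "z \<sqsubset> x"
      using dir.dense[OF m(3)] by blast
    have "z \<in> itv r v" "z \<in> itv y x"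
      using z m x by (auto intro: dir.le_less_trans dir.less_trans)
    then have "R x z" "R z x"
      using y(2) sub xI z unfolding B_def by auto
    then show False
      using asym by blast
  qed
  with r have notB: "itv r v \<inter> B = {}"
    by blast
  have sub: "itv r v \<subseteq> itv u v"
    using r by (auto intro: dir.less_trans)
  have drop: "\<exists>y. y \<in> itv r v \<and> c \<sqsubset> y \<and> R y c" if c: "c \<in> itv r v" for c
  proof -
    have "c \<notin> B"
      using that notB by blast
    then obtain y where y: "y \<in> itv u v" "c \<sqsubset> y" "\<not> R c y"
      by (auto simp: B_def)
    then have "R y c"
      using total[of c y] that sub by blast
    with y that show ?thesis
      by (auto intro: dir.less_trans)
  qed
  \<comment> \<open>From some point on, \<open>f\<close> stays below \<open>f c\<close>. Otherwise
    the points after \<open>c\<close> with smaller value have a supremum \<open>s\<close>; the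
    minimum at \<open>s\<close> seen from the left shows that \<open>s\<close> itself is such a
    point, and then \<open>s\<close> belongs to \<open>B\<close>.\<close>
  have ev: "\<exists>d\<in>itv r v. c \<sqsubseteq> d \<and> (\<forall>y\<in>itv d v. R y c)" if c: "c \<in> itv r v" for c
  proof -
    have cI: "c \<in> itv u v"
      using c sub by blast
    have "dset {y. R y c}"
      unfolding dset_def mem_Collect_eq by (intro dfn_2[OF R]) auto
    moreover have "c \<sqsubset> v"
      using c by simp
    ultimately obtain d where d: "c \<sqsubset> d" "d \<sqsubset> v" "itv d v \<subseteq> {y. R y c} \<or> itv d v \<inter> {y. R y c} = {}"
      using cuts_tail_itv by blast
    have dI: "d \<in> itv r v"
      using c d by (auto intro: dir.less_trans)
    show ?thesis
    proof (cases "itv d v \<subseteq> {y. R y c}")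
      case True
      with d dI show ?thesis
        by (intro bexI[of _ d]) (auto simp: dir.less_imp_le)
    next
      case False
      define E where "E = {y. c \<sqsubset> y \<and> y \<sqsubset> v \<and> R y c}"
      have dE: "dset E"
        unfolding dset_def E_def mem_Collect_eq by (intro dfn_dir_intros dfn_2[OF R]) auto
      obtain y0 where y0: "y0 \<in> E"
        using drop[OF c] by (auto simp: E_def)
      have "itv d v \<inter> {y. R y c} = {}"
        using d(3) False by blast
      then have "y \<sqsubseteq> d" if "y \<in> E" for y
        using that by (auto simp: E_def dir.not_less[symmetric])
      then obtain s where s: "\<And>x. x \<in> E \<Longrightarrow> x \<sqsubseteq> s" "\<And>u. (\<And>x. x \<in> E \<Longrightarrow> x \<sqsubseteq> u) \<Longrightarrow> s \<sqsubseteq> u"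
        using ex_lub[OF dE y0] by blast
      have "s \<sqsubseteq> d"
        by (rule s(2)) fact
      moreover have "c \<sqsubset> s"
        using s(1)[OF y0] y0 by (auto simp: E_def intro: dir.less_le_trans)
      ultimately have sI: "s \<in> itv r v"
        using c d by (auto intro: dir.less_trans dir.le_less_trans)
      have "s \<in> E"
      proof (rule ccontr)
        assume "s \<notin> E"
        obtain y where y: "y \<sqsubset> s" "\<forall>z\<in>itv y s. R s z"
          using left sI sub by blast
        have "\<exists>e\<in>E. y \<sqsubset> e"
          using s(2)[of y] y(1) by (metis dir.leD dir.not_le)
        then obtain e where e: "e \<in> E" "y \<sqsubset> e"
          by blast
        with s(1) \<open>s \<notin> E\<close> have "e \<sqsubset> s"
          by (metis le_def)
        with e y have "R s e" "R e c"
          by (auto simp: E_def)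
        then have "R s c"
          by (rule trans)
        with \<open>s \<notin> E\<close> \<open>c \<sqsubset> s\<close> sI show False
          by (auto simp: E_def)
      qed
      moreover have "R s y" if y: "y \<in> itv u v" "s \<sqsubset> y" for y
      proof -
        have "y \<notin> E"
          using y(2) s(1) by (meson dir.leD)
        moreover have "c \<sqsubset> y"
          using \<open>c \<sqsubset> s\<close> y(2) by (rule dir.less_trans)
        ultimately have "R c y"
          using y(1) total[OF cI y(1)] by (auto simp: E_def)
        with \<open>s \<in> E\<close> show ?thesis
          using trans by (auto simp: E_def)
      qed
      ultimately have "s \<in> B"
        by (simp add: B_def)
      with notB sI show ?thesis
        by blast
    qed
  qed
  define P where "P = {w. \<exists>w1 w2. w1 \<sqsubset> w \<and> w \<sqsubset> w2 \<and>
    (\<forall>y1\<in>itv w1 w. \<forall>y2\<in>itv w w2. R y2 y1)}"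
  have dP: "dset P"
    unfolding dset_def P_def mem_Collect_eq Ball_def mem_itv
    by (intro dfn_dir_intros dfn_2[OF R])
  \<comment> \<open>The supremum \<open>s\<close> of the points after \<open>c\<close> whose value
    exceeds \<open>f c\<close> is a place where \<open>f\<close> jumps from above \<open>f c\<close>
    to below it. Such places occur beyond every \<open>c\<close>, hence everywhere near
    \<open>v\<close>.\<close>
  have cofinal: "\<exists>\<beta>. c \<sqsubset> \<beta> \<and> \<beta> \<in> itv r v \<and> \<beta> \<in> P" if c: "c \<in> itv r v" for c
  proof -
    have cI: "c \<in> itv u v"
      using c sub by blast
    obtain d where d: "d \<in> itv r v" "c \<sqsubseteq> d" "\<forall>y\<in>itv d v. R y c"
      using ev[OF c] by blast
    define E where "E = {y. c \<sqsubset> y \<and> y \<sqsubset> v \<and> R c y}"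
    have dE: "dset E"
      unfolding dset_def E_def mem_Collect_eq by (intro dfn_dir_intros dfn_2[OF R]) auto
    obtain y where y: "c \<sqsubset> y" "\<forall>z\<in>itv c y. R c z"
      using right[OF cI] by blast
    obtain m where m: "c \<sqsubset> m" "m \<sqsubseteq> y" "m \<sqsubseteq> v"
      using y(1) c by (metis dir.linear dir.order_refl mem_itv)
    obtain y0 where "c \<sqsubset> y0" "y0 \<sqsubset> m"
      using dir.dense[OF m(1)] by blast
    with m y have y0: "y0 \<in> E"
      by (auto simp: E_def intro: dir.less_le_trans)
    have Ed: "y \<sqsubseteq> d" if "y \<in> E" for y
      using that d asym by (auto simp: E_def dir.not_less[symmetric])
    then obtain s where s: "\<And>x. x \<in> E \<Longrightarrow> x \<sqsubseteq> s" "\<And>u. (\<And>x. x \<in> E \<Longrightarrow> x \<sqsubseteq> u) \<Longrightarrow> s \<sqsubseteq> u"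
      using ex_lub[OF dE y0] by blast
    have "s \<sqsubseteq> d"
      by (rule s(2)) fact
    moreover have cs: "c \<sqsubset> s"
      using s(1)[OF y0] y0 by (auto simp: E_def intro: dir.less_le_trans)
    ultimately have sI: "s \<in> itv r v"
      using c d by (auto intro: dir.less_trans dir.le_less_trans)
    have R1: "R z c" if "z \<in> itv s v" for z
    proof -
      have "z \<notin> E" "c \<sqsubset> z" "z \<in> itv u v" "z \<noteq> c"
        using that s(1) cs sI sub by (auto intro: dir.less_trans dest: dir.leD)
      then show ?thesis
        using total[OF cI, of z] by (auto simp: E_def)
    qed
    have "dset {z. R c z}"
      unfolding dset_def mem_Collect_eq by (intro dfn_2[OF R]) auto
    then obtain w1 where w1: "w1 \<sqsubset> s" "c \<sqsubseteq> w1" "itv w1 s \<subseteq> {z. R c z} \<or> itv w1 s \<inter> {z. R c z} = {}"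
      using cuts_germ_left[OF _ cs] by blast
    have R2: "R c z" if z: "z \<in> itv w1 s" for z
    proof (rule ccontr)
      assume "\<not> R c z"
      with z w1 have none: "\<not> R c z" if "z \<in> itv w1 s" for z
        using that by blast
      have sE: "s \<in> E"
      proof (rule ccontr)
        assume "s \<notin> E"
        have "\<exists>e\<in>E. w1 \<sqsubset> e"
          using s(2)[of w1] w1(1) by (metis dir.leD dir.not_le)
        then obtain e where e: "e \<in> E" "w1 \<sqsubset> e"
          by blast
        with s(1) \<open>s \<notin> E\<close> have "e \<sqsubset> s"
          by (metis le_def)
        with e none show False
          by (auto simp: E_def)
      qed
      obtain y where y: "y \<sqsubset> s" "\<forall>z\<in>itv y s. R s z"
        using left sI sub by blast
      obtain m where m: "y \<sqsubseteq> m" "w1 \<sqsubseteq> m" "m \<sqsubset> s"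
        using y(1) w1(1) by (metis dir.linear dir.order_refl)
      obtain z where z: "m \<sqsubset> z" "z \<sqsubset> s"
        using dir.dense[OF m(3)] by blast
      with m y have "R s z"
        by (auto intro: dir.le_less_trans)
      with sE have "R c z"
        using trans by (auto simp: E_def)
      moreover have "z \<in> itv w1 s"
        using m z by (auto intro: dir.le_less_trans)
      ultimately show False
        using none by blast
    qed
    have "s \<in> P"
      unfolding P_def mem_Collect_eq
    proof (rule exI[of _ w1], rule exI[of _ v], intro conjI ballI)
      fix y1 y2 assume "y1 \<in> itv w1 s" "y2 \<in> itv s v"
      then show "R y2 y1"
        using trans[OF R1 R2] by blast
    qed (use w1(1) sI in auto)
    with cs sI show ?thesis
      by blast
  qed
  obtain r' where r': "r \<sqsubset> r'" "r' \<sqsubset> v" "itv r' v \<subseteq> P \<or> itv r' v \<inter> P = {}"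
    using cuts_tail_itv[OF dP r(2)] .
  obtain \<beta> where "r' \<sqsubset> \<beta>" "\<beta> \<in> itv r v" "\<beta> \<in> P"
    using cofinal[of r'] r' by auto
  then have "\<beta> \<in> itv r' v \<inter> P"
    by auto
  with r' have "itv r' v \<subseteq> P"
    by blast
  then show ?thesis
    using that[of r'] r r' by (auto simp: P_def subset_iff intro: dir.less_trans)
qed

text \<open>Inside a final segment where \<open>f\<close> jumps down at every point, the same
  argument for the reversed domain finds points where it jumps up. The relation \<open>R\<close> is
  not reversed, only the order of its arguments on the line.\<close>

lemma not_local_minima:
  assumes R: "dfn UNIV (\<lambda>v. R (v 0) (v 1))" and uv: "u \<sqsubset> v"
    and irrefl: "\<And>x. \<not> R x x"
    and trans: "\<And>x y z. R x y \<Longrightarrow> R y z \<Longrightarrow> R x z"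
    and total: "\<And>x y. x \<in> itv u v \<Longrightarrow> y \<in> itv u v \<Longrightarrow> x \<noteq> y \<Longrightarrow> R x y \<or> R y x"
    and right: "\<And>x. x \<in> itv u v \<Longrightarrow> \<exists>y. x \<sqsubset> y \<and> (\<forall>z\<in>itv x y. R x z)"
    and left: "\<And>x. x \<in> itv u v \<Longrightarrow> \<exists>y. y \<sqsubset> x \<and> (\<forall>z\<in>itv y x. R x z)"
  shows False
proof -
  obtain r where r: "u \<sqsubset> r" "r \<sqsubset> v"
    "\<And>w. w \<in> itv r v \<Longrightarrow> \<exists>w1 w2. w1 \<sqsubset> w \<and> w \<sqsubset> w2 \<and> (\<forall>y1\<in>itv w1 w. \<forall>y2\<in>itv w w2. R y2 y1)"
    by (rule local_minima_jump[OF assms]) (assumption | rule that)+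
  have sub: "x \<in> itv u v" if "x \<in> itv r v" for x
    using that r by (auto intro: dir.less_trans)
  note jump = omin_dir.local_minima_jump[OF omin_dir_rev, of R r v, unfolded rev_itv,
      OF R r(2) irrefl trans total[OF sub sub] left[OF sub] right[OF sub]]
  obtain r' where r': "r' \<sqsubset> v" "r \<sqsubset> r'"
    "\<And>w. w \<in> itv r r' \<Longrightarrow> \<exists>w1 w2. w \<sqsubset> w1 \<and> w2 \<sqsubset> w \<and> (\<forall>y1\<in>itv w w1. \<forall>y2\<in>itv w2 w. R y2 y1)"
    by (rule jump) (assumption | rule that)+
  obtain w where w: "w \<in> itv r r'" "w \<in> itv r v"
    using dir.dense[OF r'(2)] r'(1) by (auto intro: dir.less_trans)
  obtain w1 w2 where 1: "w1 \<sqsubset> w" "w \<sqsubset> w2" "\<forall>y1\<in>itv w1 w. \<forall>y2\<in>itv w w2. R y2 y1"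
    using r(3)[OF w(2)] by blast
  obtain w3 w4 where 2: "w \<sqsubset> w3" "w4 \<sqsubset> w" "\<forall>y1\<in>itv w w3. \<forall>y2\<in>itv w4 w. R y2 y1"
    using r'(3)[OF w(1)] by blast
  obtain m1 where m1: "w1 \<sqsubseteq> m1" "w4 \<sqsubseteq> m1" "m1 \<sqsubset> w"
    using 1 2 by (metis dir.linear dir.order_refl)
  obtain m2 where m2: "m2 \<sqsubseteq> w2" "m2 \<sqsubseteq> w3" "w \<sqsubset> m2"
    using 1 2 by (metis dir.linear dir.order_refl)
  obtain y1 y2 where "m1 \<sqsubset> y1" "y1 \<sqsubset> w" "w \<sqsubset> y2" "y2 \<sqsubset> m2"
    using dir.dense m1 m2 by metis
  with 1 2 m1 m2 have "R y1 y2" "R y2 y1"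
    by (auto intro: dir.le_less_trans dir.less_le_trans)
  then show False
    using irrefl trans by blast
qed

text \<open>The core of the monotonicity theorem, for \<open>R x y\<close> meaning
  \<open>f x < f y\<close> with \<open>f\<close> injective. Each point shows one of four
  combinations of one-sided behaviour; one of them holds on a whole interval. Local minima and
  maxima have been excluded, and the two remaining combinations give monotone behaviour.\<close>

lemma linear_order_agrees:
  assumes R: "dfn UNIV (\<lambda>v. R (v 0) (v 1))" and pq: "p \<sqsubset> q"
    and irrefl: "\<And>x. \<not> R x x"
    and trans: "\<And>x y z. R x y \<Longrightarrow> R y z \<Longrightarrow> R x z"
    and total: "\<And>x y. x \<in> itv p q \<Longrightarrow> y \<in> itv p q \<Longrightarrow> x \<noteq> y \<Longrightarrow> R x y \<or> R y x"
  obtains u v where "u \<sqsubset> v" "itv u v \<subseteq> itv p q"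
    "(\<forall>x\<in>itv u v. \<forall>y\<in>itv u v. x \<sqsubset> y \<longrightarrow> R x y) \<or> (\<forall>x\<in>itv u v. \<forall>y\<in>itv u v. x \<sqsubset> y \<longrightarrow> R y x)"
proof -
  define right where "right = (\<lambda>S x. \<exists>y. x \<sqsubset> y \<and> (\<forall>z\<in>itv x y. S x z))"
  define left where "left = (\<lambda>S x. \<exists>y. y \<sqsubset> x \<and> (\<forall>z\<in>itv y x. S x z))"
  define R' where "R' = (\<lambda>x y. R y x)"
  have R': "dfn UNIV (\<lambda>v. R' (v 0) (v 1))"
    unfolding R'_def by (intro dfn_2[OF R]) auto
  have mixed: "\<exists>y. x \<sqsubset> y \<and> (\<forall>z\<in>itv x y. R x z) \<or> x \<sqsubset> y \<and> (\<forall>z\<in>itv x y. R' x z)"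
    "\<exists>y. y \<sqsubset> x \<and> (\<forall>z\<in>itv y x. R x z) \<or> y \<sqsubset> x \<and> (\<forall>z\<in>itv y x. R' x z)" if x: "x \<in> itv p q" for x
  proof -
    have d: "dset {z. R x z}"
      unfolding dset_def mem_Collect_eq by (intro dfn_2[OF R]) auto
    obtain y where y: "x \<sqsubset> y" "y \<sqsubseteq> q" "itv x y \<subseteq> {z. R x z} \<or> itv x y \<inter> {z. R x z} = {}"
      using cuts_germ_right[OF d, of x q] x by auto
    have "z \<in> itv p q" "x \<noteq> z" if "z \<in> itv x y" for z
      using that y x by (auto intro: dir.less_trans dir.less_le_trans)
    then show "\<exists>y. x \<sqsubset> y \<and> (\<forall>z\<in>itv x y. R x z) \<or> x \<sqsubset> y \<and> (\<forall>z\<in>itv x y. R' x z)"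
      using total[OF x] y unfolding R'_def by blast
    obtain y where y: "y \<sqsubset> x" "p \<sqsubseteq> y" "itv y x \<subseteq> {z. R x z} \<or> itv y x \<inter> {z. R x z} = {}"
      using cuts_germ_left[OF d, of p x] x by auto
    have "z \<in> itv p q" "x \<noteq> z" if "z \<in> itv y x" for z
      using that y x by (auto intro: dir.less_trans dir.le_less_trans)
    then show "\<exists>y. y \<sqsubset> x \<and> (\<forall>z\<in>itv y x. R x z) \<or> y \<sqsubset> x \<and> (\<forall>z\<in>itv y x. R' x z)"
      using total[OF x] y unfolding R'_def by blast
  qed
  have cover: "itv p q \<subseteq> {x. right R x \<and> left R x} \<union> {x. right R x \<and> left R' x} \<union>
    {x. right R' x \<and> left R x} \<union> {x. right R' x \<and> left R' x}"
    using mixed unfolding right_def left_def by blast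
  have dR: "dset {x. right S x \<and> left T x}"
    if "dfn UNIV (\<lambda>v. S (v 0) (v 1))" "dfn UNIV (\<lambda>v. T (v 0) (v 1))" for S T
    unfolding dset_def mem_Collect_eq right_def left_def Ball_def mem_itv
    by (intro dfn_dir_intros dfn_2[OF that(1)] dfn_2[OF that(2)])
  have "infinite (itv p q)"
    using infinite_itv[OF pq] .
  then have "\<exists>S\<in>{R, R'}. \<exists>T\<in>{R, R'}. infinite (itv p q \<inter> {x. right S x \<and> left T x})"
  proof (rule contrapos_np)
    assume "\<not> (\<exists>S\<in>{R, R'}. \<exists>T\<in>{R, R'}. infinite (itv p q \<inter> {x. right S x \<and> left T x}))"
    then have "finite (\<Union>S\<in>{R, R'}. \<Union>T\<in>{R, R'}. itv p q \<inter> {x. right S x \<and> left T x})"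
      by blast
    moreover have "itv p q \<subseteq> (\<Union>S\<in>{R, R'}. \<Union>T\<in>{R, R'}. itv p q \<inter> {x. right S x \<and> left T x})"
      using cover by blast
    ultimately show "finite (itv p q)"
      by (meson finite_subset)
  qed
  then obtain S T where ST: "S \<in> {R, R'}" "T \<in> {R, R'}"
    "infinite (itv p q \<inter> {x. right S x \<and> left T x})"
    by blast
  have "dfn UNIV (\<lambda>v. S (v 0) (v 1))" "dfn UNIV (\<lambda>v. T (v 0) (v 1))"
    using ST(1,2) R R' by blast+
  then have "dset (itv p q \<inter> {x. right S x \<and> left T x})"
    by (intro dset_Int dset_itv dR)
  from infinite_contains_itv[OF this ST(3)] obtain u v where
    uv: "u \<sqsubset> v" "itv u v \<subseteq> itv p q \<inter> {x. right S x \<and> left T x}" .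
  have sub: "x \<in> itv p q" if "x \<in> itv u v" for x
    using uv(2) that by blast
  have S_right: "\<exists>y. x \<sqsubset> y \<and> (\<forall>z\<in>itv x y. S x z)" if "x \<in> itv u v" for x
    using uv(2) that unfolding right_def by blast
  have T_left: "\<exists>y. y \<sqsubset> x \<and> (\<forall>z\<in>itv y x. T x z)" if "x \<in> itv u v" for x
    using uv(2) that unfolding left_def by blast
  have S: "S = R \<or> S = R'"
    using ST(1) by blast
  have trans_S: "S x y \<Longrightarrow> S y z \<Longrightarrow> S x z" for x y z
    using S trans[of x y z] trans[of z y x] by (auto simp: R'_def)
  have irrefl_S: "\<not> S x x" for x
    using S irrefl by (auto simp: R'_def)
  have total_S: "S x y \<or> S y x" if "x \<in> itv u v" "y \<in> itv u v" "x \<noteq> y" for x y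
    using S total[OF sub[OF that(1)] sub[OF that(2)] that(3)] by (auto simp: R'_def)
  have dS: "dfn UNIV (\<lambda>v. S (v 0) (v 1))"
    using S R R' by blast
  \<comment> \<open>Equal behaviour on both sides would make every point a strict local minimum for
    \<open>S\<close>.\<close>
  have T: "T = (\<lambda>x y. S y x)"
  proof (rule ccontr)
    assume "T \<noteq> (\<lambda>x y. S y x)"
    then have "T = S"
      using ST(1,2) by (auto simp: R'_def)
    then have S_left: "\<exists>y. y \<sqsubset> x \<and> (\<forall>z\<in>itv y x. S x z)" if "x \<in> itv u v" for x
      using T_left[OF that] by simp
    show False
      by (rule not_local_minima[OF dS uv(1) irrefl_S trans_S total_S S_right S_left])
  qed
  have S_left: "\<exists>y. y \<sqsubset> x \<and> (\<forall>z\<in>itv y x. S z x)" if "x \<in> itv u v" for x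
    using T_left[OF that] unfolding T .
  have "S x y" if "x \<in> itv u v" "y \<in> itv u v" "x \<sqsubset> y" for x y
    by (rule local_to_global[OF conv_itv dS trans_S S_right S_left that])
  moreover have "itv u v \<subseteq> itv p q"
    using uv(2) by blast
  ultimately show ?thesis
    using that[OF uv(1)] S by (auto simp: R'_def)
qed

text \<open>
  A decreasing function is increasing with respect to the reversed order on its domain, so only the
  order on the domain is allowed to vary.
\<close>

definition increasing_on :: "'a set \<Rightarrow> ('a \<Rightarrow> 'a) \<Rightarrow> bool" where
  "increasing_on J f \<longleftrightarrow> (\<forall>x\<in>J. \<forall>y\<in>J. x \<sqsubset> y \<longrightarrow> f x < f y) \<and> conv (f ` J)"

lemma increasing_on_mono:
  fixes f :: "'a \<Rightarrow> 'a"
  assumes "\<And>x y. x \<in> J \<Longrightarrow> y \<in> J \<Longrightarrow> x \<sqsubset> y \<Longrightarrow> f x < f y" "x \<in> J" "y \<in> J" "f x < f y"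
  shows "x \<sqsubset> y"
  using dir.less_linear[of x y] assms(1)[of y x] assms(2-) by (auto dest: order_less_asym)

end

section \<open>Definable functions of one variable, the monotonicity theorem and exchange\<close>

context omin
begin

lemma up_dir: "omin_dir M (<)"
  by unfold_locales simp

lemma down_dir: "omin_dir M (>)"
  by unfold_locales simp

lemma up_itv: "omin_dir.itv (<) u v = {u<..<v :: 'a}"
  by (auto simp: omin_dir.itv_def[OF up_dir])

lemma infinite_contains_Ioo:
  assumes "dset X" "infinite X"
  obtains u v where "u < v" "{u<..<v} \<subseteq> X"
  using omin_dir.infinite_contains_itv[OF up_dir assms] unfolding up_itv by blast

definition dfun :: "'a set \<Rightarrow> ('a \<Rightarrow> 'a) \<Rightarrow> bool" where
  "dfun X f \<longleftrightarrow> dfn UNIV (\<lambda>v. v 0 \<in> X \<and> v 1 = f (v 0))"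

lemma dset_dfun:
  assumes "dfun X f"
  shows "dset X"
proof -
  have "dfn UNIV (\<lambda>v. \<exists>b. v 0 \<in> X \<and> b = f (v 0))"
    by (rule dfn_ex, rule dfn_2[OF assms[unfolded dfun_def]]) auto
  then show ?thesis
    by (simp add: dset_def)
qed

lemma dfun_2:
  assumes "dfun X f" "dfn UNIV (\<lambda>v. P (v 0) (v 1))"
  shows "dfn UNIV (\<lambda>v. v 0 \<in> X \<and> v 1 \<in> X \<and> P (f (v 0)) (f (v 1)))"
proof -
  have "dfn UNIV (\<lambda>v. \<exists>a b. (v 0 \<in> X \<and> a = f (v 0)) \<and> (v 1 \<in> X \<and> b = f (v 1)) \<and> P a b)"
    by (intro dfn_ex dfn_conj dfn_2[OF assms(1)[unfolded dfun_def]] dfn_2[OF assms(2)] atomic_trm_var)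
  then show ?thesis
    by (rule dfn_cong) auto
qed

lemma dset_image:
  assumes "dfun X f" "dset Y" "Y \<subseteq> X"
  shows "dset (f ` Y)"
proof -
  have "dfn UNIV (\<lambda>v. \<exists>a. a \<in> Y \<and> (a \<in> X \<and> v 0 = f a))"
    by (intro dfn_ex dfn_conj dfn_2[OF assms(1)[unfolded dfun_def]] dset_atomic[OF assms(2)]
        atomic_trm_var)
  then show ?thesis
    unfolding dset_def by (rule dfn_cong) (use assms(3) in auto)
qed

text \<open>An infinite fibre contains an interval. If all fibres are finite, their least points
  form an infinite definable set on which \<open>f\<close> is injective, and this set contains an
  interval.\<close>

lemma constant_or_injective:
  assumes f: "dfun X f" and pq: "p < q" "{p<..<q} \<subseteq> X"
  obtains u v where "u < v" "{u<..<v} \<subseteq> {p<..<q}"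
    "(\<exists>c. \<forall>x\<in>{u<..<v}. f x = c) \<or> inj_on f {u<..<v}"
proof (cases "\<exists>c. infinite {x \<in> {p<..<q}. f x = c}")
  case True
  then obtain c where c: "infinite {x \<in> {p<..<q}. f x = c}"
    by blast
  have "dfn UNIV (\<lambda>v. (p < v 0 \<and> v 0 < q) \<and> (v 0 \<in> X \<and> c = f (v 0)))"
    by (intro dfn_intros dfn_2[OF f[unfolded dfun_def]] UNIV_I)
  then have "dset {x \<in> {p<..<q}. f x = c}"
    unfolding dset_def by (rule dfn_cong) (use pq in auto)
  from infinite_contains_Ioo[OF this c] obtain u v where "u < v" "{u<..<v} \<subseteq> {x \<in> {p<..<q}. f x = c}" .
  then show ?thesis
    using that[of u v] by blast
next
  case False
  define G where "G = {x \<in> {p<..<q}. \<forall>y\<in>{p<..<q}. f y = f x \<longrightarrow> x \<le> y}"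
  have E: "dfn UNIV (\<lambda>v. v 0 \<in> X \<and> v 1 \<in> X \<and> f (v 0) = f (v 1))"
    by (rule dfun_2[OF f]) (intro dfn_intros)
  have "dfn UNIV (\<lambda>v. (p < v 0 \<and> v 0 < q) \<and>
      (\<forall>y. (p < y \<and> y < q) \<and> (y \<in> X \<and> v 0 \<in> X \<and> f y = f (v 0)) \<longrightarrow> v 0 \<le> y))"
    by (intro dfn_intros dfn_2[OF E] UNIV_I)
  then have dG: "dset G"
    unfolding dset_def G_def by (rule dfn_cong) (use pq in \<open>auto simp: subset_iff\<close>)
  have "{p<..<q} \<subseteq> (\<Union>x\<in>G. {y \<in> {p<..<q}. f y = f x})"
  proof
    fix y assume y: "y \<in> {p<..<q}"
    define m where "m = Min {x \<in> {p<..<q}. f x = f y}"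
    have fin: "finite {x \<in> {p<..<q}. f x = f y}"
      using False by blast
    then have "m \<in> {x \<in> {p<..<q}. f x = f y}"
      unfolding m_def by (rule Min_in) (use y in auto)
    moreover have "m \<le> z" if "z \<in> {p<..<q}" "f z = f y" for z
      unfolding m_def by (rule Min_le[OF fin]) (use that in auto)
    ultimately show "y \<in> (\<Union>x\<in>G. {y \<in> {p<..<q}. f y = f x})"
      using y unfolding G_def by auto
  qed
  moreover have "infinite {p<..<q}"
    using pq by (simp add: infinite_Ioo)
  moreover have "finite (\<Union>x\<in>G. {y \<in> {p<..<q}. f y = f x})" if "finite G"
    using that False by (intro finite_UN_I) blast+
  ultimately have "infinite G"
    using finite_subset by blast
  from infinite_contains_Ioo[OF dG this] obtain u v where uv: "u < v" "{u<..<v} \<subseteq> G" .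
  have "inj_on f {u<..<v}"
  proof (rule inj_onI)
    fix x y assume "x \<in> {u<..<v}" "y \<in> {u<..<v}" and eq: "f x = f y"
    then have "x \<in> G" "y \<in> G"
      using uv by blast+
    with eq have "x \<le> y" "y \<le> x"
      by (simp_all add: G_def)
    then show "x = y"
      by simp
  qed
  then show ?thesis
    using that[of u v] uv unfolding G_def by blast
qed

text \<open>Membership in \<open>X\<close> accompanies every value of \<open>f\<close>, because
  \<open>dfun\<close> describes \<open>f\<close> by its graph over \<open>X\<close> only.\<close>

definition loc_const :: "'a set \<Rightarrow> ('a \<Rightarrow> 'a) \<Rightarrow> 'a set" where
  "loc_const X f = {x. \<exists>u v. (u < x \<and> x < v) \<and> (\<forall>z. u < z \<and> z < v \<longrightarrow> z \<in> X \<and> x \<in> X \<and> f z = f x)}"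

lemma dset_loc_const:
  assumes "dfun X f"
  shows "dset (loc_const X f)"
proof -
  have E: "dfn UNIV (\<lambda>v. v 0 \<in> X \<and> v 1 \<in> X \<and> f (v 0) = f (v 1))"
    by (rule dfun_2[OF assms]) (intro dfn_intros)
  show ?thesis
    unfolding dset_def loc_const_def mem_Collect_eq by (intro dfn_intros dfn_2[OF E])
qed

lemma loc_const_global:
  assumes "dfun X f" "conv J" "J \<subseteq> loc_const X f" "x \<in> J" "y \<in> J"
  shows "f x = f y"
proof -
  interpret up: omin_dir M "(<)"
    by (rule up_dir)
  have R: "dfn UNIV (\<lambda>v. v 0 \<in> X \<and> v 1 \<in> X \<and> f (v 0) = f (v 1))"
    by (rule dfun_2[OF assms(1)]) (intro dfn_intros)
  have loc: "(\<exists>y>x. \<forall>z\<in>up.itv x y. x \<in> X \<and> z \<in> X \<and> f x = f z) \<and>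
    (\<exists>y<x. \<forall>z\<in>up.itv y x. z \<in> X \<and> x \<in> X \<and> f z = f x)" if x: "x \<in> J" for x
  proof -
    obtain u v where uv: "u < x" "x < v" "\<forall>z. u < z \<and> z < v \<longrightarrow> z \<in> X \<and> x \<in> X \<and> f z = f x"
      using x assms(3) unfolding loc_const_def by blast
    have "x \<in> X \<and> z \<in> X \<and> f x = f z" if "z \<in> up.itv x v" for z
    proof -
      have "u < z \<and> z < v"
        using that uv(1) by (auto simp: up_itv)
      with uv(3) have "z \<in> X \<and> x \<in> X \<and> f z = f x"
        by blast
      then show ?thesis
        by simp
    qed
    moreover have "z \<in> X \<and> x \<in> X \<and> f z = f x" if "z \<in> up.itv u x" for z
    proof -
      have "u < z \<and> z < v"
        using that uv(2) by (auto simp: up_itv)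
      with uv(3) show ?thesis
        by blast
    qed
    ultimately show ?thesis
      using uv(1,2) by blast
  qed
  have loc1: "\<exists>y>x. \<forall>z\<in>up.itv x y. x \<in> X \<and> z \<in> X \<and> f x = f z" if "x \<in> J" for x
    using loc[OF that] by (rule conjunct1)
  have loc2: "\<exists>y<x. \<forall>z\<in>up.itv y x. z \<in> X \<and> x \<in> X \<and> f z = f x" if "x \<in> J" for x
    using loc[OF that] by (rule conjunct2)
  have "f x = f y" if "x \<in> J" "y \<in> J" "x < y" for x y
    using up.local_to_global[OF assms(2) R _ loc1 loc2 that] by simp
  with assms(4,5) show ?thesis
    by (metis linorder_neqE)
qed

end

context omin_dir
begin

definition loc_increasing :: "'a set \<Rightarrow> ('a \<Rightarrow> 'a) \<Rightarrow> 'a set" where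
  "loc_increasing X f = {x. \<exists>u v. (u \<sqsubset> x \<and> x \<sqsubset> v) \<and> (\<forall>z. u \<sqsubset> z \<and> z \<sqsubset> v \<longrightarrow> z \<in> X) \<and>
     increasing_on (itv u v) f}"

lemma dset_loc_increasing:
  assumes f: "dfun X f"
  shows "dset (loc_increasing X f)"
proof -
  have E: "dfn UNIV (\<lambda>v. v 0 \<in> X \<and> v 1 \<in> X \<and> f (v 0) < f (v 1))"
    by (rule dfun_2[OF f]) (intro dfn_intros)
  note F = f[unfolded dfun_def]
  \<comment> \<open>Values of \<open>f\<close> have to be named by quantified variables, since
    formulas know \<open>f\<close> only through its graph.\<close>
  have "dfn UNIV (\<lambda>w. \<exists>u v. (u \<sqsubset> w 0 \<and> w 0 \<sqsubset> v) \<and> (\<forall>z. u \<sqsubset> z \<and> z \<sqsubset> v \<longrightarrow> z \<in> X) \<and>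
    (\<forall>x y. (u \<sqsubset> x \<and> x \<sqsubset> v) \<and> (u \<sqsubset> y \<and> y \<sqsubset> v) \<and> x \<sqsubset> y \<longrightarrow> x \<in> X \<and> y \<in> X \<and> f x < f y) \<and>
    (\<forall>x y m a b. (u \<sqsubset> x \<and> x \<sqsubset> v) \<and> (u \<sqsubset> y \<and> y \<sqsubset> v) \<and> (x \<in> X \<and> a = f x) \<and> (y \<in> X \<and> b = f y) \<and> a < m \<and> m < b \<longrightarrow>
       (\<exists>z. (u \<sqsubset> z \<and> z \<sqsubset> v) \<and> (z \<in> X \<and> m = f z))))"
    by (intro dfn_dir_intros dset_atomic[OF dset_dfun[OF f]] dfn_2[OF E] dfn_2[OF F])
  then show ?thesis
    unfolding dset_def
  proof (rule dfn_cong)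
    fix w :: "nat \<Rightarrow> 'a"
    have "(\<forall>x y. (u \<sqsubset> x \<and> x \<sqsubset> v) \<and> (u \<sqsubset> y \<and> y \<sqsubset> v) \<and> x \<sqsubset> y \<longrightarrow> x \<in> X \<and> y \<in> X \<and> f x < f y) \<and>
      (\<forall>x y m a b. (u \<sqsubset> x \<and> x \<sqsubset> v) \<and> (u \<sqsubset> y \<and> y \<sqsubset> v) \<and> (x \<in> X \<and> a = f x) \<and> (y \<in> X \<and> b = f y) \<and> a < m \<and> m < b \<longrightarrow>
       (\<exists>z. (u \<sqsubset> z \<and> z \<sqsubset> v) \<and> (z \<in> X \<and> m = f z))) \<longleftrightarrow> increasing_on (itv u v) f" (is "?inc \<and> ?conv \<longleftrightarrow> _")
      if X: "\<forall>z. u \<sqsubset> z \<and> z \<sqsubset> v \<longrightarrow> z \<in> X" for u v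
    proof -
      have "?inc \<longleftrightarrow> (\<forall>x\<in>itv u v. \<forall>y\<in>itv u v. x \<sqsubset> y \<longrightarrow> f x < f y)"
        using X by auto
      moreover have "conv (f ` itv u v)" if c: ?conv
        unfolding conv_def
      proof (intro ballI allI impI, elim conjE imageE)
        fix y1 y2 m x1 x2 assume "y1 = f x1" "y2 = f x2" "x1 \<in> itv u v" "x2 \<in> itv u v" "y1 < m" "m < y2"
        then show "m \<in> f ` itv u v"
          using c[rule_format, of x1 x2 y1 y2 m] X by auto
      qed
      moreover have ?conv if c: "conv (f ` itv u v)"
      proof (intro allI impI, elim conjE)
        fix x y m a b assume "u \<sqsubset> x" "x \<sqsubset> v" "u \<sqsubset> y" "y \<sqsubset> v" "a = f x" "b = f y" "a < m" "m < b"
        then have "m \<in> f ` itv u v"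
          using c[unfolded conv_def, rule_format, of a b m] by auto
        then show "\<exists>z. (u \<sqsubset> z \<and> z \<sqsubset> v) \<and> (z \<in> X \<and> m = f z)"
          using X by auto
      qed
      ultimately show ?thesis
        unfolding increasing_on_def by blast
    qed
    then show "(\<exists>u v. (u \<sqsubset> w 0 \<and> w 0 \<sqsubset> v) \<and> (\<forall>z. u \<sqsubset> z \<and> z \<sqsubset> v \<longrightarrow> z \<in> X) \<and>
      (\<forall>x y. (u \<sqsubset> x \<and> x \<sqsubset> v) \<and> (u \<sqsubset> y \<and> y \<sqsubset> v) \<and> x \<sqsubset> y \<longrightarrow> x \<in> X \<and> y \<in> X \<and> f x < f y) \<and>
      (\<forall>x y m a b. (u \<sqsubset> x \<and> x \<sqsubset> v) \<and> (u \<sqsubset> y \<and> y \<sqsubset> v) \<and> (x \<in> X \<and> a = f x) \<and> (y \<in> X \<and> b = f y) \<and> a < m \<and> m < b \<longrightarrow>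
       (\<exists>z. (u \<sqsubset> z \<and> z \<sqsubset> v) \<and> (z \<in> X \<and> m = f z)))) = (w 0 \<in> loc_increasing X f)"
      unfolding loc_increasing_def mem_Collect_eq by (simp only: cong: conj_cong)
  qed
qed

lemma loc_increasing_global:
  assumes f: "dfun X f" and J: "conv J" "J \<subseteq> loc_increasing X f"
  shows "increasing_on J f"
proof -
  have R: "dfn UNIV (\<lambda>v. v 0 \<in> X \<and> v 1 \<in> X \<and> f (v 0) < f (v 1))"
    by (rule dfun_2[OF f]) (intro dfn_intros)
  have loc: "\<exists>u v. u \<sqsubset> x \<and> x \<sqsubset> v \<and> itv u v \<subseteq> X \<and> increasing_on (itv u v) f" if "x \<in> J" for x
    using J(2) that unfolding loc_increasing_def by fastforce
  have right: "\<exists>y. x \<sqsubset> y \<and> (\<forall>z\<in>itv x y. x \<in> X \<and> z \<in> X \<and> f x < f z)"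
    and left: "\<exists>y. y \<sqsubset> x \<and> (\<forall>z\<in>itv y x. z \<in> X \<and> x \<in> X \<and> f z < f x)" if x: "x \<in> J" for x
  proof -
    obtain u v where uv: "u \<sqsubset> x" "x \<sqsubset> v" "itv u v \<subseteq> X" "increasing_on (itv u v) f"
      using loc[OF x] by blast
    then show "\<exists>y. x \<sqsubset> y \<and> (\<forall>z\<in>itv x y. x \<in> X \<and> z \<in> X \<and> f x < f z)"
      by (intro exI[of _ v]) (auto simp: increasing_on_def subset_iff intro: dir.less_trans)
    show "\<exists>y. y \<sqsubset> x \<and> (\<forall>z\<in>itv y x. z \<in> X \<and> x \<in> X \<and> f z < f x)"
      using uv by (intro exI[of _ u]) (auto simp: increasing_on_def subset_iff intro: dir.less_trans)
  qed
  have "x \<in> X \<and> y \<in> X \<and> f x < f y" if "x \<in> J" "y \<in> J" "x \<sqsubset> y" for x y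
    by (rule local_to_global[OF J(1) R _ right left that]) auto
  then have inc: "f x < f y" if "x \<in> J" "y \<in> J" "x \<sqsubset> y" for x y
    using that by blast
  have JX: "J \<subseteq> X"
    using loc by fastforce
  have "m \<in> f ` J" if xy: "x \<in> J" "y \<in> J" and m: "f x < m" "m < f y" for x y m
  proof (rule ccontr)
    assume no: "m \<notin> f ` J"
    have "x \<sqsubset> y"
      using increasing_on_mono[of J f x y] inc xy m by auto
    \<comment> \<open>An omitted value \<open>m\<close> would have to be jumped over at the supremum
      of \<open>W\<close>; but near that point the image of \<open>f\<close> is convex.\<close>
    define W where "W = {z. x \<sqsubseteq> z \<and> z \<sqsubseteq> y \<and> f z < m}"
    have WJ: "z \<in> J" if "x \<sqsubseteq> z" "z \<sqsubseteq> y" for z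
      using convD[OF J(1) xy that] .
    have "dfn UNIV (\<lambda>w. \<exists>b. (x \<sqsubseteq> w 0 \<and> w 0 \<sqsubseteq> y) \<and> (w 0 \<in> X \<and> b = f (w 0)) \<and> b < m)"
      by (intro dfn_dir_intros dfn_2[OF f[unfolded dfun_def]] UNIV_I)
    then have dW: "dset W"
      unfolding dset_def by (rule dfn_cong) (use WJ JX in \<open>auto simp: W_def\<close>)
    have xW: "x \<in> W"
      using \<open>x \<sqsubset> y\<close> m by (simp add: W_def dir.less_imp_le)
    obtain s where s: "\<And>z. z \<in> W \<Longrightarrow> z \<sqsubseteq> s" "\<And>u. (\<And>z. z \<in> W \<Longrightarrow> z \<sqsubseteq> u) \<Longrightarrow> s \<sqsubseteq> u"
      using ex_lub[OF dW xW, of y] by (auto simp: W_def)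
    have s': "x \<sqsubseteq> s" "s \<sqsubseteq> y"
      using s(1)[OF xW] s(2)[of y] by (auto simp: W_def)
    have sJ: "s \<in> J"
      by (rule WJ[OF s'])
    then obtain u v where uv: "u \<sqsubset> s" "s \<sqsubset> v" "itv u v \<subseteq> X" "increasing_on (itv u v) f"
      using loc by blast
    obtain z1 z2 where z: "z1 \<in> itv u v" "z2 \<in> itv u v" "z1 \<in> J" "z2 \<in> J" "f z1 < m" "m < f z2"
    proof (cases "f s < m")
      case True
      then have "s \<sqsubset> y"
        using s'(2) m(2) by (auto simp: le_def)
      then obtain m' where m': "s \<sqsubset> m'" "m' \<sqsubseteq> v" "m' \<sqsubseteq> y"
        using uv(2) by (metis dir.linear dir.order_refl)
      obtain z where z: "s \<sqsubset> z" "z \<sqsubset> m'"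
        using dir.dense[OF m'(1)] by blast
      have "z \<in> J"
        using z m' s' by (intro WJ) (meson dir.less_imp_le dir.le_less_trans dir.less_le_trans)+
      moreover have "z \<notin> W"
        using s(1) z by (meson dir.leD)
      ultimately have "m < f z"
        using no z m' s' by (auto simp: W_def not_less)
      moreover have "z \<in> itv u v" "s \<in> itv u v"
        using z m' uv by (auto intro: dir.less_trans dir.less_le_trans)
      ultimately show ?thesis
        using that sJ True \<open>z \<in> J\<close> by blast
    next
      case False
      then have "m < f s"
        using no sJ by (metis image_eqI linorder_neqE)
      obtain z where z: "z \<in> W" "u \<sqsubset> z"
        using s(2)[of u] uv(1) by (metis dir.leD dir.not_le)
      have "z \<in> J" "f z < m"
        using z WJ by (auto simp: W_def)
      moreover have "z \<in> itv u v" "s \<in> itv u v"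
        using z s(1)[OF z(1)] uv by (auto intro: dir.le_less_trans)
      ultimately show ?thesis
        using that sJ \<open>m < f s\<close> by blast
    qed
    then have "m \<in> f ` itv u v"
      using uv(4) unfolding increasing_on_def conv_def by blast
    then obtain w where w: "w \<in> itv u v" "m = f w"
      by blast
    have "z1 \<sqsubset> w" "w \<sqsubset> z2"
      using increasing_on_mono[of "itv u v" f] uv(4) w z unfolding increasing_on_def by blast+
    then have "w \<in> J"
      using convD[OF J(1) z(3,4)] by (simp add: dir.less_imp_le)
    with no w show False
      by blast
  qed
  then have "conv (f ` J)"
    unfolding conv_def by blast
  with inc show ?thesis
    by (simp add: increasing_on_def)
qed

text \<open>The image is infinite and therefore contains an interval \<open>(a, b)\<close>. On a
  part of the domain that is mapped into \<open>(a, b)\<close> there are no jumps.\<close>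

lemma increasing_subinterval:
  assumes f: "dfun X f" and uv: "u \<sqsubset> v" "itv u v \<subseteq> X"
    and inc: "\<And>x y. x \<in> itv u v \<Longrightarrow> y \<in> itv u v \<Longrightarrow> x \<sqsubset> y \<Longrightarrow> f x < f y"
  obtains u' v' where "u' \<sqsubset> v'" "itv u' v' \<subseteq> itv u v" "increasing_on (itv u' v') f"
proof -
  have inj: "inj_on f (itv u v)"
    unfolding inj_on_def using inc by (metis dir.neqE order_less_irrefl)
  then have "infinite (f ` itv u v)"
    using infinite_itv[OF uv(1)] finite_imageD by blast
  from infinite_contains_Ioo[OF dset_image[OF f dset_itv uv(2)] this]
  obtain a b where ab: "a < b" "{a<..<b} \<subseteq> f ` itv u v" .
  define W where "W = {x \<in> itv u v. a < f x \<and> f x < b}"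
  have "dfn UNIV (\<lambda>w. \<exists>c. (u \<sqsubset> w 0 \<and> w 0 \<sqsubset> v) \<and> (w 0 \<in> X \<and> c = f (w 0)) \<and> a < c \<and> c < b)"
    by (intro dfn_dir_intros dfn_2[OF f[unfolded dfun_def]] UNIV_I)
  then have dW: "dset W"
    unfolding dset_def by (rule dfn_cong) (use uv in \<open>auto simp: W_def\<close>)
  have "{a<..<b} \<subseteq> f ` W"
    using ab(2) by (fastforce simp: W_def)
  then have "infinite W"
    using infinite_Ioo[OF ab(1)] by (metis finite_imageI finite_subset)
  from infinite_contains_itv[OF dW this] obtain u' v' where uv': "u' \<sqsubset> v'" "itv u' v' \<subseteq> W" .
  have sub: "itv u' v' \<subseteq> itv u v"
    using uv' by (auto simp: W_def)
  have "conv (f ` itv u' v')"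
    unfolding conv_def
  proof (intro ballI allI impI, elim conjE imageE)
    fix m y1 y2 x1 x2
    assume m: "y1 < m" "m < y2" "y1 = f x1" "y2 = f x2" and x: "x1 \<in> itv u' v'" "x2 \<in> itv u' v'"
    have "a < f x1" "f x2 < b"
      using x uv' unfolding W_def by blast+
    with m have "m \<in> {a<..<b}"
      by auto
    then obtain z where z: "z \<in> itv u v" "m = f z"
      using ab(2) by blast
    have "x1 \<sqsubset> z" "z \<sqsubset> x2"
      using increasing_on_mono[of "itv u v" f] inc sub x z m by blast+
    then have "z \<in> itv u' v'"
      using x by (auto intro: dir.less_trans)
    with z show "m \<in> f ` itv u' v'"
      by blast
  qed
  then show ?thesis
    using that[OF uv'(1) sub] inc sub unfolding increasing_on_def by blast
qed

end

context omin
begin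

text \<open>Continuity of the monotone pieces is expressed by the convexity of their images. Every
  interval in \<open>X\<close> contains a point near which \<open>f\<close> is constant or strictly
  monotone with convex image, so only finitely many points are bad. On a convex set that avoids
  these and all cuts of the three sets of good points, the local behaviour is global.\<close>

theorem monotonicity:
  assumes f: "dfun X f"
  obtains C where "finite C" "\<And>J. conv J \<Longrightarrow> J \<inter> C = {} \<Longrightarrow> J \<inter> X = {} \<or> J \<subseteq> X \<and>
    ((\<exists>c. \<forall>x\<in>J. f x = c) \<or> omin_dir.increasing_on (<) J f \<or> omin_dir.increasing_on (>) J f)"
proof -
  interpret up: omin_dir M "(<)"
    by (rule up_dir)
  interpret down: omin_dir M "(>)"
    by (rule down_dir)
  have down_itv: "down.itv u v = {v<..<u}" for u v
    by (auto simp: down.itv_def)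
  define B where "B = X - (loc_const X f \<union> up.loc_increasing X f \<union> down.loc_increasing X f)"
  have ds: "dset X" "dset (loc_const X f)" "dset (up.loc_increasing X f)" "dset (down.loc_increasing X f)"
    using f by (simp_all add: dset_dfun dset_loc_const up.dset_loc_increasing down.dset_loc_increasing)
  then have "dset B"
    unfolding B_def by (intro dset_Diff dset_Un)
  have "finite B"
  proof (rule ccontr)
    assume "infinite B"
    from infinite_contains_Ioo[OF \<open>dset B\<close> this] obtain p q where pq: "p < q" "{p<..<q} \<subseteq> B" .
    then have pqX: "{p<..<q} \<subseteq> X"
      by (auto simp: B_def)
    obtain u v where uv: "u < v" "{u<..<v} \<subseteq> {p<..<q}"
      "(\<exists>c. \<forall>x\<in>{u<..<v}. f x = c) \<or> inj_on f {u<..<v}"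
      using constant_or_injective[OF f pq(1) pqX] .
    obtain x where x: "u < x" "x < v"
      using dense[OF uv(1)] by blast
    have uvX: "{u<..<v} \<subseteq> X"
      using uv pqX by blast
    from uv(3) show False
    proof
      assume "\<exists>c. \<forall>x\<in>{u<..<v}. f x = c"
      then have "\<forall>z. u < z \<and> z < v \<longrightarrow> z \<in> X \<and> x \<in> X \<and> f z = f x"
        using x uvX by (auto simp: subset_iff)
      with x have "x \<in> loc_const X f"
        unfolding loc_const_def by blast
      moreover have "x \<in> B"
        using x uv(2) pq(2) by (meson greaterThanLessThan_iff subsetD)
      ultimately show False
        by (simp add: B_def)
    next
      assume inj: "inj_on f {u<..<v}"
      define R where "R = (\<lambda>x y. x \<in> X \<and> y \<in> X \<and> f x < f y)"
      have dR: "dfn UNIV (\<lambda>v. R (v 0) (v 1))"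
        unfolding R_def by (rule dfun_2[OF f]) (intro dfn_intros)
      have total: "R x y \<or> R y x" if "x \<in> up.itv u v" "y \<in> up.itv u v" "x \<noteq> y" for x y
        using that inj uvX unfolding R_def up_itv by (metis inj_onD linorder_neqE subsetD)
      obtain u' v' where uv': "u' < v'" "up.itv u' v' \<subseteq> up.itv u v"
        "(\<forall>x\<in>up.itv u' v'. \<forall>y\<in>up.itv u' v'. x < y \<longrightarrow> R x y) \<or> (\<forall>x\<in>up.itv u' v'. \<forall>y\<in>up.itv u' v'. x < y \<longrightarrow> R y x)"
      proof (rule up.linear_order_agrees[OF dR uv(1) _ _ total])
        show "\<not> R x x" for x
          by (simp add: R_def)
        show "R x z" if "R x y" "R y z" for x y z
          using that by (auto simp: R_def)
      qed
      have sub': "{u'<..<v'} \<subseteq> X" "{u'<..<v'} \<subseteq> {p<..<q}"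
        using uv'(2) uvX uv(2) unfolding up_itv by blast+
      from uv'(3) have "\<exists>x\<in>{u'<..<v'}. x \<in> up.loc_increasing X f \<union> down.loc_increasing X f"
      proof
        assume "\<forall>x\<in>up.itv u' v'. \<forall>y\<in>up.itv u' v'. x < y \<longrightarrow> R x y"
        then obtain a b where ab: "a < b" "up.itv a b \<subseteq> up.itv u' v'" "up.increasing_on (up.itv a b) f"
          using up.increasing_subinterval[OF f uv'(1)] sub' unfolding up_itv R_def by metis
        obtain x where "a < x" "x < b"
          using dense[OF ab(1)] by blast
        moreover have "x \<in> up.loc_increasing X f"
          unfolding up.loc_increasing_def mem_Collect_eq
          by (rule exI[of _ a], rule exI[of _ b]) (use ab calculation sub' in \<open>auto simp: up_itv subset_iff\<close>)
        ultimately show ?thesis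
          using ab(2) by (auto simp: up_itv)
      next
        assume dec: "\<forall>x\<in>up.itv u' v'. \<forall>y\<in>up.itv u' v'. x < y \<longrightarrow> R y x"
        obtain a b where ab: "b < a" "down.itv a b \<subseteq> down.itv v' u'" "down.increasing_on (down.itv a b) f"
        proof (rule down.increasing_subinterval[OF f uv'(1)])
          show "down.itv v' u' \<subseteq> X"
            using sub' by (simp add: down_itv)
          show "f x < f y" if "x \<in> down.itv v' u'" "y \<in> down.itv v' u'" "y < x" for x y
            using dec that unfolding R_def up_itv down_itv by blast
        qed
        obtain x where "b < x" "x < a"
          using dense[OF ab(1)] by blast
        moreover have "x \<in> down.loc_increasing X f"
          unfolding down.loc_increasing_def mem_Collect_eq
          by (rule exI[of _ a], rule exI[of _ b]) (use ab calculation sub' in \<open>auto simp: down_itv subset_iff\<close>)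
        ultimately show ?thesis
          using ab(2) by (auto simp: down_itv)
      qed
      then show False
        using sub'(2) pq(2) unfolding B_def by blast
    qed
  qed
  obtain C where C: "finite C" "\<And>Y. Y \<in> {X, loc_const X f, up.loc_increasing X f, down.loc_increasing X f} \<Longrightarrow> cuts C Y"
    using ex_cuts_family[of "{X, loc_const X f, up.loc_increasing X f, down.loc_increasing X f}"] ds by auto
  show ?thesis
  proof
    show "finite (C \<union> B)"
      using C(1) \<open>finite B\<close> by simp
    fix J assume J: "conv J" "J \<inter> (C \<union> B) = {}"
    then have JC: "J \<inter> C = {}" and JB: "J \<inter> B = {}"
      by blast+
    note cut = cutsD[OF C(2) J(1) JC]
    show "J \<inter> X = {} \<or> J \<subseteq> X \<and> ((\<exists>c. \<forall>x\<in>J. f x = c) \<or> up.increasing_on J f \<or> down.increasing_on J f)"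
    proof (cases "J \<inter> X = {}")
      case False
      then have JX: "J \<subseteq> X"
        using cut[of X] by blast
      then consider "J \<subseteq> loc_const X f" | "J \<subseteq> up.loc_increasing X f" | "J \<subseteq> down.loc_increasing X f"
        using False JB cut[of "loc_const X f"] cut[of "up.loc_increasing X f"]
          cut[of "down.loc_increasing X f"] unfolding B_def by blast
      then show ?thesis
      proof cases
        case 1
        then have "\<exists>c. \<forall>x\<in>J. f x = c"
          using loc_const_global[OF f J(1)] by metis
        with JX show ?thesis
          by blast
      qed (use JX up.loc_increasing_global[OF f J(1)] down.loc_increasing_global[OF f J(1)] in blast)+
    qed simp
  qed
qed

text \<open>On the cells where \<open>f\<close> is strictly monotone it takes each value at most
  once. So an infinite fibre belongs to the value of \<open>f\<close> on one of the finitely many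
  cells where \<open>f\<close> is constant.\<close>

lemma finite_infinite_fibres:
  assumes f: "dfun X f"
  shows "finite {c. infinite {x \<in> X. f x = c}}"
proof -
  obtain C where C: "finite C" "\<And>J. conv J \<Longrightarrow> J \<inter> C = {} \<Longrightarrow> J \<inter> X = {} \<or> J \<subseteq> X \<and>
    ((\<exists>c. \<forall>x\<in>J. f x = c) \<or> omin_dir.increasing_on (<) J f \<or> omin_dir.increasing_on (>) J f)"
    using monotonicity[OF f] by blast
  have "{c. infinite {x \<in> X. f x = c}} \<subseteq> (\<lambda>A. f (SOME z. z \<in> cell C A)) ` Pow C"
  proof (rule subsetI, rule ccontr)
    fix c assume c: "c \<in> {c. infinite {x \<in> X. f x = c}}"
      and no: "c \<notin> (\<lambda>A. f (SOME z. z \<in> cell C A)) ` Pow C"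
    have "finite {x \<in> cell C A. x \<in> X \<and> f x = c}" if A: "A \<in> Pow C" for A
    proof (cases "{x \<in> cell C A. x \<in> X \<and> f x = c} = {}")
      case False
      then obtain x where x: "x \<in> cell C A" "x \<in> X" "f x = c"
        by blast
      then have "(SOME z. z \<in> cell C A) \<in> cell C A"
        by (metis someI)
      then have "\<not> (\<exists>d. \<forall>x\<in>cell C A. f x = d)"
        using x no A by (metis imageI)
      then have "inj_on f (cell C A)"
        using C(2)[OF conv_cell cell_disjoint, of A] x
        unfolding omin_dir.increasing_on_def[OF up_dir] omin_dir.increasing_on_def[OF down_dir] inj_on_def
        by (metis disjoint_iff linorder_neqE order_less_irrefl)
      then have "{x \<in> cell C A. x \<in> X \<and> f x = c} \<subseteq> {x}"
        using x by (auto simp: inj_on_def)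
      then show ?thesis
        by (rule finite_subset) simp
    qed (metis finite.emptyI)
    then have "finite (C \<union> (\<Union>A\<in>Pow C. {x \<in> cell C A. x \<in> X \<and> f x = c}))"
      using C(1) by simp
    moreover have "{x \<in> X. f x = c} \<subseteq> C \<union> (\<Union>A\<in>Pow C. {x \<in> cell C A. x \<in> X \<and> f x = c})"
      using Compl_eq_cells[of C] by auto
    ultimately show False
      using c finite_subset by blast
  qed
  then show ?thesis
    using C(1) by (meson finite_Pow_iff finite_imageI finite_subset)
qed

text \<open>\<open>c\<close> is the value at \<open>d\<close> of a function definable over
  \<open>B\<close>. Its fibre over \<open>c\<close> is finite, since otherwise \<open>c\<close>
  would lie in a finite set definable over \<open>B\<close>. So \<open>d\<close> is one of finitely
  many elements of a set definable over \<open>c\<close> and \<open>B\<close>.\<close>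

lemma dcl_exchange:
  assumes "c \<in> dcl (insert d B)" "c \<notin> dcl B"
  shows "d \<in> dcl (insert c B)"
proof -
  from assms(1) have "dfn (insert d B) (\<lambda>v. v 0 = c)"
    by (simp add: dcl_def)
  from dfn_abstract[OF this] obtain P where P: "dfn B P" "\<And>v. (v 0 = c) = P (case_nat d v)"
    by blast
  define G where "G = (\<lambda>a z. P (case_nat a (\<lambda>_. z)))"
  \<comment> \<open>Away from \<open>d\<close> the formula need not determine a unique value;
    \<open>F\<close> keeps only the arguments where it does.\<close>
  define F where "F = (\<lambda>a z. G a z \<and> (\<forall>z'. G a z' \<longrightarrow> z' = z))"
  have dG: "dfn B (\<lambda>v. G (v 0) (v 1))"
    unfolding G_def by (rule dfn_env[OF P(1)]) (auto intro: atomic_trm_case_nat)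
  have dF: "dfn B (\<lambda>v. F (v 0) (v 1))"
    unfolding F_def by (intro dfn_intros dfn_2[OF dG])
  have Gd: "G d z \<longleftrightarrow> z = c" for z
    using P(2)[of "\<lambda>_. z"] by (simp add: G_def)
  then have Fdc: "F d c"
    by (simp add: F_def)
  define X where "X = {a. \<exists>z. F a z}"
  define f where "f = (\<lambda>a. THE z. F a z)"
  have F: "F a z \<longleftrightarrow> a \<in> X \<and> z = f a" for a z
  proof
    assume az: "F a z"
    then have "f a = z"
      unfolding f_def by (rule the_equality) (use az in \<open>auto simp: F_def\<close>)
    with az show "a \<in> X \<and> z = f a"
      by (auto simp: X_def)
  next
    assume "a \<in> X \<and> z = f a"
    then obtain z' where z': "F a z'"
      by (auto simp: X_def)
    then have "f a = z'"
      unfolding f_def by (rule the_equality) (use z' in \<open>auto simp: F_def\<close>)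
    with z' \<open>a \<in> X \<and> z = f a\<close> show "F a z"
      by simp
  qed
  have f: "dfun X f"
    unfolding dfun_def F[symmetric] using dF by (rule dfn_mono) simp
  have "finite {a. F a c}"
  proof (rule ccontr)
    assume inf: "infinite {a. F a c}"
    have "dset {a. F a c}"
      by (rule dsetI[of UNIV]) (auto intro!: dfn_2[OF dfn_mono[OF dF]])
    from infinite_contains_Ioo[OF this inf] obtain u v where uv: "u < v" "{u<..<v} \<subseteq> {a. F a c}" .
    \<comment> \<open>Infinity of a fibre is expressed in first-order terms: the fibre contains an
      interval.\<close>
    define V where "V = {c. \<exists>u v. u < v \<and> (\<forall>a. u < a \<and> a < v \<longrightarrow> F a c)}"
    have dV: "dfn B (\<lambda>w. w 0 \<in> V)"
      unfolding V_def mem_Collect_eq by (intro dfn_intros dfn_2[OF dF])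
    have "V \<subseteq> {c. infinite {x \<in> X. f x = c}}"
    proof
      fix c assume "c \<in> V"
      then obtain u v where uv: "u < v" "\<forall>a. u < a \<and> a < v \<longrightarrow> F a c"
        by (auto simp: V_def)
      then have "{u<..<v} \<subseteq> {x \<in> X. f x = c}"
        by (auto simp: F)
      then show "c \<in> {c. infinite {x \<in> X. f x = c}}"
        using infinite_Ioo[OF uv(1)] finite_subset by blast
    qed
    then have "finite V"
      using finite_infinite_fibres[OF f] finite_subset by blast
    from finite_subset_dcl[OF this dV] have "V \<subseteq> dcl B" .
    moreover have "c \<in> V"
      using uv unfolding V_def mem_Collect_eq by (metis greaterThanLessThan_iff mem_Collect_eq subsetD)
    ultimately show False
      using assms(2) by blast
  qed
  moreover have "dfn (insert c B) (\<lambda>v. v 0 \<in> {a. F a c})"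
    unfolding mem_Collect_eq
    by (rule dfn_2[OF dfn_mono[OF dF]]) auto
  ultimately show ?thesis
    using finite_subset_dcl Fdc by blast
qed

end

section \<open>Group-intervals in terms of the order alone\<close>

context omin
begin

text \<open>For convex definable sets this amounts to being an open interval, but no endpoints have
  to be named.\<close>

definition opn :: "'a set \<Rightarrow> bool" where
  "opn J \<longleftrightarrow> (\<forall>x\<in>J. (\<exists>y\<in>J. x < y) \<and> (\<exists>y\<in>J. y < x))"

lemma conv_Int: "conv I \<Longrightarrow> conv J \<Longrightarrow> conv (I \<inter> J)"
  unfolding conv_def by blast

end

context omin_dir
begin

lemma opn_iff: "opn J \<longleftrightarrow> (\<forall>x\<in>J. (\<exists>y\<in>J. x \<sqsubset> y) \<and> (\<exists>y\<in>J. y \<sqsubset> x))"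
  using lt_dir by (auto simp: opn_def)

lemma opn_no_max: "opn J \<Longrightarrow> no_max J"
  by (simp add: opn_iff no_max_def)

lemma opn_itv: "opn (itv u v)"
  unfolding opn_iff
proof (intro ballI conjI)
  fix x assume x: "x \<in> itv u v"
  then obtain y z where "u \<sqsubset> y" "y \<sqsubset> x" "x \<sqsubset> z" "z \<sqsubset> v"
    using dir.dense[of u x] dir.dense[of x v] by auto
  with x show "\<exists>y\<in>itv u v. x \<sqsubset> y" "\<exists>y\<in>itv u v. y \<sqsubset> x"
    by (auto intro: dir.less_trans)
qed

lemma opn_Int_conv:
  assumes "conv I" "conv J" "opn I" "opn J"
  shows "opn (I \<inter> J)"
  unfolding opn_iff
proof (intro ballI conjI)
  fix x assume x: "x \<in> I \<inter> J"
  then obtain y1 y2 where y: "y1 \<in> I" "x \<sqsubset> y1" "y2 \<in> J" "x \<sqsubset> y2"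
    using assms(3,4) unfolding opn_iff by blast
  then show "\<exists>y\<in>I \<inter> J. x \<sqsubset> y"
    using convD[OF assms(1), of x y1 y2] convD[OF assms(2), of x y2 y1] x
    by (metis IntD1 IntD2 IntI dir.less_imp_le dir.linear)
  obtain z1 z2 where z: "z1 \<in> I" "z1 \<sqsubset> x" "z2 \<in> J" "z2 \<sqsubset> x"
    using assms(3,4) x unfolding opn_iff by blast
  then show "\<exists>y\<in>I \<inter> J. y \<sqsubset> x"
    using convD[OF assms(1), of z1 x z2] convD[OF assms(2), of z2 x z1] x
    by (metis IntD1 IntD2 IntI dir.less_imp_le dir.linear)
qed

text \<open>
  \<open>P u v w\<close> stands for \<open>u + v = w\<close>. The condition that subtraction is total subsumes the limit
  conditions at both ends.
\<close>

definition partial_addition :: "'a set \<Rightarrow> ('a \<Rightarrow> 'a \<Rightarrow> 'a \<Rightarrow> bool) \<Rightarrow> bool" where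
  "partial_addition I P \<longleftrightarrow>
     (\<forall>u v w. P u v w \<longrightarrow> u \<in> I \<and> v \<in> I \<and> w \<in> I) \<and>
     (\<forall>u v w w'. P u v w \<and> P u v w' \<longrightarrow> w = w') \<and>
     (\<forall>u v w. P u v w \<longrightarrow> P v u w) \<and>
     (\<forall>u v w a b s t. P u v a \<and> P a w s \<and> P v w b \<and> P u b t \<longrightarrow> s = t) \<and>
     (\<forall>u u' v w w'. u \<sqsubset> u' \<and> P u v w \<and> P u' v w' \<longrightarrow> w \<sqsubset> w') \<and>
     (\<forall>u w. u \<in> I \<and> w \<in> I \<longrightarrow> (u \<sqsubset> w \<longleftrightarrow> (\<exists>v. P u v w))) \<and>
     (\<forall>u v w v'. P u v w \<and> v' \<sqsubset> v \<and> v' \<in> I \<longrightarrow> (\<exists>w'. P u v' w'))"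

text \<open>With \<open>lt = (<)\<close> the zero sits at the left end, as in a positive
  group-interval; with \<open>lt = (>)\<close> it sits at the right end, as in a negative one.
  Neither topology nor endpoints enter.\<close>

definition pgi :: "'a set \<Rightarrow> ('a \<Rightarrow> 'a \<Rightarrow> 'a \<Rightarrow> bool) \<Rightarrow> bool" where
  "pgi I P \<longleftrightarrow> I \<noteq> {} \<and> conv I \<and> opn I \<and> partial_addition I P"

lemma partial_additionD:
  assumes "partial_addition I P"
  shows "P u v w \<Longrightarrow> u \<in> I" "P u v w \<Longrightarrow> v \<in> I" "P u v w \<Longrightarrow> w \<in> I"
    and "P u v w \<Longrightarrow> P u v w' \<Longrightarrow> w = w'"
    and "P u v w \<Longrightarrow> P v u w"
    and "P u v a \<Longrightarrow> P a w s \<Longrightarrow> P v w b \<Longrightarrow> P u b t \<Longrightarrow> s = t"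
    and "u \<sqsubset> u' \<Longrightarrow> P u v w \<Longrightarrow> P u' v w' \<Longrightarrow> w \<sqsubset> w'"
    and "P u v w \<Longrightarrow> v \<sqsubset> v' \<Longrightarrow> P u v' w' \<Longrightarrow> w \<sqsubset> w'"
    and "u \<in> I \<Longrightarrow> w \<in> I \<Longrightarrow> u \<sqsubset> w \<Longrightarrow> \<exists>v. P u v w"
    and "P u v w \<Longrightarrow> u \<sqsubset> w" and "P u v w \<Longrightarrow> v \<sqsubset> w"
    and "P u v w \<Longrightarrow> v' \<sqsubset> v \<Longrightarrow> v' \<in> I \<Longrightarrow> \<exists>w'. P u v' w'"
  using assms unfolding partial_addition_def by meson+

context
  fixes I P assumes P: "partial_addition I P"
begin

lemmas PD = partial_additionD[OF P]

lemma partial_addition_cancel: "P u v w \<Longrightarrow> P u v' w \<Longrightarrow> v = v'"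
  using PD(8) by (metis dir.less_irrefl dir.neqE)

lemma partial_addition_less_iff:
  assumes "P u v w" "P u v' w'"
  shows "v \<sqsubset> v' \<longleftrightarrow> w \<sqsubset> w'"
  using PD(4,8) assms by (metis dir.less_asym dir.neqE)

text \<open>If \<open>w \<sqsubset> w'\<close>, then \<open>w + v'\<close> is defined because
  \<open>w' + v'\<close> is, and it would lie both below and above \<open>y\<close>. If
  \<open>w = w'\<close>, cancellation applies.\<close>

lemma partial_addition_complement:
  assumes "P w v y" "P w' v' y" "v \<sqsubset> v'"
  shows "w' \<sqsubset> w"
proof (rule ccontr)
  assume "\<not> w' \<sqsubset> w"
  then consider "w = w'" | "w \<sqsubset> w'"
    by (metis dir.neqE)
  then show False
  proof cases
    case 1
    with assms show False
      using partial_addition_cancel by (metis dir.less_irrefl)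
  next
    case 2
    obtain s where s: "P w v' s"
      using PD(12)[OF PD(5)[OF assms(2)] 2] PD(1)[OF assms(1)] PD(5) by blast
    have "s \<sqsubset> y" "y \<sqsubset> s"
      using PD(7)[OF 2 s assms(2)] PD(8)[OF assms(1,3) s] by auto
    then show False
      by (meson dir.less_asym)
  qed
qed

lemma partial_addition_complement_iff:
  "P w v y \<Longrightarrow> P w' v' y \<Longrightarrow> v \<sqsubset> v' \<longleftrightarrow> w' \<sqsubset> w"
  using partial_addition_complement partial_addition_complement[OF PD(5) PD(5)] by blast

text \<open>Taking \<open>e\<close> away from \<open>v\<close> takes it away from
  \<open>u + v\<close>. Associativity speaks only of sums that are all defined, so the difference
  \<open>f\<close> between \<open>w\<close> and \<open>u + v'\<close> is first compared with
  \<open>e\<close>: the smaller of the two provides the missing sum, and then both must be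
  equal.\<close>

lemma partial_addition_shift:
  assumes uv: "P u v w" and v: "P v' e v" and w: "P w' e w"
  shows "P u v' w'"
proof -
  obtain w'' where w'': "P u v' w''"
    using PD(12)[OF uv PD(10)[OF v] PD(1)[OF v]] by blast
  have "w'' \<sqsubset> w"
    using PD(8)[OF w'' PD(10)[OF v] uv] .
  then obtain f where f: "P w'' f w"
    using PD(9) PD(3)[OF w''] PD(3)[OF uv] by blast
  consider "e \<sqsubset> f" | "f \<sqsubseteq> e"
    by (metis dir.not_less)
  then have "f = e"
  proof cases
    case 1
    obtain s where s: "P w'' e s"
      using PD(12)[OF f 1 PD(2)[OF v]] by blast
    have "s = w"
      using PD(6)[OF w'' s v uv] .
    moreover have "s \<sqsubset> w"
      using PD(8)[OF s 1 f] .
    ultimately show ?thesis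
      by simp
  next
    case 2
    obtain v'' where v'': "P v' f v''" "v'' \<sqsubseteq> v"
      using 2 PD(12)[OF v _ PD(2)[OF f]] PD(8)[OF _ _ v] v unfolding le_def by blast
    obtain s where s: "P u v'' s"
      using v''(2) PD(12)[OF uv _ PD(3)[OF v''(1)]] uv unfolding le_def by blast
    have "w = s"
      using PD(6)[OF w'' f v''(1) s] .
    with s uv have "v'' = v"
      using partial_addition_cancel by blast
    with v'' v show ?thesis
      using partial_addition_cancel by blast
  qed
  with f w have "w'' = w'"
    using partial_addition_cancel PD(5) by blast
  with w'' show ?thesis
    by simp
qed

end

definition restr :: "'a set \<Rightarrow> ('a \<Rightarrow> 'a \<Rightarrow> 'a \<Rightarrow> bool) \<Rightarrow> 'a \<Rightarrow> 'a \<Rightarrow> 'a \<Rightarrow> bool" where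
  "restr J P u v w \<longleftrightarrow> P u v w \<and> u \<in> J \<and> v \<in> J \<and> w \<in> J"

text \<open>Differences are smaller than their minuend and so remain in an initial segment
  \<open>J\<close>; sums that leave \<open>J\<close> are simply dropped.\<close>

lemma partial_addition_restr:
  assumes P: "partial_addition I P" and J: "J \<subseteq> I" "\<And>x j. x \<in> I \<Longrightarrow> j \<in> J \<Longrightarrow> x \<sqsubset> j \<Longrightarrow> x \<in> J"
  shows "partial_addition J (restr J P)"
proof -
  note PD = partial_additionD[OF P]
  have diff: "\<exists>v. restr J P u v w" if uw: "u \<in> J" "w \<in> J" "u \<sqsubset> w" for u w
  proof -
    obtain v where v: "P u v w"
      using PD(9)[of u w] uw J(1) by blast
    have "v \<in> J"
      using J(2)[OF PD(2)[OF v] uw(2) PD(11)[OF v]] .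
    with v uw show ?thesis
      by (auto simp: restr_def)
  qed
  have sum: "\<exists>w'. restr J P u v' w'" if uv: "restr J P u v w" and v': "v' \<sqsubset> v" "v' \<in> J" for u v w v'
  proof -
    have P': "P u v w" "w \<in> J" "u \<in> J"
      using uv by (auto simp: restr_def)
    obtain w' where w': "P u v' w'"
      using PD(12)[OF P'(1) v'(1)] v'(2) J(1) by blast
    have "w' \<in> J"
      using J(2)[OF PD(3)[OF w'] P'(2) PD(8)[OF w' v'(1) P'(1)]] .
    with w' P' v' show ?thesis
      by (auto simp: restr_def)
  qed
  show ?thesis
    unfolding partial_addition_def
  proof (intro conjI allI impI)
    fix u w assume "u \<in> J \<and> w \<in> J"
    then show "(u \<sqsubset> w) = (\<exists>v. restr J P u v w)"
      using diff PD(10) by (auto simp: restr_def)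
  next
    fix u v w v' assume "restr J P u v w \<and> v' \<sqsubset> v \<and> v' \<in> J"
    then show "\<exists>w'. restr J P u v' w'"
      using sum by blast
  next
    fix u v w a b s t
    assume "restr J P u v a \<and> restr J P a w s \<and> restr J P v w b \<and> restr J P u b t"
    then show "s = t"
      using PD(6)[of u v a w s b t] by (auto simp: restr_def)
  qed (use PD(4,5,7) in \<open>auto simp: restr_def\<close>)
qed

lemma pgi_restr:
  assumes "pgi I P" and J: "J \<subseteq> I" "\<And>x j. x \<in> I \<Longrightarrow> j \<in> J \<Longrightarrow> x \<sqsubset> j \<Longrightarrow> x \<in> J" "J \<noteq> {}" "no_max J"
  shows "pgi J (restr J P)"
proof -
  have I: "conv I" "opn I" "partial_addition I P"
    using assms(1) by (auto simp: pgi_def)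
  have "conv J"
    unfolding conv_iff using I(1) J(1,2) unfolding conv_iff by blast
  moreover have "opn J"
    using J I(2) unfolding opn_iff no_max_def by blast
  moreover have "partial_addition J (restr J P)"
    using J(1,2) by (rule partial_addition_restr[OF I(3)])
  ultimately show ?thesis
    unfolding pgi_def using J(3) by blast
qed

lemma pgi_dset:
  assumes "pgi I P" and P: "dfn UNIV (\<lambda>v. P (v 0) (v 1) (v 2))"
  shows "dset I"
proof -
  have I: "opn I" "partial_addition I P"
    using assms(1) by (auto simp: pgi_def)
  have "dfn UNIV (\<lambda>v. \<exists>a b. P (v 0) a b)"
    by (intro dfn_intros dfn_3[OF P])
  then show ?thesis
    unfolding dset_def
  proof (rule dfn_cong)
    fix v :: "nat \<Rightarrow> 'a"
    show "(\<exists>a b. P (v 0) a b) = (v 0 \<in> I)"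
      using I partial_additionD(1,9)[OF I(2)] unfolding opn_iff by blast
  qed
qed

section \<open>Moving additions along definable maps: monotone images, translations and
  reflections\<close>

definition transport :: "('a \<Rightarrow> 'a) \<Rightarrow> 'a set \<Rightarrow> ('a \<Rightarrow> 'a \<Rightarrow> 'a \<Rightarrow> bool) \<Rightarrow> 'a \<Rightarrow> 'a \<Rightarrow> 'a \<Rightarrow> bool" where
  "transport f I P u v w \<longleftrightarrow> (\<exists>a b c. (a \<in> I \<and> u = f a) \<and> (b \<in> I \<and> v = f b) \<and> (c \<in> I \<and> w = f c) \<and> P a b c)"

lemma dfn_transport:
  assumes "dfun I f" "dfn UNIV (\<lambda>v. P (v 0) (v 1) (v 2))"
  shows "dfn UNIV (\<lambda>v. transport f I P (v 0) (v 1) (v 2))"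
  unfolding transport_def
  by (intro dfn_intros dfn_2[OF assms(1)[unfolded dfun_def]] dfn_3[OF assms(2)])

text \<open>The directions \<open>lt\<close> and \<open>lt'\<close> are independent, because a
  decreasing map turns a structure of positive type into one of negative type.\<close>

lemma pgi_transport:
  assumes "pgi I P" and J: "conv (f ` I)" and lt': "lt' = (<) \<or> lt' = (>)"
    and mono: "\<And>x y. x \<in> I \<Longrightarrow> y \<in> I \<Longrightarrow> x \<sqsubset> y \<Longrightarrow> lt' (f x) (f y)"
  shows "omin_dir.pgi lt' (f ` I) (transport f I P)"
proof -
  interpret tgt: omin_dir M lt'
    by unfold_locales (rule lt')
  have I: "I \<noteq> {}" "opn I" "partial_addition I P"
    using assms(1) by (auto simp: pgi_def)
  note PD = partial_additionD[OF I(3)]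
  have inj: "x = y" if "x \<in> I" "y \<in> I" "f x = f y" for x y
    using mono that by (metis dir.neqE tgt.dir.less_irrefl)
  have less: "lt' (f x) (f y) \<longleftrightarrow> x \<sqsubset> y" if "x \<in> I" "y \<in> I" for x y
    using mono that by (metis dir.neqE tgt.dir.less_asym tgt.dir.less_irrefl)
  have T: "transport f I P (f a) (f b) (f c) \<longleftrightarrow> P a b c" if "a \<in> I" "b \<in> I" "c \<in> I" for a b c
    unfolding transport_def using that inj by blast
  have T_I: "\<exists>a\<in>I. \<exists>b\<in>I. \<exists>c\<in>I. u = f a \<and> v = f b \<and> w = f c \<and> P a b c" if "transport f I P u v w" for u v w
    using that unfolding transport_def by blast
  have "opn (f ` I)"
    unfolding tgt.opn_iff
  proof (intro ballI conjI)
    fix y assume "y \<in> f ` I"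
    then obtain x where x: "x \<in> I" "y = f x"
      by blast
    then obtain x1 x2 where "x1 \<in> I" "x \<sqsubset> x1" "x2 \<in> I" "x2 \<sqsubset> x"
      using I(2) unfolding opn_iff by blast
    with x mono show "\<exists>z\<in>f ` I. lt' y z" "\<exists>z\<in>f ` I. lt' z y"
      by blast+
  qed
  moreover have "tgt.partial_addition (f ` I) (transport f I P)"
    unfolding tgt.partial_addition_def
  proof (intro conjI allI impI)
    fix u v w assume "transport f I P u v w"
    then show "u \<in> f ` I" "v \<in> f ` I" "w \<in> f ` I" "transport f I P v u w"
      using PD(5) unfolding transport_def by blast+
  next
    fix u v w w' assume "transport f I P u v w \<and> transport f I P u v w'"
    then show "w = w'"
      unfolding transport_def using inj PD(4) by metis
  next
    fix u v w a b s t
    assume h: "transport f I P u v a \<and> transport f I P a w s \<and> transport f I P v w b \<and> transport f I P u b t"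
    then obtain u' v' a' where 1: "u' \<in> I" "v' \<in> I" "a' \<in> I" "u = f u'" "v = f v'" "a = f a'" "P u' v' a'"
      using T_I by blast
    from h obtain w' s' where 2: "w' \<in> I" "s' \<in> I" "w = f w'" "s = f s'" "P a' w' s'"
      using T_I[of a w s] inj 1 by metis
    from h obtain b' where 3: "b' \<in> I" "b = f b'" "P v' w' b'"
      using T_I[of v w b] inj 1 2 by metis
    from h obtain t' where 4: "t' \<in> I" "t = f t'" "P u' b' t'"
      using T_I[of u b t] inj 1 3 by metis
    show "s = t"
      using PD(6)[OF 1(7) 2(5) 3(3) 4(3)] 2 4 by simp
  next
    fix u u' v w w'
    assume h: "lt' u u' \<and> transport f I P u v w \<and> transport f I P u' v w'"
    then obtain u1 v1 w1 where 1: "u1 \<in> I" "v1 \<in> I" "w1 \<in> I" "u = f u1" "v = f v1" "w = f w1" "P u1 v1 w1"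
      using T_I by blast
    from h obtain u2 w2 where 2: "u2 \<in> I" "w2 \<in> I" "u' = f u2" "w' = f w2" "P u2 v1 w2"
      using T_I[of u' v w'] inj 1 by metis
    show "lt' w w'"
      using h 1 2 less PD(7)[of u1 u2 v1 w1 w2] by simp
  next
    fix u w assume "u \<in> f ` I \<and> w \<in> f ` I"
    then obtain a c where ac: "a \<in> I" "c \<in> I" "u = f a" "w = f c"
      by blast
    show "lt' u w = (\<exists>v. transport f I P u v w)"
    proof
      assume "lt' u w"
      then have "a \<sqsubset> c"
        using ac less by simp
      then obtain b where b: "P a b c"
        using PD(9) ac by blast
      then have "transport f I P u (f b) w"
        using T[of a b c] PD(2)[OF b] ac by simp
      then show "\<exists>v. transport f I P u v w"
        by blast
    next
      assume "\<exists>v. transport f I P u v w"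
      then obtain v where v: "transport f I P u v w"
        by blast
      then obtain b where "P a b c"
        using T_I[OF v] inj ac by metis
      then show "lt' u w"
        using PD(10) less ac by blast
    qed
  next
    fix u v w v' assume h: "transport f I P u v w \<and> lt' v' v \<and> v' \<in> f ` I"
    then obtain a b c where 1: "a \<in> I" "b \<in> I" "c \<in> I" "u = f a" "v = f b" "w = f c" "P a b c"
      using T_I by blast
    from h obtain b' where b': "b' \<in> I" "v' = f b'"
      by blast
    with h 1 less have "b' \<sqsubset> b"
      by simp
    then obtain c' where c': "P a b' c'"
      using PD(12)[OF 1(7)] b' by blast
    then have "transport f I P u v' (f c')"
      using T[of a b' c'] PD(3)[OF c'] 1 b' by simp
    then show "\<exists>w'. transport f I P u v' w'"
      by blast
  qed
  ultimately show ?thesis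
    unfolding tgt.pgi_def using I(1) J by blast
qed

text \<open>As \<open>R\<close> is single-valued, no definable choice is involved.\<close>

lemma dfun_relation:
  assumes R: "dfn UNIV (\<lambda>v. R (v 0) (v 1))" and fn: "\<And>v w w'. R v w \<Longrightarrow> R v w' \<Longrightarrow> w = w'"
    and V: "dset V" "\<And>v. v \<in> V \<Longrightarrow> \<exists>w. R v w"
  obtains f where "dfun V f" "\<And>v. v \<in> V \<Longrightarrow> R v (f v)"
proof
  define f where "f = (\<lambda>v. THE w. R v w)"
  show Rf: "R v (f v)" if v: "v \<in> V" for v
    unfolding f_def by (rule theI') (use V(2)[OF v] fn in blast)
  have "dfn UNIV (\<lambda>v. v 0 \<in> V \<and> R (v 0) (v 1))"
    by (intro dfn_intros dset_atomic[OF V(1)] dfn_2[OF R])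
  then show "dfun V f"
    unfolding dfun_def by (rule dfn_cong) (use Rf fn in metis)
qed

text \<open>If \<open>J\<close> is not an initial segment of \<open>I\<close>, its infimum
  \<open>x\<close> belongs to \<open>I\<close>, and \<open>J\<close> is the translate by
  \<open>x\<close> of an initial segment \<open>V\<close>. The addition of \<open>V\<close> is
  transported along this translation.\<close>

lemma pgi_sub:
  assumes I: "pgi I P" and P: "dfn UNIV (\<lambda>v. P (v 0) (v 1) (v 2))"
    and J: "J \<subseteq> I" "conv J" "opn J" "J \<noteq> {}" "dset J"
  obtains P' where "dfn UNIV (\<lambda>v. P' (v 0) (v 1) (v 2))" "pgi J P'"
proof (cases "\<forall>x\<in>I. \<forall>j\<in>J. x \<sqsubset> j \<longrightarrow> x \<in> J")
  case True
  have "dfn UNIV (\<lambda>v. restr J P (v 0) (v 1) (v 2))"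
    unfolding restr_def by (intro dfn_intros dfn_3[OF P] dset_atomic[OF J(5)])
  moreover have "pgi J (restr J P)"
    using True J opn_no_max by (intro pgi_restr[OF I]) blast+
  ultimately show ?thesis
    by (rule that)
next
  case False
  then obtain x0 j0 where x0: "x0 \<in> I" "j0 \<in> J" "x0 \<sqsubset> j0" "x0 \<notin> J"
    by blast
  have PI: "conv I" "partial_addition I P"
    using I by (auto simp: pgi_def)
  note PD = partial_additionD[OF PI(2)]
  have x0_lower: "x0 \<sqsubseteq> j" if "j \<in> J" for j
  proof (rule ccontr)
    assume "\<not> x0 \<sqsubseteq> j"
    then have "j \<sqsubseteq> x0"
      by (metis dir.linear)
    then show False
      using convD[OF J(2) that x0(2)] x0(3,4) dir.less_imp_le by blast
  qed
  obtain x where x: "\<And>j. j \<in> J \<Longrightarrow> x \<sqsubseteq> j" "\<And>u. (\<And>j. j \<in> J \<Longrightarrow> u \<sqsubseteq> j) \<Longrightarrow> u \<sqsubseteq> x"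
    using ex_glb[OF J(5) x0(2), of x0] x0_lower by blast
  have x_less: "x \<sqsubset> j" if j: "j \<in> J" for j
  proof -
    obtain j' where "j' \<in> J" "j' \<sqsubset> j"
      using j J(3) unfolding opn_iff by blast
    with x(1) show ?thesis
      by (meson dir.le_less_trans)
  qed
  have xI: "x \<in> I"
    using convD[OF PI(1) x0(1), of j0 x] x(2)[of x0] x0_lower x0(2) J(1) x_less[OF x0(2)]
    by (meson dir.less_imp_le subsetD)
  have in_J: "w \<in> J" if w: "x \<sqsubset> w" "j \<in> J" "w \<sqsubseteq> j" for w j
  proof -
    have "\<not> w \<sqsubseteq> x"
      using w(1) by (simp add: dir.not_le)
    then obtain j' where "j' \<in> J" "\<not> w \<sqsubseteq> j'"
      using x(2)[of w] by blast
    then show ?thesis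
      using convD[OF J(2) _ w(2) _ w(3), of j'] by (metis dir.linear)
  qed
  define V where "V = {v. \<exists>w. w \<in> J \<and> P x v w}"
  have dV: "dset V"
    unfolding dset_def V_def mem_Collect_eq
    by (intro dfn_intros dset_atomic[OF J(5)] dfn_3[OF P] UNIV_I)
  have V_init: "v' \<in> V" if v: "v' \<in> I" "v \<in> V" "v' \<sqsubset> v" for v v'
  proof -
    obtain w where w: "w \<in> J" "P x v w"
      using v(2) by (auto simp: V_def)
    obtain w' where w': "P x v' w'"
      using PD(12)[OF w(2) v(3,1)] by blast
    have "w' \<sqsubset> w"
      using PD(8)[OF w' v(3) w(2)] .
    then have "w' \<in> J"
      using in_J[OF PD(10)[OF w'] w(1)] by (simp add: dir.less_imp_le)
    with w' show ?thesis
      by (auto simp: V_def)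
  qed
  have onto: "\<exists>v. v \<in> V \<and> P x v j" if "j \<in> J" for j
    using PD(9)[OF xI _ x_less[OF that]] that J(1) unfolding V_def by blast
  have "no_max V"
    unfolding no_max_def
  proof
    fix v assume "v \<in> V"
    then obtain w where w: "w \<in> J" "P x v w"
      by (auto simp: V_def)
    then obtain w2 where w2: "w2 \<in> J" "w \<sqsubset> w2"
      using J(3) unfolding opn_iff by blast
    obtain v2 where v2: "v2 \<in> V" "P x v2 w2"
      using onto[OF w2(1)] by blast
    then show "\<exists>y\<in>V. v \<sqsubset> y"
      using partial_addition_less_iff[OF PI(2) w(2) v2(2)] w2 by blast
  qed
  moreover have "V \<subseteq> I"
    using PD(2) by (auto simp: V_def)
  moreover have "V \<noteq> {}"
    using onto J(4) by blast
  ultimately have V: "pgi V (restr V P)"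
    using V_init by (intro pgi_restr[OF I]) blast+
  obtain f where f: "dfun V f" "\<And>v. v \<in> V \<Longrightarrow> P x v (f v)"
  proof (rule dfun_relation[of "P x" V])
    show "dfn UNIV (\<lambda>v. P x (v 0) (v 1))"
      by (intro dfn_3[OF P] atomic_trm_var atomic_trm_const UNIV_I)
    show "w = w'" if "P x v w" "P x v w'" for v w w'
      using PD(4) that by blast
  qed (use dV in \<open>auto simp: V_def\<close>)
  have im: "f ` V = J"
  proof
    show "f ` V \<subseteq> J"
      using f(2) PD(4) unfolding V_def by blast
    show "J \<subseteq> f ` V"
      using onto f(2) PD(4) by blast
  qed
  have "pgi (f ` V) (transport f V (restr V P))"
  proof (rule pgi_transport[OF V _ lt_dir])
    show "f v \<sqsubset> f v'" if "v \<in> V" "v' \<in> V" "v \<sqsubset> v'" for v v'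
      using PD(8)[OF f(2)[OF that(1)] that(3) f(2)[OF that(2)]] .
  qed (use im J in simp)
  moreover have "dfn UNIV (\<lambda>v. restr V P (v 0) (v 1) (v 2))"
    unfolding restr_def by (intro dfn_intros dfn_3[OF P] dset_atomic[OF dV])
  ultimately show ?thesis
    using that[of "transport f V (restr V P)"] dfn_transport[OF f(1)] unfolding im by blast
qed

text \<open>The map \<open>v \<mapsto> y - v\<close> sends the initial segment below
  \<open>d = y - x\<close> onto the interval from \<open>x\<close> to \<open>y\<close> and reverses
  the order. It requires the larger end \<open>y\<close> to be a point of \<open>I\<close>.\<close>

lemma pgi_flip:
  assumes I: "pgi I P" and P: "dfn UNIV (\<lambda>v. P (v 0) (v 1) (v 2))"
    and xy: "x \<in> I" "y \<in> I" "x \<sqsubset> y"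
  obtains P' where "dfn UNIV (\<lambda>v. P' (v 0) (v 1) (v 2))" "omin_dir.pgi (\<lambda>x y. y \<sqsubset> x) (itv x y) P'"
proof -
  have PI: "conv I" "opn I" "partial_addition I P"
    using I by (auto simp: pgi_def)
  note PD = partial_additionD[OF PI(3)]
  obtain d where d: "P x d y"
    using PD(9)[OF xy] by blast
  define V where "V = {v \<in> I. v \<sqsubset> d}"
  have dI: "dset I"
    using pgi_dset[OF I P] .
  have dV: "dset V"
    unfolding dset_def V_def mem_Collect_eq
    by (intro dfn_dir_intros dset_atomic[OF dI] UNIV_I)
  have "d \<in> I"
    using PD(2)[OF d] .
  have "no_max V"
    unfolding no_max_def V_def
  proof
    fix v assume v: "v \<in> {v \<in> I. v \<sqsubset> d}"
    then obtain m where "v \<sqsubset> m" "m \<sqsubset> d"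
      using dir.dense by blast
    then show "\<exists>y\<in>{v \<in> I. v \<sqsubset> d}. v \<sqsubset> y"
      using convD[OF PI(1), of v d m] v \<open>d \<in> I\<close> by (auto simp: dir.less_imp_le)
  qed
  moreover have "V \<noteq> {}"
    using PI(2) \<open>d \<in> I\<close> unfolding opn_iff V_def by blast
  ultimately have V: "pgi V (restr V P)"
    by (intro pgi_restr[OF I]) (auto simp: V_def intro: dir.less_trans)
  obtain f where f: "dfun V f" "\<And>v. v \<in> V \<Longrightarrow> P v (f v) y"
  proof (rule dfun_relation[of "\<lambda>v w. P v w y" V])
    show "dfn UNIV (\<lambda>v. P (v 0) (v 1) y)"
      by (intro dfn_3[OF P] atomic_trm_var atomic_trm_const UNIV_I)
    show "w = w'" if "P v w y" "P v w' y" for v w w'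
      using partial_addition_cancel[OF PI(3)] that by blast
    show "\<exists>w. P v w y" if "v \<in> V" for v
      using that PD(9)[of v y] PD(11)[OF d] xy by (auto simp: V_def intro: dir.less_trans)
  qed (use dV in simp_all)
  have im: "f ` V = itv x y"
  proof (intro equalityI subsetI)
    fix w assume "w \<in> f ` V"
    then obtain v where v: "v \<in> V" "w = f v"
      by blast
    then have "P w v y"
      using f(2) PD(5) by blast
    then show "w \<in> itv x y"
      using partial_addition_complement[OF PI(3) _ d] v PD(10) by (auto simp: V_def)
  next
    fix w assume w: "w \<in> itv x y"
    then have "w \<in> I"
      using convD[OF PI(1) xy(1,2)] by (simp add: dir.less_imp_le)
    then obtain v where v: "P w v y"
      using PD(9) xy w by auto
    then have "v \<sqsubset> d"
      using partial_addition_complement_iff[OF PI(3) v d] w by simp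
    then have "v \<in> V"
      using PD(2)[OF v] by (simp add: V_def)
    moreover have "f v = w"
      using partial_addition_cancel[OF PI(3)] f(2)[OF \<open>v \<in> V\<close>] PD(5)[OF v] by blast
    ultimately show "w \<in> f ` V"
      by blast
  qed
  have "omin_dir.pgi (\<lambda>x y. y \<sqsubset> x) (f ` V) (transport f V (restr V P))"
  proof (rule pgi_transport[OF V])
    show "f v' \<sqsubset> f v" if "v \<in> V" "v' \<in> V" "v \<sqsubset> v'" for v v'
      using partial_addition_complement[OF PI(3) PD(5) PD(5)] f(2) that by blast
  qed (use im conv_itv lt_dir in auto)
  moreover have "dfn UNIV (\<lambda>v. restr V P (v 0) (v 1) (v 2))"
    unfolding restr_def by (intro dfn_intros dfn_3[OF P] dset_atomic[OF dV])
  ultimately show ?thesis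
    using that[of "transport f V (restr V P)"] dfn_transport[OF f(1)] unfolding im by blast
qed

end

section \<open>Short subsets of the line\<close>

context omin
begin

definition gi :: "'a set \<Rightarrow> bool" where
  "gi I \<longleftrightarrow> (\<exists>P. dfn UNIV (\<lambda>v. P (v 0) (v 1) (v 2)) \<and>
     (omin_dir.pgi (<) I P \<or> omin_dir.pgi (>) I P))"

lemma giI:
  "lt = (<) \<or> lt = (>) \<Longrightarrow> omin_dir.pgi lt I P \<Longrightarrow> dfn UNIV (\<lambda>v. P (v 0) (v 1) (v 2)) \<Longrightarrow> gi I"
  unfolding gi_def by blast

lemma giE:
  assumes "gi I"
  obtains lt P where "lt = (<) \<or> lt = (>)" "omin_dir M lt" "omin_dir.pgi lt I P"
    "dfn UNIV (\<lambda>v. P (v 0) (v 1) (v 2))"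
  using assms up_dir down_dir unfolding gi_def by blast

lemma gi_props:
  assumes "gi I"
  shows "dset I" "conv I" "opn I" "I \<noteq> {}"
proof -
  obtain lt P where P: "lt = (<) \<or> lt = (>)" "omin_dir M lt" "omin_dir.pgi lt I P"
    "dfn UNIV (\<lambda>v. P (v 0) (v 1) (v 2))"
    using giE[OF assms] .
  interpret omin_dir M lt
    by (rule P(2))
  show "dset I"
    using pgi_dset[OF P(3,4)] .
  show "conv I" "opn I" "I \<noteq> {}"
    using P(3) by (simp_all add: pgi_def)
qed

lemma gi_sub:
  assumes "gi I" "J \<subseteq> I" "conv J" "opn J" "J \<noteq> {}" "dset J"
  shows "gi J"
proof -
  obtain lt P where P: "lt = (<) \<or> lt = (>)" "omin_dir M lt" "omin_dir.pgi lt I P"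
    "dfn UNIV (\<lambda>v. P (v 0) (v 1) (v 2))"
    using giE[OF assms(1)] .
  obtain P' where "dfn UNIV (\<lambda>v. P' (v 0) (v 1) (v 2))" "omin_dir.pgi lt J P'"
    using omin_dir.pgi_sub[OF P(2,3,4) assms(2-6)] .
  then show ?thesis
    using giI[OF P(1)] by blast
qed

lemma gi_image:
  assumes "gi I" "dfun I f" and inc: "omin_dir.increasing_on (<) I f \<or> omin_dir.increasing_on (>) I f"
  shows "gi (f ` I)"
proof -
  obtain lt P where P: "lt = (<) \<or> lt = (>)" "omin_dir M lt" "omin_dir.pgi lt I P"
    "dfn UNIV (\<lambda>v. P (v 0) (v 1) (v 2))"
    using giE[OF assms(1)] .
  note inc' = omin_dir.increasing_on_def[OF up_dir] omin_dir.increasing_on_def[OF down_dir]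
  have "conv (f ` I)"
    using inc unfolding inc' by blast
  moreover have "\<exists>lt'. (lt' = (<) \<or> lt' = (>)) \<and> (\<forall>x\<in>I. \<forall>y\<in>I. lt x y \<longrightarrow> lt' (f x) (f y))"
    using inc P(1)
  proof (elim disjE)
    assume "omin_dir.increasing_on (<) I f" "lt = (<)"
    then show ?thesis
      unfolding inc' by (intro exI[of _ "(<)"]) auto
  next
    assume "omin_dir.increasing_on (<) I f" "lt = (>)"
    then show ?thesis
      unfolding inc' by (intro exI[of _ "(>)"]) auto
  next
    assume "omin_dir.increasing_on (>) I f" "lt = (<)"
    then show ?thesis
      unfolding inc' by (intro exI[of _ "(>)"]) auto
  next
    assume "omin_dir.increasing_on (>) I f" "lt = (>)"
    then show ?thesis
      unfolding inc' by (intro exI[of _ "(<)"]) auto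
  qed
  then obtain lt' where lt': "lt' = (<) \<or> lt' = (>)" "\<forall>x\<in>I. \<forall>y\<in>I. lt x y \<longrightarrow> lt' (f x) (f y)"
    by blast
  ultimately have "omin_dir.pgi lt' (f ` I) (omin_dir.transport f I P)"
    using omin_dir.pgi_transport[OF P(2,3) _ lt'(1)] by blast
  then show ?thesis
    using giI[OF lt'(1)] omin_dir.dfn_transport[OF P(2) assms(2) P(4)] by blast
qed

text \<open>A cover is asked for instead of a partition, so that unions and definable subsets cause
  no work; \<open>SH_cuts\<close> gives disjoint pieces when they are wanted.\<close>

definition SH :: "'a set \<Rightarrow> bool" where
  "SH X \<longleftrightarrow> dset X \<and> (\<exists>F \<G>. finite F \<and> finite \<G> \<and> (\<forall>I\<in>\<G>. gi I) \<and> X \<subseteq> F \<union> \<Union>\<G>)"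

lemma SH_dset: "SH X \<Longrightarrow> dset X"
  by (simp add: SH_def)

lemma SHE:
  assumes "SH X"
  obtains F \<G> where "finite F" "finite \<G>" "\<forall>I\<in>\<G>. gi I" "X \<subseteq> F \<union> \<Union>\<G>"
  using assms unfolding SH_def by blast

lemma SH_finite: "finite X \<Longrightarrow> SH X"
  unfolding SH_def by (intro conjI dset_finite, assumption, rule exI[of _ X], rule exI[of _ "{}"]) auto

lemma SH_gi: "gi I \<Longrightarrow> SH I"
  unfolding SH_def
  by (intro conjI gi_props(1), assumption, rule exI[of _ "{}"], rule exI[of _ "{I}"]) auto

lemma SH_subset: "SH X \<Longrightarrow> dset Y \<Longrightarrow> Y \<subseteq> X \<Longrightarrow> SH Y"
  unfolding SH_def by (meson order_trans)

lemma SH_Un: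
  assumes "SH X" "SH Y"
  shows "SH (X \<union> Y)"
proof -
  obtain F \<G> where X: "finite F" "finite \<G>" "\<forall>I\<in>\<G>. gi I" "X \<subseteq> F \<union> \<Union>\<G>"
    using SHE[OF assms(1)] .
  obtain E \<H> where Y: "finite E" "finite \<H>" "\<forall>I\<in>\<H>. gi I" "Y \<subseteq> E \<union> \<Union>\<H>"
    using SHE[OF assms(2)] .
  have "dset (X \<union> Y)"
    using assms by (intro dset_Un SH_dset)
  moreover have "finite (F \<union> E)" "finite (\<G> \<union> \<H>)" "\<forall>I\<in>\<G> \<union> \<H>. gi I" "X \<union> Y \<subseteq> (F \<union> E) \<union> \<Union>(\<G> \<union> \<H>)"
    using X Y by auto
  ultimately show ?thesis
    unfolding SH_def by blast
qed

lemma SH_UN: "finite A \<Longrightarrow> (\<And>i. i \<in> A \<Longrightarrow> SH (X i)) \<Longrightarrow> SH (\<Union>i\<in>A. X i)"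
  by (induction A rule: finite_induct) (auto intro: SH_finite SH_Un)

lemma opn_cell:
  assumes "finite C"
  shows "opn (cell C A)"
  unfolding opn_def
proof (intro ballI conjI)
  interpret up: omin_dir M "(<)"
    by (rule up_dir)
  fix z assume z: "z \<in> cell C A"
  then have "z \<notin> C"
    by (simp add: cell_def)
  obtain u v where uv: "u < z" "z < v" "{u<..<v} \<inter> C = {}"
    using up.ex_gap_at[OF assms \<open>z \<notin> C\<close>] unfolding up_itv by blast
  have cell: "y \<in> cell C A" if y: "y \<in> {u<..<v}" for y
  proof -
    have "c < y \<longleftrightarrow> c < z" if "c \<in> C" for c
    proof -
      have "c \<notin> {u<..<v}"
        using uv(3) that by blast
      then show ?thesis
        using y uv by auto
    qed
    moreover have "y \<notin> C"
      using uv(3) y by blast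
    ultimately show ?thesis
      using z unfolding cell_def by auto
  qed
  obtain y1 y2 where "z < y1" "y1 < v" "u < y2" "y2 < z"
    using dense uv by metis
  then show "\<exists>y\<in>cell C A. z < y" "\<exists>y\<in>cell C A. y < z"
    using cell uv by (meson greaterThanLessThan_iff order_less_trans)+
qed

text \<open>A convex piece that avoids the extra points and all cuts of the covering group-intervals
  lies in a single one of these and inherits its structure through \<open>gi_sub\<close>.\<close>

lemma SH_cuts:
  assumes "SH X"
  obtains C where "finite C"
    "\<And>J. conv J \<Longrightarrow> opn J \<Longrightarrow> J \<noteq> {} \<Longrightarrow> dset J \<Longrightarrow> J \<subseteq> X \<Longrightarrow> J \<inter> C = {} \<Longrightarrow> gi J"
proof -
  obtain F \<G> where X: "finite F" "finite \<G>" "\<forall>I\<in>\<G>. gi I" "X \<subseteq> F \<union> \<Union>\<G>"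
    using SHE[OF assms] .
  obtain C where C: "finite C" "\<And>I. I \<in> \<G> \<Longrightarrow> cuts C I"
    using ex_cuts_family[OF X(2)] X(3) gi_props(1) by blast
  show ?thesis
  proof
    show "finite (F \<union> C)"
      using C(1) X(1) by simp
    fix J assume J: "conv J" "opn J" "J \<noteq> {}" "dset J" "J \<subseteq> X" "J \<inter> (F \<union> C) = {}"
    then obtain z where "z \<in> J"
      by blast
    then obtain I where I: "I \<in> \<G>" "z \<in> I"
      using J(5,6) X(4) by blast
    have "J \<inter> C = {}"
      using J(6) by blast
    then have "J \<subseteq> I"
      using cutsD[OF C(2)[OF I(1)] J(1)] I(2) \<open>z \<in> J\<close> by blast
    then show "gi J"
      using gi_sub[OF X(3)[rule_format, OF I(1)]] J by blast
  qed
qed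

text \<open>The group-intervals covering \<open>Y\<close> are cut where \<open>f\<close> changes its
  behaviour. On each piece \<open>f\<close> is constant or carries the addition over to the
  image.\<close>

lemma SH_image:
  assumes Y: "SH Y" and f: "dfun X f" and YX: "Y \<subseteq> X"
  shows "SH (f ` Y)"
proof -
  obtain F \<G> where G: "finite F" "finite \<G>" "\<forall>I\<in>\<G>. gi I" "Y \<subseteq> F \<union> \<Union>\<G>"
    using SHE[OF Y] .
  obtain C where C: "finite C" "\<And>J. conv J \<Longrightarrow> J \<inter> C = {} \<Longrightarrow> J \<inter> X = {} \<or> J \<subseteq> X \<and>
    ((\<exists>c. \<forall>x\<in>J. f x = c) \<or> omin_dir.increasing_on (<) J f \<or> omin_dir.increasing_on (>) J f)"
    using monotonicity[OF f] by blast
  have dX: "dset X"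
    using dset_dfun[OF f] .
  have piece: "SH (f ` (I \<inter> cell C A \<inter> X))" if I: "I \<in> \<G>" for I A
  proof -
    define J where "J = I \<inter> cell C A"
    note gi = gi_props[OF G(3)[rule_format, OF I]]
    have J: "conv J" "dset J" "J \<inter> C = {}"
      unfolding J_def using gi conv_cell dset_cell[OF C(1)] cell_disjoint[of C A]
      by (auto intro: conv_Int dset_Int)
    have "opn J"
      unfolding J_def using omin_dir.opn_Int_conv[OF up_dir gi(2) conv_cell gi(3) opn_cell[OF C(1)]] .
    have "SH (f ` (J \<inter> X))"
    proof (cases "J \<inter> X = {}")
      case True
      then show ?thesis
        by (simp add: SH_finite)
    next
      case False
      then have JX: "J \<subseteq> X" "J \<inter> X = J"
        using C(2)[OF J(1,3)] by blast+
      from False consider c where "\<forall>x\<in>J. f x = c"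
        | "omin_dir.increasing_on (<) J f \<or> omin_dir.increasing_on (>) J f"
        using C(2)[OF J(1,3)] by blast
      then show ?thesis
      proof cases
        case (1 c)
        then have "f ` J \<subseteq> {c}"
          by blast
        then show ?thesis
          unfolding JX(2) by (intro SH_finite) (simp add: finite_subset)
      next
        case 2
        have "gi J"
          using gi_sub[OF G(3)[rule_format, OF I] _ J(1) \<open>opn J\<close> _ J(2)] False unfolding J_def by blast
        moreover have "dfun J f"
        proof -
          have "dfn UNIV (\<lambda>v. v 0 \<in> J \<and> (v 0 \<in> X \<and> v 1 = f (v 0)))"
            using f J(2) unfolding dfun_def dset_def by (rule dfn_conj[rotated])
          then show ?thesis
            unfolding dfun_def by (rule dfn_cong) (use JX(1) in blast)
        qed
        ultimately show ?thesis
          unfolding JX(2) using 2 by (intro SH_gi gi_image)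
      qed
    qed
    then show ?thesis
      by (simp add: J_def)
  qed
  have "SH (f ` F \<union> f ` C \<union> (\<Union>I\<in>\<G>. \<Union>A\<in>Pow C. f ` (I \<inter> cell C A \<inter> X)))"
    by (intro SH_Un SH_UN piece SH_finite[OF finite_imageI[OF G(1)]] SH_finite[OF finite_imageI[OF C(1)]])
      (simp_all add: G(2) C(1))
  moreover have "f ` Y \<subseteq> f ` F \<union> f ` C \<union> (\<Union>I\<in>\<G>. \<Union>A\<in>Pow C. f ` (I \<inter> cell C A \<inter> X))"
  proof
    fix z assume "z \<in> f ` Y"
    then obtain y where y: "y \<in> Y" "z = f y"
      by blast
    show "z \<in> f ` F \<union> f ` C \<union> (\<Union>I\<in>\<G>. \<Union>A\<in>Pow C. f ` (I \<inter> cell C A \<inter> X))"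
    proof (cases "y \<in> F \<union> C")
      case False
      then obtain I where "I \<in> \<G>" "y \<in> I"
        using G(4) y by blast
      moreover obtain A where "A \<in> Pow C" "y \<in> cell C A"
        using False Compl_eq_cells[of C] by blast
      ultimately show ?thesis
        using y YX by blast
    qed (use y in blast)
  qed
  moreover have "dset (f ` Y)"
    using dset_image[OF f SH_dset[OF Y] YX] .
  ultimately show ?thesis
    by (meson SH_subset)
qed

text \<open>If the sizes of the fibres were unbounded, saturation would provide one fibre with at
  least \<open>n\<close> elements for every \<open>n\<close>.\<close>

lemma uniform_finiteness:
  assumes E: "dfn UNIV (\<lambda>v. E (v 0) (v 1))" and fin: "\<And>a. finite {z. E a z}"
  obtains N where "\<And>a. card {z. E a z} \<le> N"
proof (rule ccontr)
  assume "\<not> thesis"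
  then have big: "\<exists>a. N < card {z. E a z}" for N
    using that by (meson not_le)
  obtain B where B: "finite B" "B \<subseteq> UNIV" "dfn B (\<lambda>v. E (v 0) (v 1))"
    using dfn_finite_params[OF E] .
  \<comment> \<open>At least \<open>n\<close> elements means an increasing chain of length
    \<open>n\<close>. The chain is part of an environment, so this is a formula over
    \<open>B\<close>.\<close>
  define p where "p = (\<lambda>n a. \<exists>t::nat \<Rightarrow> 'a. \<forall>i\<in>{..<n}. E a (t i) \<and> (\<forall>j\<in>{..<n}. i < j \<longrightarrow> t i < t j))"
  have p_imp: "n \<le> card {z. E a z}" if p: "p n a" for n a
  proof -
    from p obtain t where t: "\<forall>i\<in>{..<n}. E a (t i) \<and> (\<forall>j\<in>{..<n}. i < j \<longrightarrow> t i < t j)"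
      unfolding p_def by blast
    have "inj_on t {..<n}"
      unfolding inj_on_def using t by (metis linorder_neqE order_less_irrefl)
    moreover have "t ` {..<n} \<subseteq> {z. E a z}"
      using t by blast
    ultimately show ?thesis
      using card_inj_on_le[OF _ _ fin] by fastforce
  qed
  have p_if: "p n a" if n: "n \<le> card {z. E a z}" for n a
  proof -
    define xs where "xs = sorted_list_of_set {z. E a z}"
    have xs: "sorted_wrt (<) xs" "set xs = {z. E a z}" "length xs = card {z. E a z}"
      using fin by (simp_all add: xs_def)
    have "E a (xs ! i)" if "i < n" for i
      using xs(2,3) n that nth_mem[of i xs] by auto
    moreover have "xs ! i < xs ! j" if "j < n" "i < j" for i j
      using sorted_wrt_nth_less[OF xs(1) that(2)] xs(3) n that(1) by simp
    ultimately show ?thesis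
      unfolding p_def by (intro exI[of _ "(!) xs"]) auto
  qed
  have "\<exists>a. \<forall>q\<in>range p. q a"
  proof (rule saturation_1[of B])
    show "countable B"
      using B(1) by (rule countable_finite)
    fix q assume "q \<in> range p"
    then obtain n where "q = p n"
      by blast
    then show "dfn B (\<lambda>v. q (v 0))"
      unfolding p_def
      by (auto intro!: dfn_ex_env dfn_ball_finite dfn_conj dfn_imp dfn_less dfn_2[OF B(3)])
  next
    fix \<Q> assume "finite \<Q>" "\<Q> \<subseteq> range p"
    then obtain S where S: "finite S" "\<Q> = p ` S"
      by (metis finite_subset_image)
    obtain a where a: "Max (insert 0 S) < card {z. E a z}"
      using big by blast
    have "p n a" if "n \<in> S" for n
      using that S(1) a by (intro p_if) (meson Max_ge finite.insertI insertCI less_imp_le order_trans)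
    with S(2) show "\<exists>a. \<forall>q\<in>\<Q>. q a"
      by blast
  qed
  then obtain a where "\<And>n. p n a"
    by blast
  then have "Suc (card {z. E a z}) \<le> card {z. E a z}"
    using p_imp by blast
  then show False
    by simp
qed

text \<open>Induction on the uniform bound for the sizes of the fibres: their least elements form
  the image of a definable function, and removing them lowers the bound.\<close>

lemma SH_finite_fibres:
  assumes Y: "SH Y" and E: "dfn UNIV (\<lambda>v. E (v 0) (v 1))" and fin: "\<And>a. finite {z. E a z}"
  shows "SH {z. \<exists>a\<in>Y. E a z}"
proof -
  obtain N where "\<And>a. card {z. E a z} \<le> N"
    using uniform_finiteness[OF E fin] by blast
  then show ?thesis
    using E fin
  proof (induction N arbitrary: E)
    case 0
    then have "{z. E a z} = {}" for a
      using 0 by (metis card_0_eq le_zero_eq)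
    then show ?case
      by (auto simp: SH_finite)
  next
    case (Suc N)
    note E = Suc.prems(2)
    define X where "X = {a. \<exists>z. E a z}"
    define f where "f = (\<lambda>a. Min {z. E a z})"
    define E' where "E' = (\<lambda>a z. E a z \<and> (\<exists>z'. E a z' \<and> z' < z))"
    have f_in: "E a (f a)" if "a \<in> X" for a
      using Min_in[OF Suc.prems(3)[of a]] that unfolding X_def f_def by blast
    have f_le: "f a \<le> z" if "E a z" for a z
      unfolding f_def using Min_le[OF Suc.prems(3)[of a]] that by blast
    have dX: "dset X"
      unfolding dset_def X_def mem_Collect_eq by (intro dfn_intros dfn_2[OF E])
    have "dfn UNIV (\<lambda>v. E (v 0) (v 1) \<and> (\<forall>z. E (v 0) z \<longrightarrow> v 1 \<le> z))"
      by (intro dfn_intros dfn_2[OF E])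
    then have f: "dfun X f"
      unfolding dfun_def
    proof (rule dfn_cong)
      fix v :: "nat \<Rightarrow> 'a"
      show "(E (v 0) (v 1) \<and> (\<forall>z. E (v 0) z \<longrightarrow> v 1 \<le> z)) = (v 0 \<in> X \<and> v 1 = f (v 0))"
        using f_in f_le unfolding X_def by (metis (mono_tags) mem_Collect_eq order_antisym)
    qed
    have "SH {z. \<exists>a\<in>Y. E' a z}"
    proof (rule Suc.IH)
      show "dfn UNIV (\<lambda>v. E' (v 0) (v 1))"
        unfolding E'_def by (intro dfn_intros dfn_2[OF E])
      fix a
      have sub: "{z. E' a z} \<subseteq> {z. E a z} - {f a}"
        using f_le by (auto simp: E'_def dest: leD)
      then show "finite {z. E' a z}"
        using Suc.prems(3)[of a] by (meson finite_Diff finite_subset)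
      show "card {z. E' a z} \<le> N"
      proof (cases "a \<in> X")
        case True
        have "card {z. E' a z} \<le> card ({z. E a z} - {f a})"
          using sub Suc.prems(3)[of a] by (intro card_mono) auto
        also have "\<dots> = card {z. E a z} - 1"
          using f_in[OF True] by (simp add: Suc.prems(3))
        finally show ?thesis
          using Suc.prems(1)[of a] by simp
      next
        case False
        then have "{z. E' a z} = {}"
          by (auto simp: X_def E'_def)
        then show ?thesis
          by simp
      qed
    qed
    moreover have "SH (f ` (Y \<inter> X))"
      using SH_image[OF SH_subset[OF Y] f] dX SH_dset[OF Y] by (simp add: dset_Int)
    moreover have "{z. \<exists>a\<in>Y. E a z} = f ` (Y \<inter> X) \<union> {z. \<exists>a\<in>Y. E' a z}"
    proof (intro equalityI subsetI)
      fix z assume "z \<in> {z. \<exists>a\<in>Y. E a z}"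
      then obtain a where a: "a \<in> Y" "E a z"
        by blast
      then have "a \<in> X"
        by (auto simp: X_def)
      then show "z \<in> f ` (Y \<inter> X) \<union> {z. \<exists>a\<in>Y. E' a z}"
        using a f_in[of a] f_le[OF a(2)] unfolding E'_def by (cases "z = f a") (auto simp: order_less_le)
    qed (use f_in in \<open>auto simp: E'_def\<close>)
    ultimately show ?case
      by (simp add: SH_Un)
  qed
qed

text \<open>For \<open>cuts\<close> the exceptional points are merely known to exist. These points
  are given by a formula, so they vary definably with the members of a definable family.\<close>

definition bdry :: "'a set \<Rightarrow> 'a set" where
  "bdry X = {z. \<not> (\<exists>u v. (u < z \<and> z < v) \<and>
     ((\<forall>w. u < w \<and> w < v \<longrightarrow> w \<in> X) \<or> (\<forall>w. u < w \<and> w < v \<longrightarrow> w \<notin> X)))}"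

lemma finite_bdry:
  assumes "dset X"
  shows "finite (bdry X)"
proof -
  interpret up: omin_dir M "(<)"
    by (rule up_dir)
  obtain C where C: "cuts C X"
    using ex_cuts[OF assms] .
  have "bdry X \<subseteq> C"
  proof (rule subsetI, rule ccontr)
    fix z assume z: "z \<in> bdry X" "z \<notin> C"
    obtain u v where uv: "u < z" "z < v" "up.itv u v \<inter> C = {}"
      using up.ex_gap_at[OF cuts_finite[OF C] z(2)] .
    from cutsD[OF C up.conv_itv uv(3)]
    have "(\<forall>w. u < w \<and> w < v \<longrightarrow> w \<in> X) \<or> (\<forall>w. u < w \<and> w < v \<longrightarrow> w \<notin> X)"
      unfolding up_itv by (auto simp: subset_iff disjoint_iff)
    with uv z(1) show False
      unfolding bdry_def by blast
  qed
  then show ?thesis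
    using cuts_finite[OF C] finite_subset by blast
qed

text \<open>Away from the boundary, membership in \<open>X\<close> is locally constant, and
  \<open>local_to_global\<close> applies to the relation of being both inside or both
  outside.\<close>

lemma no_bdry:
  assumes X: "dset X" and J: "conv J" "J \<inter> bdry X = {}"
  shows "J \<subseteq> X \<or> J \<inter> X = {}"
proof -
  interpret up: omin_dir M "(<)"
    by (rule up_dir)
  have R: "dfn UNIV (\<lambda>v. v 0 \<in> X \<longleftrightarrow> v 1 \<in> X)"
    by (intro dfn_iff dset_atomic[OF X] atomic_trm_var)
  have loc: "\<exists>u v. u < x \<and> x < v \<and> (\<forall>w\<in>up.itv u v. x \<in> X \<longleftrightarrow> w \<in> X)" if "x \<in> J" for x
  proof -
    have "x \<notin> bdry X"
      using that J(2) by blast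
    then obtain u v where uv: "u < x" "x < v"
      "(\<forall>w. u < w \<and> w < v \<longrightarrow> w \<in> X) \<or> (\<forall>w. u < w \<and> w < v \<longrightarrow> w \<notin> X)"
      unfolding bdry_def by blast
    then have "\<forall>w\<in>up.itv u v. x \<in> X \<longleftrightarrow> w \<in> X"
      unfolding up_itv by auto
    with uv show ?thesis
      by blast
  qed
  have right: "\<exists>y>x. \<forall>z\<in>up.itv x y. x \<in> X \<longleftrightarrow> z \<in> X" and left: "\<exists>y<x. \<forall>z\<in>up.itv y x. z \<in> X \<longleftrightarrow> x \<in> X"
    if x: "x \<in> J" for x
  proof -
    obtain u v where uv: "u < x" "x < v" "\<forall>w\<in>up.itv u v. x \<in> X \<longleftrightarrow> w \<in> X"
      using loc[OF x] by blast
    have "up.itv x v \<subseteq> up.itv u v" "up.itv u x \<subseteq> up.itv u v"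
      using uv unfolding up_itv by auto
    with uv show "\<exists>y>x. \<forall>z\<in>up.itv x y. x \<in> X \<longleftrightarrow> z \<in> X" "\<exists>y<x. \<forall>z\<in>up.itv y x. z \<in> X \<longleftrightarrow> x \<in> X"
      by blast+
  qed
  have "x \<in> X \<longleftrightarrow> y \<in> X" if "x \<in> J" "y \<in> J" "x < y" for x y
    by (rule up.local_to_global[OF J(1) R _ right left that]) auto
  then have "x \<in> X \<longleftrightarrow> y \<in> X" if "x \<in> J" "y \<in> J" for x y
    using that by (metis linorder_neqE)
  then show ?thesis
    by blast
qed

text \<open>
  Induction on the number of variables. For the step, the boundary points of the fibres form a short
  set, and between them the image is covered by finitely many fibres.
\<close>

lemma SH_image_product:
  assumes "\<And>j. j < k \<Longrightarrow> SH (I j)" and "dfn UNIV (\<lambda>v. F (\<lambda>i. v (Suc i)) (v 0))"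
    and "\<And>t z z'. F t z \<Longrightarrow> F t z' \<Longrightarrow> z = z'"
    and "\<And>t t' z. (\<And>i. i < k \<Longrightarrow> t i = t' i) \<Longrightarrow> F t z \<Longrightarrow> F t' z"
  shows "SH {z. \<exists>t. (\<forall>j\<in>{..<k}. t j \<in> I j) \<and> F t z}"
  using assms
proof (induction k arbitrary: I F)
  case 0
  have "z = z'" if "F t z" "F t' z'" for t t' z z'
    using "0.prems"(4)[of t t' z] "0.prems"(3)[of t' z z'] that by simp
  then have "{z. \<exists>t. F t z} = {} \<or> (\<exists>z. {z. \<exists>t. F t z} = {z})"
    by blast
  then have "finite {z. \<exists>t. F t z}"
    by auto
  then show ?case
    by (simp add: SH_finite)
next
  case (Suc k)
  note F = Suc.prems(2)
  have dI: "dset (I j)" if "j < Suc k" for j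
    using SH_dset[OF Suc.prems(1)[OF that]] .
  \<comment> \<open>The image of the slice with first coordinate \<open>a\<close>, to which the
    induction hypothesis applies.\<close>
  define J where "J = (\<lambda>a. {z. \<exists>t. (\<forall>j\<in>{..<k}. t j \<in> I (Suc j)) \<and> F (case_nat a t) z})"
  have at: "atomic_trm B (\<lambda>v. case_nat (f v) (\<lambda>j. v (2 * j + 1)) i)"
    if "atomic_trm B f" for B f i
    using that by (auto intro: atomic_trm_case_nat)
  have dJ: "dfn UNIV (\<lambda>v. v 1 \<in> J (v 0))"
    unfolding J_def mem_Collect_eq
  proof (rule dfn_ex_env, intro dfn_conj dfn_ball_finite)
    show "dfn UNIV (\<lambda>v. v (2 * j + 1) \<in> I (Suc j))" if "j \<in> {..<k}" for j
      using that dI by (intro dset_atomic) auto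
    have F': "dfn UNIV (\<lambda>v. (\<lambda>z t. F t z) (v 0) (\<lambda>i. v (Suc i)))"
      using F .
    show "dfn UNIV (\<lambda>v. F (case_nat (v (2 * 0)) (\<lambda>i. v (2 * i + 1))) (v (2 * 1)))"
      by (rule dfn_1_env[OF F']) (auto intro: at)
  qed simp
  note dJ2 = dfn_2[where P = "\<lambda>a z. z \<in> J a", OF dJ]
  have SH_J: "SH (J a)" for a
    unfolding J_def
  proof (rule Suc.IH)
    show "SH (I (Suc j))" if "j < k" for j
      using Suc.prems(1) that by simp
    have F': "dfn UNIV (\<lambda>v. (\<lambda>z t. F t z) (v 0) (\<lambda>i. v (Suc i)))"
      using F .
    show "dfn UNIV (\<lambda>v. F (case_nat a (\<lambda>i. v (Suc i))) (v 0))"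
      by (rule dfn_1_env[OF F'], simp, rule atomic_trm_case_nat) auto
    show "z = z'" if "F (case_nat a t) z" "F (case_nat a t) z'" for t z z'
      using Suc.prems(3) that by blast
    show "F (case_nat a t') z" if "\<And>i. i < k \<Longrightarrow> t i = t' i" "F (case_nat a t) z" for t t' z
      using Suc.prems(4)[of "case_nat a t" "case_nat a t'" z] that by (auto split: nat.split)
  qed
  define Z where "Z = {z. \<exists>a. a \<in> I 0 \<and> z \<in> J a}"
  have dZ: "dset Z"
    unfolding dset_def Z_def mem_Collect_eq
    by (intro dfn_intros dset_atomic[OF dI] dJ2) simp
  have dbd: "dfn UNIV (\<lambda>v. v 1 \<in> bdry (J (v 0)))"
    unfolding bdry_def mem_Collect_eq
    by (intro dfn_intros dJ2)
  have finb: "finite {z. z \<in> bdry (J a)}" for a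
    using finite_bdry[OF SH_dset[OF SH_J[of a]]] by simp
  define Bd where "Bd = {z. \<exists>a\<in>I 0. z \<in> bdry (J a)}"
  have SH_Bd: "SH Bd"
    unfolding Bd_def using SH_finite_fibres[OF Suc.prems(1)[of 0] dbd finb] by simp
  obtain C where C: "finite C" "\<And>X. X \<in> {Z, Bd} \<Longrightarrow> cuts C X"
    using ex_cuts_family[of "{Z, Bd}"] dZ SH_dset[OF SH_Bd] by blast
  \<comment> \<open>A cell either lies in the short set \<open>Bd\<close> or is disjoint from it. In
    the second case it contains no boundary point of any slice image, so a slice image that meets
    the cell covers all of it.\<close>
  have "SH (cell C A \<inter> Z)" for A
  proof (cases "cell C A \<inter> Z \<subseteq> Bd")
    case True
    then show ?thesis
      using SH_subset[OF SH_Bd] dZ dset_cell[OF C(1)] dset_Int by blast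
  next
    case False
    then obtain z where z: "z \<in> cell C A" "z \<in> Z" "z \<notin> Bd"
      by blast
    have disj: "cell C A \<inter> Bd = {}"
      using cutsD[OF C(2) conv_cell cell_disjoint, of Bd] z by blast
    obtain a where a: "a \<in> I 0" "z \<in> J a"
      using z(2) by (auto simp: Z_def)
    have "cell C A \<inter> bdry (J a) = {}"
      using disj a(1) by (auto simp: Bd_def)
    then have "cell C A \<subseteq> J a"
      using no_bdry[OF SH_dset[OF SH_J] conv_cell] z(1) a(2) by blast
    then show ?thesis
      using SH_subset[OF SH_J] dZ dset_cell[OF C(1)] dset_Int by (meson inf.coboundedI1)
  qed
  then have "SH (C \<union> (\<Union>A\<in>Pow C. cell C A \<inter> Z))"
    by (intro SH_Un SH_UN SH_finite[OF C(1)]) (simp add: C(1))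
  moreover have "Z \<subseteq> C \<union> (\<Union>A\<in>Pow C. cell C A \<inter> Z)"
    using Compl_eq_cells[of C] by blast
  ultimately have "SH Z"
    using dZ SH_subset by blast
  moreover have "Z = {z. \<exists>t. (\<forall>j\<in>{..<Suc k}. t j \<in> I j) \<and> F t z}"
  proof (intro equalityI subsetI)
    fix z assume "z \<in> Z"
    then obtain a t where "a \<in> I 0" "\<forall>j\<in>{..<k}. t j \<in> I (Suc j)" "F (case_nat a t) z"
      by (auto simp: Z_def J_def)
    moreover from this have "\<forall>j\<in>{..<Suc k}. case_nat a t j \<in> I j"
      by (auto split: nat.split)
    ultimately show "z \<in> {z. \<exists>t. (\<forall>j\<in>{..<Suc k}. t j \<in> I j) \<and> F t z}"
      by blast
  next
    fix z assume "z \<in> {z. \<exists>t. (\<forall>j\<in>{..<Suc k}. t j \<in> I j) \<and> F t z}"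
    then obtain t where t: "\<forall>j\<in>{..<Suc k}. t j \<in> I j" "F t z"
      by blast
    have "case_nat (t 0) (\<lambda>i. t (Suc i)) = t"
      by (auto split: nat.split)
    with t show "z \<in> Z"
      unfolding Z_def J_def by (auto intro!: exI[of _ "t 0"] exI[of _ "\<lambda>i. t (Suc i)"])
  qed
  ultimately show ?case
    by simp
qed

end

context omin_dir
begin

text \<open>The addition of \<open>I\<close> may point in the other direction. Then it is reflected,
  and this is why \<open>x\<close> and \<open>y\<close> have to be points of \<open>I\<close> and
  not just its ends.\<close>

lemma gi_pgi_itv:
  assumes "gi I" "x \<in> I" "y \<in> I" "x \<sqsubset> y"
  obtains P where "dfn UNIV (\<lambda>v. P (v 0) (v 1) (v 2))" "pgi (itv x y) P"
proof -
  obtain lt' P where P: "lt' = (<) \<or> lt' = (>)" "omin_dir M lt'" "omin_dir.pgi lt' I P"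
    "dfn UNIV (\<lambda>v. P (v 0) (v 1) (v 2))"
    using giE[OF assms(1)] .
  consider "lt' = lt" | "lt' = (\<lambda>x y. y \<sqsubset> x)"
    using P(1) lt_dir by auto
  then show ?thesis
  proof cases
    case 1
    have "itv x y \<subseteq> I"
      using convD[OF gi_props(2)[OF assms(1)] assms(2,3)] by (auto simp: dir.less_imp_le)
    moreover have "itv x y \<noteq> {}"
      using assms(4) by (simp add: itv_eq_empty_iff)
    ultimately obtain P' where "dfn UNIV (\<lambda>v. P' (v 0) (v 1) (v 2))" "pgi (itv x y) P'"
      using pgi_sub[OF P(3)[unfolded 1] P(4) _ conv_itv opn_itv _ dset_itv] by blast
    then show ?thesis
      by (rule that)
  next
    case 2
    obtain P' where "dfn UNIV (\<lambda>v. P' (v 0) (v 1) (v 2))"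
      "omin_dir.pgi (\<lambda>x y. lt' y x) (omin_dir.itv lt' y x) P'"
      by (rule omin_dir.pgi_flip[OF P(2-4) assms(3,2)]) (use assms(4) 2 in simp_all)
    then show ?thesis
      using that unfolding 2 rev_itv by blast
  qed
qed

end

section \<open>A definable ultrafilter on a definable set of environments\<close>

context fo_str
begin

lemma dfn_2_env:
  assumes "dfn B (\<lambda>v. P (\<lambda>i. v (2 * i)) (\<lambda>i. v (2 * i + 1)))"
    and "\<And>i. atomic_trm B (\<lambda>v. f v i)" "\<And>i. atomic_trm B (\<lambda>v. g v i)"
  shows "dfn B (\<lambda>v. P (f v) (g v))"
proof -
  have "atomic_trm B (\<lambda>v. if even i then f v (i div 2) else g v (i div 2))" for i
    by (intro atomic_trm_if assms)
  from dfn_subst[OF assms(1), of "\<lambda>v i. if even i then f v (i div 2) else g v (i div 2)", OF this]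
  show ?thesis
    by simp
qed

end

context omin
begin

text \<open>
  A property holds for the selected point of \<open>Z\<close> if it holds when the first coordinate is
  infinitesimally close to the bottom of the projection of \<open>Z\<close>, the second one infinitesimally
  close to the bottom of its fibre, and so on. This replaces definable choice, which need not exist.
\<close>

fun sel :: "nat \<Rightarrow> ((nat \<Rightarrow> 'a) \<Rightarrow> bool) \<Rightarrow> ((nat \<Rightarrow> 'a) \<Rightarrow> bool) \<Rightarrow> bool" where
  "sel 0 Z \<phi> \<longleftrightarrow> \<phi> (\<lambda>_. undefined)"
| "sel (Suc k) Z \<phi> \<longleftrightarrow> (\<exists>e. (\<exists>t. Z (case_nat e t)) \<and>
     (\<forall>s. (\<exists>t. Z (case_nat s t)) \<and> s \<le> e \<longrightarrow> sel k (\<lambda>t. Z (case_nat s t)) (\<lambda>t. \<phi> (case_nat s t))))"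

definition supp :: "nat \<Rightarrow> ((nat \<Rightarrow> 'a) \<Rightarrow> bool) \<Rightarrow> bool" where
  "supp k Z \<longleftrightarrow> (\<forall>t t'. (\<forall>i<k. t i = t' i) \<longrightarrow> Z t = Z t')"

lemma supp_case_nat: "supp (Suc k) Z \<Longrightarrow> supp k (\<lambda>t. Z (case_nat s t))"
  unfolding supp_def by (auto simp: less_Suc_eq_0_disj split: nat.split)

lemma ex_case_nat: "(\<exists>t. Z t) \<longleftrightarrow> (\<exists>s t. Z (case_nat s t))" for Z :: "(nat \<Rightarrow> 'a) \<Rightarrow> bool"
proof
  assume "\<exists>t. Z t"
  then obtain t where "Z t" ..
  moreover have "case_nat (t 0) (\<lambda>i. t (Suc i)) = t"
    by (auto split: nat.split)
  ultimately show "\<exists>s t. Z (case_nat s t)"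
    by metis
qed auto

text \<open>Once all \<open>k\<close> coordinates are fixed, \<open>Z\<close> is empty or
  everything. So the \<open>undefined\<close> environment in \<open>sel 0\<close> satisfies
  \<open>Z\<close>.\<close>

lemma sel_base: "supp 0 Z \<Longrightarrow> \<exists>t. Z t \<Longrightarrow> Z t'"
  unfolding supp_def by auto

lemma sel_all:
  "supp k Z \<Longrightarrow> \<exists>t. Z t \<Longrightarrow> (\<And>t. Z t \<Longrightarrow> \<phi> t) \<Longrightarrow> sel k Z \<phi>"
proof (induction k arbitrary: Z \<phi>)
  case 0
  then show ?case
    using sel_base[OF 0(1,2)] by simp
next
  case (Suc k)
  obtain e where e: "\<exists>t. Z (case_nat e t)"
    using Suc.prems(2) unfolding ex_case_nat[of Z] by blast
  have "sel k (\<lambda>t. Z (case_nat s t)) (\<lambda>t. \<phi> (case_nat s t))" if "\<exists>t. Z (case_nat s t)" for s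
    by (rule Suc.IH[OF supp_case_nat[OF Suc.prems(1)] that]) (rule Suc.prems(3))
  with e show ?case
    by auto
qed

lemma sel_conj:
  "sel k Z \<phi> \<Longrightarrow> sel k Z \<psi> \<Longrightarrow> sel k Z (\<lambda>t. \<phi> t \<and> \<psi> t)"
proof (induction k arbitrary: Z \<phi> \<psi>)
  case (Suc k)
  obtain e where e: "\<exists>t. Z (case_nat e t)"
    "\<And>s. \<exists>t. Z (case_nat s t) \<Longrightarrow> s \<le> e \<Longrightarrow> sel k (\<lambda>t. Z (case_nat s t)) (\<lambda>t. \<phi> (case_nat s t))"
    using Suc.prems(1) by auto
  obtain e' where e': "\<exists>t. Z (case_nat e' t)"
    "\<And>s. \<exists>t. Z (case_nat s t) \<Longrightarrow> s \<le> e' \<Longrightarrow> sel k (\<lambda>t. Z (case_nat s t)) (\<lambda>t. \<psi> (case_nat s t))"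
    using Suc.prems(2) by auto
  have "\<exists>t. Z (case_nat (min e e') t)"
    using e(1) e'(1) by (simp add: min_def)
  moreover have "sel k (\<lambda>t. Z (case_nat s t)) (\<lambda>t. \<phi> (case_nat s t) \<and> \<psi> (case_nat s t))"
    if "\<exists>t. Z (case_nat s t)" "s \<le> min e e'" for s
    using Suc.IH[OF e(2)[OF that(1)] e'(2)[OF that(1)]] that(2) by simp
  ultimately show ?case
    unfolding sel.simps by (intro exI[of _ "min e e'"]) blast
qed simp

lemma sel_mono:
  "supp k Z \<Longrightarrow> \<exists>t. Z t \<Longrightarrow> sel k Z \<phi> \<Longrightarrow> (\<And>t. Z t \<Longrightarrow> \<phi> t \<Longrightarrow> \<psi> t) \<Longrightarrow> sel k Z \<psi>"
proof (induction k arbitrary: Z \<phi> \<psi>)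
  case 0
  then show ?case
    using sel_base[OF 0(1,2)] by simp
next
  case (Suc k)
  obtain e where e: "\<exists>t. Z (case_nat e t)"
    "\<And>s. \<exists>t. Z (case_nat s t) \<Longrightarrow> s \<le> e \<Longrightarrow> sel k (\<lambda>t. Z (case_nat s t)) (\<lambda>t. \<phi> (case_nat s t))"
    using Suc.prems(3) by auto
  have "sel k (\<lambda>t. Z (case_nat s t)) (\<lambda>t. \<psi> (case_nat s t))" if s: "\<exists>t. Z (case_nat s t)" "s \<le> e" for s
    by (rule Suc.IH[OF supp_case_nat[OF Suc.prems(1)] s(1) e(2)[OF s]]) (rule Suc.prems(4))
  with e(1) show ?case
    by auto
qed

lemma not_sel_False: "\<not> sel k Z (\<lambda>t. False)"
proof (induction k arbitrary: Z)
  case (Suc k)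
  show ?case
  proof
    assume "sel (Suc k) Z (\<lambda>t. False)"
    then obtain e where "\<exists>t. Z (case_nat e t)"
      "\<forall>s. (\<exists>t. Z (case_nat s t)) \<and> s \<le> e \<longrightarrow> sel k (\<lambda>t. Z (case_nat s t)) (\<lambda>t. False)"
      by auto
    with Suc.IH[of "\<lambda>t. Z (case_nat e t)"] show False
      by blast
  qed
qed simp

text \<open>The recursion unfolds to finitely many first-order quantifiers, so the ultrafilter
  depends definably on parameters \<open>p\<close> of the set and of the property. This is what
  makes the limit addition definable.\<close>

lemma dfn_sel:
  assumes "dfn UNIV (\<lambda>v. Z (\<lambda>i. v (2 * i)) (\<lambda>i. v (2 * i + 1)))"
    and "dfn UNIV (\<lambda>v. \<phi> (\<lambda>i. v (2 * i)) (\<lambda>i. v (2 * i + 1)))"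
  shows "dfn UNIV (\<lambda>p. sel k (Z p) (\<phi> p))"
  using assms
proof (induction k arbitrary: Z \<phi>)
  case 0
  show ?case
    unfolding sel.simps by (rule dfn_2_env[OF 0(2)]) auto
next
  case (Suc k)
  have shift: "dfn UNIV (\<lambda>v. \<psi> (\<lambda>i. v (2 * Suc (Suc i))) (case_nat (v (2 * 0)) (\<lambda>i. v (2 * i + 1))))"
    if "dfn UNIV (\<lambda>v. \<psi> (\<lambda>i. v (2 * i)) (\<lambda>i. v (2 * i + 1)))" for \<psi>
    by (rule dfn_2_env[OF that]) (auto intro: atomic_trm_case_nat)
  have inner: "dfn UNIV (\<lambda>p. sel k (\<lambda>t. Z (\<lambda>i. p (Suc (Suc i))) (case_nat (p 0) t))
      (\<lambda>t. \<phi> (\<lambda>i. p (Suc (Suc i))) (case_nat (p 0) t)))"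
    by (rule Suc.IH[of "\<lambda>p t. Z (\<lambda>i. p (Suc (Suc i))) (case_nat (p 0) t)"
          "\<lambda>p t. \<phi> (\<lambda>i. p (Suc (Suc i))) (case_nat (p 0) t)"]; rule shift; fact)
  have Z_ex: "dfn UNIV (\<lambda>v. \<exists>t. Z (h v) (case_nat (f v) t))"
    if h: "\<And>i. atomic_trm UNIV (\<lambda>v. h v i)" and f: "atomic_trm UNIV f" for h f
  proof (rule dfn_ex_env, rule dfn_2_env[OF Suc.prems(1)])
    show "atomic_trm UNIV (\<lambda>v. h (\<lambda>i. v (2 * i)) i)" for i
      by (rule atomic_trm_comp[OF h]) simp
    show "atomic_trm UNIV (\<lambda>v. case_nat (f (\<lambda>i. v (2 * i))) (\<lambda>i. v (2 * i + 1)) i)" for i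
      by (intro atomic_trm_case_nat atomic_trm_comp[OF f] atomic_trm_var)
  qed
  show ?case
    unfolding sel.simps by (intro dfn_intros Z_ex inner)
qed

text \<open>The first coordinates \<open>s\<close> for which the property is selected in the fibre
  form a definable set, and such a set is decided near the bottom of the projection by
  \<open>bottom_germ\<close>.\<close>

lemma sel_ultra:
  "supp k Z \<Longrightarrow> \<exists>t. Z t \<Longrightarrow> dfn UNIV Z \<Longrightarrow> dfn UNIV \<phi> \<Longrightarrow> sel k Z \<phi> \<or> sel k Z (\<lambda>t. \<not> \<phi> t)"
proof (induction k arbitrary: Z \<phi>)
  case (Suc k)
  define X where "X = {s. \<exists>t. Z (case_nat s t)}"
  define Y where "Y = {s. sel k (\<lambda>t. Z (case_nat s t)) (\<lambda>t. \<phi> (case_nat s t))}"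
  have shift: "dfn UNIV (\<lambda>v. \<psi> (case_nat (v (2 * 0)) (\<lambda>i. v (2 * i + 1))))"
    if "dfn UNIV \<psi>" for \<psi>
    by (rule dfn_env[OF that]) (intro atomic_trm_case_nat atomic_trm_var)
  have dX: "dset X"
    unfolding dset_def X_def mem_Collect_eq by (rule dfn_ex_env, rule shift, fact)
  have dY: "dset Y"
    unfolding dset_def Y_def mem_Collect_eq
    by (rule dfn_sel[of "\<lambda>p t. Z (case_nat (p 0) t)" "\<lambda>p t. \<phi> (case_nat (p 0) t)"]; rule shift; fact)
  have fix_first: "dfn UNIV (\<lambda>t. \<psi> (case_nat s t))" if "dfn UNIV \<psi>" for \<psi> s
    by (rule dfn_env[OF that]) (intro atomic_trm_case_nat atomic_trm_var atomic_trm_const UNIV_I)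
  obtain x0 where "x0 \<in> X"
    using Suc.prems(2) unfolding ex_case_nat[of Z] X_def by blast
  then obtain e where e: "e \<in> X" "(\<forall>s\<in>X. s \<le> e \<longrightarrow> s \<in> Y) \<or> (\<forall>s\<in>X. s \<le> e \<longrightarrow> s \<notin> Y)"
    using omin_dir.bottom_germ[OF up_dir dX _ dY, of x0] unfolding omin_dir.le_def[OF up_dir] order_le_less
    by blast
  have "sel k (\<lambda>t. Z (case_nat s t)) (\<lambda>t. \<not> \<phi> (case_nat s t))" if "s \<in> X" "s \<notin> Y" for s
    using Suc.IH[OF supp_case_nat[OF Suc.prems(1), of s] _ fix_first[OF Suc.prems(3)] fix_first[OF Suc.prems(4)]]
      that unfolding X_def Y_def by blast
  with e show ?case
    unfolding sel.simps X_def Y_def by blast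
qed simp

end

section \<open>Increasing unions of short intervals\<close>

context omin
begin

text \<open>Going through \<open>V\<close> one element at a time, some \<open>c\<close> is the first
  that makes \<open>d\<close> definable; exchange recovers this \<open>c\<close> from
  \<open>d\<close> and the other elements.\<close>

lemma dcl_drop:
  "finite V \<Longrightarrow> d \<in> dcl (B \<union> V) \<Longrightarrow> d \<notin> dcl B \<Longrightarrow> \<exists>c\<in>V. c \<in> dcl (insert d (B \<union> (V - {c})))"
proof (induction V rule: finite_induct)
  case (insert c V)
  show ?case
  proof (cases "d \<in> dcl (B \<union> V)")
    case True
    then obtain b where b: "b \<in> V" "b \<in> dcl (insert d (B \<union> (V - {b})))"
      using insert.IH insert.prems(2) by blast
    have "insert d (B \<union> (V - {b})) \<subseteq> insert d (B \<union> (insert c V - {b}))"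
      by blast
    with b show ?thesis
      using dcl_mono by blast
  next
    case False
    then have "c \<in> dcl (insert d (B \<union> V))"
      using dcl_exchange[of d c "B \<union> V"] insert.prems(1) by simp
    moreover have "B \<union> V = B \<union> (insert c V - {c})"
      using insert.hyps(2) by blast
    ultimately show ?thesis
      by (metis insertI1)
  qed
qed simp

end

definition family_op :: "((nat \<Rightarrow> 'a) \<Rightarrow> bool) \<Rightarrow> (nat \<Rightarrow> 'a) \<Rightarrow> 'a \<Rightarrow> 'a \<Rightarrow> 'a \<Rightarrow> bool" where
  "family_op Q t u v w \<longleftrightarrow> Q (case_nat u (case_nat v (case_nat w t)))"

lemma (in fo_str) dfn_family_op:
  assumes "dfn {} Q" "\<And>i. atomic_trm B (\<lambda>v. t v i)" "atomic_trm B f" "atomic_trm B g" "atomic_trm B h"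
  shows "dfn B (\<lambda>v. family_op Q (t v) (f v) (g v) (h v))"
  unfolding family_op_def
  by (rule dfn_env[OF dfn_mono[OF assms(1) empty_subsetI]]) (intro atomic_trm_case_nat assms)

context omin_dir
begin

text \<open>The restriction to the interval belongs to the notion, since for a given
  \<open>t\<close> the relation \<open>family_op Q t\<close> may hold of arbitrary points
  elsewhere.\<close>

definition chunk :: "((nat \<Rightarrow> 'a) \<Rightarrow> bool) \<Rightarrow> 'a \<Rightarrow> 'a \<Rightarrow> (nat \<Rightarrow> 'a) \<Rightarrow> bool" where
  "chunk Q x y t \<longleftrightarrow> x \<sqsubset> y \<and> partial_addition (itv x y) (restr (itv x y) (family_op Q t))"

lemma restr_restr: "J' \<subseteq> J \<Longrightarrow> restr J' (restr J P) = restr J' P"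
  by (auto simp: restr_def fun_eq_iff)

lemma chunk_antimono:
  assumes "chunk Q x y t" "x \<sqsubset> y'" "y' \<sqsubseteq> y"
  shows "chunk Q x y' t"
proof -
  have sub: "itv x y' \<subseteq> itv x y"
    using assms(3) by (auto intro: dir.less_le_trans)
  have "partial_addition (itv x y') (restr (itv x y') (restr (itv x y) (family_op Q t)))"
    by (rule partial_addition_restr[of "itv x y"])
      (use assms(1) sub in \<open>auto simp: chunk_def intro: dir.less_trans\<close>)
  with assms(2) show ?thesis
    unfolding chunk_def restr_restr[OF sub] by blast
qed

text \<open>The axioms of a partial addition are finitely many first-order conditions, so
  \<open>y\<close> and \<open>t\<close> can be quantified and only \<open>x\<close> is
  named.\<close>

lemma dfn_chunk:
  assumes "dfn {} Q"
  shows "dfn {x} (\<lambda>v. chunk Q x (v 0) (\<lambda>i. v (Suc i)))"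
  unfolding chunk_def partial_addition_def restr_def mem_itv
  by (intro dfn_dir_intros dfn_family_op[OF assms]) auto

lemma family_op_support:
  assumes "dfn {} Q"
  obtains k where "\<And>t t'. (\<And>i. i < k \<Longrightarrow> t i = t' i) \<Longrightarrow> family_op Q t = family_op Q t'"
proof -
  obtain N where N: "\<And>v v'. (\<And>i. i < N \<Longrightarrow> v i = v' i) \<Longrightarrow> Q v = Q v'"
    using dfn_support[OF assms] by blast
  show ?thesis
  proof
    fix t t' :: "nat \<Rightarrow> 'a" assume t: "\<And>i. i < N \<Longrightarrow> t i = t' i"
    have "Q (case_nat u (case_nat v (case_nat w t))) = Q (case_nat u (case_nat v (case_nat w t')))" for u v w
      by (rule N) (use t in \<open>auto split: nat.split\<close>)
    then show "family_op Q t = family_op Q t'"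
      by (simp add: family_op_def fun_eq_iff)
  qed
qed

end

text \<open>
  All intervals \<open>(x, y)\<close> with \<open>y \<in> R\<close> carry an addition from one definable family, but no final
  segment of \<open>R\<close> is short; this is going to be contradictory.
\<close>

locale tail_family = omin_dir M lt
  for M :: "('f, 'r, 'a::unbounded_dense_linorder) fo_structure" and lt (infix "\<sqsubset>" 50) +
  fixes R :: "'a set" and x :: 'a and Q :: "(nat \<Rightarrow> 'a) \<Rightarrow> bool"
  assumes dset_R: "dset R" and conv_R: "conv R" and no_max_R: "no_max R" and R_ne: "R \<noteq> {}"
    and x_less: "\<And>r. r \<in> R \<Longrightarrow> x \<sqsubset> r" and R_down: "\<And>z r. x \<sqsubset> z \<Longrightarrow> z \<sqsubseteq> r \<Longrightarrow> r \<in> R \<Longrightarrow> z \<in> R"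
    and dfn_Q: "dfn {} Q" and ex_chunk: "\<And>y. y \<in> R \<Longrightarrow> \<exists>t. chunk Q x y t"
    and SH_bounded: "\<And>y. y \<in> R \<Longrightarrow> SH (itv x y)"
    and long: "\<And>y. y \<in> R \<Longrightarrow> \<not> SH {z \<in> R. y \<sqsubset> z}"
begin

lemma R_above: "y \<in> R \<Longrightarrow> \<exists>z\<in>R. y \<sqsubset> z"
  using no_max_R by (simp add: no_max_def)

lemma R_above2: "y \<in> R \<Longrightarrow> y' \<in> R \<Longrightarrow> \<exists>z\<in>R. y \<sqsubset> z \<and> y' \<sqsubset> z"
  using R_above by (metis dir.less_trans dir.neqE)

text \<open>
  If no \<open>d\<close> belonged to all sets \<open>W y\<close>, then \<open>d \<mapsto> sup {y. W y d}\<close> would map a short set onto a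
  set that contains a final segment of \<open>R\<close>.
\<close>

lemma descending_intersection:
  assumes W: "dfn UNIV (\<lambda>v. W (v 0) (v 1))" and w: "w \<in> R"
    and bounded: "\<And>y d. y \<in> R \<Longrightarrow> W y d \<Longrightarrow> x \<sqsubset> d \<and> d \<sqsubset> w"
    and dec: "\<And>y y' d. y \<in> R \<Longrightarrow> y' \<in> R \<Longrightarrow> y' \<sqsubseteq> y \<Longrightarrow> W y d \<Longrightarrow> W y' d"
    and ne: "\<And>y. y \<in> R \<Longrightarrow> \<exists>d. W y d"
  obtains d where "\<And>y. y \<in> R \<Longrightarrow> W y d"
proof (rule ccontr)
  assume "\<not> thesis"
  then have "\<exists>y\<in>R. \<not> W y d" for d
    using that by blast
  then obtain b where b: "\<And>d. b d \<in> R \<and> \<not> W (b d) d"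
    by metis
  define D where "D = {d. \<exists>y. y \<in> R \<and> W y d}"
  \<comment> \<open>\<open>K d s\<close> says that \<open>s\<close> is the supremum of the
    \<open>y\<close> in \<open>R\<close> with \<open>W y d\<close>; the bound \<open>b d\<close>
    guarantees its existence.\<close>
  define K where "K = (\<lambda>d s. (\<forall>y. y \<in> R \<and> W y d \<longrightarrow> y \<sqsubseteq> s) \<and> (\<forall>u. (\<forall>y. y \<in> R \<and> W y d \<longrightarrow> y \<sqsubseteq> u) \<longrightarrow> s \<sqsubseteq> u))"
  have le_b: "y \<sqsubseteq> b d" if "y \<in> R" "W y d" for y d
  proof (rule ccontr)
    assume "\<not> y \<sqsubseteq> b d"
    then have "b d \<sqsubseteq> y"
      by (metis dir.linear)
    with dec[OF that(1) _ _ that(2)] b show False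
      by blast
  qed
  have dD: "dset D"
    unfolding dset_def D_def mem_Collect_eq
    by (intro dfn_intros dset_atomic[OF dset_R] dfn_2[OF W])
  have dK: "dfn UNIV (\<lambda>v. K (v 0) (v 1))"
    unfolding K_def by (intro dfn_dir_intros dset_atomic[OF dset_R] dfn_2[OF W])
  obtain f where f: "dfun D f" "\<And>d. d \<in> D \<Longrightarrow> K d (f d)"
  proof (rule dfun_relation[OF dK _ dD])
    show "s = s'" if "K d s" "K d s'" for d s s'
      using that unfolding K_def by (metis dir.order_antisym)
    show "\<exists>s. K d s" if "d \<in> D" for d
    proof -
      have dY: "dset {y. y \<in> R \<and> W y d}"
        unfolding dset_def mem_Collect_eq
        by (intro dfn_intros dset_atomic[OF dset_R] dfn_2[OF W] UNIV_I)
      obtain y0 where y0: "y0 \<in> {y. y \<in> R \<and> W y d}"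
        using \<open>d \<in> D\<close> by (auto simp: D_def)
      obtain s where "\<And>y. y \<in> {y. y \<in> R \<and> W y d} \<Longrightarrow> y \<sqsubseteq> s"
        "\<And>u. (\<And>y. y \<in> {y. y \<in> R \<and> W y d} \<Longrightarrow> y \<sqsubseteq> u) \<Longrightarrow> s \<sqsubseteq> u"
        using ex_lub[OF dY y0, of "b d"] le_b by blast
      then have "K d s"
        unfolding K_def by blast
      then show ?thesis ..
    qed
  qed (auto intro: that)
  have "D \<subseteq> itv x w"
    using bounded by (auto simp: D_def)
  then have "SH D"
    using SH_subset[OF SH_bounded[OF w] dD] by blast
  then have SH_f: "SH (f ` D)"
    using SH_image f(1) by blast
  obtain r where r: "r \<in> R" "{z \<in> R. r \<sqsubset> z} \<subseteq> f ` D \<or> {z \<in> R. r \<sqsubset> z} \<inter> f ` D = {}"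
    using cuts_tail[OF SH_dset[OF SH_f] conv_R R_ne no_max_R] .
  obtain y where y: "y \<in> R" "r \<sqsubset> y"
    using R_above[OF r(1)] by blast
  obtain d where d: "W y d"
    using ne[OF y(1)] by blast
  have "d \<in> D"
    using y(1) d by (auto simp: D_def)
  note K = f(2)[OF this, unfolded K_def]
  \<comment> \<open>The value of \<open>f\<close> at a point of \<open>W y\<close> lies between
    \<open>y\<close> and \<open>b d\<close>, hence in \<open>R\<close> and beyond \<open>r\<close>.
    So the tail of \<open>R\<close> meets the image and is therefore contained in it.\<close>
  have "y \<sqsubseteq> f d"
    using K y(1) d by blast
  moreover have "f d \<sqsubseteq> b d"
    using K le_b by blast
  ultimately have "f d \<in> {z \<in> R. r \<sqsubset> z}"
    using y(2) b R_down x_less r(1) by (metis (mono_tags, lifting) dir.less_le_trans mem_Collect_eq dir.less_trans)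
  with r(2) \<open>d \<in> D\<close> have "{z \<in> R. r \<sqsubset> z} \<subseteq> f ` D"
    by blast
  moreover have "dset {z \<in> R. r \<sqsubset> z}"
    unfolding dset_def mem_Collect_eq by (intro dfn_dir_intros dset_atomic[OF dset_R] UNIV_I)
  ultimately show False
    using SH_subset[OF SH_f] long[OF r(1)] by blast
qed

text \<open>\<open>Z y\<close> collects the parameters that are still allowed for the addition up to
  \<open>y\<close>. It may shrink as \<open>y\<close> grows but never becomes empty; no single
  parameter is asked to work for all \<open>y\<close>.\<close>

definition admissible :: "nat \<Rightarrow> ('a \<Rightarrow> (nat \<Rightarrow> 'a) \<Rightarrow> bool) \<Rightarrow> bool" where
  "admissible k Z \<longleftrightarrow> (\<forall>y\<in>R. \<forall>t. Z y t \<longrightarrow> chunk Q x y t) \<and>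
     (\<forall>y\<in>R. \<forall>y'\<in>R. y' \<sqsubseteq> y \<longrightarrow> (\<forall>t. Z y t \<longrightarrow> Z y' t)) \<and> (\<forall>y\<in>R. \<exists>t. Z y t) \<and> (\<forall>y. supp k (Z y))"

text \<open>The values of \<open>w - u\<close> that stay possible however large \<open>y\<close>
  becomes; different \<open>y\<close> may need different parameters for the same value.\<close>

definition diffs :: "('a \<Rightarrow> (nat \<Rightarrow> 'a) \<Rightarrow> bool) \<Rightarrow> 'a \<Rightarrow> 'a \<Rightarrow> 'a set" where
  "diffs Z u w = {d. (x \<sqsubset> d \<and> d \<sqsubset> w) \<and> (\<forall>y. y \<in> R \<longrightarrow> (\<exists>t. Z y t \<and> family_op Q t u d w))}"

text \<open>In terms of the rank belonging to \<open>dcl\<close>: the tuple of the first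
  \<open>k\<close> coordinates of \<open>t\<close> has rank at most \<open>n\<close> over
  \<open>B\<close>.\<close>

definition spans :: "'a set \<Rightarrow> nat \<Rightarrow> (nat \<Rightarrow> 'a) \<Rightarrow> nat \<Rightarrow> bool" where
  "spans B k t n \<longleftrightarrow> (\<exists>U \<subseteq> {..<k}. card U \<le> n \<and> (\<forall>i<k. t i \<in> dcl (B \<union> t ` U)))"

text \<open>By exchange \<open>d\<close> takes the place of one of the coordinates generating
  \<open>t\<close>, so one generator fewer is needed once \<open>d\<close> is named.\<close>

lemma spans_drop:
  assumes spans: "spans B k t n" and B: "B \<subseteq> B'" and d: "d \<in> dcl (B' \<union> t ` {..<k})" "d \<notin> dcl B'"
  shows "n \<noteq> 0 \<and> spans (insert d B') k t (n - 1)"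
proof -
  obtain U where U: "U \<subseteq> {..<k}" "card U \<le> n" "\<And>i. i < k \<Longrightarrow> t i \<in> dcl (B \<union> t ` U)"
    using spans unfolding spans_def by blast
  have fin: "finite U"
    using U(1) finite_subset by blast
  have "t i \<in> dcl (B' \<union> t ` U)" if "i < k" for i
    using U(3)[OF that] dcl_mono[of "B \<union> t ` U" "B' \<union> t ` U"] B by blast
  then have "B' \<union> t ` {..<k} \<subseteq> dcl (B' \<union> t ` U)"
    using dcl_superset[of "B' \<union> t ` U"] by blast
  then have "d \<in> dcl (B' \<union> t ` U)"
    using dcl_trans d(1) by blast
  then obtain c where "c \<in> t ` U" and c: "c \<in> dcl (insert d (B' \<union> (t ` U - {c})))"
    using dcl_drop[of "t ` U" d B'] fin d(2) by blast
  then obtain j where j: "j \<in> U" "c = t j"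
    by blast
  define U' where "U' = U - {j}"
  have "insert d (B' \<union> (t ` U - {c})) \<subseteq> insert d B' \<union> t ` U'"
    using j by (auto simp: U'_def)
  then have "c \<in> dcl (insert d B' \<union> t ` U')"
    using c dcl_mono by blast
  then have "B \<union> t ` U \<subseteq> dcl (insert d B' \<union> t ` U')"
    using dcl_superset[of "insert d B' \<union> t ` U'"] B j(2) unfolding U'_def by blast
  then have "t i \<in> dcl (insert d B' \<union> t ` U')" if "i < k" for i
    using U(3)[OF that] dcl_trans by blast
  moreover have "card U' \<le> n - 1" "n \<noteq> 0"
    using U(2) j(1) fin card_gt_0_iff[of U] by (auto simp: U'_def)
  moreover have "U' \<subseteq> {..<k}"
    using U(1) by (auto simp: U'_def)
  ultimately show ?thesis
    unfolding spans_def by blast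
qed

lemma chunk_diff_unique:
  assumes "chunk Q x y t" "w \<sqsubset> y" "x \<sqsubset> u" "x \<sqsubset> d" "d \<sqsubset> w" "x \<sqsubset> d'" "d' \<sqsubset> w" "u \<sqsubset> w"
    and "family_op Q t u d w" "family_op Q t u d' w"
  shows "d = d'"
proof -
  have "restr (itv x y) (family_op Q t) u d w" "restr (itv x y) (family_op Q t) u d' w"
    using assms unfolding restr_def by (auto intro: dir.less_trans)
  then show ?thesis
    using partial_addition_cancel assms(1) unfolding chunk_def by blast
qed

text \<open>
  Fixing a difference that is not yet determined lowers the rank of the parameters, so after finitely
  many steps every difference has only finitely many possible values.
\<close>

lemma ex_finite_diffs:
  assumes op: "\<And>t t'. (\<And>i. i < k \<Longrightarrow> t i = t' i) \<Longrightarrow> family_op Q t = family_op Q t'"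
  shows "finite B \<Longrightarrow> x \<in> B \<Longrightarrow> dfn B (\<lambda>v. v 0 \<in> R) \<Longrightarrow> dfn B (\<lambda>v. Z (v 0) (\<lambda>i. v (Suc i))) \<Longrightarrow>
    admissible k Z \<Longrightarrow> (\<And>y t. y \<in> R \<Longrightarrow> Z y t \<Longrightarrow> spans B k t n) \<Longrightarrow>
    \<exists>Z'. dfn UNIV (\<lambda>v. Z' (v 0) (\<lambda>i. v (Suc i))) \<and> admissible k Z' \<and>
      (\<forall>u\<in>R. \<forall>w\<in>R. u \<sqsubset> w \<longrightarrow> finite (diffs Z' u w))"
proof (induction n arbitrary: B Z rule: less_induct)
  case (less n)
  show ?case
  proof (cases "\<forall>u\<in>R. \<forall>w\<in>R. u \<sqsubset> w \<longrightarrow> finite (diffs Z u w)")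
    case True
    then show ?thesis
      using less.prems(4,5) dfn_mono by blast
  next
    case False
    then obtain u w where uw: "u \<in> R" "w \<in> R" "u \<sqsubset> w" "infinite (diffs Z u w)"
      by blast
    \<comment> \<open>\<open>u\<close> and \<open>w\<close> are named before \<open>d\<close> is
      chosen, so that the set of possible differences is definable over \<open>B'\<close> and
      contains a point generic over \<open>B'\<close>.\<close>
    define B' where "B' = insert u (insert w B)"
    have B': "B \<subseteq> B'" "finite B'" "u \<in> B'" "w \<in> B'" "x \<in> B'"
      using less.prems(1,2) by (auto simp: B'_def)
    have Z: "dfn C (\<lambda>v. Z (f v) (h v))" if "B \<subseteq> C" "atomic_trm C f" "\<And>i. atomic_trm C (\<lambda>v. h v i)" for C f h
      using dfn_1_env[OF dfn_mono[OF less.prems(4) that(1)] that(2,3)] .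
    have R: "dfn C (\<lambda>v. f v \<in> R)" if "B \<subseteq> C" "atomic_trm C f" for C f
      using dfn_1[OF dfn_mono[OF less.prems(3) that(1)] that(2)] .
    have "dfn B' (\<lambda>v. v 0 \<in> diffs Z u w)"
      unfolding diffs_def mem_Collect_eq
      by (intro dfn_dir_intros dfn_ex_env R Z dfn_family_op[OF dfn_Q]) (use B' in auto)
    then obtain d where d: "d \<in> diffs Z u w" "d \<notin> dcl B'"
      using ex_generic[OF countable_finite[OF B'(2)] _ uw(4)] by blast
    \<comment> \<open>The value \<open>d\<close> is prescribed for some \<open>y'\<close> above both
      \<open>y\<close> and \<open>w\<close>. Being above \<open>w\<close> makes \<open>w - u\<close>
      unique for each parameter, and quantifying over \<open>y'\<close> keeps the family decreasing
      in \<open>y\<close>.\<close>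
    define Z1 where "Z1 = (\<lambda>y t. \<exists>y'. y' \<in> R \<and> y \<sqsubseteq> y' \<and> w \<sqsubset> y' \<and> Z y' t \<and> family_op Q t u d w)"
    have adm: "\<And>y t. y \<in> R \<Longrightarrow> Z y t \<Longrightarrow> chunk Q x y t"
      "\<And>y y' t. y \<in> R \<Longrightarrow> y' \<in> R \<Longrightarrow> y' \<sqsubseteq> y \<Longrightarrow> Z y t \<Longrightarrow> Z y' t"
      "\<And>y. supp k (Z y)"
      using less.prems(5) unfolding admissible_def by blast+
    have d': "x \<sqsubset> d" "d \<sqsubset> w" "\<And>y. y \<in> R \<Longrightarrow> \<exists>t. Z y t \<and> family_op Q t u d w"
      using d(1) unfolding diffs_def by blast+
    have Z1_Z: "Z y t" if "y \<in> R" "Z1 y t" for y t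
      using that adm(2) unfolding Z1_def by blast
    have adm1: "admissible k Z1"
      unfolding admissible_def
    proof (intro conjI ballI allI impI)
      show "chunk Q x y t" if "y \<in> R" "Z1 y t" for y t
        using adm(1) Z1_Z that by blast
      show "Z1 y' t" if "y \<in> R" "y' \<in> R" "y' \<sqsubseteq> y" "Z1 y t" for y y' t
        using that unfolding Z1_def by (meson dir.order_trans)
      show "\<exists>t. Z1 y t" if y: "y \<in> R" for y
      proof -
        obtain y' where "y' \<in> R" "y \<sqsubset> y'" "w \<sqsubset> y'"
          using R_above2[OF y uw(2)] by blast
        then show ?thesis
          using d'(3)[of y'] unfolding Z1_def by (meson dir.less_imp_le)
      qed
      show "supp k (Z1 y)" for y
        unfolding supp_def
      proof (intro allI impI)
        fix t t' :: "nat \<Rightarrow> 'a" assume tt: "\<forall>i<k. t i = t' i"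
        have "family_op Q t = family_op Q t'"
          by (rule op) (use tt in simp)
        moreover have "Z y' t = Z y' t'" for y'
          using adm(3)[of y'] tt unfolding supp_def by blast
        ultimately show "Z1 y t = Z1 y t'"
          unfolding Z1_def by simp
      qed
    qed
    have dZ1: "dfn (insert d B') (\<lambda>v. Z1 (v 0) (\<lambda>i. v (Suc i)))"
      unfolding Z1_def
      by (intro dfn_dir_intros R Z dfn_family_op[OF dfn_Q]) (use B' in auto)
    have drop: "n \<noteq> 0 \<and> spans (insert d B') k t (n - 1)" if yt: "y \<in> R" "Z1 y t" for y t
    proof (rule spans_drop[OF _ B'(1) _ d(2)])
      obtain y' where y': "y' \<in> R" "w \<sqsubset> y'" "Z y' t" "family_op Q t u d w"
        using yt(2) unfolding Z1_def by blast
      show "spans B k t n"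
        using less.prems(6) y' by blast
      \<comment> \<open>Coordinates from \<open>k\<close> on do not influence the operation.
        Replacing them by \<open>x\<close> leaves only named parameters and the first
        \<open>k\<close> coordinates of \<open>t\<close>.\<close>
      define t0 where "t0 = (\<lambda>i. if i < k then t i else x)"
      have t0: "family_op Q t0 = family_op Q t"
        by (rule op) (simp add: t0_def)
      have "dfn (B' \<union> t ` {..<k}) (\<lambda>v. (x \<sqsubset> v 0 \<and> v 0 \<sqsubset> w) \<and> family_op Q t0 u (v 0) w)"
        by (intro dfn_dir_intros dfn_family_op[OF dfn_Q]) (use B' in \<open>auto simp: t0_def\<close>)
      then have "dfn (B' \<union> t ` {..<k}) (\<lambda>v. v 0 = d)"
      proof (rule dfn_cong)
        fix v :: "nat \<Rightarrow> 'a"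
        have "x \<sqsubset> u"
          using x_less uw(1) by blast
        then show "((x \<sqsubset> v 0 \<and> v 0 \<sqsubset> w) \<and> family_op Q t0 u (v 0) w) = (v 0 = d)"
          using chunk_diff_unique[OF adm(1)[OF y'(1,3)] y'(2), of u d "v 0"] d' uw(3) y'(4)
          unfolding t0 by metis
      qed
      then show "d \<in> dcl (B' \<union> t ` {..<k})"
        by (simp add: dcl_def)
    qed
    \<comment> \<open>One admissible parameter suffices to see that \<open>n\<close> is not 0: with
      rank 0 every difference would already be in \<open>dcl B'\<close>, and \<open>d\<close> is
      not.\<close>
    obtain y0 t0 where "y0 \<in> R" "Z1 y0 t0"
      using R_ne adm1 unfolding admissible_def by blast
    then have "n - 1 < n"
      using drop by (metis diff_less less_one not_gr_zero)
    moreover have "dfn (insert d B') (\<lambda>v. v 0 \<in> R)"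
      by (rule R) (use B' in auto)
    ultimately show ?thesis
      using less.IH[of "n - 1" "insert d B'" Z1] B' dZ1 adm1 drop by blast
  qed
qed

theorem contradiction: False
proof -
  obtain k where op: "\<And>t t'. (\<And>i. i < k \<Longrightarrow> t i = t' i) \<Longrightarrow> family_op Q t = family_op Q t'"
    using family_op_support[OF dfn_Q] by blast
  obtain B where B: "finite B" "B \<subseteq> UNIV" "dfn B (\<lambda>v. v 0 \<in> R)"
    using dfn_finite_params[OF dset_R[unfolded dset_def]] .
  \<comment> \<open>The start: all parameters are allowed, and \<open>k\<close> coordinates have
    rank at most \<open>k\<close>.\<close>
  have "\<exists>Z. dfn UNIV (\<lambda>v. Z (v 0) (\<lambda>i. v (Suc i))) \<and> admissible k Z \<and>
      (\<forall>u\<in>R. \<forall>w\<in>R. u \<sqsubset> w \<longrightarrow> finite (diffs Z u w))"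
  proof (rule ex_finite_diffs[where k = k and B = "insert x B" and Z = "chunk Q x" and n = k, OF op])
    show "dfn (insert x B) (\<lambda>v. chunk Q x (v 0) (\<lambda>i. v (Suc i)))"
      using dfn_mono[OF dfn_chunk[OF dfn_Q]] by simp
    show "dfn (insert x B) (\<lambda>v. v 0 \<in> R)"
      using dfn_mono[OF B(3)] by blast
    show "admissible k (chunk Q x)"
      unfolding admissible_def
    proof (intro conjI ballI allI impI)
      show "chunk Q x y' t" if "y' \<in> R" "y' \<sqsubseteq> y" "chunk Q x y t" for y y' t
        using chunk_antimono that x_less by blast
      show "supp k (chunk Q x y)" for y
        unfolding supp_def chunk_def using op by (metis (no_types, lifting))
    qed (use ex_chunk in blast)+
    show "spans (insert x B) k t k" for t
      unfolding spans_def
      by (rule exI[of _ "{..<k}"]) (use dcl_superset[of "insert x B \<union> t ` {..<k}"] in auto)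
  qed (use B(1) in auto)
  then obtain Z where Z: "dfn UNIV (\<lambda>v. Z (v 0) (\<lambda>i. v (Suc i)))" and adm: "admissible k Z"
    and fin: "\<And>u w. u \<in> R \<Longrightarrow> w \<in> R \<Longrightarrow> u \<sqsubset> w \<Longrightarrow> finite (diffs Z u w)"
    by blast
  note dZ = dfn_1_env[where P = Z, OF Z]
  have chunk: "chunk Q x y t" if "y \<in> R" "Z y t" for y t
    using adm that unfolding admissible_def by blast
  have dec: "Z y' t" if "y \<in> R" "y' \<in> R" "y' \<sqsubseteq> y" "Z y t" for y y' t
    using adm that unfolding admissible_def by blast
  have ne: "\<exists>t. Z y t" if "y \<in> R" for y
    using adm that unfolding admissible_def by blast
  have supp: "supp k (Z y)" for y
    using adm unfolding admissible_def by blast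

  \<comment> \<open>The limit of the ultrafilters \<open>sel k (Z y)\<close> as \<open>y\<close>
    moves to the upper end of \<open>R\<close>.\<close>
  define ev where "ev = (\<lambda>\<phi>. \<exists>y0. y0 \<in> R \<and> (\<forall>y. y \<in> R \<and> y0 \<sqsubset> y \<longrightarrow> sel k (Z y) \<phi>))"
  have ev_Z: "ev (Z y)" if "y \<in> R" for y
    unfolding ev_def
  proof (rule exI[of _ y], intro conjI allI impI)
    fix y' assume y': "y' \<in> R \<and> y \<sqsubset> y'"
    show "sel k (Z y') (Z y)"
      by (rule sel_all[OF supp ne]) (use y' that dec[of y' y] in \<open>auto simp: dir.less_imp_le\<close>)
  qed fact
  have ev_mono: "ev \<psi>" if "ev \<phi>" "y \<in> R" "\<And>t. Z y t \<Longrightarrow> \<phi> t \<Longrightarrow> \<psi> t" for \<phi> \<psi> y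
  proof -
    obtain y0 where y0: "y0 \<in> R" "\<forall>y. y \<in> R \<and> y0 \<sqsubset> y \<longrightarrow> sel k (Z y) \<phi>"
      using \<open>ev \<phi>\<close> unfolding ev_def by blast
    obtain y1 where y1: "y1 \<in> R" "y \<sqsubset> y1" "y0 \<sqsubset> y1"
      using R_above2[OF \<open>y \<in> R\<close> y0(1)] by blast
    have "sel k (Z y') \<psi>" if y': "y' \<in> R" "y1 \<sqsubset> y'" for y'
    proof (rule sel_mono[OF supp ne[OF y'(1)]])
      show "sel k (Z y') \<phi>"
        using y0 y1 y' by (meson dir.less_trans)
      show "\<psi> t" if "Z y' t" "\<phi> t" for t
        using \<open>\<And>t. Z y t \<Longrightarrow> \<phi> t \<Longrightarrow> \<psi> t\<close>[OF dec[OF y'(1) \<open>y \<in> R\<close> _ that(1)] that(2)] y1 y'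
        by (meson dir.less_imp_le dir.less_trans)
    qed
    with y1 show ?thesis
      unfolding ev_def by blast
  qed
  have ev_conj: "ev (\<lambda>t. \<phi> t \<and> \<psi> t)" if "ev \<phi>" "ev \<psi>" for \<phi> \<psi>
  proof -
    obtain y0 y1 where y: "y0 \<in> R" "\<forall>y. y \<in> R \<and> y0 \<sqsubset> y \<longrightarrow> sel k (Z y) \<phi>"
      "y1 \<in> R" "\<forall>y. y \<in> R \<and> y1 \<sqsubset> y \<longrightarrow> sel k (Z y) \<psi>"
      using \<open>ev \<phi>\<close> \<open>ev \<psi>\<close> unfolding ev_def by blast
    obtain y2 where y2: "y2 \<in> R" "y0 \<sqsubset> y2" "y1 \<sqsubset> y2"
      using R_above2[OF y(1,3)] by blast
    have "sel k (Z y) (\<lambda>t. \<phi> t \<and> \<psi> t)" if "y \<in> R" "y2 \<sqsubset> y" for y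
      by (rule sel_conj) (use y y2 that in \<open>meson dir.less_trans\<close>)+
    with y2 show ?thesis
      unfolding ev_def by blast
  qed
  have not_ev_False: "\<not> ev (\<lambda>t. False)"
    unfolding ev_def using not_sel_False R_above by blast
  have ev_const: P if "ev \<phi>" "y \<in> R" "\<And>t. Z y t \<Longrightarrow> \<phi> t \<Longrightarrow> P" for \<phi> y P
    using ev_mono[OF that(1,2), of "\<lambda>t. P"] that(3) not_ev_False by (cases P) auto
  \<comment> \<open>For each \<open>y\<close> the property or its negation is selected. The set of
    \<open>y\<close> for which the property is selected is definable, so the decision is eventually
    the same.\<close>
  have ev_ultra: "ev \<phi> \<or> ev (\<lambda>t. \<not> \<phi> t)" if \<phi>: "dfn UNIV \<phi>" for \<phi>
  proof -
    have sel: "sel k (Z y) \<phi> \<or> sel k (Z y) (\<lambda>t. \<not> \<phi> t)" if "y \<in> R" for y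
      by (rule sel_ultra[OF supp ne[OF that] _ \<phi>]) (intro dZ atomic_trm_const atomic_trm_var UNIV_I)
    have "dset {y. sel k (Z y) \<phi>}"
      unfolding dset_def mem_Collect_eq
    proof (rule dfn_sel[of "\<lambda>p. Z (p 0)" "\<lambda>p. \<phi>"])
      show "dfn UNIV (\<lambda>v. Z (v (2 * 0)) (\<lambda>i. v (2 * i + 1)))"
        by (intro dZ atomic_trm_var)
      show "dfn UNIV (\<lambda>v. \<phi> (\<lambda>i. v (2 * i + 1)))"
        by (intro dfn_env[OF \<phi>] atomic_trm_var)
    qed
    then obtain r where r: "r \<in> R" "{z \<in> R. r \<sqsubset> z} \<subseteq> {y. sel k (Z y) \<phi>} \<or> {z \<in> R. r \<sqsubset> z} \<inter> {y. sel k (Z y) \<phi>} = {}"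
      using cuts_tail[OF _ conv_R R_ne no_max_R] by blast
    then show ?thesis
      unfolding ev_def using sel by blast
  qed
  have ev_bex: "\<exists>d\<in>A. ev (\<phi> d)" if A: "finite A" and ev: "ev (\<lambda>t. \<exists>d\<in>A. \<phi> d t)"
    and \<phi>: "\<And>d. dfn UNIV (\<phi> d)" for A \<phi>
    using A ev
  proof (induction A rule: finite_induct)
    case empty
    then show ?case
      using not_ev_False by simp
  next
    case (insert d A)
    show ?case
    proof (cases "ev (\<phi> d)")
      case False
      then have "ev (\<lambda>t. \<not> \<phi> d t)"
        using ev_ultra[OF \<phi>] by blast
      obtain r where "r \<in> R"
        using R_ne by blast
      have "ev (\<lambda>t. \<exists>d\<in>A. \<phi> d t)"
        by (rule ev_mono[OF ev_conj[OF \<open>ev (\<lambda>t. \<not> \<phi> d t)\<close> insert.prems] \<open>r \<in> R\<close>]) auto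
      then show ?thesis
        using insert.IH by blast
    qed blast
  qed

  have op_dfn: "dfn UNIV (\<lambda>t. family_op Q t u v w)" for u v w
    by (intro dfn_family_op[OF dfn_Q] atomic_trm_var atomic_trm_const UNIV_I)
  define P where "P = (\<lambda>u v w. u \<in> R \<and> v \<in> R \<and> w \<in> R \<and> ev (\<lambda>t. family_op Q t u v w))"
  have dP: "dfn UNIV (\<lambda>v. P (v 0) (v 1) (v 2))"
  proof -
    have s: "dfn UNIV (\<lambda>p. sel k (Z (p 0)) (\<lambda>t. family_op Q t (p (Suc 0)) (p (Suc (Suc 0))) (p (Suc (Suc (Suc 0))))))"
    proof (rule dfn_sel[of "\<lambda>p. Z (p 0)" "\<lambda>p t. family_op Q t (p (Suc 0)) (p (Suc (Suc 0))) (p (Suc (Suc (Suc 0))))"])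
      show "dfn UNIV (\<lambda>v. Z (v (2 * 0)) (\<lambda>i. v (2 * i + 1)))"
        by (intro dZ atomic_trm_var)
      show "dfn UNIV (\<lambda>v. family_op Q (\<lambda>i. v (2 * i + 1)) (v (2 * Suc 0)) (v (2 * Suc (Suc 0))) (v (2 * Suc (Suc (Suc 0)))))"
        by (intro dfn_family_op[OF dfn_Q] atomic_trm_var)
    qed
    have s': "dfn UNIV (\<lambda>v. sel k (Z (v 0)) (\<lambda>t. family_op Q t (v (Suc (Suc 0))) (v (Suc (Suc 1))) (v (Suc (Suc 2)))))"
      using dfn_subst[OF s, of "\<lambda>v i. if i = 0 then v 0 else v (Suc i)"]
      by (simp add: eval_nat_numeral atomic_trm_if)
    show ?thesis
      unfolding P_def ev_def
      by (intro dfn_dir_intros dset_atomic[OF dset_R] s')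
  qed
  have upper: "\<exists>y\<in>R. u \<sqsubset> y \<and> v \<sqsubset> y \<and> w \<sqsubset> y" if uvw: "u \<in> R" "v \<in> R" "w \<in> R" for u v w
  proof -
    obtain y where y: "y \<in> R" "u \<sqsubset> y" "v \<sqsubset> y"
      using R_above2[OF uvw(1,2)] by blast
    obtain z where "z \<in> R" "y \<sqsubset> z" "w \<sqsubset> z"
      using R_above2[OF y(1) uvw(3)] by blast
    with y show ?thesis
      by (blast intro: dir.less_trans)
  qed
  have PA: "partial_addition (itv x y) (restr (itv x y) (family_op Q t))" if "y \<in> R" "Z y t" for y t
    using chunk[OF that] unfolding chunk_def by blast
  have restr_iff: "restr (itv x y) (family_op Q t) u v w \<longleftrightarrow> family_op Q t u v w"
    if "u \<in> R" "v \<in> R" "w \<in> R" "u \<sqsubset> y" "v \<sqsubset> y" "w \<sqsubset> y" for y t u v w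
    using that x_less by (auto simp: restr_def)
  have total: "\<exists>v. P u v w" if uw: "u \<in> R" "w \<in> R" "u \<sqsubset> w" for u w
  proof -
    define A where "A = diffs Z u w"
    have A: "finite A"
      unfolding A_def using fin uw by blast
    \<comment> \<open>If values of the difference outside the finite set \<open>A\<close> occurred
      for arbitrarily large \<open>y\<close>, the sets \<open>W y\<close> would have a common
      element by \<open>descending_intersection\<close>; this element would be possible for all
      \<open>y\<close> and hence belong to \<open>A\<close>.\<close>
    define W where "W = (\<lambda>y d. (x \<sqsubset> d \<and> d \<sqsubset> w) \<and> d \<notin> A \<and>
      (\<exists>y'. (y' \<in> R \<and> y \<sqsubseteq> y' \<and> w \<sqsubset> y') \<and> (\<exists>t. Z y' t \<and> family_op Q t u d w)))"
    have dW: "dfn UNIV (\<lambda>v. W (v 0) (v 1))"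
      unfolding W_def
      by (intro dfn_dir_intros dset_atomic[OF dset_R] dset_atomic[OF dset_finite[OF A]] dfn_ex_env dZ
          dfn_family_op[OF dfn_Q] UNIV_I)
    have "\<exists>y1\<in>R. \<forall>d. \<not> W y1 d"
    proof (rule ccontr)
      assume "\<not> ?thesis"
      then obtain d where d: "\<And>y. y \<in> R \<Longrightarrow> W y d"
      proof (rule_tac descending_intersection[OF dW uw(2)])
        show "x \<sqsubset> d \<and> d \<sqsubset> w" if "W y d" for y d
          using that by (auto simp: W_def)
        show "W y' d" if "y' \<sqsubseteq> y" "W y d" for y y' d
          using that unfolding W_def by (meson dir.order_trans)
      qed (auto intro: that)
      have "d \<in> A"
        unfolding A_def diffs_def
      proof (intro CollectI conjI allI impI)
        fix y assume "y \<in> R"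
        then obtain y' t where "y' \<in> R" "y \<sqsubseteq> y'" "Z y' t" "family_op Q t u d w"
          using d unfolding W_def by blast
        then show "\<exists>t. Z y t \<and> family_op Q t u d w"
          using dec \<open>y \<in> R\<close> by blast
      qed (use d uw(1) in \<open>auto simp: W_def\<close>)
      then show False
        using d[OF uw(1)] by (simp add: W_def)
    qed
    then obtain y1 where y1: "y1 \<in> R" "\<And>d. \<not> W y1 d"
      by blast
    obtain y2 where y2: "y2 \<in> R" "y1 \<sqsubset> y2" "w \<sqsubset> y2"
      using R_above2[OF y1(1) uw(2)] by blast
    have "\<exists>d\<in>A. family_op Q t u d w" if t: "Z y2 t" for t
    proof -
      have "u \<in> itv x y2" "w \<in> itv x y2"
        using uw x_less y2 by (auto intro: dir.less_trans)
      then obtain d where d: "restr (itv x y2) (family_op Q t) u d w"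
        using partial_additionD(9)[OF PA[OF y2(1) t]] uw(3) by blast
      then have "d \<sqsubset> w"
        using partial_additionD(11)[OF PA[OF y2(1) t]] by blast
      with d t y2 y1(2)[of d] show ?thesis
        unfolding W_def restr_def by (auto simp: dir.less_imp_le)
    qed
    then have "ev (\<lambda>t. \<exists>d\<in>A. family_op Q t u d w)"
      by (intro ev_mono[OF ev_Z[OF y2(1)] y2(1)])
    from ev_bex[OF A this op_dfn] obtain d where d: "d \<in> A" "ev (\<lambda>t. family_op Q t u d w)"
      by blast
    have "d \<in> R"
      using d(1) R_down[OF _ _ uw(2)] unfolding A_def diffs_def by (auto simp: dir.less_imp_le)
    with d uw show ?thesis
      unfolding P_def by blast
  qed
  have P_R: "u \<in> R" "v \<in> R" "w \<in> R" and P_ev: "ev (\<lambda>t. family_op Q t u v w)" if "P u v w" for u v w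
    using that by (auto simp: P_def)
  \<comment> \<open>The pattern for all laws of \<open>P\<close>: take \<open>y\<close> above all
    points involved, use the law for a single parameter in \<open>Z y\<close>, and pass to the
    limit. A conclusion that does not mention the parameter follows by
    \<open>ev_const\<close>.\<close>
  have P_less: "u \<sqsubset> w \<and> v \<sqsubset> w" if p: "P u v w" for u v w
  proof -
    note R = P_R[OF p]
    obtain y where y: "y \<in> R" "u \<sqsubset> y" "v \<sqsubset> y" "w \<sqsubset> y"
      using upper[OF R] by blast
    show ?thesis
    proof (rule ev_const[OF P_ev[OF p] y(1)])
      fix t assume t: "Z y t" "family_op Q t u v w"
      then have "restr (itv x y) (family_op Q t) u v w"
        using restr_iff[OF R y(2-4)] by blast
      then show "u \<sqsubset> w \<and> v \<sqsubset> w"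
        using partial_additionD(10,11)[OF PA[OF y(1) t(1)]] by blast
    qed
  qed
  have P_comm: "P v u w" if p: "P u v w" for u v w
  proof -
    note R = P_R[OF p]
    obtain y where y: "y \<in> R" "u \<sqsubset> y" "v \<sqsubset> y" "w \<sqsubset> y"
      using upper[OF R] by blast
    have "ev (\<lambda>t. family_op Q t v u w)"
    proof (rule ev_mono[OF P_ev[OF p] y(1)])
      fix t assume t: "Z y t" "family_op Q t u v w"
      then have "restr (itv x y) (family_op Q t) u v w"
        using restr_iff[OF R y(2-4)] by blast
      then show "family_op Q t v u w"
        using partial_additionD(5)[OF PA[OF y(1) t(1)]] unfolding restr_def by blast
    qed
    with R show ?thesis
      by (simp add: P_def)
  qed
  have P_fun: "w = w'" if p: "P u v w" "P u v w'" for u v w w'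
  proof -
    obtain y where y: "y \<in> R" "u \<sqsubset> y" "v \<sqsubset> y" "w \<sqsubset> y"
      using upper[OF P_R[OF p(1)]] by blast
    obtain y' where y': "y' \<in> R" "y \<sqsubset> y'" "w' \<sqsubset> y'"
      using R_above2[OF y(1) P_R(3)[OF p(2)]] by blast
    then have less: "u \<sqsubset> y'" "v \<sqsubset> y'" "w \<sqsubset> y'"
      using y by (auto intro: dir.less_trans)
    show ?thesis
    proof (rule ev_const[OF ev_conj[OF P_ev[OF p(1)] P_ev[OF p(2)]] y'(1)])
      fix t assume t: "Z y' t" "family_op Q t u v w \<and> family_op Q t u v w'"
      then show "w = w'"
        using partial_additionD(4)[OF PA[OF y'(1) t(1)], of u v w w']
          restr_iff[OF P_R[OF p(1)] less] restr_iff[OF P_R[OF p(2)] less(1,2) y'(3)] by blast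
    qed
  qed
  have P_mono: "w \<sqsubset> w'" if p: "P u v w" "P u' v w'" and u: "u \<sqsubset> u'" for u u' v w w'
  proof -
    obtain y where y: "y \<in> R" "u' \<sqsubset> y" "v \<sqsubset> y" "w \<sqsubset> y"
      using upper[OF P_R(1)[OF p(2)] P_R(2,3)[OF p(1)]] by blast
    obtain y' where y': "y' \<in> R" "y \<sqsubset> y'" "w' \<sqsubset> y'"
      using R_above2[OF y(1) P_R(3)[OF p(2)]] by blast
    then have less: "u \<sqsubset> y'" "u' \<sqsubset> y'" "v \<sqsubset> y'" "w \<sqsubset> y'"
      using y u by (meson dir.less_trans)+
    show ?thesis
    proof (rule ev_const[OF ev_conj[OF P_ev[OF p(1)] P_ev[OF p(2)]] y'(1)])
      fix t assume t: "Z y' t" "family_op Q t u v w \<and> family_op Q t u' v w'"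
      then show "w \<sqsubset> w'"
        using partial_additionD(7)[OF PA[OF y'(1) t(1)] u, of v w w']
          restr_iff[OF P_R[OF p(1)] less(1,3,4)] restr_iff[OF P_R[OF p(2)] less(2,3) y'(3)] by blast
    qed
  qed
  have P_assoc: "s = r" if p: "P u v a" "P a w s" "P v w b" "P u b r" for u v w a b s r
  proof -
    obtain y where y: "y \<in> R" "s \<sqsubset> y" "r \<sqsubset> y"
      using R_above2[OF P_R(3)[OF p(2)] P_R(3)[OF p(4)]] by blast
    have less: "a \<sqsubset> y" "w \<sqsubset> y" "u \<sqsubset> y" "b \<sqsubset> y" "v \<sqsubset> y"
      using P_less[OF p(1)] P_less[OF p(2)] P_less[OF p(3)] P_less[OF p(4)] y by (meson dir.less_trans)+
    show ?thesis
    proof (rule ev_const[OF ev_conj[OF ev_conj[OF P_ev[OF p(1)] P_ev[OF p(2)]]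
            ev_conj[OF P_ev[OF p(3)] P_ev[OF p(4)]]] y(1)])
      fix t assume t: "Z y t" "(family_op Q t u v a \<and> family_op Q t a w s) \<and>
        (family_op Q t v w b \<and> family_op Q t u b r)"
      then show "s = r"
        using partial_additionD(6)[OF PA[OF y(1) t(1)], of u v a w s b r]
          restr_iff[OF P_R[OF p(1)] less(3,5,1)] restr_iff[OF P_R[OF p(2)] less(1,2) y(2)]
          restr_iff[OF P_R[OF p(3)] less(5,2,4)] restr_iff[OF P_R[OF p(4)] less(3,4) y(3)] by blast
    qed
  qed
  \<comment> \<open>Only differences are known to have limits, so the sum \<open>u + v'\<close> is
    found as \<open>w - (v - v')\<close> and identified by
    \<open>partial_addition_shift\<close>.\<close>
  have P_down: "\<exists>w'. P u v' w'" if p: "P u v w" and v': "v' \<sqsubset> v" "v' \<in> R" for u v w v'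
  proof -
    obtain e where e: "P v' e v"
      using total[OF v'(2) P_R(2)[OF p] v'(1)] by blast
    have "e \<sqsubset> w"
      using P_less[OF e] P_less[OF p] by (meson dir.less_trans)
    then obtain w' where "P e w' w"
      using total[OF P_R(2)[OF e] P_R(3)[OF p]] by blast
    then have w': "P w' e w"
      by (rule P_comm)
    obtain y where y: "y \<in> R" "w \<sqsubset> y"
      using R_above[OF P_R(3)[OF p]] by blast
    have less: "u \<sqsubset> y" "v \<sqsubset> y" "v' \<sqsubset> y" "e \<sqsubset> y" "w' \<sqsubset> y"
      using P_less[OF p] P_less[OF e] P_less[OF w'] y by (meson dir.less_trans)+
    have "ev (\<lambda>t. family_op Q t u v' w')"
    proof (rule ev_mono[OF ev_conj[OF P_ev[OF p] ev_conj[OF P_ev[OF e] P_ev[OF w']]] y(1)])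
      fix t assume t: "Z y t" "family_op Q t u v w \<and> family_op Q t v' e v \<and> family_op Q t w' e w"
      then show "family_op Q t u v' w'"
        using partial_addition_shift[OF PA[OF y(1) t(1)], of u v w v' e w']
          restr_iff[OF P_R[OF p] less(1,2) y(2)] restr_iff[OF P_R[OF e] less(3,4,2)]
          restr_iff[OF P_R[OF w'] less(5,4) y(2)] unfolding restr_def by blast
    qed
    then show ?thesis
      unfolding P_def using P_R[OF p] v'(2) P_R(1)[OF w'] by blast
  qed
  have "partial_addition R P"
    unfolding partial_addition_def
  proof (intro conjI allI impI)
    show "(u \<sqsubset> w) = (\<exists>v. P u v w)" if "u \<in> R \<and> w \<in> R" for u w
      using total P_less that by blast
    show "u \<in> R" "v \<in> R" "w \<in> R" "P v u w" if "P u v w" for u v w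
      using P_R[OF that] P_comm[OF that] by simp_all
    show "w = w'" if "P u v w \<and> P u v w'" for u v w w'
      using P_fun that by (elim conjE)
    show "s = r" if "P u v a \<and> P a w s \<and> P v w b \<and> P u b r" for u v w a b s r
      using P_assoc that by (elim conjE)
    show "w \<sqsubset> w'" if "u \<sqsubset> u' \<and> P u v w \<and> P u' v w'" for u u' v w w'
      using P_mono that by (elim conjE)
    show "\<exists>w'. P u v' w'" if "P u v w \<and> v' \<sqsubset> v \<and> v' \<in> R" for u v w v'
      using P_down that by (elim conjE)
  qed
  moreover have "opn R"
    unfolding opn_iff
  proof (intro ballI conjI)
    fix r assume r: "r \<in> R"
    then obtain z where "x \<sqsubset> z" "z \<sqsubset> r"
      using dir.dense[OF x_less[OF r]] by blast
    then show "\<exists>y\<in>R. y \<sqsubset> r"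
      using R_down[of z r] r by (auto simp: dir.less_imp_le)
    show "\<exists>y\<in>R. r \<sqsubset> y"
      using R_above[OF r] .
  qed
  \<comment> \<open>The whole of \<open>R\<close> would be a group-interval, hence short, although
    none of its final segments is.\<close>
  ultimately have "pgi R P"
    unfolding pgi_def using R_ne conv_R by blast
  then have "SH R"
    using SH_gi giI[OF lt_dir _ dP] by blast
  moreover obtain r where "r \<in> R"
    using R_ne by blast
  moreover have "dset {z \<in> R. r \<sqsubset> z}"
    unfolding dset_def mem_Collect_eq by (intro dfn_dir_intros dset_atomic[OF dset_R] UNIV_I)
  ultimately show False
    using long SH_subset by blast
qed

end

section \<open>Reduction of increasing unions to a uniform family of additions\<close>

context omin_dir
begin

text \<open>Otherwise there is an increasing sequence such that no interval between consecutive
  terms is a group-interval. Saturation gives a point \<open>z\<close> of \<open>R\<close> above the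
  whole sequence. The short interval up to \<open>z\<close> has finitely many cuts, and each of the
  infinitely many steps would have to contain one.\<close>

lemma ex_start:
  assumes dR: "dset R" and R: "conv R" "no_max R" "R \<noteq> {}"
    and a: "\<And>r. r \<in> R \<Longrightarrow> a \<sqsubset> r" and SH: "\<And>r. r \<in> R \<Longrightarrow> SH (itv a r)"
  obtains x where "x \<in> insert a R" "\<And>y. y \<in> R \<Longrightarrow> x \<sqsubset> y \<Longrightarrow> gi (itv x y)"
proof (rule ccontr)
  assume "\<not> thesis"
  then have step: "\<forall>x\<in>insert a R. \<exists>y. y \<in> R \<and> x \<sqsubset> y \<and> \<not> gi (itv x y)"
    using that by blast
  obtain f where f: "\<And>n. f n \<in> insert a R" "\<And>n. f n \<sqsubset> f (Suc n) \<and> f (Suc n) \<in> R \<and> \<not> gi (itv (f n) (f (Suc n)))"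
    using dependent_nat_choice[of "\<lambda>n x. x \<in> insert a R" "\<lambda>n x y. x \<sqsubset> y \<and> y \<in> R \<and> \<not> gi (itv x y)"] step
    by blast
  have f_mono: "f m \<sqsubset> f n" if "m < n" for m n
    using that by (induction n) (auto simp: less_Suc_eq f(2) intro: dir.less_trans)
  obtain B where B: "finite B" "B \<subseteq> UNIV" "dfn B (\<lambda>v. v 0 \<in> R)"
    using dfn_finite_params[OF dR[unfolded dset_def]] .
  define \<P> where "\<P> = insert (\<lambda>z. z \<in> R) (range (\<lambda>n z. f n \<sqsubset> z))"
  have "\<exists>z. \<forall>p\<in>\<P>. p z"
  proof (rule saturation_1[of "B \<union> range f"])
    show "countable (B \<union> range f)"
      using B(1) by (simp add: countable_finite)
    show "dfn (B \<union> range f) (\<lambda>v. p (v 0))" if "p \<in> \<P>" for p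
      using that unfolding \<P>_def by (auto intro!: dfn_lt dfn_mono[OF B(3)])
    fix \<Q> assume \<Q>: "finite \<Q>" "\<Q> \<subseteq> \<P>"
    have "finite (\<Q> - {\<lambda>z. z \<in> R})" "\<Q> - {\<lambda>z. z \<in> R} \<subseteq> range (\<lambda>n z. f n \<sqsubset> z)"
      using \<Q> by (auto simp: \<P>_def)
    then obtain S where S: "finite S" "\<Q> - {\<lambda>z. z \<in> R} = (\<lambda>n z. f n \<sqsubset> z) ` S"
      by (metis finite_subset_image)
    define m where "m = Max (insert 0 S)"
    have m: "n < Suc m" if "n \<in> S" for n
      using that S(1) by (simp add: m_def less_Suc_eq_le)
    have "p (f (Suc m))" if "p \<in> \<Q>" for p
    proof (cases "p = (\<lambda>z. z \<in> R)")
      case True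
      then show ?thesis
        using f(2) by simp
    next
      case False
      with that S(2) have "p \<in> (\<lambda>n z. f n \<sqsubset> z) ` S"
        by blast
      then show ?thesis
        using m f_mono by blast
    qed
    then show "\<exists>z. \<forall>p\<in>\<Q>. p z"
      by blast
  qed
  then obtain z where z: "z \<in> R" "\<And>n. f n \<sqsubset> z"
    unfolding \<P>_def by auto
  obtain C where C: "finite C"
    "\<And>J. conv J \<Longrightarrow> opn J \<Longrightarrow> J \<noteq> {} \<Longrightarrow> dset J \<Longrightarrow> J \<subseteq> itv a z \<Longrightarrow> J \<inter> C = {} \<Longrightarrow> gi J"
    using SH_cuts[OF SH[OF z(1)]] by blast
  have "\<exists>c. c \<in> C \<and> f n \<sqsubset> c \<and> c \<sqsubset> f (Suc n)" for n
  proof -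
    have "a \<sqsubseteq> f n"
      using f(1)[of n] a by (auto simp: le_def)
    then have "itv (f n) (f (Suc n)) \<subseteq> itv a z"
      using z(2)[of "Suc n"] by (auto intro: dir.le_less_trans dir.less_trans)
    moreover have "itv (f n) (f (Suc n)) \<noteq> {}"
      using f(2)[of n] by (simp add: itv_eq_empty_iff)
    ultimately show ?thesis
      using C(2)[OF conv_itv opn_itv _ dset_itv] f(2)[of n] by (auto simp: disjoint_iff)
  qed
  then obtain c where c: "\<And>n. c n \<in> C \<and> f n \<sqsubset> c n \<and> c n \<sqsubset> f (Suc n)"
    by metis
  have "c m \<sqsubset> c n" if "m < n" for m n
  proof -
    have "f (Suc m) \<sqsubseteq> f n"
      using f_mono[of "Suc m" n] that by (cases "Suc m = n") (auto simp: le_def)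
    then show ?thesis
      using c[of m] c[of n] by (meson dir.less_le_trans dir.less_trans)
  qed
  then have "inj c"
    by (intro linorder_injI) (metis dir.less_irrefl)
  moreover have "range c \<subseteq> C"
    using c by blast
  ultimately show False
    using C(1) by (meson finite_subset finite_imageD infinite_UNIV_nat)
qed

text \<open>Compactness over all parameter-free \<open>Q\<close>. Failure at one \<open>y\<close>
  persists for all larger ones by \<open>chunk_antimono\<close>, so finitely many families fail
  simultaneously; by saturation some \<open>z\<close> defeats all of them, yet the addition on the
  interval up to \<open>z\<close> is a member of some family.\<close>

lemma ex_uniform_family:
  assumes dR: "dset R" and R: "no_max R" "R \<noteq> {}"
    and x: "\<And>r. r \<in> R \<Longrightarrow> x \<sqsubset> r"
    and pgi: "\<And>y. y \<in> R \<Longrightarrow> \<exists>P. dfn UNIV (\<lambda>v. P (v 0) (v 1) (v 2)) \<and> pgi (itv x y) P"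
  obtains Q where "dfn {} Q" "\<And>y. y \<in> R \<Longrightarrow> \<exists>t. chunk Q x y t"
proof (rule ccontr)
  assume "\<not> thesis"
  then have "\<forall>Q. dfn {} Q \<longrightarrow> (\<exists>y. y \<in> R \<and> (\<forall>t. \<not> chunk Q x y t))"
    using that by blast
  then obtain b where b: "\<And>Q. dfn {} Q \<Longrightarrow> b Q \<in> R \<and> (\<forall>t. \<not> chunk Q x (b Q) t)"
    by metis
  obtain B where B: "finite B" "B \<subseteq> UNIV" "dfn B (\<lambda>v. v 0 \<in> R)"
    using dfn_finite_params[OF dR[unfolded dset_def]] .
  \<comment> \<open>There may be uncountably many \<open>Q\<close>, but every condition uses only
    \<open>x\<close> and the finitely many parameters of \<open>R\<close>.\<close>
  define p where "p = (\<lambda>Q y. \<not> (\<exists>t. chunk Q x y t))"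
  define \<P> where "\<P> = insert (\<lambda>y. y \<in> R) (p ` {Q. dfn {} Q})"
  have "\<exists>z. \<forall>p\<in>\<P>. p z"
  proof (rule saturation_1[of "insert x B"])
    show "countable (insert x B)"
      using B(1) by (simp add: countable_finite)
    fix q assume "q \<in> \<P>"
    then consider "q = (\<lambda>y. y \<in> R)" | Q where "dfn {} Q" "q = p Q"
      by (auto simp: \<P>_def)
    then show "dfn (insert x B) (\<lambda>v. q (v 0))"
    proof cases
      case 1
      then show ?thesis
        using dfn_mono[OF B(3)] by blast
    next
      case (2 Q)
      have "dfn {x} (\<lambda>v. \<exists>t. chunk Q x (v 0) t)"
        by (rule dfn_ex_env, rule dfn_1_env[OF dfn_chunk[OF 2(1)]]) auto
      then show ?thesis
        unfolding 2(2) p_def by (intro dfn_not) (auto intro: dfn_mono)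
    qed
  next
    fix \<Q> assume \<Q>: "finite \<Q>" "\<Q> \<subseteq> \<P>"
    have "finite (\<Q> - {\<lambda>y. y \<in> R})" "\<Q> - {\<lambda>y. y \<in> R} \<subseteq> p ` {Q. dfn {} Q}"
      using \<Q> by (auto simp: \<P>_def)
    then obtain S where S: "finite S" "S \<subseteq> {Q. dfn {} Q}" "\<Q> - {\<lambda>y. y \<in> R} = p ` S"
      by (metis finite_subset_image)
    obtain r where r: "r \<in> R" "\<forall>c\<in>b ` S. c \<sqsubset> r"
      using no_max_above[of "b ` S" R] S b R by blast
    have "p Q r" if Q: "Q \<in> S" for Q
    proof -
      have "dfn {} Q"
        using Q S(2) by blast
      then have "x \<sqsubset> b Q" "\<forall>t. \<not> chunk Q x (b Q) t"
        using b x by blast+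
      moreover have "b Q \<sqsubset> r"
        using r(2) Q by blast
      ultimately show ?thesis
        unfolding p_def using chunk_antimono by (meson dir.less_imp_le)
    qed
    then have "q r" if "q \<in> \<Q>" for q
    proof (cases "q = (\<lambda>y. y \<in> R)")
      case False
      with that S(3) have "q \<in> p ` S"
        by blast
      then show ?thesis
        using \<open>\<And>Q. Q \<in> S \<Longrightarrow> p Q r\<close> by blast
    qed (use r(1) in simp)
    then show "\<exists>z. \<forall>q\<in>\<Q>. q z"
      by blast
  qed
  then obtain z where z: "z \<in> R" "\<And>Q. dfn {} Q \<Longrightarrow> \<not> (\<exists>t. chunk Q x z t)"
    unfolding \<P>_def p_def by auto
  obtain P where P: "dfn UNIV (\<lambda>v. P (v 0) (v 1) (v 2))" "pgi (itv x z) P"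
    using pgi[OF z(1)] by blast
  obtain Q t where Q: "dfn {} Q" "\<And>u v w. P u v w = Q (case_nat u (case_nat v (case_nat w t)))"
    using dfn_family[OF P(1)] by blast
  have PA: "partial_addition (itv x z) P"
    using P(2) by (simp add: pgi_def)
  have "restr (itv x z) (family_op Q t) = P"
    using partial_additionD(1-3)[OF PA] by (auto simp: restr_def family_op_def Q(2)[symmetric] fun_eq_iff)
  then have "chunk Q x z t"
    unfolding chunk_def using PA x[OF z(1)] by simp
  with z(2)[OF Q(1)] show False
    by blast
qed

text \<open>If one final segment is short, a short initial part completes it. If none is, the
  conditions of \<open>tail_family\<close> can be met on a final segment of \<open>R\<close>, which
  is impossible.\<close>

theorem SH_increasing_union:
  assumes dR: "dset R" and R: "conv R" "no_max R"
    and a: "\<And>r. r \<in> R \<Longrightarrow> a \<sqsubset> r" and down: "\<And>z r. a \<sqsubset> z \<Longrightarrow> z \<sqsubseteq> r \<Longrightarrow> r \<in> R \<Longrightarrow> z \<in> R"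
    and SH: "\<And>r. r \<in> R \<Longrightarrow> SH (itv a r)"
  shows "SH R"
proof (cases "\<exists>y\<in>R. SH {z \<in> R. y \<sqsubset> z}")
  case True
  then obtain y where y: "y \<in> R" "SH {z \<in> R. y \<sqsubset> z}"
    by blast
  have "R \<subseteq> (itv a y \<union> {y}) \<union> {z \<in> R. y \<sqsubset> z}"
    using a by auto
  moreover have "SH ((itv a y \<union> {y}) \<union> {z \<in> R. y \<sqsubset> z})"
    using SH[OF y(1)] y(2) by (intro SH_Un) (auto intro: SH_finite)
  ultimately show ?thesis
    using SH_subset dR by blast
next
  case long: False
  show ?thesis
  proof (cases "R = {}")
    case False
    obtain x0 where x0: "x0 \<in> insert a R" "\<And>y. y \<in> R \<Longrightarrow> x0 \<sqsubset> y \<Longrightarrow> gi (itv x0 y)"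
      using ex_start[OF dR R False a SH] by blast
    \<comment> \<open>\<open>x\<close> is moved strictly above \<open>x0\<close>, and later
      \<open>y'\<close> strictly above \<open>y\<close>, so that both ends of the interval from
      \<open>x\<close> to \<open>y\<close> are inner points of a group-interval, as
      \<open>gi_pgi_itv\<close> demands.\<close>
    obtain x where x: "x \<in> R" "x0 \<sqsubset> x"
      using x0(1) False a R(2) unfolding no_max_def by blast
    define R0 where "R0 = {z \<in> R. x \<sqsubset> z}"
    have dR0: "dset R0"
      unfolding dset_def R0_def mem_Collect_eq
      by (intro dfn_dir_intros dset_atomic[OF dR] UNIV_I)
    have "\<exists>s\<in>R0. r \<sqsubset> s" if r: "r \<in> R" "x \<sqsubseteq> r" for r
    proof -
      obtain s where "s \<in> R" "r \<sqsubset> s"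
        using R(2) r(1) unfolding no_max_def by blast
      with r(2) show ?thesis
        unfolding R0_def by (blast intro: dir.le_less_trans)
    qed
    then have R0: "no_max R0" "R0 \<noteq> {}"
      using x(1) unfolding R0_def no_max_def by (auto simp: le_def)
    have conv_R0: "conv R0"
      using R(1) unfolding R0_def conv_iff by (blast intro: dir.less_trans)
    have x_less: "x \<sqsubset> r" if "r \<in> R0" for r
      using that by (simp add: R0_def)
    have "\<exists>P. dfn UNIV (\<lambda>v. P (v 0) (v 1) (v 2)) \<and> pgi (itv x y) P" if y: "y \<in> R0" for y
    proof -
      obtain y' where y': "y' \<in> R" "y \<sqsubset> y'"
        using y R(2) unfolding R0_def no_max_def by blast
      have g: "gi (itv x0 y')"
        using x0(2)[OF y'(1)] x(2) x_less[OF y] y'(2) by (meson dir.less_trans)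
      have mem: "x \<in> itv x0 y'" "y \<in> itv x0 y'"
        using x(2) x_less[OF y] y'(2) by (auto intro: dir.less_trans)
      obtain P where "dfn UNIV (\<lambda>v. P (v 0) (v 1) (v 2))" "pgi (itv x y) P"
        using gi_pgi_itv[OF g mem x_less[OF y]] .
      then show ?thesis
        by blast
    qed
    then obtain Q where Q: "dfn {} Q" "\<And>y. y \<in> R0 \<Longrightarrow> \<exists>t. chunk Q x y t"
      using ex_uniform_family[OF dR0 R0(1,2) x_less] by blast
    have "tail_family M lt R0 x Q"
    proof unfold_locales
      show "z \<in> R0" if "x \<sqsubset> z" "z \<sqsubseteq> r" "r \<in> R0" for z r
        using that down[of z r] a[OF x(1)] unfolding R0_def by (auto intro: dir.less_trans)
      show "SH (itv x y)" if "y \<in> R0" for y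
      proof (rule SH_subset[OF SH dset_itv])
        show "y \<in> R"
          using that by (simp add: R0_def)
        show "itv x y \<subseteq> itv a y"
          using a[OF x(1)] by (auto intro: dir.less_trans)
      qed
      show "\<not> SH {z \<in> R0. y \<sqsubset> z}" if "y \<in> R0" for y
      proof -
        have "{z \<in> R0. y \<sqsubset> z} = {z \<in> R. y \<sqsubset> z}"
          using x_less[OF that] unfolding R0_def by (auto intro: dir.less_trans)
        then show ?thesis
          using long that unfolding R0_def by simp
      qed
    qed (use dR0 R0 conv_R0 x_less Q in auto)
    then show ?thesis
      using tail_family.contradiction by blast
  qed (simp add: SH_finite)
qed

end

section \<open>Generalized group-intervals\<close>

context omin_dir
begin

text \<open>Subtraction is obtained by an intermediate value argument. The \<open>v\<close> with
  \<open>u + v\<close> below \<open>w\<close> exist by \<open>small\<close> and are bounded by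
  \<open>large\<close>; one-sided continuity excludes that the sum at their supremum differs from
  \<open>w\<close>.\<close>

lemma pgi_criterion:
  assumes I: "I \<noteq> {}" "conv I" "opn I" and dP: "dfn UNIV (\<lambda>v. P (v 0) (v 1) (v 2))"
    and closed: "\<And>u v w. P u v w \<Longrightarrow> u \<in> I \<and> v \<in> I \<and> w \<in> I"
    and fn: "\<And>u v w w'. P u v w \<Longrightarrow> P u v w' \<Longrightarrow> w = w'"
    and comm: "\<And>u v w. P u v w \<Longrightarrow> P v u w"
    and assoc: "\<And>u v w a b s t. P u v a \<Longrightarrow> P a w s \<Longrightarrow> P v w b \<Longrightarrow> P u b t \<Longrightarrow> s = t"
    and mono: "\<And>u u' v w w'. u \<sqsubset> u' \<Longrightarrow> P u v w \<Longrightarrow> P u' v w' \<Longrightarrow> w \<sqsubset> w'"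
    and init: "\<And>u v w v'. P u v w \<Longrightarrow> v' \<sqsubset> v \<Longrightarrow> v' \<in> I \<Longrightarrow> \<exists>w'. P u v' w'"
    and no_last: "\<And>u v w. P u v w \<Longrightarrow> \<exists>v' w'. v \<sqsubset> v' \<and> P u v' w'"
    and greater: "\<And>u v w. P u v w \<Longrightarrow> u \<sqsubset> w"
    and small: "\<And>u w. u \<in> I \<Longrightarrow> w \<in> I \<Longrightarrow> u \<sqsubset> w \<Longrightarrow> \<exists>v w'. P u v w' \<and> w' \<sqsubset> w"
    and large: "\<And>u w. u \<in> I \<Longrightarrow> w \<in> I \<Longrightarrow> u \<sqsubset> w \<Longrightarrow> \<exists>v w'. P u v w' \<and> w \<sqsubset> w'"
    and cont_left: "\<And>u v w m. P u v w \<Longrightarrow> m \<sqsubset> w \<Longrightarrow>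
      \<exists>v1. v1 \<sqsubset> v \<and> (\<forall>v' w'. v1 \<sqsubset> v' \<and> v' \<sqsubset> v \<and> P u v' w' \<longrightarrow> m \<sqsubset> w')"
    and cont_right: "\<And>u v w m. P u v w \<Longrightarrow> w \<sqsubset> m \<Longrightarrow>
      \<exists>v2. v \<sqsubset> v2 \<and> (\<forall>v' w'. v \<sqsubset> v' \<and> v' \<sqsubset> v2 \<and> P u v' w' \<longrightarrow> w' \<sqsubset> m)"
  shows "pgi I P"
proof -
  have mono2: "w \<sqsubset> w'" if "v \<sqsubset> v'" "P u v w" "P u v' w'" for u v v' w w'
    using mono[OF that(1) comm[OF that(2)] comm[OF that(3)]] .
  have "\<exists>v. P u v w" if uw: "u \<in> I" "w \<in> I" "u \<sqsubset> w" for u w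
  proof -
    define W where "W = {v. \<exists>w'. P u v w' \<and> w' \<sqsubset> w}"
    have dW: "dset W"
      unfolding dset_def W_def mem_Collect_eq by (intro dfn_dir_intros dfn_3[OF dP] UNIV_I)
    obtain v0 where v0: "v0 \<in> W"
      using small[OF uw] unfolding W_def by blast
    obtain v1 w1 where v1: "P u v1 w1" "w \<sqsubset> w1"
      using large[OF uw] by blast
    have le: "v \<sqsubseteq> v1" if "v \<in> W" for v
    proof (rule ccontr)
      assume "\<not> v \<sqsubseteq> v1"
      with that obtain w' where "v1 \<sqsubset> v" "P u v w'" "w' \<sqsubset> w"
        by (auto simp: W_def dir.not_le)
      with mono2[OF this(1) v1(1) this(2)] v1(2) show False
        by (meson dir.less_asym dir.less_trans)
    qed
    obtain s where s: "\<And>v. v \<in> W \<Longrightarrow> v \<sqsubseteq> s" "\<And>u. (\<And>v. v \<in> W \<Longrightarrow> v \<sqsubseteq> u) \<Longrightarrow> s \<sqsubseteq> u"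
      using ex_lub[OF dW v0 le] by blast
    have "s \<sqsubseteq> v1"
      using s(2) le by blast
    moreover have "s \<in> I"
      using convD[OF I(2), of v0 v1 s] s(1)[OF v0] \<open>s \<sqsubseteq> v1\<close> closed v1(1) v0 unfolding W_def by blast
    ultimately obtain ws where ws: "P u s ws"
      using init[OF v1(1)] v1(1) by (auto simp: le_def)
    have "ws = w"
    proof (rule ccontr)
      assume "ws \<noteq> w"
      then consider "ws \<sqsubset> w" | "w \<sqsubset> ws"
        by (metis dir.neqE)
      then show False
      proof cases
        case 1
        obtain v2 where v2: "s \<sqsubset> v2" "\<forall>v' w'. s \<sqsubset> v' \<and> v' \<sqsubset> v2 \<and> P u v' w' \<longrightarrow> w' \<sqsubset> w"
          using cont_right[OF ws 1] by blast
        obtain v3 w3 where v3: "s \<sqsubset> v3" "P u v3 w3"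
          using no_last[OF ws] by blast
        obtain m where m: "s \<sqsubset> m" "m \<sqsubseteq> v2" "m \<sqsubseteq> v3"
          using v2(1) v3(1) by (metis dir.linear dir.order_refl)
        obtain v' where v': "s \<sqsubset> v'" "v' \<sqsubset> m"
          using dir.dense[OF m(1)] by blast
        have less: "v' \<sqsubset> v2" "v' \<sqsubset> v3"
          using v'(2) m(2,3) by (auto intro: dir.less_le_trans)
        have "v' \<in> I"
          using convD[OF I(2) \<open>s \<in> I\<close>, of v3 v'] closed[OF v3(2)] v'(1) less(2) by (simp add: dir.less_imp_le)
        then obtain w' where "P u v' w'"
          using init[OF v3(2) less(2)] by blast
        with v2(2) v'(1) less(1) have "v' \<in> W"
          unfolding W_def by blast
        with s(1) v'(1) show False
          by (meson dir.leD)
      next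
        case 2
        obtain v2 where v2: "v2 \<sqsubset> s" "\<forall>v' w'. v2 \<sqsubset> v' \<and> v' \<sqsubset> s \<and> P u v' w' \<longrightarrow> w \<sqsubset> w'"
          using cont_left[OF ws 2] by blast
        have "v \<sqsubseteq> v2" if v: "v \<in> W" for v
        proof (rule ccontr)
          assume "\<not> v \<sqsubseteq> v2"
          then have "v2 \<sqsubset> v"
            by (simp add: dir.not_le)
          obtain w' where w': "P u v w'" "w' \<sqsubset> w"
            using v unfolding W_def by blast
          have "v \<noteq> s"
            using fn[OF ws, of w'] w' 2 by (auto dest: dir.less_asym)
          then have "v \<sqsubset> s"
            using s(1)[OF v] by (simp add: le_def)
          with v2(2) \<open>v2 \<sqsubset> v\<close> w' show False
            by (meson dir.less_asym)
        qed
        with s(2) v2(1) show False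
          by (meson dir.leD)
      qed
    qed
    with ws show ?thesis
      by blast
  qed
  then have diff: "(u \<sqsubset> w) = (\<exists>v. P u v w)" if "u \<in> I \<and> w \<in> I" for u w
    using greater that by blast
  have "partial_addition I P"
    unfolding partial_addition_def
    by (intro conjI allI impI diff; (elim conjE)?) (use closed in blast, use closed in blast,
      use closed in blast, erule (1) fn, erule comm, erule (3) assoc, erule (2) mono, assumption, assumption,
      erule (2) init)
  then show ?thesis
    unfolding pgi_def using I by blast
qed

end

lemma ex_Fin_between: "b < c \<Longrightarrow> \<exists>z. b < Fin z \<and> Fin z < c"
  for b c :: "'a::unbounded_dense_linorder extended"
proof (cases b; cases c)
  fix x y assume "b < c" "b = Fin x" "c = Fin y"
  then show ?thesis
    using dense[of x y] by auto
qed (auto simp: gt_ex lt_ex)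

context omin
begin

lemma dset_open_interval: "dset (open_interval b c)"
proof -
  have "dfn UNIV (\<lambda>v. b < Fin (v 0))" for b :: "'a extended"
    by (cases b) (auto intro!: dfn_less)
  moreover have "dfn UNIV (\<lambda>v. Fin (v 0) < c)" for c :: "'a extended"
    by (cases c) (auto intro!: dfn_less)
  ultimately show ?thesis
    unfolding dset_def open_interval_def mem_Collect_eq by (intro dfn_conj)
qed

lemma conv_open_interval: "conv (open_interval b c)"
  unfolding conv_def open_interval_def
  by (auto intro: less_trans[of b "Fin _"] less_trans[of "Fin _" "Fin _" c])

lemma opn_open_interval: "opn (open_interval b c)"
  unfolding opn_def
proof (intro ballI conjI)
  fix x assume x: "x \<in> open_interval b c"
  then obtain y z where yz: "Fin x < Fin y" "Fin y < c" "b < Fin z" "Fin z < Fin x"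
    using ex_Fin_between[of "Fin x" c] ex_Fin_between[of b "Fin x"] by (auto simp: open_interval_def)
  have "b < Fin y" "Fin z < c"
    using x less_trans[OF _ yz(1), of b] less_trans[OF yz(4), of c] by (auto simp: open_interval_def)
  with yz show "\<exists>y\<in>open_interval b c. x < y" "\<exists>y\<in>open_interval b c. y < x"
    unfolding open_interval_def by auto
qed

lemma open_interval_ne: "b < c \<Longrightarrow> open_interval b c \<noteq> {}" for b c :: "'a extended"
  using ex_Fin_between[of b c] by (auto simp: open_interval_def)

lemma ex_sup:
  assumes "dset X" "X \<noteq> {}"
  obtains c where "\<And>x. x \<in> X \<Longrightarrow> Fin x \<le> c" "\<And>y. Fin y < c \<Longrightarrow> \<exists>x\<in>X. y < x"
proof (cases "\<exists>u. \<forall>x\<in>X. x \<le> u")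
  case True
  interpret up: omin_dir M "(<)"
    by (rule up_dir)
  have le: "up.le x y \<longleftrightarrow> x \<le> y" for x y
    by (auto simp: up.le_def)
  from True obtain u x0 where "\<forall>x\<in>X. x \<le> u" "x0 \<in> X"
    using assms(2) by blast
  then obtain s where "\<And>x. x \<in> X \<Longrightarrow> x \<le> s" "\<And>u. (\<And>x. x \<in> X \<Longrightarrow> x \<le> u) \<Longrightarrow> s \<le> u"
    using up.ex_lub[OF assms(1), of x0 u] unfolding le by blast
  then show ?thesis
    using that[of "Fin s"] by (auto simp: not_less[symmetric])
next
  case False
  then show ?thesis
    using that[of Pinf] by (auto simp: not_le)
qed

lemma ex_inf:
  assumes "dset X" "X \<noteq> {}"
  obtains b where "\<And>x. x \<in> X \<Longrightarrow> b \<le> Fin x" "\<And>y. b < Fin y \<Longrightarrow> \<exists>x\<in>X. x < y"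
proof (cases "\<exists>u. \<forall>x\<in>X. u \<le> x")
  case True
  interpret down: omin_dir M "(>)"
    by (rule down_dir)
  have le: "down.le x y \<longleftrightarrow> y \<le> x" for x y
    by (auto simp: down.le_def)
  from True obtain u x0 where "\<forall>x\<in>X. u \<le> x" "x0 \<in> X"
    using assms(2) by blast
  then obtain s where "\<And>x. x \<in> X \<Longrightarrow> s \<le> x" "\<And>u. (\<And>x. x \<in> X \<Longrightarrow> u \<le> x) \<Longrightarrow> u \<le> s"
    using down.ex_lub[OF assms(1), of x0 u] unfolding le by blast
  then show ?thesis
    using that[of "Fin s"] by (auto simp: not_less[symmetric])
next
  case False
  then show ?thesis
    using that[of Minf] by (auto simp: not_le)
qed

lemma conv_opn_open_interval:
  assumes "dset X" "conv X" "opn X" "X \<noteq> {}"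
  obtains b c where "X = open_interval b c" "b < c"
proof -
  obtain b where b: "\<And>x. x \<in> X \<Longrightarrow> b \<le> Fin x" "\<And>y. b < Fin y \<Longrightarrow> \<exists>x\<in>X. x < y"
    using ex_inf[OF assms(1,4)] by blast
  obtain c where c: "\<And>x. x \<in> X \<Longrightarrow> Fin x \<le> c" "\<And>y. Fin y < c \<Longrightarrow> \<exists>x\<in>X. y < x"
    using ex_sup[OF assms(1,4)] by blast
  have less: "b < Fin x" "Fin x < c" if x: "x \<in> X" for x
  proof -
    obtain y z where yz: "y \<in> X" "x < y" "z \<in> X" "z < x"
      using x assms(3) unfolding opn_def by blast
    have "b \<le> Fin z" "Fin z < Fin x"
      using b(1)[OF yz(3)] yz by auto
    then show "b < Fin x"
      by (rule le_less_trans)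
    have "Fin x < Fin y" "Fin y \<le> c"
      using c(1)[OF yz(1)] yz by auto
    then show "Fin x < c"
      by (rule less_le_trans)
  qed
  have "X = open_interval b c"
    using less b(2) c(2) assms(2) unfolding open_interval_def conv_def by blast
  moreover obtain x where "x \<in> X"
    using assms(4) by blast
  then have "b < c"
    using less by (meson less_trans)
  ultimately show ?thesis
    by (rule that)
qed

end

text \<open>The point \<open>y0\<close> guarantees that \<open>b\<close> is a genuine left endpoint,
  which excludes the dummy filter \<open>bot\<close>.\<close>

lemma eventually_right_of:
  fixes b :: "'a::{linorder_topology, unbounded_dense_linorder} extended"
  assumes "b < Fin y0"
  shows "eventually P (right_of b) \<longleftrightarrow> (\<exists>y. b < Fin y \<and> (\<forall>z. b < Fin z \<and> z < y \<longrightarrow> P z))"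
proof (cases b)
  case (Fin x)
  then show ?thesis
    using assms by (auto simp: eventually_at_right[of x y0])
next
  case Minf
  then show ?thesis
    by (auto simp: eventually_at_bot_dense)
qed (use assms in simp)

lemma eventually_left_of:
  fixes c :: "'a::{linorder_topology, unbounded_dense_linorder} extended"
  assumes "Fin y0 < c"
  shows "eventually P (left_of c) \<longleftrightarrow> (\<exists>y. Fin y < c \<and> (\<forall>z. y < z \<and> Fin z < c \<longrightarrow> P z))"
proof (cases c)
  case (Fin x)
  then show ?thesis
    using assms by (auto simp: eventually_at_left[of y0 x])
next
  case Pinf
  then show ?thesis
    by (auto simp: eventually_at_top_dense)
qed (use assms in simp)

lemma filterlim_nhds_ext_greater:
  fixes f :: "'b \<Rightarrow> 'a::{linorder_topology, unbounded_dense_linorder}"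
  assumes "filterlim f (nhds_ext c) F" "Fin w < c"
  shows "eventually (\<lambda>x. w < f x) F"
proof (cases c)
  case (Fin x)
  then show ?thesis
    using assms order_tendstoD(1)[of f x F w] by simp
next
  case Pinf
  then show ?thesis
    using assms by (simp add: filterlim_at_top_dense)
qed (use assms in simp)

lemma filterlim_nhds_ext_less:
  fixes f :: "'b \<Rightarrow> 'a::{linorder_topology, unbounded_dense_linorder}"
  assumes "filterlim f (nhds_ext c) F" "c < Fin w"
  shows "eventually (\<lambda>x. f x < w) F"
proof (cases c)
  case (Fin x)
  then show ?thesis
    using assms order_tendstoD(2)[of f x F w] by simp
next
  case Minf
  then show ?thesis
    using assms by (simp add: filterlim_at_bot_dense)
qed (use assms in simp)

lemma filterlim_nhds_ext_leftI:
  fixes f :: "'b \<Rightarrow> 'a::{linorder_topology, unbounded_dense_linorder}"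
  assumes "\<And>w. Fin w < c \<Longrightarrow> eventually (\<lambda>x. w < f x) F" "eventually (\<lambda>x. Fin (f x) < c) F" "b < c"
  shows "filterlim f (nhds_ext c) F"
proof (cases c)
  case (Fin x)
  then show ?thesis
    using assms by (auto intro!: order_tendstoI elim: eventually_mono intro: less_trans)
next
  case Pinf
  then show ?thesis
    using assms by (simp add: filterlim_at_top_dense)
qed (use assms in simp)

lemma filterlim_nhds_ext_rightI:
  fixes f :: "'b \<Rightarrow> 'a::{linorder_topology, unbounded_dense_linorder}"
  assumes "\<And>w. c < Fin w \<Longrightarrow> eventually (\<lambda>x. f x < w) F" "eventually (\<lambda>x. c < Fin (f x)) F" "c < b"
  shows "filterlim f (nhds_ext c) F"
proof (cases c)
  case (Fin x)
  then show ?thesis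
    using assms by (auto intro!: order_tendstoI elim: eventually_mono intro: less_trans)
next
  case Minf
  then show ?thesis
    using assms by (simp add: filterlim_at_bot_dense)
qed (use assms in simp)

section \<open>From generalized group-intervals to additions described by the order\<close>

locale omin_top = omin M
  for M :: "('f, 'r, 'a::{linorder_topology, unbounded_dense_linorder}) fo_structure"
begin

lemma partial_sum_cont:
  assumes "partial_sum M I D p" and uv: "(u, v) \<in> D" and A: "open A" "p u v \<in> A"
  obtains v1 v2 where "v1 < v" "v < v2" "\<And>v'. v1 < v' \<Longrightarrow> v' < v2 \<Longrightarrow> (u, v') \<in> D \<Longrightarrow> p u v' \<in> A"
proof -
  have "continuous_on D (\<lambda>(x, y). p x y)"
    using assms(1) by (simp add: partial_sum_def)
  then obtain S where S: "open S" "(u, v) \<in> S" "\<forall>z\<in>D. z \<in> S \<longrightarrow> (case z of (x, y) \<Rightarrow> p x y) \<in> A"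
    using uv A unfolding continuous_on_topological by (metis (mono_tags, lifting) case_prod_conv)
  obtain U V where UV: "open U" "open V" "(u, v) \<in> U \<times> V" "U \<times> V \<subseteq> S"
    using open_prod_elim[OF S(1,2)] by blast
  obtain a b where "a < v" "v < b"
    using lt_ex gt_ex by blast
  then obtain v1 v2 where v: "v1 < v" "{v1<..v} \<subseteq> V" "v < v2" "{v..<v2} \<subseteq> V"
    using open_left[OF UV(2), of v a] open_right[OF UV(2), of v b] UV(3) by auto
  show ?thesis
  proof (rule that[OF v(1,3)])
    fix v' assume v': "v1 < v'" "v' < v2" "(u, v') \<in> D"
    have "v' \<in> V"
      using v v'(1,2) by (cases "v' \<le> v") (auto simp: subset_iff)
    then have "(u, v') \<in> S"
      using UV(3,4) by auto
    then show "p u v' \<in> A"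
      using S(3)[rule_format, OF v'(3)] by simp
  qed
qed

lemma dfn_partial_sum:
  assumes "partial_sum M I D p"
  shows "dfn UNIV (\<lambda>v. (v 0, v 1) \<in> D \<and> v 2 = p (v 0) (v 1))"
proof -
  have "dfn UNIV (\<lambda>v. restrict v {..<3} \<in> {v \<in> Pow_n 3. (v 0, v 1) \<in> D \<and> v 2 = p (v 0) (v 1)})"
    using assms unfolding partial_sum_def definable_iff_dfn by blast
  then show ?thesis
    by (rule dfn_cong) simp
qed

lemma partial_sumD:
  assumes "partial_sum M I D p"
  shows "(u, v) \<in> D \<Longrightarrow> u \<in> I" "(u, v) \<in> D \<Longrightarrow> v \<in> I" "(u, v) \<in> D \<Longrightarrow> p u v \<in> I"
    "(u, v) \<in> D \<Longrightarrow> (v, u) \<in> D" "(u, v) \<in> D \<Longrightarrow> p v u = p u v"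
    "(u, v) \<in> D \<Longrightarrow> (p u v, w) \<in> D \<Longrightarrow> (v, w) \<in> D \<Longrightarrow> (u, p v w) \<in> D \<Longrightarrow> p (p u v) w = p u (p v w)"
    "u < u' \<Longrightarrow> (u, v) \<in> D \<Longrightarrow> (u', v) \<in> D \<Longrightarrow> p u v < p u' v"
  using assms unfolding partial_sum_def by (blast, blast, blast, blast, metis, blast, blast)

text \<open>
  A part \<open>J\<close> of the interval on which the operation is a positive (\<open>lt = (<)\<close>) or a negative
  (\<open>lt = (>)\<close>) group-interval.
\<close>

lemma gi_partial_sum:
  assumes ps: "partial_sum M I D p" and lt: "lt = (<) \<or> lt = (>)"
    and J: "J \<subseteq> I" "J \<noteq> {}" "conv J" "opn J" "dset J"
    and closed: "\<And>u v. u \<in> J \<Longrightarrow> v \<in> J \<Longrightarrow> (u, v) \<in> D \<Longrightarrow> p u v \<in> J \<and> lt u (p u v)"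
    and init: "\<And>u v v'. u \<in> J \<Longrightarrow> v \<in> J \<Longrightarrow> v' \<in> J \<Longrightarrow> lt v' v \<Longrightarrow> (u, v) \<in> D \<Longrightarrow> (u, v') \<in> D"
    and no_last: "\<And>u v. u \<in> J \<Longrightarrow> v \<in> J \<Longrightarrow> (u, v) \<in> D \<Longrightarrow> \<exists>v'\<in>J. lt v v' \<and> (u, v') \<in> D"
    and small: "\<And>u w. u \<in> J \<Longrightarrow> w \<in> J \<Longrightarrow> lt u w \<Longrightarrow> \<exists>v\<in>J. (u, v) \<in> D \<and> lt (p u v) w"
    and large: "\<And>u w. u \<in> J \<Longrightarrow> w \<in> J \<Longrightarrow> lt u w \<Longrightarrow> \<exists>v\<in>J. (u, v) \<in> D \<and> lt w (p u v)"
  shows "gi J"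
proof -
  interpret omin_dir M lt
    by unfold_locales (rule lt)
  note ps' = partial_sumD[OF ps]
  define P where "P = (\<lambda>u v w. u \<in> J \<and> v \<in> J \<and> (u, v) \<in> D \<and> w = p u v)"
  have dP: "dfn UNIV (\<lambda>v. P (v 0) (v 1) (v 2))"
    unfolding P_def by (intro dfn_conj dset_atomic[OF J(5)] dfn_partial_sum[OF ps] atomic_trm_var)
  have mono: "lt (p u v) (p u' v)" if "lt u u'" "(u, v) \<in> D" "(u', v) \<in> D" for u u' v
    using lt ps'(7) that by auto
  have open_lt: "open {z. lt m z}" "open {z. lt z m}" for m
    using lt by (auto simp flip: greaterThan_def lessThan_def)
  \<comment> \<open>For \<open>lt = (>)\<close> the two ends of a neighbourhood change
    places.\<close>
  have between: "lt v1' z \<and> lt z v2' \<longleftrightarrow> v1 < z \<and> z < v2"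
    if "(if lt = (<) then (v1, v2) else (v2, v1)) = (v1', v2')" for v1 v2 v1' v2' z
    using that lt by (auto split: if_splits)
  have cont: "\<exists>v1 v2. lt v1 v \<and> lt v v2 \<and> (\<forall>v' w'. lt v1 v' \<and> lt v' v2 \<and> P u v' w' \<longrightarrow> w' \<in> A)"
    if P: "P u v w" and A: "open A" "w \<in> A" for u v w A
  proof -
    have uv: "(u, v) \<in> D" "p u v \<in> A"
      using P A by (auto simp: P_def)
    obtain v1 v2 where v: "v1 < v" "v < v2" "\<And>v'. v1 < v' \<Longrightarrow> v' < v2 \<Longrightarrow> (u, v') \<in> D \<Longrightarrow> p u v' \<in> A"
      using partial_sum_cont[OF ps uv(1) A(1) uv(2)] by blast
    obtain v1' v2' where "(if lt = (<) then (v1, v2) else (v2, v1)) = (v1', v2')"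
      by force
    note b = between[OF this]
    have "lt v1' v \<and> lt v v2'"
      using b v(1,2) by blast
    moreover have "w' \<in> A" if "lt v1' v'" "lt v' v2'" "P u v' w'" for v' w'
      using b[of v'] that v(3) by (auto simp: P_def)
    ultimately show ?thesis
      by blast
  qed
  have "pgi J P"
  proof (rule pgi_criterion[OF J(2-4) dP])
    show "w = w'" if "P u v w" "P u v w'" for u v w w'
      using that by (simp add: P_def)
    show "u \<in> J \<and> v \<in> J \<and> w \<in> J" "P v u w" "lt u w" if "P u v w" for u v w
      using that closed ps'(4,5) by (auto simp: P_def)
    show "s = t" if "P u v a" "P a w s" "P v w b" "P u b t" for u v w a b s t
      using that ps'(6) by (auto simp: P_def)
    show "lt w w'" if "lt u u'" "P u v w" "P u' v w'" for u u' v w w'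
      using that mono by (auto simp: P_def)
    show "\<exists>w'. P u v' w'" if "P u v w" "lt v' v" "v' \<in> J" for u v w v'
      using that init by (auto simp: P_def)
    show "\<exists>v' w'. lt v v' \<and> P u v' w'" if "P u v w" for u v w
      using that no_last[of u v] by (auto simp: P_def)
    show "\<exists>v w'. P u v w' \<and> lt w' w" "\<exists>v w'. P u v w' \<and> lt w w'" if "u \<in> J" "w \<in> J" "lt u w" for u w
      using small[OF that] large[OF that] that(1) by (auto simp: P_def)
    show "\<exists>v1. lt v1 v \<and> (\<forall>v' w'. lt v1 v' \<and> lt v' v \<and> P u v' w' \<longrightarrow> lt m w')"
      if w: "P u v w" "lt m w" for u v w m
    proof -
      obtain v1 v2 where v: "lt v1 v" "lt v v2"
        "\<forall>v' w'. lt v1 v' \<and> lt v' v2 \<and> P u v' w' \<longrightarrow> w' \<in> {z. lt m z}"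
        using cont[OF w(1) open_lt(1)[of m]] w(2) by blast
      then show ?thesis
        by (intro exI[of _ v1]) (blast intro: dir.less_trans)
    qed
    show "\<exists>v2. lt v v2 \<and> (\<forall>v' w'. lt v v' \<and> lt v' v2 \<and> P u v' w' \<longrightarrow> lt w' m)"
      if w: "P u v w" "lt w m" for u v w m
    proof -
      obtain v1 v2 where v: "lt v1 v" "lt v v2"
        "\<forall>v' w'. lt v1 v' \<and> lt v' v2 \<and> P u v' w' \<longrightarrow> w' \<in> {z. lt z m}"
        using cont[OF w(1) open_lt(2)[of m]] w(2) by blast
      then show ?thesis
        by (intro exI[of _ v2]) (blast intro: dir.less_trans)
    qed
  qed
  then show ?thesis
    using giI[OF lt _ dP] by blast
qed

text \<open>The limit at zero provides sums slightly above \<open>u\<close>, and the limit at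
  \<open>r\<close> provides sums close to \<open>c\<close>; these are the conditions
  \<open>small\<close> and \<open>large\<close> of the criterion.\<close>

lemma gi_positive_group_interval:
  assumes pos: "positive_group_interval M b c D p"
  shows "gi (open_interval b c)"
proof -
  have bc: "b < c" and ps: "partial_sum M (open_interval b c) D p"
    using pos by (auto simp: positive_group_interval_def)
  note ps' = partial_sumD[OF ps]
  have r: "\<exists>r. b < r \<and> r \<le> c \<and> (\<forall>y. (x, y) \<in> D \<longleftrightarrow> b < Fin y \<and> Fin y < r) \<and>
      ((\<lambda>x'. p x' x) \<longlongrightarrow> x) (right_of b) \<and> filterlim (\<lambda>x'. p x x') (nhds_ext c) (left_of r)"
    if "x \<in> open_interval b c" for x
    using pos that unfolding positive_group_interval_def open_interval_def by blast
  have small: "\<exists>v0. (u, v0) \<in> D \<and> (\<forall>v. b < Fin v \<and> v \<le> v0 \<longrightarrow> lo < p u v \<and> p u v < hi)"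
    if u: "u \<in> open_interval b c" and lo: "lo < u" "u < hi" for u lo hi
  proof -
    obtain r where r: "b < r" "\<forall>y. (u, y) \<in> D \<longleftrightarrow> b < Fin y \<and> Fin y < r"
      "((\<lambda>x'. p x' u) \<longlongrightarrow> u) (right_of b)"
      using r[OF u] by blast
    have "eventually (\<lambda>x'. lo < p x' u \<and> p x' u < hi) (right_of b)"
      using order_tendstoD[OF r(3)] lo by (auto intro: eventually_conj)
    then obtain y where y: "b < Fin y" "\<forall>z. b < Fin z \<and> z < y \<longrightarrow> lo < p z u \<and> p z u < hi"
      using eventually_right_of[of b u] u by (auto simp: open_interval_def)
    obtain v0 where v0: "b < Fin v0" "Fin v0 < min (Fin y) r"
      using ex_Fin_between[of b "min (Fin y) r"] r(1) y(1) by auto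
    have D: "(u, v) \<in> D" if "b < Fin v" "v \<le> v0" for v
    proof -
      have "Fin v \<le> Fin v0" "Fin v0 < r"
        using that v0 by auto
      then have "Fin v < r"
        by (rule le_less_trans)
      with r(2) that show ?thesis
        by simp
    qed
    moreover have "lo < p u v \<and> p u v < hi" if v: "b < Fin v" "v \<le> v0" for v
    proof -
      have "p v u = p u v"
        using ps'(5)[OF D[OF v]] .
      moreover have "v < y"
        using v v0 by auto
      ultimately show ?thesis
        using y(2)[rule_format, of v] v by simp
    qed
    ultimately show ?thesis
      using v0(1) by blast
  qed
  show ?thesis
  proof (rule gi_partial_sum[OF ps, of "(<)"])
    show "open_interval b c \<noteq> {}"
      by (rule open_interval_ne[OF bc])
    fix u v assume u: "u \<in> open_interval b c" and v: "v \<in> open_interval b c" and uv: "(u, v) \<in> D"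
    obtain r where r: "b < r" "r \<le> c" "\<forall>y. (u, y) \<in> D \<longleftrightarrow> b < Fin y \<and> Fin y < r"
      using r[OF u] by blast
    \<comment> \<open>That sums exceed their summands has to be derived. If
      \<open>u + v \<le> u\<close>, a smaller \<open>v1\<close> gives \<open>u + v1\<close> strictly
      below \<open>u\<close>. Near zero the sums tend to \<open>u\<close> and hence exceed
      \<open>u + v1\<close>, which contradicts monotonicity.\<close>
    have "u < p u v"
    proof (rule ccontr)
      assume "\<not> u < p u v"
      obtain v1 where v1: "b < Fin v1" "Fin v1 < Fin v"
        using ex_Fin_between[of b "Fin v"] v by (auto simp: open_interval_def)
      then have v1D: "(u, v1) \<in> D"
        using r(3) uv less_trans[OF v1(2), of r] by auto
      have "p v1 u < p v u"
        using ps'(7)[OF _ ps'(4)[OF v1D] ps'(4)[OF uv]] v1 by simp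
      then have lo: "p u v1 < u"
        using ps'(5)[OF v1D] ps'(5)[OF uv] \<open>\<not> u < p u v\<close> by simp
      obtain hi where "u < hi"
        using gt_ex by blast
      from small[OF u lo this] obtain v0 where v0: "(u, v0) \<in> D" "\<forall>v. b < Fin v \<and> v \<le> v0 \<longrightarrow> p u v1 < p u v"
        by blast
      then have "b < Fin (min v0 v1)"
        using v1(1) r(3) by (simp add: min_def)
      with v0(2) have less: "p u v1 < p u (min v0 v1)"
        by simp
      have "v0 < v1"
      proof (rule ccontr)
        assume "\<not> v0 < v1"
        then have "min v0 v1 = v1"
          by simp
        with less show False
          by simp
      qed
      then have "p u v0 < p u v1"
        using ps'(7)[OF _ ps'(4)[OF v0(1)] ps'(4)[OF v1D]] ps'(5)[OF v0(1)] ps'(5)[OF v1D] by simp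
      moreover have "min v0 v1 = v0"
        using \<open>v0 < v1\<close> by simp
      ultimately show False
        using less by simp
    qed
    then show "p u v \<in> open_interval b c \<and> u < p u v"
      using ps'(3)[OF uv] by simp
    show "\<exists>v'\<in>open_interval b c. v < v' \<and> (u, v') \<in> D"
    proof -
      have "Fin v < r"
        using r(3) uv by blast
      then obtain v' where v': "Fin v < Fin v'" "Fin v' < r"
        using ex_Fin_between by blast
      have "b < Fin v'"
        using v'(1) v unfolding open_interval_def by (auto intro: less_trans)
      then have "(u, v') \<in> D"
        using r(3) v'(2) by blast
      with v'(1) ps'(2) show ?thesis
        by auto
    qed
  next
    fix u v v' assume u: "u \<in> open_interval b c" and v: "v' \<in> open_interval b c" "v' < v" "(u, v) \<in> D"
    obtain r where r: "\<forall>y. (u, y) \<in> D \<longleftrightarrow> b < Fin y \<and> Fin y < r"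
      using r[OF u] by blast
    then show "(u, v') \<in> D"
      using v less_trans[of "Fin v'" "Fin v" r] by (auto simp: open_interval_def)
  next
    fix u w assume u: "u \<in> open_interval b c" and w: "w \<in> open_interval b c" and uw: "u < w"
    obtain lo where "lo < u"
      using lt_ex by blast
    from small[OF u this uw] obtain v0 where "(u, v0) \<in> D" "\<forall>v. b < Fin v \<and> v \<le> v0 \<longrightarrow> p u v < w"
      by blast
    moreover from this have "v0 \<in> open_interval b c"
      using ps'(2) by blast
    ultimately show "\<exists>v\<in>open_interval b c. (u, v) \<in> D \<and> p u v < w"
      by (auto simp: open_interval_def)
    obtain r where r: "b < r" "r \<le> c" "\<forall>y. (u, y) \<in> D \<longleftrightarrow> b < Fin y \<and> Fin y < r"
      "filterlim (\<lambda>x'. p u x') (nhds_ext c) (left_of r)"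
      using r[OF u] by blast
    have ev: "eventually (\<lambda>x'. w < p u x') (left_of r)"
      using filterlim_nhds_ext_greater[OF r(4)] w by (simp add: open_interval_def)
    obtain y0 where y0: "b < Fin y0" "Fin y0 < r"
      using ex_Fin_between[OF r(1)] by blast
    obtain y where y: "Fin y < r" "\<forall>z. y < z \<and> Fin z < r \<longrightarrow> w < p u z"
      using ev[unfolded eventually_left_of[OF y0(2)]] by (elim exE conjE)
    have "Fin (max y y0) < r"
      using y(1) y0(2) by (simp add: max_def)
    then obtain v where v: "Fin (max y y0) < Fin v" "Fin v < r"
      using ex_Fin_between by blast
    have "b < Fin v"
      using less_trans[OF y0(1), of "Fin v"] v(1) by simp
    then have "(u, v) \<in> D"
      using r(3) v(2) by blast
    with y(2) v ps'(2) show "\<exists>v\<in>open_interval b c. (u, v) \<in> D \<and> w < p u v"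
      by auto
  qed (simp_all add: conv_open_interval opn_open_interval dset_open_interval)
qed

text \<open>The mirror image of the positive case: zero is approached from the left at
  \<open>c\<close>, and sums are smaller than their summands.\<close>

lemma gi_negative_group_interval:
  assumes neg: "negative_group_interval M b c D p"
  shows "gi (open_interval b c)"
proof -
  have bc: "b < c" and ps: "partial_sum M (open_interval b c) D p"
    using neg by (auto simp: negative_group_interval_def)
  note ps' = partial_sumD[OF ps]
  have r: "\<exists>r. b \<le> r \<and> r < c \<and> (\<forall>y. (x, y) \<in> D \<longleftrightarrow> r < Fin y \<and> Fin y < c) \<and>
      ((\<lambda>x'. p x' x) \<longlongrightarrow> x) (left_of c) \<and> filterlim (\<lambda>x'. p x x') (nhds_ext b) (right_of r)"
    if "x \<in> open_interval b c" for x
    using neg that unfolding negative_group_interval_def open_interval_def by blast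
  have small: "\<exists>v0. (u, v0) \<in> D \<and> (\<forall>v. v0 \<le> v \<and> Fin v < c \<longrightarrow> lo < p u v \<and> p u v < hi)"
    if u: "u \<in> open_interval b c" and lo: "lo < u" "u < hi" for u lo hi
  proof -
    obtain r where r: "r < c" "\<forall>y. (u, y) \<in> D \<longleftrightarrow> r < Fin y \<and> Fin y < c"
      "((\<lambda>x'. p x' u) \<longlongrightarrow> u) (left_of c)"
      using r[OF u] by blast
    have "eventually (\<lambda>x'. lo < p x' u \<and> p x' u < hi) (left_of c)"
      using order_tendstoD[OF r(3)] lo by (auto intro: eventually_conj)
    then obtain y where y: "Fin y < c" "\<forall>z. y < z \<and> Fin z < c \<longrightarrow> lo < p z u \<and> p z u < hi"
      using eventually_left_of[of u c] u by (auto simp: open_interval_def)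
    obtain v0 where v0: "max (Fin y) r < Fin v0" "Fin v0 < c"
      using ex_Fin_between[of "max (Fin y) r" c] r(1) y(1) by auto
    have D: "(u, v) \<in> D" if "v0 \<le> v" "Fin v < c" for v
    proof -
      have "r < Fin v0" "Fin v0 \<le> Fin v"
        using that v0 by auto
      then have "r < Fin v"
        by (rule less_le_trans)
      with r(2) that show ?thesis
        by simp
    qed
    moreover have "lo < p u v \<and> p u v < hi" if v: "v0 \<le> v" "Fin v < c" for v
    proof -
      have "p v u = p u v"
        using ps'(5)[OF D[OF v]] .
      moreover have "y < v"
        using v v0 by auto
      ultimately show ?thesis
        using y(2)[rule_format, of v] v by simp
    qed
    ultimately show ?thesis
      using v0(2) by blast
  qed
  show ?thesis
  proof (rule gi_partial_sum[OF ps, of "(>)"])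
    show "open_interval b c \<noteq> {}"
      by (rule open_interval_ne[OF bc])
    fix u v assume u: "u \<in> open_interval b c" and v: "v \<in> open_interval b c" and uv: "(u, v) \<in> D"
    obtain r where r: "b \<le> r" "r < c" "\<forall>y. (u, y) \<in> D \<longleftrightarrow> r < Fin y \<and> Fin y < c"
      using r[OF u] by blast
    have "p u v < u"
    proof (rule ccontr)
      assume "\<not> p u v < u"
      obtain v1 where v1: "Fin v < Fin v1" "Fin v1 < c"
        using ex_Fin_between[of "Fin v" c] v by (auto simp: open_interval_def)
      then have v1D: "(u, v1) \<in> D"
        using r(3) uv less_trans[OF _ v1(1), of r] by auto
      have "p v u < p v1 u"
        using ps'(7)[OF _ ps'(4)[OF uv] ps'(4)[OF v1D]] v1 by simp
      then have hi: "u < p u v1"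
        using ps'(5)[OF v1D] ps'(5)[OF uv] \<open>\<not> p u v < u\<close> by simp
      obtain lo where "lo < u"
        using lt_ex by blast
      from small[OF u this hi] obtain v0 where v0: "(u, v0) \<in> D" "\<forall>v. v0 \<le> v \<and> Fin v < c \<longrightarrow> p u v < p u v1"
        by blast
      then have "Fin (max v0 v1) < c"
        using v1(2) r(3) by (simp add: max_def)
      with v0(2) have less: "p u (max v0 v1) < p u v1"
        by simp
      have "v1 < v0"
      proof (rule ccontr)
        assume "\<not> v1 < v0"
        then have "max v0 v1 = v1"
          by simp
        with less show False
          by simp
      qed
      then have "p u v1 < p u v0"
        using ps'(7)[OF _ ps'(4)[OF v1D] ps'(4)[OF v0(1)]] ps'(5)[OF v0(1)] ps'(5)[OF v1D] by simp
      moreover have "max v0 v1 = v0"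
        using \<open>v1 < v0\<close> by simp
      ultimately show False
        using less by simp
    qed
    then show "p u v \<in> open_interval b c \<and> p u v < u"
      using ps'(3)[OF uv] by simp
    show "\<exists>v'\<in>open_interval b c. v' < v \<and> (u, v') \<in> D"
    proof -
      have "r < Fin v"
        using r(3) uv by blast
      then obtain v' where v': "r < Fin v'" "Fin v' < Fin v"
        using ex_Fin_between by blast
      have "Fin v' < c"
        using v'(2) v less_trans[OF v'(2), of c] unfolding open_interval_def by simp
      then have "(u, v') \<in> D"
        using r(3) v'(1) by blast
      with v'(2) ps'(2) show ?thesis
        by auto
    qed
  next
    fix u v v' assume u: "u \<in> open_interval b c" and v: "v' \<in> open_interval b c" "v < v'" "(u, v) \<in> D"
    obtain r where r: "\<forall>y. (u, y) \<in> D \<longleftrightarrow> r < Fin y \<and> Fin y < c"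
      using r[OF u] by blast
    then show "(u, v') \<in> D"
      using v less_trans[of r "Fin v" "Fin v'"] by (auto simp: open_interval_def)
  next
    fix u w assume u: "u \<in> open_interval b c" and w: "w \<in> open_interval b c" and uw: "w < u"
    obtain hi where "u < hi"
      using gt_ex by blast
    from small[OF u uw this] obtain v0 where "(u, v0) \<in> D" "\<forall>v. v0 \<le> v \<and> Fin v < c \<longrightarrow> w < p u v"
      by blast
    moreover from this have "v0 \<in> open_interval b c"
      using ps'(2) by blast
    ultimately show "\<exists>v\<in>open_interval b c. (u, v) \<in> D \<and> w < p u v"
      by (auto simp: open_interval_def)
    obtain r where r: "b \<le> r" "r < c" "\<forall>y. (u, y) \<in> D \<longleftrightarrow> r < Fin y \<and> Fin y < c"
      "filterlim (\<lambda>x'. p u x') (nhds_ext b) (right_of r)"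
      using r[OF u] by blast
    have ev: "eventually (\<lambda>x'. p u x' < w) (right_of r)"
      using filterlim_nhds_ext_less[OF r(4)] w by (simp add: open_interval_def)
    obtain y0 where y0: "r < Fin y0" "Fin y0 < c"
      using ex_Fin_between[OF r(2)] by blast
    obtain y where y: "r < Fin y" "\<forall>z. r < Fin z \<and> z < y \<longrightarrow> p u z < w"
      using ev[unfolded eventually_right_of[OF y0(1)]] by (elim exE conjE)
    have "r < Fin (min y y0)"
      using y(1) y0(1) by (simp add: min_def)
    then obtain v where v: "r < Fin v" "Fin v < Fin (min y y0)"
      using ex_Fin_between by blast
    have "Fin v < c"
      using less_trans[OF _ y0(2), of "Fin v"] v(2) by simp
    then have "(u, v) \<in> D"
      using r(3) v(1) by blast
    with y(2) v ps'(2) show "\<exists>v\<in>open_interval b c. (u, v) \<in> D \<and> p u v < w"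
      by auto
  qed (simp_all add: conv_open_interval opn_open_interval dset_open_interval)
qed

text \<open>The interval is cut at its zero \<open>z\<close>. The two halves are of positive and of
  negative type, and there the unit law together with monotonicity shows directly on which side of
  \<open>u\<close> the sum lies.\<close>

lemma SH_group_interval:
  assumes "group_interval M b c D p"
  shows "SH (open_interval b c)"
proof -
  have ps: "partial_sum M (open_interval b c) D p"
    using assms by (simp add: group_interval_def)
  note ps' = partial_sumD[OF ps]
  have set_eq: "{y. (x, y) \<in> D} = open_interval l r \<longleftrightarrow> (\<forall>y. (x, y) \<in> D \<longleftrightarrow> l < Fin y \<and> Fin y < r)" for x l r
    by (auto simp: open_interval_def)
  obtain z where z: "z \<in> open_interval b c" and h:
    "\<forall>x\<in>open_interval b c. (z, x) \<in> D \<and> p z x = x \<and> ((\<lambda>x'. p x' x) \<longlongrightarrow> x) (at z)"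
    "\<forall>x\<in>open_interval b c. \<exists>y. (x, y) \<in> D \<and> p x y = z"
    "\<forall>x\<in>open_interval b c. z < x \<longrightarrow> (\<exists>r. b < r \<and> r \<le> c \<and> {y. (x, y) \<in> D} = open_interval b r \<and>
      filterlim (\<lambda>x'. p x x') (nhds_ext c) (left_of r))"
    "\<forall>x\<in>open_interval b c. x < z \<longrightarrow> (\<exists>l. b \<le> l \<and> l < c \<and> {y. (x, y) \<in> D} = open_interval l c \<and>
      filterlim (\<lambda>x'. p x x') (nhds_ext b) (right_of l))"
    using assms unfolding group_interval_def by (elim conjE bexE)
  have unit: "(z, x) \<in> D \<and> p z x = x \<and> ((\<lambda>x'. p x' x) \<longlongrightarrow> x) (at z)" if "x \<in> open_interval b c" for x
    using bspec[OF h(1) that] .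
  have pos: "\<exists>r. b < r \<and> r \<le> c \<and>
      (\<forall>y. (x, y) \<in> D \<longleftrightarrow> b < Fin y \<and> Fin y < r) \<and> filterlim (\<lambda>x'. p x x') (nhds_ext c) (left_of r)"
    if "x \<in> open_interval b c" "z < x" for x
    using h(3)[unfolded set_eq] that by blast
  have neg: "\<exists>l. b \<le> l \<and> l < c \<and>
      (\<forall>y. (x, y) \<in> D \<longleftrightarrow> l < Fin y \<and> Fin y < c) \<and> filterlim (\<lambda>x'. p x x') (nhds_ext b) (right_of l)"
    if "x \<in> open_interval b c" "x < z" for x
    using h(4)[unfolded set_eq] that by blast
  have zbc: "b < Fin z" "Fin z < c"
    using z by (auto simp: open_interval_def)
  have unit': "(x, z) \<in> D" "p x z = x" if "x \<in> open_interval b c" for x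
    using unit[OF that] ps'(4,5)[of z x] by auto
  have near: "\<exists>S. open S \<and> z \<in> S \<and> (\<forall>x'\<in>S. x' \<noteq> z \<longrightarrow> (x', x) \<in> D \<longrightarrow> p x x' \<in> A)"
    if x: "x \<in> open_interval b c" and A: "open A" "x \<in> A" for x A
  proof -
    have "eventually (\<lambda>x'. p x' x \<in> A) (at z)"
      using unit[OF x] topological_tendstoD A by blast
    then show ?thesis
      unfolding eventually_at_topological using ps'(5) by (metis UNIV_I)
  qed
  have posJ: "x \<in> open_interval b c \<and> z < x" if "x \<in> open_interval (Fin z) c" for x
    using that less_trans[OF zbc(1), of "Fin x"] by (auto simp: open_interval_def)
  have negJ: "x \<in> open_interval b c \<and> x < z" if "x \<in> open_interval b (Fin z)" for x
    using that less_trans[OF _ zbc(2), of "Fin x"] by (auto simp: open_interval_def)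
  have "gi (open_interval (Fin z) c)"
  proof (rule gi_partial_sum[OF ps, of "(<)"])
    show "open_interval (Fin z) c \<subseteq> open_interval b c"
      using posJ by blast
    show "open_interval (Fin z) c \<noteq> {}"
      by (rule open_interval_ne[OF zbc(2)])
    fix u v assume u: "u \<in> open_interval (Fin z) c" and v: "v \<in> open_interval (Fin z) c" and uv: "(u, v) \<in> D"
    note u' = posJ[OF u] and v' = posJ[OF v]
    have "u < p u v"
      using ps'(7)[of z v u] v' u' unit'(2)[of u] unit'(1)[of u] ps'(4,5) uv by metis
    then show "p u v \<in> open_interval (Fin z) c \<and> u < p u v"
      using u' ps'(3)[OF uv] by (auto simp: open_interval_def)
    obtain r where r: "\<forall>y. (u, y) \<in> D \<longleftrightarrow> b < Fin y \<and> Fin y < r"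
      using pos[of u] u' by blast
    obtain w where w: "Fin v < Fin w" "Fin w < r"
      using ex_Fin_between[of "Fin v" r] r uv by blast
    have "b < Fin w" "Fin z < Fin w"
      using v' w(1) less_trans[OF _ w(1), of b] by (auto simp: open_interval_def)
    then have "(u, w) \<in> D"
      using r w(2) by blast
    with ps'(2)[OF this] w(1) \<open>Fin z < Fin w\<close> show "\<exists>v'\<in>open_interval (Fin z) c. v < v' \<and> (u, v') \<in> D"
      by (auto simp: open_interval_def)
  next
    fix u v v' assume h: "u \<in> open_interval (Fin z) c" "v' \<in> open_interval (Fin z) c" "v' < v" "(u, v) \<in> D"
    then show "(u, v') \<in> D"
      using pos[of u] posJ[of u] posJ[of v'] less_trans[of "Fin v'" "Fin v"] by (auto simp: open_interval_def)
  next
    fix u w assume u: "u \<in> open_interval (Fin z) c" and w: "w \<in> open_interval (Fin z) c" and uw: "u < w"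
    note u' = posJ[OF u] and w' = posJ[OF w]
    obtain r where r: "b < r" "\<forall>y. (u, y) \<in> D \<longleftrightarrow> b < Fin y \<and> Fin y < r"
      "filterlim (\<lambda>x'. p u x') (nhds_ext c) (left_of r)"
      using pos[of u] u' by blast
    have zr: "Fin z < r"
      using r(2) unit'(1)[of u] u' by blast
    have D: "(u, v) \<in> D" "v \<in> open_interval (Fin z) c" if "z < v" "Fin v < r" for v
    proof -
      have "b < Fin v"
        using zbc(1) that(1) less_trans[of b "Fin z" "Fin v"] by simp
      then show "(u, v) \<in> D"
        using r(2) that(2) by blast
      then show "v \<in> open_interval (Fin z) c"
        using ps'(2) that(1) by (auto simp: open_interval_def)
    qed
    obtain S where S: "open S" "z \<in> S" "\<forall>x'\<in>S. x' \<noteq> z \<longrightarrow> (x', u) \<in> D \<longrightarrow> p u x' \<in> {..<w}"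
      using near[of u "{..<w}"] u' uw by auto
    obtain g where "z < g"
      using gt_ex by blast
    obtain y where y: "z < y" "{z..<y} \<subseteq> S"
      using open_right[OF S(1,2) \<open>z < g\<close>] by blast
    obtain v where v: "Fin z < Fin v" "Fin v < min (Fin y) r"
      using ex_Fin_between[of "Fin z" "min (Fin y) r"] y(1) zr by auto
    have "v \<in> S" "v \<noteq> z"
      using v y by auto
    moreover have "(u, v) \<in> D" "v \<in> open_interval (Fin z) c"
      using D[of v] v by simp_all
    ultimately show "\<exists>v\<in>open_interval (Fin z) c. (u, v) \<in> D \<and> p u v < w"
      using S(3) ps'(4) by blast
    have ev: "eventually (\<lambda>x'. w < p u x') (left_of r)"
      using filterlim_nhds_ext_greater[OF r(3)] w by (simp add: open_interval_def)
    obtain y where y: "Fin y < r" "\<forall>x. y < x \<and> Fin x < r \<longrightarrow> w < p u x"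
      using ev[unfolded eventually_left_of[OF zr]] by (elim exE conjE)
    have "Fin (max y z) < r"
      using y(1) zr by (simp add: max_def)
    then obtain v where v: "Fin (max y z) < Fin v" "Fin v < r"
      using ex_Fin_between by blast
    then show "\<exists>v\<in>open_interval (Fin z) c. (u, v) \<in> D \<and> w < p u v"
      using D[of v] y(2) by auto
  qed (simp_all add: conv_open_interval opn_open_interval dset_open_interval)
  moreover have "gi (open_interval b (Fin z))"
  proof (rule gi_partial_sum[OF ps, of "(>)"])
    show "open_interval b (Fin z) \<subseteq> open_interval b c"
      using negJ by blast
    show "open_interval b (Fin z) \<noteq> {}"
      by (rule open_interval_ne[OF zbc(1)])
    fix u v assume u: "u \<in> open_interval b (Fin z)" and v: "v \<in> open_interval b (Fin z)" and uv: "(u, v) \<in> D"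
    note u' = negJ[OF u] and v' = negJ[OF v]
    have "p u v < u"
      using ps'(7)[of v z u] v' u' unit'(2)[of u] unit'(1)[of u] ps'(4,5) uv by metis
    then show "p u v \<in> open_interval b (Fin z) \<and> p u v < u"
      using u' ps'(3)[OF uv] by (auto simp: open_interval_def)
    obtain r where r: "\<forall>y. (u, y) \<in> D \<longleftrightarrow> r < Fin y \<and> Fin y < c"
      using neg[of u] u' by blast
    obtain w where w: "r < Fin w" "Fin w < Fin v"
      using ex_Fin_between[of r "Fin v"] r uv by blast
    have "Fin w < c" "Fin w < Fin z"
      using v' w(2) less_trans[OF w(2), of c] by (auto simp: open_interval_def)
    then have "(u, w) \<in> D"
      using r w(1) by blast
    with ps'(2)[OF this] w(2) \<open>Fin w < Fin z\<close> show "\<exists>v'\<in>open_interval b (Fin z). v' < v \<and> (u, v') \<in> D"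
      by (auto simp: open_interval_def)
  next
    fix u v v' assume h: "u \<in> open_interval b (Fin z)" "v' \<in> open_interval b (Fin z)" "v < v'" "(u, v) \<in> D"
    then show "(u, v') \<in> D"
      using neg[of u] negJ[of u] negJ[of v'] less_trans[of _ "Fin v" "Fin v'"] by (auto simp: open_interval_def)
  next
    fix u w assume u: "u \<in> open_interval b (Fin z)" and w: "w \<in> open_interval b (Fin z)" and uw: "w < u"
    note u' = negJ[OF u] and w' = negJ[OF w]
    obtain r where r: "r < c" "\<forall>y. (u, y) \<in> D \<longleftrightarrow> r < Fin y \<and> Fin y < c"
      "filterlim (\<lambda>x'. p u x') (nhds_ext b) (right_of r)"
      using neg[of u] u' by blast
    have zr: "r < Fin z"
      using r(2) unit'(1)[of u] u' by blast
    have D: "(u, v) \<in> D" "v \<in> open_interval b (Fin z)" if "v < z" "r < Fin v" for v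
    proof -
      have "Fin v < c"
        using zbc(2) that(1) less_trans[of "Fin v" "Fin z" c] by simp
      then show "(u, v) \<in> D"
        using r(2) that(2) by blast
      then show "v \<in> open_interval b (Fin z)"
        using ps'(2) that(1) by (auto simp: open_interval_def)
    qed
    obtain S where S: "open S" "z \<in> S" "\<forall>x'\<in>S. x' \<noteq> z \<longrightarrow> (x', u) \<in> D \<longrightarrow> p u x' \<in> {w<..}"
      using near[of u "{w<..}"] u' uw by auto
    obtain g where "g < z"
      using lt_ex by blast
    obtain y where y: "y < z" "{y<..z} \<subseteq> S"
      using open_left[OF S(1,2) \<open>g < z\<close>] by blast
    obtain v where v: "max (Fin y) r < Fin v" "Fin v < Fin z"
      using ex_Fin_between[of "max (Fin y) r" "Fin z"] y(1) zr by auto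
    have "v \<in> S" "v \<noteq> z"
      using v y by auto
    moreover have "(u, v) \<in> D" "v \<in> open_interval b (Fin z)"
      using D[of v] v by simp_all
    ultimately show "\<exists>v\<in>open_interval b (Fin z). (u, v) \<in> D \<and> w < p u v"
      using S(3) ps'(4) by blast
    have ev: "eventually (\<lambda>x'. p u x' < w) (right_of r)"
      using filterlim_nhds_ext_less[OF r(3)] w by (simp add: open_interval_def)
    obtain y where y: "r < Fin y" "\<forall>x. r < Fin x \<and> x < y \<longrightarrow> p u x < w"
      using ev[unfolded eventually_right_of[OF zr]] by (elim exE conjE)
    have "r < Fin (min y z)"
      using y(1) zr by (simp add: min_def)
    then obtain v where v: "r < Fin v" "Fin v < Fin (min y z)"
      using ex_Fin_between by blast
    then show "\<exists>v\<in>open_interval b (Fin z). (u, v) \<in> D \<and> p u v < w"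
      using D[of v] y(2) by auto
  qed (simp_all add: conv_open_interval opn_open_interval dset_open_interval)
  ultimately have "SH ((open_interval b (Fin z) \<union> open_interval (Fin z) c) \<union> {z})"
    by (intro SH_Un) (simp_all add: SH_gi SH_finite del: Un_insert_right)
  then show ?thesis
    by (rule SH_subset[OF _ dset_open_interval]) (auto simp: open_interval_def)
qed

lemma SH_generalized_group_interval:
  assumes "generalized_group_interval M I"
  shows "SH I"
  using assms gi_positive_group_interval gi_negative_group_interval SH_group_interval SH_gi
  unfolding generalized_group_interval_def by metis

lemma SH_gp_short_interval:
  assumes "gp_short_interval M I"
  shows "SH I"
proof -
  obtain \<J> where \<J>: "finite \<J>" "partition_on I \<J>" "\<forall>J\<in>\<J>. (\<exists>a. J = {a}) \<or> generalized_group_interval M J"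
    using assms unfolding gp_short_interval_def by blast
  have "SH J" if J: "J \<in> \<J>" for J
  proof (cases "\<exists>a. J = {a}")
    case True
    then show ?thesis
      by (auto intro: SH_finite)
  next
    case False
    with \<J>(3) J show ?thesis
      by (auto intro: SH_generalized_group_interval)
  qed
  then have "SH (\<Union>J\<in>\<J>. J)"
    by (intro SH_UN \<J>(1))
  then show ?thesis
    using \<J>(2) by (simp add: partition_on_def)
qed

end

section \<open>From additions described by the order back to generalized group-intervals\<close>

context omin_dir
begin

text \<open>One half of joint continuity. First \<open>v\<close> is lowered to \<open>v1\<close>,
  then \<open>u\<close> to \<open>u1\<close>, by prescribing sums \<open>w1\<close> and
  \<open>w2\<close> that are still above \<open>a\<close>; total subtraction supplies the summands,
  and monotonicity does the rest.\<close>

lemma partial_addition_lower: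
  assumes I: "conv I" "opn I" and PA: "partial_addition I P" and p: "P u v w" and a: "a \<sqsubset> w"
  obtains u1 v1 where "u1 \<sqsubset> u" "v1 \<sqsubset> v"
    "\<And>u' v' w'. u1 \<sqsubset> u' \<Longrightarrow> v1 \<sqsubset> v' \<Longrightarrow> P u' v' w' \<Longrightarrow> a \<sqsubset> w'"
proof -
  note PD = partial_additionD[OF PA]
  obtain m where m: "a \<sqsubseteq> m" "u \<sqsubseteq> m" "v \<sqsubseteq> m" "m \<sqsubset> w"
    using a PD(10,11)[OF p] by (metis dir.linear dir.order_refl dir.order_trans)
  obtain w1 where w1: "m \<sqsubset> w1" "w1 \<sqsubset> w"
    using dir.dense[OF m(4)] by blast
  have "w1 \<in> I"
    using convD[OF I(1) PD(1)[OF p] PD(3)[OF p]] m(2) w1 by (meson dir.less_imp_le dir.le_less_trans)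
  moreover have "u \<sqsubset> w1"
    using m(2) w1(1) by (rule dir.le_less_trans)
  ultimately obtain v1 where v1: "P u v1 w1"
    using PD(9) PD(1)[OF p] by blast
  have "v1 \<sqsubset> v"
    using partial_addition_less_iff[OF PA v1 p] w1(2) by blast
  obtain m' where m': "a \<sqsubseteq> m'" "v1 \<sqsubseteq> m'" "m' \<sqsubset> w1"
    using PD(11)[OF v1] m(1) w1(1) by (metis dir.linear dir.order_refl dir.le_less_trans)
  obtain w2 where w2: "m' \<sqsubset> w2" "w2 \<sqsubset> w1"
    using dir.dense[OF m'(3)] by blast
  have "w2 \<in> I"
    using convD[OF I(1) PD(2)[OF v1] PD(3)[OF v1]] m'(2) w2 by (meson dir.less_imp_le dir.le_less_trans)
  moreover have "v1 \<sqsubset> w2"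
    using m'(2) w2(1) by (rule dir.le_less_trans)
  ultimately obtain u1 where "P v1 u1 w2"
    using PD(9) PD(2)[OF v1] by blast
  then have u1: "P u1 v1 w2"
    by (rule PD(5))
  have "u1 \<sqsubset> u"
    using partial_addition_less_iff[OF PA PD(5)[OF u1] PD(5)[OF v1]] w2(2) by blast
  moreover have "a \<sqsubset> w'" if uv: "u1 \<sqsubset> u'" "v1 \<sqsubset> v'" "P u' v' w'" for u' v' w'
  proof -
    obtain w3 where w3: "P u' v1 w3"
      using PD(12)[OF uv(3,2) PD(2)[OF v1]] by blast
    have "w2 \<sqsubset> w3" "w3 \<sqsubset> w'"
      using PD(7)[OF uv(1) u1 w3] PD(8)[OF w3 uv(2,3)] by blast+
    with m'(1) w2(1) show ?thesis
      by (meson dir.le_less_trans dir.less_trans)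
  qed
  ultimately show ?thesis
    using that \<open>v1 \<sqsubset> v\<close> by blast
qed

text \<open>The other half. Here the sums \<open>u + v1\<close> and \<open>u1 + v1\<close> have to
  exist, so their values are chosen above \<open>w\<close> but below both \<open>a\<close> and a
  point of \<open>I\<close>.\<close>

lemma partial_addition_upper:
  assumes I: "conv I" "opn I" and PA: "partial_addition I P" and p: "P u v w" and a: "w \<sqsubset> a"
  obtains u1 v1 where "u \<sqsubset> u1" "v \<sqsubset> v1"
    "\<And>u' v' w'. u' \<sqsubset> u1 \<Longrightarrow> v' \<sqsubset> v1 \<Longrightarrow> P u' v' w' \<Longrightarrow> w' \<sqsubset> a"
proof -
  note PD = partial_additionD[OF PA]
  obtain i where i: "i \<in> I" "w \<sqsubset> i"
    using I(2) PD(3)[OF p] unfolding opn_iff by blast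
  obtain m where m: "m \<sqsubseteq> a" "m \<sqsubseteq> i" "w \<sqsubset> m"
    using a i(2) by (metis dir.linear dir.order_refl)
  obtain w2 where w2: "w \<sqsubset> w2" "w2 \<sqsubset> m"
    using dir.dense[OF m(3)] by blast
  obtain w1 where w1: "w \<sqsubset> w1" "w1 \<sqsubset> w2"
    using dir.dense[OF w2(1)] by blast
  have mem: "w1 \<in> I" "w2 \<in> I"
    using convD[OF I(1) PD(3)[OF p] i(1)] m(2) w1 w2
    by (meson dir.less_imp_le dir.less_le_trans dir.less_trans)+
  obtain v1 where v1: "P u v1 w1"
    using PD(9)[OF PD(1)[OF p] mem(1)] PD(10)[OF p] w1(1) by (meson dir.less_trans)
  have "v \<sqsubset> v1"
    using partial_addition_less_iff[OF PA p v1] w1(1) by blast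
  obtain u1 where "P v1 u1 w2"
    using PD(9)[OF PD(2)[OF v1] mem(2)] PD(11)[OF v1] w1(2) by (meson dir.less_trans)
  then have u1: "P u1 v1 w2"
    by (rule PD(5))
  have "u \<sqsubset> u1"
    using partial_addition_less_iff[OF PA PD(5)[OF v1] PD(5)[OF u1]] w1(2) by blast
  moreover have "w' \<sqsubset> a" if uv: "u' \<sqsubset> u1" "v' \<sqsubset> v1" "P u' v' w'" for u' v' w'
  proof -
    obtain w3 where w3: "P u1 v' w3"
      using PD(12)[OF u1 uv(2) PD(2)[OF uv(3)]] by blast
    have "w' \<sqsubset> w3" "w3 \<sqsubset> w2"
      using PD(7)[OF uv(1,3) w3] PD(8)[OF w3 uv(2) u1] by blast+
    with w2(2) m(1) show ?thesis
      by (meson dir.less_le_trans dir.less_trans)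
  qed
  ultimately show ?thesis
    using that \<open>v \<sqsubset> v1\<close> by blast
qed

end

context omin_top
begin

lemma partial_sum_pgi:
  assumes lt: "lt = (<) \<or> lt = (>)" and pgi: "omin_dir.pgi lt I P"
    and dP: "dfn UNIV (\<lambda>v. P (v 0) (v 1) (v 2))"
  defines "D \<equiv> {(u, v). \<exists>w. P u v w}" and "p \<equiv> (\<lambda>u v. THE w. P u v w)"
  shows "partial_sum M I D p" and "\<And>u v w. P u v w \<longleftrightarrow> (u, v) \<in> D \<and> w = p u v"
proof -
  interpret omin_dir M lt
    by unfold_locales (rule lt)
  have I: "conv I" "opn I" "partial_addition I P"
    using pgi by (auto simp: pgi_def)
  note PD = partial_additionD[OF I(3)]
  have p: "p u v = w" if "P u v w" for u v w
    unfolding p_def using that PD(4) by blast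
  show P: "P u v w \<longleftrightarrow> (u, v) \<in> D \<and> w = p u v" for u v w
    using p unfolding D_def by auto
  have open_lt: "open {z. lt m z}" "open {z. lt z m}" for m
    using lt by (auto simp flip: greaterThan_def lessThan_def)
  have lt_less: "(\<forall>x y. Q x y) \<longleftrightarrow> (\<forall>x y. lt x y \<longrightarrow> Q x y) \<and> (\<forall>x y. lt y x \<longrightarrow> Q x y) \<and> (\<forall>x. Q x x)" for Q
    by (metis dir.neqE)
  have tend: "((\<lambda>(x, y). p x y) \<longlongrightarrow> p u v) (at (u, v) within D)" if uv: "(u, v) \<in> D" for u v
  proof -
    have P_uv: "P u v (p u v)"
      using P uv by blast
    have lower: "eventually (\<lambda>z. lt a ((\<lambda>(x, y). p x y) z)) (at (u, v) within D)" if a: "lt a (p u v)" for a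
    proof -
      obtain u1 v1 where u1: "lt u1 u" "lt v1 v" "\<And>u' v' w'. lt u1 u' \<Longrightarrow> lt v1 v' \<Longrightarrow> P u' v' w' \<Longrightarrow> lt a w'"
        using partial_addition_lower[OF I P_uv a] by blast
      show ?thesis
        unfolding eventually_at_topological
        by (rule exI[of _ "{z. lt u1 z} \<times> {z. lt v1 z}"])
          (use u1 P in \<open>auto intro: open_Times open_lt\<close>)
    qed
    have upper: "eventually (\<lambda>z. lt ((\<lambda>(x, y). p x y) z) a) (at (u, v) within D)" if a: "lt (p u v) a" for a
    proof -
      obtain u1 v1 where u1: "lt u u1" "lt v v1" "\<And>u' v' w'. lt u' u1 \<Longrightarrow> lt v' v1 \<Longrightarrow> P u' v' w' \<Longrightarrow> lt w' a"
        using partial_addition_upper[OF I P_uv a] by blast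
      show ?thesis
        unfolding eventually_at_topological
        by (rule exI[of _ "{z. lt z u1} \<times> {z. lt z v1}"])
          (use u1 P in \<open>auto intro: open_Times open_lt\<close>)
    qed
    show ?thesis
      using lt lower upper by (elim disjE) (auto intro!: order_tendstoI)
  qed
  have cont: "continuous_on D (\<lambda>(x, y). p x y)"
    unfolding continuous_on_def using tend by auto
  have "dfn UNIV (\<lambda>v. restrict v {..<3} \<in> {v \<in> Pow_n 3. (v 0, v 1) \<in> D \<and> v 2 = p (v 0) (v 1)})"
    using dP by (rule dfn_cong) (simp add: P)
  then have df: "definable M 3 {v \<in> Pow_n 3. (v 0, v 1) \<in> D \<and> v 2 = p (v 0) (v 1)}"
    unfolding definable_iff_dfn by blast
  have DP: "P x y (p x y)" if "(x, y) \<in> D" for x y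
    using P that by blast
  have sub: "D \<subseteq> I \<times> I"
    using PD(1,2) unfolding D_def by blast
  have closed: "\<forall>(x, y)\<in>D. p x y \<in> I"
    using PD(3)[OF DP] by blast
  have comm: "(y, x) \<in> D \<and> p x y = p y x" if "(x, y) \<in> D" for x y
    using PD(5)[OF DP[OF that]] P[of y x "p x y"] by blast
  have assoc: "p (p x y) z = p x (p y z)"
    if xyz: "(x, y) \<in> D \<and> (p x y, z) \<in> D \<and> (y, z) \<in> D \<and> (x, p y z) \<in> D" for x y z
  proof -
    have "P x y (p x y)" "P (p x y) z (p (p x y) z)" "P y z (p y z)" "P x (p y z) (p x (p y z))"
      using DP xyz by blast+
    then show ?thesis
      by (rule PD(6))
  qed
  have mono: "p x z < p y z" if xyz: "x < y \<and> (x, z) \<in> D \<and> (y, z) \<in> D" for x y z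
  proof -
    have "P x z (p x z)" "P y z (p y z)"
      using DP xyz by blast+
    then show ?thesis
      using lt PD(7)[of x y z "p x z" "p y z"] PD(7)[of y x z "p y z" "p x z"] xyz by (elim disjE) simp_all
  qed
  show "partial_sum M I D p"
    unfolding partial_sum_def
    by (intro conjI[OF sub] conjI[OF closed] conjI[OF df] conjI[OF cont]) (intro conjI allI impI; (rule assoc mono; assumption)?; simp add: comm)
qed

lemma initial_open_interval:
  assumes X: "dset X" "X \<noteq> {}" "X \<subseteq> open_interval b c"
    and init: "\<And>x y. x \<in> X \<Longrightarrow> y \<in> open_interval b c \<Longrightarrow> y < x \<Longrightarrow> y \<in> X"
    and no_last: "\<And>x. x \<in> X \<Longrightarrow> \<exists>y\<in>X. x < y"
  obtains r where "b < r" "r \<le> c" "X = open_interval b r"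
proof -
  obtain r where r: "\<And>x. x \<in> X \<Longrightarrow> Fin x \<le> r" "\<And>y. Fin y < r \<Longrightarrow> \<exists>x\<in>X. y < x"
    using ex_sup[OF X(1,2)] by blast
  have less: "Fin x < r" if "x \<in> X" for x
    using no_last[OF that] r(1) by (metis less_extended_simps(1) less_le_trans)
  have rc: "r \<le> c"
  proof (rule ccontr)
    assume "\<not> r \<le> c"
    then obtain x where "c \<le> Fin x" "Fin x < r"
      using X(2,3) ex_Fin_between[of c r] by (metis less_imp_le not_le)
    then obtain y where "y \<in> X" "x < y"
      using r(2) by blast
    with X(3) have "Fin y < c"
      by (auto simp: open_interval_def)
    with \<open>c \<le> Fin x\<close> \<open>x < y\<close> show False
      by (metis less_extended_simps(1) less_trans not_le)
  qed
  have eq: "X = open_interval b r"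
  proof (intro equalityI subsetI)
    fix x assume "x \<in> X"
    with less X(3) show "x \<in> open_interval b r"
      by (auto simp: open_interval_def)
  next
    fix y assume y: "y \<in> open_interval b r"
    then obtain x where "x \<in> X" "y < x"
      using r(2) by (auto simp: open_interval_def)
    with y init rc show "y \<in> X"
      by (auto simp: open_interval_def)
  qed
  obtain x where "x \<in> X"
    using X(2) by blast
  then have "b < r"
    using X(3) less by (auto simp: open_interval_def intro: less_trans)
  then show ?thesis
    using that rc eq by blast
qed

lemma final_open_interval:
  assumes X: "dset X" "X \<noteq> {}" "X \<subseteq> open_interval b c"
    and fin: "\<And>x y. x \<in> X \<Longrightarrow> y \<in> open_interval b c \<Longrightarrow> x < y \<Longrightarrow> y \<in> X"
    and no_first: "\<And>x. x \<in> X \<Longrightarrow> \<exists>y\<in>X. y < x"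
  obtains l where "b \<le> l" "l < c" "X = open_interval l c"
proof -
  obtain l where l: "\<And>x. x \<in> X \<Longrightarrow> l \<le> Fin x" "\<And>y. l < Fin y \<Longrightarrow> \<exists>x\<in>X. x < y"
    using ex_inf[OF X(1,2)] by blast
  have less: "l < Fin x" if "x \<in> X" for x
    using no_first[OF that] l(1) by (metis less_extended_simps(1) le_less_trans)
  have bl: "b \<le> l"
  proof (rule ccontr)
    assume "\<not> b \<le> l"
    then obtain x where "Fin x \<le> b" "l < Fin x"
      using X(2,3) ex_Fin_between[of l b] by (metis less_imp_le not_le)
    then obtain y where "y \<in> X" "y < x"
      using l(2) by blast
    with X(3) have "b < Fin y"
      by (auto simp: open_interval_def)
    with \<open>Fin x \<le> b\<close> \<open>y < x\<close> show False
      by (metis less_extended_simps(1) less_trans not_le)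
  qed
  have eq: "X = open_interval l c"
  proof (intro equalityI subsetI)
    fix x assume "x \<in> X"
    with less X(3) show "x \<in> open_interval l c"
      by (auto simp: open_interval_def)
  next
    fix y assume y: "y \<in> open_interval l c"
    then obtain x where "x \<in> X" "x < y"
      using l(2) by (auto simp: open_interval_def)
    with y fin bl show "y \<in> X"
      by (auto simp: open_interval_def)
  qed
  obtain x where "x \<in> X"
    using X(2) by blast
  then have "l < c"
    using X(3) less by (auto simp: open_interval_def intro: less_trans)
  then show ?thesis
    using that bl eq by blast
qed

text \<open>Both limits come from differences. For \<open>w\<close> slightly above \<open>x\<close>,
  the \<open>v\<close> with \<open>x + v = w\<close> bounds a neighbourhood of \<open>b\<close> on
  which the sums stay below \<open>w\<close>; for \<open>w\<close> close to \<open>c\<close>, it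
  bounds one of \<open>r\<close> on which they stay above \<open>w\<close>.\<close>

lemma pgi_positive_group_interval:
  assumes pgi: "omin_dir.pgi (<) (open_interval b c) P" and bc: "b < c"
    and dP: "dfn UNIV (\<lambda>v. P (v 0) (v 1) (v 2))"
  shows "\<exists>D p. positive_group_interval M b c D p"
proof -
  interpret omin_dir M "(<)"
    by (rule up_dir)
  define I where "I = open_interval b c"
  have I: "conv I" "opn I" "partial_addition I P"
    using pgi by (auto simp: pgi_def I_def)
  note PD = partial_additionD[OF I(3)]
  obtain D p where ps: "partial_sum M I D p" and P: "\<And>u v w. P u v w \<longleftrightarrow> (u, v) \<in> D \<and> w = p u v"
    using partial_sum_pgi[of "(<)" I P] pgi dP unfolding I_def by blast
  have "\<exists>r. b < r \<and> r \<le> c \<and> {y. (x, y) \<in> D} = open_interval b r \<and>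
      ((\<lambda>x'. p x' x) \<longlongrightarrow> x) (right_of b) \<and> filterlim (\<lambda>x'. p x x') (nhds_ext c) (left_of r)"
    if x: "x \<in> I" for x
  proof -
    have dX: "dset {y. (x, y) \<in> D}"
    proof -
      have "dfn UNIV (\<lambda>v. \<exists>w. P x (v 0) w)"
        by (intro dfn_intros dfn_3[OF dP] UNIV_I)
      then show ?thesis
        unfolding dset_def by (rule dfn_cong) (auto simp: P)
    qed
    obtain w0 where "w0 \<in> I" "x < w0"
      using I(2) x unfolding opn_def by blast
    then obtain v0 where v0: "P x v0 w0"
      using PD(9) x by blast
    have no_last: "\<exists>v'. (x, v') \<in> D \<and> v < v'" if v: "(x, v) \<in> D" for v
    proof -
      have xv: "P x v (p x v)"
        using v P by blast
      obtain w' where w': "w' \<in> I" "p x v < w'"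
        using I(2) PD(3)[OF xv] unfolding opn_def by blast
      moreover have "x < w'"
        using PD(10)[OF xv] w'(2) by simp
      ultimately obtain v' where v': "P x v' w'"
        using PD(9) x by blast
      then show ?thesis
        using partial_addition_less_iff[OF I(3) xv v'] w'(2) P by blast
    qed
    obtain r where r: "b < r" "r \<le> c" "{y. (x, y) \<in> D} = open_interval b r"
    proof (rule initial_open_interval[OF dX])
      show "{y. (x, y) \<in> D} \<noteq> {}"
        using v0 P by blast
      show "{y. (x, y) \<in> D} \<subseteq> open_interval b c"
        using PD(2) P unfolding I_def by blast
      show "z \<in> {y. (x, y) \<in> D}" if "y \<in> {y. (x, y) \<in> D}" "z \<in> open_interval b c" "z < y" for y z
        using PD(12)[of x y "p x y" z] that P unfolding I_def by blast
    qed (use no_last in auto)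
    have D: "(x, y) \<in> D \<longleftrightarrow> b < Fin y \<and> Fin y < r" for y
      using r(3) by (auto simp: open_interval_def)
    have v0b: "b < Fin v0" "Fin v0 < r"
      using v0 P D by blast+
    have "((\<lambda>x'. p x' x) \<longlongrightarrow> x) (right_of b)"
    proof (rule order_tendstoI)
      fix a assume a: "a < x"
      show "eventually (\<lambda>x'. a < p x' x) (right_of b)"
        unfolding eventually_right_of[OF v0b(1)]
      proof (rule exI[of _ v0], intro conjI allI impI v0b(1))
        fix z assume z: "b < Fin z \<and> z < v0"
        then have "Fin z < r"
          using v0b(2) less_trans[of "Fin z" "Fin v0" r] by simp
        then have "P x z (p x z)"
          using z D P by blast
        then have "P z x (p x z)"
          by (rule PD(5))
        then show "a < p z x"
          using PD(11)[of z x "p x z"] P a by auto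
      qed
    next
      fix a assume a: "x < a"
      obtain w where w: "x < w" "w < min a w0"
        using dense[of x "min a w0"] a \<open>x < w0\<close> by auto
      have "w \<in> I"
        using I(1)[unfolded conv_def, rule_format, of x w0 w] x \<open>w0 \<in> I\<close> w by simp
      then obtain v where v: "P x v w"
        using PD(9) x w(1) by blast
      have vb: "b < Fin v" "Fin v < r"
        using v P D by blast+
      show "eventually (\<lambda>x'. p x' x < a) (right_of b)"
        unfolding eventually_right_of[OF v0b(1)]
      proof (rule exI[of _ v], intro conjI allI impI vb(1))
        fix z assume z: "b < Fin z \<and> z < v"
        then have "Fin z < r"
          using vb(2) less_trans[of "Fin z" "Fin v" r] by simp
        then have xz: "P x z (p x z)"
          using z D P by blast
        then have "p z x = p x z"
          using PD(5)[OF xz] P by auto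
        moreover have "p x z < w"
          using PD(8)[OF xz _ v] z by blast
        ultimately show "p z x < a"
          using w(2) less_trans[of "p x z" w a] by simp
      qed
    qed
    moreover have "filterlim (\<lambda>x'. p x x') (nhds_ext c) (left_of r)"
    proof (rule filterlim_nhds_ext_leftI[OF _ _ bc])
      fix w assume w: "Fin w < c"
      have "Fin (max w x) < c"
        using w x by (auto simp: I_def open_interval_def max_def)
      then obtain w1 where w1: "max w x < w1" "Fin w1 < c"
        using ex_Fin_between[of "Fin (max w x)" c] by auto
      have "b < Fin w1"
        using x w1(1) less_trans[of b "Fin x" "Fin w1"] by (auto simp: I_def open_interval_def)
      then have "w1 \<in> I"
        using w1(2) by (simp add: I_def open_interval_def)
      then obtain v where v: "P x v w1"
        using PD(9) x w1(1) by auto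
      have vb: "Fin v < r" "b < Fin v"
        using v P D by blast+
      show "eventually (\<lambda>x'. w < p x x') (left_of r)"
        unfolding eventually_left_of[OF v0b(2)]
      proof (rule exI[of _ v], intro conjI allI impI vb(1))
        fix z assume z: "v < z \<and> Fin z < r"
        then have "b < Fin z"
          using vb(2) less_trans[of b "Fin v" "Fin z"] by simp
        then have xz: "P x z (p x z)"
          using z D P by blast
        then have "w1 < p x z"
          using PD(8)[OF v _ xz] z by blast
        then show "w < p x z"
          using w1(1) less_trans[of w w1 "p x z"] by simp
      qed
    next
      show "eventually (\<lambda>x'. Fin (p x x') < c) (left_of r)"
        unfolding eventually_left_of[OF v0b(2)]
      proof (rule exI[of _ v0], intro conjI allI impI v0b(2))
        fix z assume z: "v0 < z \<and> Fin z < r"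
        then have "b < Fin z"
          using v0b(1) less_trans[of b "Fin v0" "Fin z"] by simp
        then have xz: "P x z (p x z)"
          using z D P by blast
        then show "Fin (p x z) < c"
          using PD(3)[OF xz] by (simp add: I_def open_interval_def)
      qed
    qed
    ultimately show ?thesis
      using r by blast
  qed
  then show ?thesis
    unfolding positive_group_interval_def using ps bc unfolding I_def by blast
qed

lemma pgi_negative_group_interval:
  assumes pgi: "omin_dir.pgi (>) (open_interval b c) P" and bc: "b < c"
    and dP: "dfn UNIV (\<lambda>v. P (v 0) (v 1) (v 2))"
  shows "\<exists>D p. negative_group_interval M b c D p"
proof -
  interpret omin_dir M "(>)"
    by (rule down_dir)
  define I where "I = open_interval b c"
  have I: "conv I" "opn I" "partial_addition I P"
    using pgi by (auto simp: pgi_def I_def)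
  note PD = partial_additionD[OF I(3)]
  obtain D p where ps: "partial_sum M I D p" and P: "\<And>u v w. P u v w \<longleftrightarrow> (u, v) \<in> D \<and> w = p u v"
    using partial_sum_pgi[of "(>)" I P] pgi dP unfolding I_def by blast
  have "\<exists>l. b \<le> l \<and> l < c \<and> {y. (x, y) \<in> D} = open_interval l c \<and>
      ((\<lambda>x'. p x' x) \<longlongrightarrow> x) (left_of c) \<and> filterlim (\<lambda>x'. p x x') (nhds_ext b) (right_of l)"
    if x: "x \<in> I" for x
  proof -
    have dX: "dset {y. (x, y) \<in> D}"
    proof -
      have "dfn UNIV (\<lambda>v. \<exists>w. P x (v 0) w)"
        by (intro dfn_intros dfn_3[OF dP] UNIV_I)
      then show ?thesis
        unfolding dset_def by (rule dfn_cong) (auto simp: P)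
    qed
    obtain w0 where "w0 \<in> I" "w0 < x"
      using I(2) x unfolding opn_def by blast
    then obtain v0 where v0: "P x v0 w0"
      using PD(9) x by blast
    have no_first: "\<exists>v'. (x, v') \<in> D \<and> v' < v" if v: "(x, v) \<in> D" for v
    proof -
      have xv: "P x v (p x v)"
        using v P by blast
      obtain w' where w': "w' \<in> I" "w' < p x v"
        using I(2) PD(3)[OF xv] unfolding opn_def by blast
      moreover have "w' < x"
        using PD(10)[OF xv] w'(2) by simp
      ultimately obtain v' where v': "P x v' w'"
        using PD(9) x by blast
      then show ?thesis
        using partial_addition_less_iff[OF I(3) xv v'] w'(2) P by blast
    qed
    obtain l where l: "b \<le> l" "l < c" "{y. (x, y) \<in> D} = open_interval l c"
    proof (rule final_open_interval[OF dX])
      show "{y. (x, y) \<in> D} \<noteq> {}"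
        using v0 P by blast
      show "{y. (x, y) \<in> D} \<subseteq> open_interval b c"
        using PD(2) P unfolding I_def by blast
      show "z \<in> {y. (x, y) \<in> D}" if "y \<in> {y. (x, y) \<in> D}" "z \<in> open_interval b c" "y < z" for y z
        using PD(12)[of x y "p x y" z] that P unfolding I_def by blast
    qed (use no_first in auto)
    have D: "(x, y) \<in> D \<longleftrightarrow> l < Fin y \<and> Fin y < c" for y
      using l(3) by (auto simp: open_interval_def)
    have v0b: "l < Fin v0" "Fin v0 < c"
      using v0 P D by blast+
    have "((\<lambda>x'. p x' x) \<longlongrightarrow> x) (left_of c)"
    proof (rule order_tendstoI)
      fix a assume a: "x < a"
      show "eventually (\<lambda>x'. p x' x < a) (left_of c)"
        unfolding eventually_left_of[OF v0b(2)]
      proof (rule exI[of _ v0], intro conjI allI impI v0b(2))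
        fix z assume z: "v0 < z \<and> Fin z < c"
        then have "l < Fin z"
          using v0b(1) less_trans[of l "Fin v0" "Fin z"] by simp
        then have "P x z (p x z)"
          using z D P by blast
        then have "P z x (p x z)"
          by (rule PD(5))
        then show "p z x < a"
          using PD(11)[of z x "p x z"] P a by auto
      qed
    next
      fix a assume a: "a < x"
      obtain w where w: "max a w0 < w" "w < x"
        using dense[of "max a w0" x] a \<open>w0 < x\<close> by auto
      have "w \<in> I"
        using I(1)[unfolded conv_def, rule_format, of w0 x w] x \<open>w0 \<in> I\<close> w by simp
      then obtain v where v: "P x v w"
        using PD(9) x w(2) by blast
      have vb: "l < Fin v" "Fin v < c"
        using v P D by blast+
      show "eventually (\<lambda>x'. a < p x' x) (left_of c)"
        unfolding eventually_left_of[OF v0b(2)]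
      proof (rule exI[of _ v], intro conjI allI impI vb(2))
        fix z assume z: "v < z \<and> Fin z < c"
        then have "l < Fin z"
          using vb(1) less_trans[of l "Fin v" "Fin z"] by simp
        then have xz: "P x z (p x z)"
          using z D P by blast
        then have "p z x = p x z"
          using PD(5)[OF xz] P by auto
        moreover have "w < p x z"
          using PD(8)[OF xz _ v] z by blast
        ultimately show "a < p z x"
          using w(1) less_trans[of a w "p x z"] by simp
      qed
    qed
    moreover have "filterlim (\<lambda>x'. p x x') (nhds_ext b) (right_of l)"
    proof (rule filterlim_nhds_ext_rightI[OF _ _ bc])
      fix w assume w: "b < Fin w"
      have "b < Fin (min w x)"
        using w x by (auto simp: I_def open_interval_def min_def)
      then obtain w1 where w1: "w1 < min w x" "b < Fin w1"
        using ex_Fin_between[of b "Fin (min w x)"] by auto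
      have "Fin w1 < c"
        using x w1(1) less_trans[of "Fin w1" "Fin x" c] by (auto simp: I_def open_interval_def)
      then have "w1 \<in> I"
        using w1(2) by (simp add: I_def open_interval_def)
      then obtain v where v: "P x v w1"
        using PD(9) x w1(1) by auto
      have vb: "l < Fin v" "Fin v < c"
        using v P D by blast+
      show "eventually (\<lambda>x'. p x x' < w) (right_of l)"
        unfolding eventually_right_of[OF v0b(1)]
      proof (rule exI[of _ v], intro conjI allI impI vb(1))
        fix z assume z: "l < Fin z \<and> z < v"
        then have "Fin z < c"
          using vb(2) less_trans[of "Fin z" "Fin v" c] by simp
        then have xz: "P x z (p x z)"
          using z D P by blast
        then have "p x z < w1"
          using PD(8)[OF v _ xz] z by blast
        then show "p x z < w"
          using w1(1) less_trans[of "p x z" w1 w] by simp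
      qed
    next
      show "eventually (\<lambda>x'. b < Fin (p x x')) (right_of l)"
        unfolding eventually_right_of[OF v0b(1)]
      proof (rule exI[of _ v0], intro conjI allI impI v0b(1))
        fix z assume z: "l < Fin z \<and> z < v0"
        then have "Fin z < c"
          using v0b(2) less_trans[of "Fin z" "Fin v0" c] by simp
        then have xz: "P x z (p x z)"
          using z D P by blast
        then show "b < Fin (p x z)"
          using PD(3)[OF xz] by (simp add: I_def open_interval_def)
      qed
    qed
    ultimately show ?thesis
      using l by blast
  qed
  then show ?thesis
    unfolding negative_group_interval_def using ps bc unfolding I_def by blast
qed

lemma gi_generalized_group_interval:
  assumes "gi I"
  shows "generalized_group_interval M I"
proof -
  obtain b c where bc: "I = open_interval b c" "b < c"
    using conv_opn_open_interval gi_props[OF assms] by blast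
  obtain lt P where P: "lt = (<) \<or> lt = (>)" "omin_dir M lt" "omin_dir.pgi lt I P"
    "dfn UNIV (\<lambda>v. P (v 0) (v 1) (v 2))"
    using giE[OF assms] .
  have "\<exists>D p. positive_group_interval M b c D p \<or> negative_group_interval M b c D p"
    using P(1)
  proof
    assume "lt = (<)"
    then show ?thesis
      using pgi_positive_group_interval[OF _ bc(2) P(4)] P(3) bc(1) by blast
  next
    assume "lt = (>)"
    then show ?thesis
      using pgi_negative_group_interval[OF _ bc(2) P(4)] P(3) bc(1) by blast
  qed
  then show ?thesis
    unfolding generalized_group_interval_def using bc(1) by blast
qed

text \<open>The cover is refined to a partition by the cells of a finite set of cuts, each of which
  inherits a group-interval structure.\<close>

lemma gp_short_interval_SH:
  assumes X: "conv X" "X \<noteq> {}" "SH X"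
  shows "gp_short_interval M X"
proof -
  have dX: "dset X"
    using SH_dset[OF X(3)] .
  obtain b where b: "\<And>x. x \<in> X \<Longrightarrow> b \<le> Fin x" "\<And>y. b < Fin y \<Longrightarrow> \<exists>x\<in>X. x < y"
    using ex_inf[OF dX X(2)] by blast
  obtain c where c: "\<And>x. x \<in> X \<Longrightarrow> Fin x \<le> c" "\<And>y. Fin y < c \<Longrightarrow> \<exists>x\<in>X. y < x"
    using ex_sup[OF dX X(2)] by blast
  have "open_interval b c \<subseteq> X"
    using b(2) c(2) X(1) unfolding open_interval_def conv_def by blast
  moreover have "X \<subseteq> {x. b \<le> Fin x \<and> Fin x \<le> c}"
    using b(1) c(1) by blast
  ultimately have interv: "is_interv X"
    unfolding is_interv_def using X(2) by blast
  obtain C where C: "finite C"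
    "\<And>J. conv J \<Longrightarrow> opn J \<Longrightarrow> J \<noteq> {} \<Longrightarrow> dset J \<Longrightarrow> J \<subseteq> X \<Longrightarrow> J \<inter> C = {} \<Longrightarrow> gi J"
    using SH_cuts[OF X(3)] by blast
  \<comment> \<open>A least or greatest element of \<open>X\<close> would spoil the openness of its
    cell, so these points become singletons of the partition.\<close>
  define E where "E = {x \<in> X. (\<forall>y\<in>X. y \<le> x) \<or> (\<forall>y\<in>X. x \<le> y)}"
  have "finite E"
  proof -
    have "finite {x \<in> X. \<forall>y\<in>X. y \<le> x}" "finite {x \<in> X. \<forall>y\<in>X. x \<le> y}"
      by (rule finite_subset[of _ "{SOME x. x \<in> X \<and> (\<forall>y\<in>X. y \<le> x)}"];
          auto intro: antisym someI2)
        (rule finite_subset[of _ "{SOME x. x \<in> X \<and> (\<forall>y\<in>X. x \<le> y)}"]; auto intro: antisym someI2)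
    then show ?thesis
      by (rule finite_subset[rotated, OF finite_UnI]) (auto simp: E_def)
  qed
  define C' where "C' = C \<union> E"
  have C': "finite C'"
    using C(1) \<open>finite E\<close> by (simp add: C'_def)
  have cell_gi: "gi (cell C' A \<inter> X)" if ne: "cell C' A \<inter> X \<noteq> {}" for A
  proof (rule C(2)[OF _ _ ne])
    show "conv (cell C' A \<inter> X)" "dset (cell C' A \<inter> X)"
      using conv_Int conv_cell X(1) dset_Int dset_cell[OF C'] dX by blast+
    show "cell C' A \<inter> X \<inter> C = {}"
      using cell_disjoint[of C' A] by (auto simp: C'_def)
    show "opn (cell C' A \<inter> X)"
      unfolding opn_def
    proof (intro ballI conjI)
      fix x assume x: "x \<in> cell C' A \<inter> X"
      then have "x \<notin> E"
        using cell_disjoint[of C' A] by (auto simp: C'_def)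
      then obtain y1 y2 where y: "y1 \<in> X" "x < y1" "y2 \<in> X" "y2 < x"
        using x by (auto simp: E_def not_le)
      obtain z1 z2 where z: "z1 \<in> cell C' A" "x < z1" "z2 \<in> cell C' A" "z2 < x"
        using opn_cell[OF C'] x unfolding opn_def by blast
      have "min y1 z1 \<in> X" "min y1 z1 \<in> cell C' A"
        using y z x X(1) conv_cell[of C' A] unfolding conv_def min_def by (metis IntD1 IntD2 not_le order_le_less)+
      then show "\<exists>y\<in>cell C' A \<inter> X. x < y"
        using y z by (intro bexI[of _ "min y1 z1"]) auto
      have "max y2 z2 \<in> X" "max y2 z2 \<in> cell C' A"
        using y z x X(1) conv_cell[of C' A] unfolding conv_def max_def by (metis IntD1 IntD2 not_le order_le_less)+
      then show "\<exists>y\<in>cell C' A \<inter> X. y < x"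
        using y z by (intro bexI[of _ "max y2 z2"]) auto
    qed
  qed simp
  define \<J> where "\<J> = (\<lambda>c. {c}) ` (C' \<inter> X) \<union> ((\<lambda>A. cell C' A \<inter> X) ` Pow C' - {{}})"
  have "finite \<J>"
    using C' by (simp add: \<J>_def)
  moreover have "partition_on X \<J>"
  proof (rule partition_onI)
    show "\<Union>\<J> = X"
    proof (intro equalityI subsetI)
      fix x assume x: "x \<in> X"
      show "x \<in> \<Union>\<J>"
      proof (cases "x \<in> C'")
        case True
        with x show ?thesis
          by (auto simp: \<J>_def)
      next
        case False
        then obtain A where "A \<in> Pow C'" "x \<in> cell C' A"
          using Compl_eq_cells[of C'] by blast
        with x show ?thesis
          by (auto simp: \<J>_def)
      qed
    qed (auto simp: \<J>_def)
    show "{} \<notin> \<J>"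
      by (auto simp: \<J>_def)
    show "disjnt J K" if "J \<in> \<J>" "K \<in> \<J>" "J \<noteq> K" for J K
      using that cell_disjoint[of C'] unfolding \<J>_def disjnt_def by (auto simp: cell_def)
  qed
  moreover have "(\<exists>a. J = {a}) \<or> generalized_group_interval M J" if "J \<in> \<J>" for J
    using that cell_gi gi_generalized_group_interval unfolding \<J>_def by blast
  ultimately show ?thesis
    unfolding gp_short_interval_def using interv by blast
qed

end

section \<open>Unions of definably connected short sets with a common point in their closures\<close>

context omin_dir
begin

text \<open>\<open>R\<close> consists of the points strictly between \<open>a\<close> and some
  element of \<open>K\<close>. It has no greatest element, so \<open>SH_increasing_union\<close>
  applies; only a greatest element of \<open>K\<close> can be missed, and \<open>m\<close> stands
  for it.\<close>

lemma SH_above: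
  assumes dK: "dset K"
    and itv: "\<And>k. k \<in> K \<Longrightarrow> a \<sqsubset> k \<Longrightarrow> SH (itv a k) \<and> itv a k \<subseteq> K"
  obtains R m where "SH R" "R \<subseteq> K" "{k \<in> K. a \<sqsubset> k} \<subseteq> R \<union> {m}"
    "\<And>x y. x \<in> R \<Longrightarrow> a \<sqsubset> y \<Longrightarrow> y \<sqsubset> x \<Longrightarrow> y \<in> R"
proof -
  define R where "R = {z. a \<sqsubset> z \<and> (\<exists>k. k \<in> K \<and> z \<sqsubset> k)}"
  have dR: "dset R"
    unfolding dset_def R_def mem_Collect_eq by (intro dfn_dir_intros dset_atomic[OF dK] UNIV_I)
  have "SH R"
  proof (rule SH_increasing_union[OF dR])
    show "conv R"
      unfolding R_def conv_iff by (blast intro: dir.less_trans)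
    show "no_max R"
      unfolding no_max_def
    proof
      fix z assume "z \<in> R"
      then obtain k where "a \<sqsubset> z" "k \<in> K" "z \<sqsubset> k"
        by (auto simp: R_def)
      moreover from this obtain y where "z \<sqsubset> y" "y \<sqsubset> k"
        using dir.dense by blast
      ultimately show "\<exists>y\<in>R. z \<sqsubset> y"
        unfolding R_def by (blast intro: dir.less_trans)
    qed
    show "a \<sqsubset> r" if "r \<in> R" for r
      using that by (simp add: R_def)
    show "z \<in> R" if "a \<sqsubset> z" "z \<sqsubseteq> r" "r \<in> R" for z r
      using that unfolding R_def by (blast intro: dir.le_less_trans)
    show "SH (itv a r)" if r: "r \<in> R" for r
    proof -
      obtain k where k: "k \<in> K" "a \<sqsubset> r" "r \<sqsubset> k"
        using r by (auto simp: R_def)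
      then have "SH (itv a k)"
        using itv by (blast intro: dir.less_trans)
      then show ?thesis
        by (rule SH_subset[OF _ dset_itv]) (use k(3) in \<open>auto intro: dir.less_trans\<close>)
    qed
  qed
  moreover have "R \<subseteq> K"
    unfolding R_def using itv by (auto simp: subset_iff intro: dir.less_trans)
  moreover have "\<exists>m. {k \<in> K. a \<sqsubset> k} \<subseteq> R \<union> {m}"
  proof (cases "{k \<in> K. a \<sqsubset> k} \<subseteq> R")
    case False
    then obtain m where m: "m \<in> K" "a \<sqsubset> m" "m \<notin> R"
      by blast
    then have "k \<sqsubseteq> m" if "k \<in> K" for k
      using that by (auto simp: R_def dir.not_less)
    then have "{k \<in> K. a \<sqsubset> k} \<subseteq> R \<union> {m}"
      using m(1) unfolding R_def le_def by blast
    then show ?thesis ..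
  qed blast
  moreover have "y \<in> R" if "x \<in> R" "a \<sqsubset> y" "y \<sqsubset> x" for x y
    using that unfolding R_def by (blast intro: dir.less_trans)
  ultimately show ?thesis
    using that by blast
qed

end

context omin
begin

text \<open>\<open>K\<close> is star-shaped about \<open>a\<close> with short rays on both sides.
  The point \<open>a\<close> itself may be missing from \<open>K\<close> and has to be added for
  convexity.\<close>

lemma SH_star:
  assumes dK: "dset K"
    and up: "\<And>k. k \<in> K \<Longrightarrow> a < k \<Longrightarrow> SH {a<..<k} \<and> {a<..<k} \<subseteq> K"
    and down: "\<And>k. k \<in> K \<Longrightarrow> k < a \<Longrightarrow> SH {k<..<a} \<and> {k<..<a} \<subseteq> K"
  shows "SH (insert a K)" "conv (insert a K)"
proof -
  interpret up: omin_dir M "(<)"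
    by (rule up_dir)
  interpret down: omin_dir M "(>)"
    by (rule down_dir)
  have down_itv: "down.itv u v = {v<..<u}" for u v
    by (auto simp: down.itv_def)
  obtain R m where R: "SH R" "{k \<in> K. a < k} \<subseteq> R \<union> {m}"
    by (rule up.SH_above[OF dK, of a]) (use up in \<open>auto simp: up_itv\<close>)
  obtain R' m' where R': "SH R'" "{k \<in> K. k < a} \<subseteq> R' \<union> {m'}"
    by (rule down.SH_above[OF dK, of a]) (use down in \<open>auto simp: down_itv\<close>)
  have "SH ((R \<union> R') \<union> {a, m, m'})"
    using R(1) R'(1) by (intro SH_Un SH_finite[of "{a, m, m'}"]) auto
  moreover have "insert a K \<subseteq> (R \<union> R') \<union> {a, m, m'}"
  proof
    fix k assume "k \<in> insert a K"
    then consider "k = a" | "k \<in> K" "a < k" | "k \<in> K" "k < a"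
      by (metis insertE linorder_neqE)
    then show "k \<in> (R \<union> R') \<union> {a, m, m'}"
      using R(2) R'(2) by cases blast+
  qed
  moreover have "dset (insert a K)"
    using dset_Un[OF dset_finite[of "{a}"] dK] by simp
  ultimately show "SH (insert a K)"
    using SH_subset by blast
  have above: "y \<in> K" if "k \<in> K" "a < y" "y < k" for k y
    using up[of k] that less_trans[OF that(2,3)] by auto
  have below: "y \<in> K" if "k \<in> K" "k < y" "y < a" for k y
    using down[of k] that less_trans[OF that(2,3)] by auto
  show "conv (insert a K)"
    unfolding conv_def
  proof (intro ballI allI impI, elim conjE)
    fix x z y assume xz: "x \<in> insert a K" "z \<in> insert a K" "x < y" "y < z"
    consider "y = a" | "a < y" | "y < a"
      by (metis linorder_neqE)
    then show "y \<in> insert a K"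
    proof cases
      case 2
      then show ?thesis
        using above[of z y] xz by auto
    next
      case 3
      then show ?thesis
        using below[of x y] xz by auto
    qed simp
  qed
qed

end

section \<open>Coordinate projections of definable subsets of higher powers\<close>

lemma continuous_map_coordinate: "i < n \<Longrightarrow> continuous_map (power_top n) euclidean (\<lambda>x. x i)"
  unfolding power_top_def
  using continuous_map_product_projection[of i "{..<n}" "\<lambda>_. euclidean"] by simp

context omin_top
begin

text \<open>A value \<open>m\<close> skipped by the coordinate splits \<open>S\<close> into two
  relatively open definable parts, where it is below and where it is above \<open>m\<close>.\<close>

lemma definably_connected_coordinate:
  assumes conn: "definably_connected M n S" and i: "i < n"
  shows "conv ((\<lambda>x. x i) ` S)"
  unfolding conv_def
proof (intro ballI allI impI, elim conjE imageE, rule ccontr)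
  fix a b m x y
  assume m: "a < m" "m < b" "a = x i" "b = y i" "x \<in> S" "y \<in> S" "m \<notin> (\<lambda>x. x i) ` S"
  have S: "S \<subseteq> Pow_n n" "dfn UNIV (\<lambda>v. restrict v {..<n} \<in> S)"
    using conn unfolding definably_connected_def definable_iff_dfn by blast+
  define U where "U = {s \<in> S. s i < m}"
  define V where "V = {s \<in> S. m < s i}"
  have "definable M n U" "definable M n V"
    unfolding definable_iff_dfn U_def V_def
    using S i by (auto intro!: dfn_conj dfn_less)
  moreover have "U \<noteq> {}" "V \<noteq> {}"
    using m by (auto simp: U_def V_def)
  moreover have "U \<inter> V = {}"
    by (auto simp: U_def V_def dest: less_asym)
  moreover have "U \<union> V = S"
  proof -
    have "s i \<noteq> m" if "s \<in> S" for s
      using m(7) that by blast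
    then show ?thesis
      unfolding U_def V_def by (auto simp: neq_iff)
  qed
  moreover have op: "openin (subtopology (power_top n) S) {s \<in> S. s i \<in> W}" if "open W" for W
  proof -
    have "openin (power_top n) {s \<in> topspace (power_top n). s i \<in> W}"
      by (rule openin_continuous_map_preimage[OF continuous_map_coordinate[OF i]])
        (simp add: that open_openin[symmetric])
    moreover have "{s \<in> S. s i \<in> W} = {s \<in> topspace (power_top n). s i \<in> W} \<inter> S"
      using S(1) by (auto simp: power_top_def topspace_product_topology)
    ultimately show ?thesis
      unfolding openin_subtopology by (intro exI conjI)
  qed
  have "openin (subtopology (power_top n) S) U" "openin (subtopology (power_top n) S) V"
    using op[of "{..<m}"] op[of "{m<..}"] by (simp_all add: U_def V_def)
  ultimately show False
    using conn unfolding definably_connected_def by blast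
qed

lemma closure_of_coordinate:
  assumes a: "a \<in> power_top n closure_of S" and i: "i < n" and W: "open W" "a i \<in> W"
  obtains x where "x \<in> S" "x i \<in> W"
proof -
  have op: "openin (power_top n) {s \<in> topspace (power_top n). s i \<in> W}"
    by (rule openin_continuous_map_preimage[OF continuous_map_coordinate[OF i]])
      (simp add: W(1) open_openin[symmetric])
  note closure = a[unfolded in_closure_of]
  have "a \<in> {s \<in> topspace (power_top n). s i \<in> W}"
    using conjunct1[OF closure] W(2) by simp
  from conjunct2[OF closure, THEN spec, THEN mp, OF conjI[OF this op]] that show ?thesis
    by blast
qed

text \<open>The inverse of the injection \<open>f\<close>, followed by the coordinate, is a
  definable partial function on a box of short intervals, and \<open>SH_image_product\<close> treats
  its image.\<close>

lemma SH_coordinate: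
  assumes short: "gp_short M n S" and i: "i < n"
  shows "SH ((\<lambda>x. x i) ` S)"
proof -
  obtain k I f where I: "\<forall>j<k. gp_short_interval M (I j)" and f: "inj_on f S" "f ` S \<subseteq> PiE {..<k} I"
    and graph: "definable M (n + k) {join n k x (f x) | x. x \<in> S}"
    using short unfolding gp_short_def by blast
  have S: "S \<subseteq> Pow_n n"
    using short unfolding gp_short_def definable_iff_dfn by blast
  define G where "G = {join n k x (f x) | x. x \<in> S}"
  \<comment> \<open>The environment \<open>t\<close> codes a point of \<open>S\<close> through
    \<open>f\<close>, and \<open>z\<close> is the coordinate of that point; the injectivity of
    \<open>f\<close> makes this single-valued.\<close>
  define F where "F = (\<lambda>t z. \<exists>x. restrict (\<lambda>j. if j < n then x j else t (j - n)) {..<n + k} \<in> G \<and> x i = z)"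
  have dG: "dfn UNIV (\<lambda>v. restrict v {..<n + k} \<in> G)"
    using graph unfolding definable_iff_dfn G_def by blast
  have F: "F t z \<longleftrightarrow> (\<exists>x\<in>S. f x = restrict t {..<k} \<and> x i = z)" for t z
  proof
    assume "F t z"
    then obtain x x' where x: "x' \<in> S" "x i = z"
      "restrict (\<lambda>j. if j < n then x j else t (j - n)) {..<n + k} = join n k x' (f x')"
      unfolding F_def G_def by blast
    have eq: "(if j < n then x j else t (j - n)) = (if j < n then x' j else f x' (j - n))" if "j < n + k" for j
      using fun_cong[OF x(3), of j] that by (simp add: join_def)
    have "f x' j = t j" if "j < k" for j
      using eq[of "n + j"] that by simp
    moreover have "f x' \<in> extensional {..<k}"
      using f(2) x(1) by (auto simp: PiE_def)
    ultimately have "f x' = restrict t {..<k}"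
      by (auto simp: fun_eq_iff extensional_def)
    moreover have "x' i = z"
      using eq[of i] i x(2) by simp
    ultimately show "\<exists>x\<in>S. f x = restrict t {..<k} \<and> x i = z"
      using x(1) by blast
  next
    assume "\<exists>x\<in>S. f x = restrict t {..<k} \<and> x i = z"
    then obtain x where x: "x \<in> S" "f x = restrict t {..<k}" "x i = z"
      by blast
    have "restrict (\<lambda>j. if j < n then x j else t (j - n)) {..<n + k} = join n k x (f x)"
      by (auto simp: join_def x(2) fun_eq_iff)
    with x show "F t z"
      unfolding F_def G_def by blast
  qed
  have "SH {z. \<exists>t. (\<forall>j\<in>{..<k}. t j \<in> I j) \<and> F t z}"
  proof (rule SH_image_product)
    show "SH (I j)" if "j < k" for j
      using I that SH_gp_short_interval by blast
    show "dfn UNIV (\<lambda>v. F (\<lambda>i. v (Suc i)) (v 0))"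
      unfolding F_def
    proof (rule dfn_ex_env, rule dfn_conj)
      show "dfn UNIV (\<lambda>v. restrict (\<lambda>j. if j < n then v (2 * j + 1) else v (2 * Suc (j - n))) {..<n + k} \<in> G)"
        by (rule dfn_env[OF dG, of "\<lambda>v j. if j < n then v (2 * j + 1) else v (2 * Suc (j - n))"])
          (intro atomic_trm_if atomic_trm_var)
    qed (intro dfn_eq atomic_trm_var)
    show "z = z'" if "F t z" "F t z'" for t z z'
      using that f(1) unfolding F inj_on_def by metis
    show "F t' z" if "\<And>i. i < k \<Longrightarrow> t i = t' i" "F t z" for t t' z
    proof -
      have "restrict t {..<k} = restrict t' {..<k}"
        using that(1) by (auto simp: fun_eq_iff)
      with that(2) show ?thesis
        unfolding F by simp
    qed
  qed
  moreover have "{z. \<exists>t. (\<forall>j\<in>{..<k}. t j \<in> I j) \<and> F t z} = (\<lambda>x. x i) ` S"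
  proof (intro equalityI subsetI)
    fix z assume "z \<in> (\<lambda>x. x i) ` S"
    then obtain x where x: "x \<in> S" "z = x i"
      by blast
    then have fx: "f x \<in> PiE {..<k} I"
      using f(2) by blast
    then have "F (f x) z"
      unfolding F using x by (metis PiE_restrict)
    with fx show "z \<in> {z. \<exists>t. (\<forall>j\<in>{..<k}. t j \<in> I j) \<and> F t z}"
      by blast
  qed (auto simp: F)
  ultimately show ?thesis
    by simp
qed

lemma dfn_family_Union:
  assumes "definable_family M m n T S"
  shows "definable M n (\<Union>t\<in>T. S t)"
proof -
  have T: "T \<subseteq> Pow_n m" "\<And>t. t \<in> T \<Longrightarrow> S t \<subseteq> Pow_n n"
    and "definable M (m + n) {join m n t x | t x. t \<in> T \<and> x \<in> S t}"
    using assms unfolding definable_family_def definable_iff_dfn by blast+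
  then have dG: "dfn UNIV (\<lambda>v. restrict v {..<m + n} \<in> {join m n t x | t x. t \<in> T \<and> x \<in> S t})"
    unfolding definable_iff_dfn by blast
  have "dfn UNIV (\<lambda>v. \<exists>t. restrict (\<lambda>j. if j < m then t j else v (j - m)) {..<m + n}
    \<in> {join m n t x | t x. t \<in> T \<and> x \<in> S t})"
  proof (rule dfn_ex_env)
    show "dfn UNIV (\<lambda>v. restrict (\<lambda>j. if j < m then v (2 * j + 1) else v (2 * (j - m))) {..<m + n}
      \<in> {join m n t x | t x. t \<in> T \<and> x \<in> S t})"
      by (rule dfn_env[OF dG, of "\<lambda>v j. if j < m then v (2 * j + 1) else v (2 * (j - m))"])
        (intro atomic_trm_if atomic_trm_var)
  qed
  then have "dfn UNIV (\<lambda>v. restrict v {..<n} \<in> (\<Union>t\<in>T. S t))"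
  proof (rule dfn_cong)
    fix v :: "nat \<Rightarrow> 'a"
    show "(\<exists>t. restrict (\<lambda>j. if j < m then t j else v (j - m)) {..<m + n}
      \<in> {join m n t x | t x. t \<in> T \<and> x \<in> S t}) = (restrict v {..<n} \<in> (\<Union>t\<in>T. S t))"
    proof
      assume "\<exists>t. restrict (\<lambda>j. if j < m then t j else v (j - m)) {..<m + n}
        \<in> {join m n t x | t x. t \<in> T \<and> x \<in> S t}"
      then obtain t t' x where x: "t' \<in> T" "x \<in> S t'"
        "restrict (\<lambda>j. if j < m then t j else v (j - m)) {..<m + n} = join m n t' x"
        by blast
      have "x j = v j" if "j < n" for j
        using fun_cong[OF x(3), of "m + j"] that by (simp add: join_def)
      moreover have "x \<in> extensional {..<n}"
        using T(2)[OF x(1)] x(2) by (auto simp: PiE_def)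
      ultimately have "restrict v {..<n} = x"
        by (auto simp: fun_eq_iff extensional_def)
      with x show "restrict v {..<n} \<in> (\<Union>t\<in>T. S t)"
        by blast
    next
      assume "restrict v {..<n} \<in> (\<Union>t\<in>T. S t)"
      then obtain t where t: "t \<in> T" "restrict v {..<n} \<in> S t"
        by blast
      have "restrict (\<lambda>j. if j < m then t j else v (j - m)) {..<m + n} = join m n t (restrict v {..<n})"
        by (auto simp: join_def fun_eq_iff)
      with t show "\<exists>t. restrict (\<lambda>j. if j < m then t j else v (j - m)) {..<m + n}
        \<in> {join m n t x | t x. t \<in> T \<and> x \<in> S t}"
        by blast
    qed
  qed
  then show ?thesis
    unfolding definable_iff_dfn using T(2) by blast
qed

lemma dset_coordinate:
  assumes "definable M n S" "i < n"
  shows "dset ((\<lambda>x. x i) ` S)"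
proof -
  have S: "S \<subseteq> Pow_n n" "dfn UNIV (\<lambda>v. restrict v {..<n} \<in> S)"
    using assms(1) unfolding definable_iff_dfn by blast+
  have "dfn UNIV (\<lambda>v. \<exists>x. restrict x {..<n} \<in> S \<and> x i = v 0)"
    by (intro dfn_ex_env dfn_conj dfn_env[OF S(2)] dfn_eq atomic_trm_var)
  then show ?thesis
    unfolding dset_def
  proof (rule dfn_cong)
    fix v :: "nat \<Rightarrow> 'a"
    show "(\<exists>x. restrict x {..<n} \<in> S \<and> x i = v 0) = (v 0 \<in> (\<lambda>x. x i) ` S)"
    proof
      assume "v 0 \<in> (\<lambda>x. x i) ` S"
      then obtain x where x: "x \<in> S" "v 0 = x i"
        by blast
      then have "x \<in> Pow_n n"
        using S(1) by blast
      then have "restrict x {..<n} = x"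
        by (rule PiE_restrict)
      with x show "\<exists>x. restrict x {..<n} \<in> S \<and> x i = v 0"
        by (intro exI[of _ x]) simp
    next
      assume "\<exists>x. restrict x {..<n} \<in> S \<and> x i = v 0"
      then obtain x where "restrict x {..<n} \<in> S" "x i = v 0"
        by blast
      then show "v 0 \<in> (\<lambda>x. x i) ` S"
        using assms(2) by (intro image_eqI[of _ _ "restrict x {..<n}"]) auto
    qed
  qed
qed

text \<open>The identity serves as the injection, and its graph is the diagonal over
  \<open>S\<close>.\<close>

lemma gp_short_box:
  assumes S: "definable M n S" and box: "\<And>i. i < n \<Longrightarrow> gp_short_interval M (I i)"
    and sub: "\<And>x i. x \<in> S \<Longrightarrow> i < n \<Longrightarrow> x i \<in> I i"
  shows "gp_short M n S"
proof -
  have S': "S \<subseteq> Pow_n n" "dfn UNIV (\<lambda>v. restrict v {..<n} \<in> S)"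
    using S unfolding definable_iff_dfn by blast+
  have "dfn UNIV (\<lambda>v. restrict v {..<n} \<in> S \<and> (\<forall>j\<in>{..<n}. v (n + j) = v j))"
    by (intro dfn_conj S'(2) dfn_ball_finite dfn_eq atomic_trm_var) simp
  then have "dfn UNIV (\<lambda>v. restrict v {..<n + n} \<in> {join n n x x | x. x \<in> S})"
  proof (rule dfn_cong)
    fix v :: "nat \<Rightarrow> 'a"
    show "(restrict v {..<n} \<in> S \<and> (\<forall>j\<in>{..<n}. v (n + j) = v j)) =
      (restrict v {..<n + n} \<in> {join n n x x | x. x \<in> S})"
    proof
      assume v: "restrict v {..<n} \<in> S \<and> (\<forall>j\<in>{..<n}. v (n + j) = v j)"
      have "restrict v {..<n + n} j = join n n (restrict v {..<n}) (restrict v {..<n}) j" for j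
      proof (cases "j < n \<or> n + n \<le> j")
        case False
        then have "j - n < n"
          by auto
        then have "v j = v (j - n)"
          using bspec[OF conjunct2[OF v], of "j - n"] False by simp
        moreover have "join n n (restrict v {..<n}) (restrict v {..<n}) j = v (j - n)"
          using False by (simp add: join_def less_diff_conv2)
        ultimately show ?thesis
          using False by simp
      qed (auto simp: join_def)
      then have "restrict v {..<n + n} = join n n (restrict v {..<n}) (restrict v {..<n})"
        by blast
      with v show "restrict v {..<n + n} \<in> {join n n x x | x. x \<in> S}"
        by blast
    next
      assume "restrict v {..<n + n} \<in> {join n n x x | x. x \<in> S}"
      then obtain x where x: "x \<in> S" "restrict v {..<n + n} = join n n x x"
        by blast
      have v: "v j = x j" "v (n + j) = x j" if "j < n" for j
        using fun_cong[OF x(2), of j] fun_cong[OF x(2), of "n + j"] that by (simp_all add: join_def)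
      have "x \<in> extensional {..<n}"
        using x(1) S'(1) by (auto simp: PiE_def)
      then have "restrict v {..<n} = x"
        using v by (auto simp: fun_eq_iff extensional_def)
      with v x(1) show "restrict v {..<n} \<in> S \<and> (\<forall>j\<in>{..<n}. v (n + j) = v j)"
        by simp
    qed
  qed
  moreover have "join n n x x \<in> Pow_n (n + n)" for x :: "nat \<Rightarrow> 'a"
    by (auto simp: join_def PiE_def)
  ultimately have "definable M (n + n) {join n n x x | x. x \<in> S}"
    unfolding definable_iff_dfn by blast
  moreover have "(\<lambda>x. x) ` S \<subseteq> PiE {..<n} I"
    using S'(1) sub by (auto simp: PiE_def Pi_def subset_iff)
  ultimately show ?thesis
    unfolding gp_short_def using S box by (intro conjI exI[of _ n] exI[of _ I] exI[of _ "\<lambda>x. x"]) auto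
qed

text \<open>Points of \<open>S\<close> have coordinates arbitrarily close to \<open>a i\<close>, so
  convexity of the projection fills the whole gap between \<open>a i\<close> and
  \<open>k\<close>.\<close>

lemma coordinate_interval:
  assumes conn: "definably_connected M n S" and a: "a \<in> power_top n closure_of S" and i: "i < n"
    and short: "SH ((\<lambda>x. x i) ` S)" and k: "k \<in> (\<lambda>x. x i) ` S"
  shows "a i < k \<Longrightarrow> SH {a i<..<k} \<and> {a i<..<k} \<subseteq> (\<lambda>x. x i) ` S"
    and "k < a i \<Longrightarrow> SH {k<..<a i} \<and> {k<..<a i} \<subseteq> (\<lambda>x. x i) ` S"
proof -
  note conv = definably_connected_coordinate[OF conn i]
  have dIoo: "dset {u<..<v}" for u v
    using omin_dir.dset_itv[OF up_dir] unfolding up_itv .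
  assume less: "a i < k"
  have "{a i<..<k} \<subseteq> (\<lambda>x. x i) ` S"
  proof
    fix y assume y: "y \<in> {a i<..<k}"
    obtain x where "x \<in> S" "x i \<in> {..<y}"
      using closure_of_coordinate[OF a i, of "{..<y}"] y by auto
    moreover from this have "x i \<in> (\<lambda>x. x i) ` S"
      by blast
    ultimately show "y \<in> (\<lambda>x. x i) ` S"
      using conv[unfolded conv_def, rule_format, of "x i" k y] k y by auto
  qed
  with short dIoo show "SH {a i<..<k} \<and> {a i<..<k} \<subseteq> (\<lambda>x. x i) ` S"
    using SH_subset by blast
next
  note conv = definably_connected_coordinate[OF conn i]
  have dIoo: "dset {u<..<v}" for u v
    using omin_dir.dset_itv[OF up_dir] unfolding up_itv .
  assume less: "k < a i"
  have "{k<..<a i} \<subseteq> (\<lambda>x. x i) ` S"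
  proof
    fix y assume y: "y \<in> {k<..<a i}"
    obtain x where "x \<in> S" "x i \<in> {y<..}"
      using closure_of_coordinate[OF a i, of "{y<..}"] y by auto
    moreover from this have "x i \<in> (\<lambda>x. x i) ` S"
      by blast
    ultimately show "y \<in> (\<lambda>x. x i) ` S"
      using conv[unfolded conv_def, rule_format, of k "x i" y] k y by auto
  qed
  with short dIoo show "SH {k<..<a i} \<and> {k<..<a i} \<subseteq> (\<lambda>x. x i) ` S"
    using SH_subset by blast
qed

end

theorem theorem4p6:
  fixes M :: "('f, 'r, 'a::{linorder_topology, unbounded_dense_linorder}) fo_structure"
    and T :: "(nat \<Rightarrow> 'a) set" and S :: "(nat \<Rightarrow> 'a) \<Rightarrow> (nat \<Rightarrow> 'a) set"
    and m n :: nat and a\<^sub>0 :: "nat \<Rightarrow> 'a"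
  assumes "o_minimal M" and "sufficiently_saturated M"
    and "definable_family M m n T S"
    and "\<And>t. t \<in> T \<Longrightarrow> gp_short M n (S t)"
    and "\<And>t. t \<in> T \<Longrightarrow> definably_connected M n (S t)"
    and "a\<^sub>0 \<in> Pow_n n"
    and "\<And>t. t \<in> T \<Longrightarrow> a\<^sub>0 \<in> power_top n closure_of (S t)"
  shows "gp_short M n (\<Union>t\<in>T. S t)"
proof -
  interpret omin_top M
    by unfold_locales (rule assms)+
  define K where "K = (\<lambda>i. (\<lambda>x. x i) ` (\<Union>t\<in>T. S t))"
  have U: "definable M n (\<Union>t\<in>T. S t)"
    using dfn_family_Union[OF assms(3)] .
  have star: "SH (insert (a\<^sub>0 i) (K i))" "conv (insert (a\<^sub>0 i) (K i))" if i: "i < n" for i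
  proof -
    have part: "\<exists>t\<in>T. k \<in> (\<lambda>x. x i) ` S t" if "k \<in> K i" for k
      using that by (auto simp: K_def)
    have sub: "(\<lambda>x. x i) ` S t \<subseteq> K i" if "t \<in> T" for t
      using that by (auto simp: K_def)
    \<comment> \<open>Each point of \<open>K i\<close> comes from one \<open>S t\<close>, and this
      single set already fills the gap between the point and \<open>a\<^sub>0 i\<close>. No
      uniformity in \<open>t\<close> is required here.\<close>
    note coord = coordinate_interval[OF assms(5) assms(7) i SH_coordinate[OF assms(4) i]]
    have up: "SH {a\<^sub>0 i<..<k} \<and> {a\<^sub>0 i<..<k} \<subseteq> K i" if "k \<in> K i" "a\<^sub>0 i < k" for k
      using part[OF that(1)] coord(1)[OF _ _ _ _ that(2)] sub by blast
    have down: "SH {k<..<a\<^sub>0 i} \<and> {k<..<a\<^sub>0 i} \<subseteq> K i" if "k \<in> K i" "k < a\<^sub>0 i" for k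
      using part[OF that(1)] coord(2)[OF _ _ _ _ that(2)] sub by blast
    have "dset (K i)"
      unfolding K_def using dset_coordinate[OF U i] .
    from SH_star[OF this up down] show "SH (insert (a\<^sub>0 i) (K i))" "conv (insert (a\<^sub>0 i) (K i))"
      by blast+
  qed
  \<comment> \<open>Adding \<open>a\<^sub>0 i\<close> closes the hole that \<open>K i\<close> may
    have there, and it keeps the sides of the box nonempty even if \<open>T\<close> is
    empty.\<close>
  show ?thesis
  proof (rule gp_short_box[OF U, of "\<lambda>i. insert (a\<^sub>0 i) (K i)"])
    show "gp_short_interval M (insert (a\<^sub>0 i) (K i))" if "i < n" for i
      using gp_short_interval_SH[OF star(2)[OF that] _ star(1)[OF that]] by blast
    show "x i \<in> insert (a\<^sub>0 i) (K i)" if "x \<in> (\<Union>t\<in>T. S t)" for x i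
      using that by (auto simp: K_def)
  qed
qed

end
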